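(* Let $\kappa>0$ be known and consider the class $\mathcal{D}^{\mathsf{N}}_{\kappa}=\{\mathsf{N}(\mu,\Sigma)\mid \mu\in\mathbb{R}^d,\ \Sigma\in\mathbb{R}^{d\times d},\ I\preceq\Sigma\preceq\kappa I\}$, with $\mu$ and $\Sigma$ unknown. For all $\epsilon\in(0,1]$, $\delta\in(0,1/2]$, $\alpha\in(0,1/2]$ there is an $\alpha$-accurate $(\epsilon,\delta)$-differentially private sampler for $\mathcal{D}^{\mathsf{N}}_{\kappa}$ with sample complexity $$O\left(\frac{d}{\epsilon}\cdot\kappa^2\cdot\mathrm{polylog}\left(\frac{d}{\delta\epsilon\alpha}\right)\right).$$
   Context: $A\preceq B$ means $B-A$ is positive semidefinite. $\mathsf{N}(\mu,\Sigma)$ is the Gaussian with density proportional to $\exp(-\frac12(x-\mu)^T\Sigma^{-1}(x-\mu))$. A sampler with sample complexity $n$ for a class $\mathcal{D}$ is an algorithm $\mathcal{A}$ that receives $n$ i.i.d. samples $\mathbf{X}\sim D^n$ from an unknown $D\in\mathcal{D}$ and outputs one element of the domain; with $Q_{\mathcal{A},D}$ the distribution of $\mathcal{A}(\mathbf{X})$, it is $\alpha$-accurate if $d_{\mathrm{tv}}(D,Q_{\mathcal{A},D})\le\alpha$ for all $D\in\mathcal{D}$. Datasets are neighbors if they have the same size and differ in one element. $\mathcal{M}$ is $(\epsilon,\delta)$-DP if for all neighbors $Y,Y'$ and all output sets $S$, $\Pr[\mathcal{M}(Y)\in S]\le e^\epsilon\Pr[\mathcal{M}(Y')\in S]+\delta$.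 $\mathrm{polylog}(x)$ is a quantity bounded by a polynomial in $\log x$. *)

theory Defs
  imports
    "HOL-Probability.Probability"
    "HOL-Computational_Algebra.Polynomial"
    "Jordan_Normal_Form.Gauss_Jordan_Elimination"
begin

section \<open>Euclidean space of variable dimension\<close>

text \<open>The constants of the main bound must not depend on the dimension, so the dimension is a
  natural number rather than a type. A point of \<open>d\<close>-dimensional space is a real function on
  \<open>{..<d}\<close> (extensional, i.e. \<open>undefined\<close> elsewhere); \<open>Matrix.vec d\<close> converts
  it to a vector, so that the matrix operations apply.\<close>

definition euclid :: "nat \<Rightarrow> (nat \<Rightarrow> real) measure" where
  "euclid d = (\<Pi>\<^sub>M i\<in>{..<d}. borel)"

definition lebesgue_euclid :: "nat \<Rightarrow> (nat \<Rightarrow> real) measure" where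
  "lebesgue_euclid d = (\<Pi>\<^sub>M i\<in>{..<d}. lborel)"

text \<open>The symmetry condition forces \<open>A\<close> to be square.\<close>

definition pos_semidef :: "real mat \<Rightarrow> bool" where
  "pos_semidef A \<longleftrightarrow> transpose_mat A = A \<and>
     (\<forall>x \<in> carrier_vec (dim_row A). scalar_prod x (A *\<^sub>v x) \<ge> 0)"

definition loewner_le :: "real mat \<Rightarrow> real mat \<Rightarrow> bool" (infix "\<preceq>\<^sub>L" 50) where
  "A \<preceq>\<^sub>L B \<longleftrightarrow> pos_semidef (B - A)"

section \<open>Gaussian distributions\<close>

text \<open>\<open>mat_inverse\<close> returns an option; below it is only applied to matrices
  \<open>\<Sigma>\<close> with \<open>I \<preceq>\<^sub>L \<Sigma>\<close>, which are invertible.\<close>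

definition gaussian_weight :: "nat \<Rightarrow> real vec \<Rightarrow> real mat \<Rightarrow> (nat \<Rightarrow> real) \<Rightarrow> real" where
  "gaussian_weight d \<mu> \<Sigma> x =
     (let v = Matrix.vec d x - \<mu>
      in exp (- (1 / 2) * scalar_prod v (the (mat_inverse \<Sigma>) *\<^sub>v v)))"

definition gaussian :: "nat \<Rightarrow> real vec \<Rightarrow> real mat \<Rightarrow> (nat \<Rightarrow> real) measure" where
  "gaussian d \<mu> \<Sigma> = density (lebesgue_euclid d)
     (\<lambda>x. ennreal (gaussian_weight d \<mu> \<Sigma> x / (LINT y|lebesgue_euclid d. gaussian_weight d \<mu> \<Sigma> y)))"

lemma sets_gaussian [measurable_cong]: "sets (gaussian d \<mu> \<Sigma>) = sets (euclid d)"
  unfolding gaussian_def lebesgue_euclid_def euclid_def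
  by (auto intro!: sets_PiM_cong)

definition gaussian_class :: "nat \<Rightarrow> real \<Rightarrow> (nat \<Rightarrow> real) measure set" where
  "gaussian_class d \<kappa> = {gaussian d \<mu> \<Sigma> | \<mu> \<Sigma>.
     \<mu> \<in> carrier_vec d \<and> \<Sigma> \<in> carrier_mat d d \<and>
     1\<^sub>m d \<preceq>\<^sub>L \<Sigma> \<and> \<Sigma> \<preceq>\<^sub>L \<kappa> \<cdot>\<^sub>m 1\<^sub>m d}"

section \<open>Samplers\<close>

text \<open>In this section \<open>X\<close> is a measurable space, the domain; the measure it carries is
  irrelevant. A dataset of size \<open>n\<close> is an \<open>n\<close>-tuple of points of \<open>X\<close>.\<close>

definition datasets :: "nat \<Rightarrow> 'a measure \<Rightarrow> (nat \<Rightarrow> 'a) measure" where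
  "datasets n X = (\<Pi>\<^sub>M i\<in>{..<n}. X)"

definition iid :: "nat \<Rightarrow> 'a measure \<Rightarrow> (nat \<Rightarrow> 'a) measure" where
  "iid n D = (\<Pi>\<^sub>M i\<in>{..<n}. D)"

text \<open>A randomized algorithm is a Markov kernel: it maps a dataset to the distribution of
  its output.\<close>

definition sampler :: "nat \<Rightarrow> 'a measure \<Rightarrow> ((nat \<Rightarrow> 'a) \<Rightarrow> 'a measure) \<Rightarrow> bool" where
  "sampler n X \<A> \<longleftrightarrow> \<A> \<in> datasets n X \<rightarrow>\<^sub>M prob_algebra X"

definition output_distr :: "nat \<Rightarrow> ((nat \<Rightarrow> 'a) \<Rightarrow> 'a measure) \<Rightarrow> 'a measure \<Rightarrow> 'a measure" where
  "output_distr n \<A> D = iid n D \<bind> \<A>"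

definition tv_dist :: "'a measure \<Rightarrow> 'a measure \<Rightarrow> real" where
  "tv_dist P Q = (SUP S\<in>sets P. \<bar>measure P S - measure Q S\<bar>)"

definition accurate :: "real \<Rightarrow> nat \<Rightarrow> 'a measure set \<Rightarrow> ((nat \<Rightarrow> 'a) \<Rightarrow> 'a measure) \<Rightarrow> bool" where
  "accurate \<alpha> n \<D> \<A> \<longleftrightarrow> (\<forall>D\<in>\<D>. tv_dist D (output_distr n \<A> D) \<le> \<alpha>)"

definition neighbors :: "nat \<Rightarrow> (nat \<Rightarrow> 'a) \<Rightarrow> (nat \<Rightarrow> 'a) \<Rightarrow> bool" where
  "neighbors n Y Y' \<longleftrightarrow> card {i. i < n \<and> Y i \<noteq> Y' i} = 1"

definition diff_private ::
  "real \<Rightarrow> real \<Rightarrow> nat \<Rightarrow> 'a measure \<Rightarrow> ((nat \<Rightarrow> 'a) \<Rightarrow> 'a measure) \<Rightarrow> bool" where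
  "diff_private \<epsilon> \<delta> n X \<A> \<longleftrightarrow>
     (\<forall>Y \<in> space (datasets n X). \<forall>Y' \<in> space (datasets n X). neighbors n Y Y' \<longrightarrow>
        (\<forall>S \<in> sets X. measure (\<A> Y) S \<le> exp \<epsilon> * measure (\<A> Y') S + \<delta>))"

end

theory Submission
  imports Defs "Jordan_Normal_Form.Determinant"
begin

text \<open>If real weights satisfy \<open>\<Sum> w\<^sub>i = 1\<close> and \<open>\<Sum> w\<^sub>i\<^sup>2 = 1\<close>, then \<open>\<Sum> w\<^sub>i X\<^sub>i\<close> has exactly the distribution
  \<open>N(\<mu>, \<Sigma>)\<close> of the samples. Grouping \<open>2k\<close> samples into pairs with half differences \<open>z\<^sub>i\<close>, the mechanism
  outputs the mean plus a multiple of \<open>\<Sum> p\<^sub>i z\<^sub>i / |p|\<close>, where the \<open>p\<^sub>i\<close> are independent and distributed as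
  \<open>N(1, 1)\<close>; the weights satisfy both identities for every \<open>p\<close>. Its privacy comes from \<open>p\<close>: if one pair
  changes, the change of the output can be undone by a small shift of the remaining weights that keeps
  \<open>|p|\<close> fixed, and the density of \<open>p\<close> hardly changes under this shift, provided that the \<open>z\<^sub>i\<close> are bounded
  and well spread. The mean \<open>1\<close> of the \<open>p\<^sub>i\<close> makes \<open>p\<close> correlate with the direction of the shift that
  restores the norm.

  To enforce this proviso on arbitrary data, only a largest good subset of the pairs is used, and a
  constant is output with a probability that depends smoothly on the number of discarded pairs.
  This is \<open>(2, \<delta>)\<close>-private; applying it to a random choice of one sample from each of \<open>2k\<close> blocks of
  size about \<open>e\<^sup>2 / \<epsilon>\<close> gives \<open>(\<epsilon>, \<delta>)\<close>-privacy. With \<open>k\<close> of order \<open>d \<kappa>\<close> up to logarithms, Gaussian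
  data are good with high probability.\<close>

section \<open>Product measures\<close>

text \<open>For centered weights the density at fixed norm would be constant, but the inner product
  of \<open>p\<close> with the restoring direction \<open>n\<close> would be near 0 with a
  probability that is not negligible, and there it may be impossible to restore the norm along
  \<open>n\<close>. With mean 1 it concentrates around \<open>|n|^2\<close>. The price: at fixed
  norm the log density is the coordinate sum up to a constant, and a shift \<open>\<alpha>\<close>
  changes it by its own coordinate sum, possibly of order \<open>sqrt k |\<alpha>|\<close>. The
  restoring step contributes minus the inner product of \<open>p\<close> and \<open>\<alpha>\<close>
  to first order, which leaves only the pairing of \<open>\<alpha>\<close> with
  \<open>p - 1\<close>. This needs the coordinate sum of \<open>n\<close> to equal
  \<open>|n|^2\<close>, so \<open>n\<close> is the projection of the all-ones vector to the
  complement of the span of the coordinate vectors of \<open>z\<close>. Up to logarithms a changed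
  pair has length \<open>sqrt (d \<kappa>)\<close> and the Gram matrix of the other pairs is at
  least of order \<open>k\<close>, so \<open>|\<alpha>|\<close> is about
  \<open>sqrt (d \<kappa> / k)\<close>; hence the order of \<open>k\<close>. The second factor
  \<open>\<kappa>\<close> of the claimed bound only pays for powers of
  \<open>ln \<kappa>\<close>.\<close>

lemma distr_translate_PiM_lborel:
  fixes a :: "'i \<Rightarrow> real"
  assumes [simp]: "finite I"
  shows "distr (PiM I (\<lambda>_. lborel)) (PiM I (\<lambda>_. lborel)) (\<lambda>x. \<lambda>i\<in>I. x i + a i) = PiM I (\<lambda>_. lborel)"
proof -
  interpret product_sigma_finite "\<lambda>_::'i. lborel :: real measure" by standard
  show ?thesis
  proof (rule PiM_eqI)
    fix A :: "'i \<Rightarrow> real set" assume A: "\<And>i. i \<in> I \<Longrightarrow> A i \<in> sets lborel"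
    have vim: "(\<lambda>x. \<lambda>i\<in>I. x i + a i) -` Pi\<^sub>E I A \<inter> space (PiM I (\<lambda>_. lborel))
      = Pi\<^sub>E I (\<lambda>i. (\<lambda>x. a i + x) -` A i)"
      by (auto simp: space_PiM PiE_iff extensional_def add.commute)
    have tr: "emeasure lborel ((\<lambda>x. c + x) -` B) = emeasure lborel B" if "B \<in> sets lborel" for B and c :: real
    proof -
      have "emeasure lborel B = emeasure (distr lborel borel ((+) c)) B"
        by (simp add: lborel_distr_plus)
      also have "\<dots> = emeasure lborel ((\<lambda>x. c + x) -` B)"
        using that by (subst emeasure_distr) auto
      finally show ?thesis ..
    qed
    have meas: "(\<lambda>x. a i + x) -` A i \<in> sets lborel" if "i \<in> I" for i
      using measurable_sets[of "\<lambda>x. a i + x" lborel lborel "A i"] A[OF that] by simp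
    show "emeasure (distr (PiM I (\<lambda>_. lborel)) (PiM I (\<lambda>_. lborel)) (\<lambda>x. \<lambda>i\<in>I. x i + a i)) (Pi\<^sub>E I A)
      = (\<Prod>i\<in>I. emeasure lborel (A i))"
      using A meas
      by (subst emeasure_distr) (auto simp: vim emeasure_PiM tr intro!: prod.cong)
  qed auto
qed

lemma nn_integral_translate_PiM_lborel:
  fixes a :: "'i \<Rightarrow> real"
  assumes [simp]: "finite I" and f[measurable]: "f \<in> borel_measurable (PiM I (\<lambda>_. lborel))"
  shows "(\<integral>\<^sup>+x. f (\<lambda>i\<in>I. x i + a i) \<partial>PiM I (\<lambda>_. lborel)) = (\<integral>\<^sup>+x. f x \<partial>PiM I (\<lambda>_. lborel))"
proof -
  have "(\<integral>\<^sup>+x. f x \<partial>PiM I (\<lambda>_. lborel)) =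
     (\<integral>\<^sup>+x. f x \<partial>distr (PiM I (\<lambda>_. lborel)) (PiM I (\<lambda>_. lborel)) (\<lambda>x. \<lambda>i\<in>I. x i + a i))"
    by (simp add: distr_translate_PiM_lborel)
  also have "\<dots> = (\<integral>\<^sup>+x. f (\<lambda>i\<in>I. x i + a i) \<partial>PiM I (\<lambda>_. lborel))"
    by (rule nn_integral_distr) auto
  finally show ?thesis ..
qed

text \<open>Uniqueness of Haar measure: by translation invariance, both integrals factor out of
  \<open>\<integral>\<integral> f (L x + y) g y\<close>.\<close>

lemma nn_integral_linear_PiM_lborel:
  fixes L L' :: "('i \<Rightarrow> real) \<Rightarrow> 'i \<Rightarrow> real"
  assumes [simp]: "finite I"
    and L[measurable]: "L \<in> PiM I (\<lambda>_. lborel) \<rightarrow>\<^sub>M PiM I (\<lambda>_. lborel)"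
    and L': "\<And>x y. x \<in> extensional I \<Longrightarrow> y \<in> extensional I \<Longrightarrow>
      L (\<lambda>i\<in>I. x i + L' y i) = (\<lambda>i\<in>I. L x i + y i)"
    and f[measurable]: "f \<in> borel_measurable (PiM I (\<lambda>_. lborel))"
  shows "(\<integral>\<^sup>+x. f (L x) \<partial>PiM I (\<lambda>_. lborel)) =
    (\<integral>\<^sup>+x. indicator (Pi\<^sub>E I (\<lambda>_. {0..1})) (\<lambda>i\<in>I. - L x i) \<partial>PiM I (\<lambda>_. lborel)) * (\<integral>\<^sup>+x. f x \<partial>PiM I (\<lambda>_. lborel))"
proof -
  let ?M = "PiM I (\<lambda>_. lborel :: real measure)"
  interpret product_sigma_finite "\<lambda>_::'i. lborel :: real measure" by standard
  interpret S: sigma_finite_measure ?M by (rule sigma_finite) simp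
  interpret P: pair_sigma_finite ?M ?M ..
  define C where "C = Pi\<^sub>E I (\<lambda>_. {0..1::real})"
  have C[measurable]: "C \<in> sets ?M" unfolding C_def by (rule sets_PiM_I_finite) auto
  define g :: "_ \<Rightarrow> ennreal" where "g = indicator C"
  have [measurable]: "g \<in> borel_measurable ?M" unfolding g_def by measurable
  have g1: "(\<integral>\<^sup>+y. g y \<partial>?M) = 1"
  proof -
    have "(\<integral>\<^sup>+y. g y \<partial>?M) = emeasure ?M C" unfolding g_def by simp
    also have "\<dots> = (\<Prod>i\<in>I. emeasure lborel {0..1::real})" unfolding C_def by (rule emeasure_PiM) auto
    finally show ?thesis by simp
  qed
  have sp: "x \<in> space ?M \<longleftrightarrow> x \<in> extensional I" for x by (simp add: space_PiM PiE_def)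
  have Lm: "L x \<in> extensional I" if "x \<in> extensional I" for x
    using measurable_space[OF L, of x] that by (simp add: sp)
  \<comment> \<open>\<open>L' y\<close> is a preimage of \<open>y\<close> under the linear part, so
    translating the argument by it translates the value of \<open>L\<close> by
    \<open>y\<close>.\<close>
  have shift: "(\<integral>\<^sup>+x. h (L x) \<partial>?M) = (\<integral>\<^sup>+x. h (\<lambda>i\<in>I. L x i + y i) \<partial>?M)"
    if [measurable]: "h \<in> borel_measurable ?M" and y: "y \<in> extensional I" for h :: "_ \<Rightarrow> ennreal" and y
  proof -
    have "(\<integral>\<^sup>+x. h (L x) \<partial>?M) = (\<integral>\<^sup>+x. h (L (\<lambda>i\<in>I. x i + L' y i)) \<partial>?M)"
      by (rule nn_integral_translate_PiM_lborel[symmetric, where f="\<lambda>x. h (L x)"]) auto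
    also have "\<dots> = (\<integral>\<^sup>+x. h (\<lambda>i\<in>I. L x i + y i) \<partial>?M)"
      by (intro nn_integral_cong) (simp add: L' sp y)
    finally show ?thesis .
  qed
  have [measurable]: "(\<lambda>x. L x i) \<in> borel_measurable ?M" if "i \<in> I" for i
    using measurable_compose[OF L measurable_component_singleton[OF that]] by simp
  have neg[measurable]: "(\<lambda>x. \<lambda>i\<in>I. - L x i) \<in> ?M \<rightarrow>\<^sub>M ?M" by measurable
  have "(\<integral>\<^sup>+x. f (L x) \<partial>?M) = (\<integral>\<^sup>+y. g y * (\<integral>\<^sup>+x. f (L x) \<partial>?M) \<partial>?M)"
    by (simp add: nn_integral_multc g1)
  also have "\<dots> = (\<integral>\<^sup>+y. \<integral>\<^sup>+x. g y * f (\<lambda>i\<in>I. L x i + y i) \<partial>?M \<partial>?M)"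
    by (intro nn_integral_cong) (simp add: shift sp nn_integral_cmult)
  also have "\<dots> = (\<integral>\<^sup>+x. \<integral>\<^sup>+y. g y * f (\<lambda>i\<in>I. L x i + y i) \<partial>?M \<partial>?M)"
    by (rule P.Fubini') measurable
  \<comment> \<open>Substituting \<open>y - L x\<close> for \<open>y\<close> moves the translate
    from \<open>f\<close> to the unit cube \<open>g\<close>; after a second swap,
    \<open>shift\<close> removes \<open>y\<close> from the factor with \<open>g\<close>.\<close>
  also have "\<dots> = (\<integral>\<^sup>+x. \<integral>\<^sup>+y. g (\<lambda>i\<in>I. y i - L x i) * f y \<partial>?M \<partial>?M)"
  proof (rule nn_integral_cong)
    fix x assume x: "x \<in> space ?M"
    let ?h = "\<lambda>y. g (\<lambda>i\<in>I. y i - L x i) * f y"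
    have "(\<integral>\<^sup>+y. g y * f (\<lambda>i\<in>I. L x i + y i) \<partial>?M) = (\<integral>\<^sup>+y. ?h (\<lambda>i\<in>I. y i + L x i) \<partial>?M)"
    proof (rule nn_integral_cong)
      fix y assume y: "y \<in> space ?M"
      then have "(\<lambda>i\<in>I. (\<lambda>i\<in>I. y i + L x i) i - L x i) = y"
        by (auto simp: sp extensional_def fun_eq_iff)
      then show "g y * f (\<lambda>i\<in>I. L x i + y i) = ?h (\<lambda>i\<in>I. y i + L x i)"
        by (simp add: add.commute)
    qed
    also have "\<dots> = (\<integral>\<^sup>+y. ?h y \<partial>?M)"
      by (rule nn_integral_translate_PiM_lborel) auto
    finally show "(\<integral>\<^sup>+y. g y * f (\<lambda>i\<in>I. L x i + y i) \<partial>?M) = (\<integral>\<^sup>+y. ?h y \<partial>?M)" .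
  qed
  also have "\<dots> = (\<integral>\<^sup>+y. \<integral>\<^sup>+x. g (\<lambda>i\<in>I. y i - L x i) * f y \<partial>?M \<partial>?M)"
    by (rule P.Fubini') measurable
  also have "\<dots> = (\<integral>\<^sup>+y. (\<integral>\<^sup>+x. g (\<lambda>i\<in>I. - L x i) \<partial>?M) * f y \<partial>?M)"
  proof (rule nn_integral_cong)
    fix y assume y: "y \<in> space ?M"
    let ?h = "\<lambda>u. g (\<lambda>i\<in>I. - u i)"
    have m: "(\<lambda>u. \<lambda>i\<in>I. - u i) \<in> ?M \<rightarrow>\<^sub>M ?M" by measurable
    have h[measurable]: "?h \<in> borel_measurable ?M" using m by measurable
    define z where "z = (\<lambda>i\<in>I. - y i)"
    have z: "z \<in> extensional I" by (simp add: z_def)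
    have "(\<integral>\<^sup>+x. g (\<lambda>i\<in>I. - L x i) \<partial>?M) = (\<integral>\<^sup>+x. ?h (\<lambda>i\<in>I. L x i + z i) \<partial>?M)"
      using shift[OF h z] by simp
    also have "\<dots> = (\<integral>\<^sup>+x. g (\<lambda>i\<in>I. y i - L x i) \<partial>?M)"
      by (intro nn_integral_cong arg_cong[of _ _ g]) (auto simp: z_def fun_eq_iff)
    finally show "(\<integral>\<^sup>+x. g (\<lambda>i\<in>I. y i - L x i) * f y \<partial>?M) = (\<integral>\<^sup>+x. g (\<lambda>i\<in>I. - L x i) \<partial>?M) * f y"
      using y by (subst nn_integral_multc) auto
  qed
  also have "\<dots> = (\<integral>\<^sup>+x. g (\<lambda>i\<in>I. - L x i) \<partial>?M) * (\<integral>\<^sup>+y. f y \<partial>?M)"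
    by (rule nn_integral_cmult) auto
  finally show ?thesis unfolding g_def C_def .
qed

lemma PiM_density_lborel:
  fixes f :: "'i \<Rightarrow> real \<Rightarrow> ennreal"
  assumes [simp]: "finite I" and f[measurable]: "\<And>i. f i \<in> borel_measurable lborel"
    and p: "\<And>i. prob_space (density lborel (f i))"
  shows "PiM I (\<lambda>i. density lborel (f i)) = density (PiM I (\<lambda>_. lborel)) (\<lambda>x. \<Prod>i\<in>I. f i (x i))"
proof -
  interpret L: product_sigma_finite "\<lambda>_::'i. lborel :: real measure" by standard
  interpret D: product_prob_space "\<lambda>i. density lborel (f i)"
    using p by (rule product_prob_spaceI)
  show ?thesis
  proof (rule D.PiM_eqI[symmetric])
    show "sets (density (PiM I (\<lambda>_. lborel)) (\<lambda>x. \<Prod>i\<in>I. f i (x i))) = sets (PiM I (\<lambda>i. density lborel (f i)))"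
      by (auto intro!: sets_PiM_cong)
    fix A :: "'i \<Rightarrow> real set" assume A: "\<And>i. i \<in> I \<Longrightarrow> A i \<in> sets (density lborel (f i))"
    then have A'[measurable]: "\<And>i. i \<in> I \<Longrightarrow> A i \<in> sets borel" by simp
    have "emeasure (density (PiM I (\<lambda>_. lborel)) (\<lambda>x. \<Prod>i\<in>I. f i (x i))) (Pi\<^sub>E I A)
       = (\<integral>\<^sup>+x. (\<Prod>i\<in>I. f i (x i)) * indicator (Pi\<^sub>E I A) x \<partial>PiM I (\<lambda>_. lborel))"
      by (rule emeasure_density) (auto intro!: sets_PiM_I_finite)
    also have "\<dots> = (\<integral>\<^sup>+x. (\<Prod>i\<in>I. f i (x i) * indicator (A i) (x i)) \<partial>PiM I (\<lambda>_. lborel))"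
    proof (rule nn_integral_cong)
      fix x :: "'i \<Rightarrow> real" assume "x \<in> space (PiM I (\<lambda>_. lborel))"
      then have "indicator (Pi\<^sub>E I A) x = (\<Prod>i\<in>I. indicator (A i) (x i) :: ennreal)"
        by (auto simp: indicator_def space_PiM PiE_iff prod_zero_iff)
      then show "(\<Prod>i\<in>I. f i (x i)) * indicator (Pi\<^sub>E I A) x = (\<Prod>i\<in>I. f i (x i) * indicator (A i) (x i))"
        by (simp add: prod.distrib)
    qed
    also have "\<dots> = (\<Prod>i\<in>I. \<integral>\<^sup>+x. f i x * indicator (A i) x \<partial>lborel)"
      by (rule L.product_nn_integral_prod) auto
    also have "\<dots> = (\<Prod>i\<in>I. emeasure (density lborel (f i)) (A i))"
      by (intro prod.cong refl emeasure_density[symmetric]) auto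
    finally show "emeasure (density (PiM I (\<lambda>_. lborel)) (\<lambda>x. \<Prod>i\<in>I. f i (x i))) (Pi\<^sub>E I A)
      = (\<Prod>i\<in>I. emeasure (density lborel (f i)) (A i))" .
  qed simp
qed

section \<open>Factorization of positive definite forms\<close>

text \<open>Fewer equations than unknowns: padded with zero rows, the coefficients form a singular
  square matrix.\<close>

lemma exists_nonzero_kernel_vector:
  fixes a :: "nat \<Rightarrow> nat \<Rightarrow> real"
  assumes kd: "k < d"
  shows "\<exists>v. (\<exists>l<d. v l \<noteq> 0) \<and> (\<forall>i<k. (\<Sum>l<d. a i l * v l) = 0)"
proof -
  define A where "A = Matrix.mat d d (\<lambda>(i,l). if i < k then a i l else 0)"
  have A: "A \<in> carrier_mat d d" by (simp add: A_def)
  \<comment> \<open>Row \<open>k\<close> is one of the padding rows, so scaling it by 0 changes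
    nothing, whereas it multiplies the determinant by 0.\<close>
  have "multrow k 0 A = A"
    by (rule eq_matI) (use kd in \<open>auto simp: A_def\<close>)
  then have "Determinant.det A = 0"
    using det_multrow[OF kd A, of 0] by simp
  then obtain v where v: "v \<in> carrier_vec d" "v \<noteq> 0\<^sub>v d" "A *\<^sub>v v = 0\<^sub>v d"
    using det_0_iff_vec_prod_zero[OF A] by auto
  have "\<exists>l<d. v $ l \<noteq> 0" using v by (metis carrier_vecD eq_vecI index_zero_vec(1) index_zero_vec(2))
  moreover have "(\<Sum>l<d. a i l * v $ l) = 0" if "i < k" for i
  proof -
    have "(A *\<^sub>v v) $ i = 0" using v(3) that kd by simp
    then show ?thesis using that kd v(1) by (simp add: A_def scalar_prod_def lessThan_atLeast0)
  qed
  ultimately show ?thesis by (intro exI[of _ "\<lambda>l. v $ l"]) auto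
qed

definition quad_form :: "nat \<Rightarrow> (nat \<Rightarrow> nat \<Rightarrow> real) \<Rightarrow> (nat \<Rightarrow> real) \<Rightarrow> (nat \<Rightarrow> real) \<Rightarrow> real" where
  "quad_form d S v w = (\<Sum>i<d. \<Sum>k<d. v i * S i k * w k)"

lemma quad_form_alt: "quad_form d S v w = (\<Sum>i<d. v i * (\<Sum>k<d. S i k * w k))"
  by (simp add: quad_form_def sum_distrib_left mult.assoc)

lemma quad_form_alt2: "quad_form d S v w = (\<Sum>k<d. (\<Sum>i<d. v i * S i k) * w k)"
  unfolding quad_form_def by (subst sum.swap) (simp add: sum_distrib_right)

lemma quad_form_sym:
  assumes "\<And>i k. i < d \<Longrightarrow> k < d \<Longrightarrow> S i k = S k i"
  shows "quad_form d S v w = quad_form d S w v"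
  unfolding quad_form_def by (subst sum.swap) (auto intro!: sum.cong simp: assms)

lemma quad_form_scale: "quad_form d S (\<lambda>i. a * v i) (\<lambda>i. b * w i) = a * b * quad_form d S v w"
  by (simp add: quad_form_def sum_distrib_left algebra_simps)

text \<open>Induction without explicit projections: orthogonality to the \<open>m < d\<close>
  vectors found so far is a system of \<open>m\<close> linear equations, so it has a nonzero
  solution, which is then normalized by its length in the form \<open>S\<close>.\<close>

lemma orthonormal_family:
  fixes S :: "nat \<Rightarrow> nat \<Rightarrow> real"
  assumes sym: "\<And>i k. i < d \<Longrightarrow> k < d \<Longrightarrow> S i k = S k i"
    and pd: "\<And>v. \<exists>i<d. v i \<noteq> 0 \<Longrightarrow> quad_form d S v v > 0"
  shows "m \<le> d \<Longrightarrow> \<exists>B. \<forall>i<m. \<forall>j<m. quad_form d S (B i) (B j) = (if i = j then 1 else 0)"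
proof (induction m)
  case (Suc m)
  then obtain B where B: "\<And>i j. i < m \<Longrightarrow> j < m \<Longrightarrow> quad_form d S (B i) (B j) = (if i = j then 1 else 0)"
    by auto
  from exists_nonzero_kernel_vector[of m d "\<lambda>i l. \<Sum>k<d. B i k * S k l"] Suc.prems
  obtain v where v: "\<exists>l<d. v l \<noteq> 0" "\<And>i. i < m \<Longrightarrow> quad_form d S (B i) v = 0"
    by (auto simp: quad_form_alt2)
  define r where "r = sqrt (quad_form d S v v)"
  have r: "r > 0" "r * r = quad_form d S v v" using pd[OF v(1)] by (auto simp: r_def)
  define w where "w = (\<lambda>i. (1/r) * v i)"
  have ww: "quad_form d S w w = 1"
    unfolding w_def quad_form_scale using r pd[OF v(1)] by (simp add: field_simps)
  have Bw: "quad_form d S (B i) w = 0" "quad_form d S w (B i) = 0" if "i < m" for i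
  proof -
    have "quad_form d S (\<lambda>k. 1 * B i k) w = 0"
      unfolding w_def quad_form_scale using v(2)[OF that] by simp
    then show "quad_form d S (B i) w = 0" by simp
    then show "quad_form d S w (B i) = 0" using quad_form_sym[of d S, OF sym] by metis
  qed
  show ?case
    by (intro exI[of _ "B(m := w)"]) (auto simp: less_Suc_eq B ww Bw)
qed simp

text \<open>With the orthonormal family as the rows of \<open>X\<close>, and \<open>Y\<close> the
  product of \<open>S\<close> with the transpose of \<open>X\<close>, orthonormality reads
  \<open>X * Y = 1\<close>. One-sided inverses of square matrices are two-sided, and
  \<open>Y * X = 1\<close> exhibits the inverse of \<open>S\<close> as the transpose of
  \<open>X\<close> times \<open>X\<close>.\<close>

lemma pos_def_factor:
  fixes S :: "nat \<Rightarrow> nat \<Rightarrow> real"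
  assumes sym: "\<And>i k. i < d \<Longrightarrow> k < d \<Longrightarrow> S i k = S k i"
    and pd: "\<And>v. \<exists>i<d. v i \<noteq> 0 \<Longrightarrow> quad_form d S v v > 0"
  obtains B where "\<And>i j. i < d \<Longrightarrow> j < d \<Longrightarrow> quad_form d S (B i) (B j) = (if i = j then 1 else 0)"
    and "\<And>i l. i < d \<Longrightarrow> l < d \<Longrightarrow> (\<Sum>k<d. S i k * (\<Sum>j<d. B j k * B j l)) = (if i = l then 1 else 0)"
proof -
  obtain B where B: "\<And>i j. i < d \<Longrightarrow> j < d \<Longrightarrow> quad_form d S (B i) (B j) = (if i = j then 1 else 0)"
    using orthonormal_family[of d S d, OF sym pd] by auto
  define X where "X = Matrix.mat d d (\<lambda>(i,k). B i k)"
  define Y where "Y = Matrix.mat d d (\<lambda>(i,j). \<Sum>k<d. S i k * B j k)"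
  have X: "X \<in> carrier_mat d d" and Y: "Y \<in> carrier_mat d d" by (auto simp: X_def Y_def)
  have "X * Y = 1\<^sub>m d"
    by (rule eq_matI) (auto simp: X_def Y_def scalar_prod_def quad_form_alt B[symmetric] lessThan_atLeast0)
  then have YX: "Y * X = 1\<^sub>m d" by (rule mat_mult_left_right_inverse[OF X Y])
  have "(\<Sum>k<d. S i k * (\<Sum>j<d. B j k * B j l)) = (if i = l then 1 else 0)" if "i < d" "l < d" for i l
  proof -
    have "(\<Sum>k<d. S i k * (\<Sum>j<d. B j k * B j l)) = (\<Sum>j<d. (\<Sum>k<d. S i k * B j k) * B j l)"
      unfolding sum_distrib_left sum_distrib_right by (subst sum.swap) (simp add: algebra_simps)
    also have "\<dots> = (Y * X) $$ (i, l)"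
      using that by (simp add: X_def Y_def scalar_prod_def lessThan_atLeast0)
    finally show ?thesis using that by (simp add: YX)
  qed
  with B show ?thesis by (rule that)
qed

lemma pos_def_solvable:
  fixes S :: "nat \<Rightarrow> nat \<Rightarrow> real"
  assumes sym: "\<And>i k. i < d \<Longrightarrow> k < d \<Longrightarrow> S i k = S k i"
    and pd: "\<And>v. \<exists>i<d. v i \<noteq> 0 \<Longrightarrow> quad_form d S v v > 0"
  shows "\<exists>\<xi>. \<forall>i<d. (\<Sum>k<d. S i k * \<xi> k) = w i"
proof -
  obtain B where B: "\<And>i l. i < d \<Longrightarrow> l < d \<Longrightarrow> (\<Sum>k<d. S i k * (\<Sum>j<d. B j k * B j l)) = (if i = l then 1 else 0)"
    by (rule pos_def_factor[OF sym pd]) auto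
  define T where "T = (\<lambda>k l. \<Sum>j<d. B j k * B j l)"
  have "(\<Sum>k<d. S i k * (\<Sum>l<d. T k l * w l)) = w i" if "i < d" for i
  proof -
    have "(\<Sum>k<d. S i k * (\<Sum>l<d. T k l * w l)) = (\<Sum>k<d. \<Sum>l<d. (S i k * T k l) * w l)"
      by (simp add: sum_distrib_left mult.assoc)
    also have "\<dots> = (\<Sum>l<d. (\<Sum>k<d. S i k * T k l) * w l)"
      by (subst sum.swap) (simp add: sum_distrib_right)
    also have "\<dots> = (\<Sum>l<d. if i = l then w l else 0)"
      by (intro sum.cong refl) (simp add: B that T_def)
    finally show ?thesis using that by simp
  qed
  then show ?thesis by (intro exI[of _ "\<lambda>k. \<Sum>l<d. T k l * w l"]) auto
qed

section \<open>Gaussians as affine images of standard normal vectors\<close>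

abbreviation std_normal :: "real measure" where
  "std_normal \<equiv> density lborel std_normal_density"

lemma prob_space_std_normal: "prob_space std_normal"
  by (rule prob_space_normal_density) simp

definition affine_image :: "nat \<Rightarrow> (nat \<Rightarrow> real) \<Rightarrow> (nat \<Rightarrow> nat \<Rightarrow> real) \<Rightarrow> (nat \<Rightarrow> real) \<Rightarrow> nat \<Rightarrow> real" where
  "affine_image d \<mu> M \<zeta> = (\<lambda>i\<in>{..<d}. \<mu> i + (\<Sum>j<d. M i j * \<zeta> j))"

lemma PiM_std_normal:
  assumes [simp]: "finite I"
  shows "PiM I (\<lambda>_. std_normal) = density (PiM I (\<lambda>_. lborel))
    (\<lambda>x. ennreal ((1 / sqrt (2 * pi)) ^ card I * exp (- (1/2) * (\<Sum>i\<in>I. (x i)\<^sup>2))))"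
proof -
  have "PiM I (\<lambda>_. std_normal) = density (PiM I (\<lambda>_. lborel)) (\<lambda>x. \<Prod>i\<in>I. ennreal (std_normal_density (x i)))"
    by (rule PiM_density_lborel) (auto intro: prob_space_std_normal)
  also have "(\<lambda>x. \<Prod>i\<in>I. ennreal (std_normal_density (x i))) =
     (\<lambda>x. ennreal ((1 / sqrt (2 * pi)) ^ card I * exp (- (1/2) * (\<Sum>i\<in>I. (x i)\<^sup>2))))"
    by (simp add: prod_ennreal std_normal_density_def prod.distrib exp_sum[symmetric]
        sum_divide_distrib sum_negf fun_eq_iff prod_dividef power_one_over flip: exp_sum)
  finally show ?thesis .
qed

text \<open>No determinant is computed. The linear change of variables multiplies Lebesgue integrals
  by some constant \<open>c\<close>, and since the image measure has total mass 1,
  \<open>K * c\<close> is forced to be the reciprocal of the total weight \<open>W\<close>.\<close>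

lemma distr_affine_image_std_normal:
  fixes \<mu> :: "nat \<Rightarrow> real"
  assumes BM: "\<And>\<zeta> j. j < d \<Longrightarrow> (\<Sum>k<d. B j k * (\<Sum>l<d. M k l * \<zeta> l)) = \<zeta> j"
    and MB: "\<And>x i. i < d \<Longrightarrow> (\<Sum>j<d. M i j * (\<Sum>k<d. B j k * x k)) = x i"
  defines "w \<equiv> \<lambda>x. exp (- (1/2) * (\<Sum>j<d. (\<Sum>k<d. B j k * (x k - \<mu> k))\<^sup>2))"
  shows "distr (PiM {..<d} (\<lambda>_. std_normal)) (euclid d) (affine_image d \<mu> M) =
    density (lebesgue_euclid d) (\<lambda>x. ennreal (w x / (LINT y|lebesgue_euclid d. w y)))"
proof -
  let ?M = "PiM {..<d} (\<lambda>_. lborel :: real measure)"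
  let ?G = "PiM {..<d} (\<lambda>_. std_normal)"
  define K where "K = (1 / sqrt (2 * pi)) ^ d"
  have K: "K > 0" by (simp add: K_def)
  have G: "?G = density ?M (\<lambda>x. ennreal (K * exp (- (1/2) * (\<Sum>i<d. (x i)\<^sup>2))))"
    by (subst PiM_std_normal) (auto simp: K_def)
  have setsE: "sets (euclid d) = sets ?M" unfolding euclid_def by (rule sets_PiM_cong) auto
  have setsG: "sets ?G = sets ?M" by (simp add: G)
  define L where "L = (\<lambda>x. \<lambda>i\<in>{..<d}. \<Sum>j<d. M i j * x j)"
  define L' where "L' = (\<lambda>(y :: nat \<Rightarrow> real). \<lambda>j. \<Sum>k<d. B j k * y k)"
  have Lmeas[measurable]: "L \<in> ?M \<rightarrow>\<^sub>M ?M" unfolding L_def by measurable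
  have wmeas[measurable]: "w \<in> borel_measurable ?M" unfolding w_def by measurable
  have aff[measurable]: "affine_image d \<mu> M \<in> ?M \<rightarrow>\<^sub>M ?M" unfolding affine_image_def by measurable
  have w_aff: "w (affine_image d \<mu> M \<zeta>) = exp (- (1/2) * (\<Sum>i<d. (\<zeta> i)\<^sup>2))" for \<zeta>
  proof -
    have "(\<Sum>k<d. B j k * (affine_image d \<mu> M \<zeta> k - \<mu> k)) = \<zeta> j" if "j < d" for j
      using BM[OF that, of \<zeta>] by (simp add: affine_image_def)
    then show ?thesis unfolding w_def by simp
  qed
  define c where "c = (\<integral>\<^sup>+x. indicator (Pi\<^sub>E {..<d} (\<lambda>_. {0..1})) (\<lambda>i\<in>{..<d}. - L x i) \<partial>?M)"
  have haar: "(\<integral>\<^sup>+x. f (L x) \<partial>?M) = c * (\<integral>\<^sup>+x. f x \<partial>?M)" if "f \<in> borel_measurable ?M" for f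
    unfolding c_def
  proof (rule nn_integral_linear_PiM_lborel[where L' = L'])
    fix x y :: "nat \<Rightarrow> real"
    show "L (\<lambda>i\<in>{..<d}. x i + L' y i) = (\<lambda>i\<in>{..<d}. L x i + y i)"
      by (auto simp: L_def L'_def fun_eq_iff distrib_left sum.distrib MB)
  qed (use that in auto)
  have aff_alt: "affine_image d \<mu> M x = (\<lambda>i\<in>{..<d}. L x i + \<mu> i)" for x
    by (auto simp: affine_image_def L_def)
  have em: "emeasure (distr ?G (euclid d) (affine_image d \<mu> M)) A = ennreal K * c * (\<integral>\<^sup>+x. ennreal (w x) * indicator A x \<partial>?M)"
    if A: "A \<in> sets (euclid d)" for A
  proof -
    have A'[measurable]: "A \<in> sets ?M" using A setsE by simp
    have affG: "affine_image d \<mu> M \<in> ?G \<rightarrow>\<^sub>M euclid d"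
      using aff measurable_cong_sets[OF setsG setsE] by simp
    let ?g = "\<lambda>x. ennreal (w x) * indicator A x"
    have [measurable]: "?g \<in> borel_measurable ?M" by measurable
    have tr[measurable]: "(\<lambda>x. \<lambda>i\<in>{..<d}. x i + \<mu> i) \<in> ?M \<rightarrow>\<^sub>M ?M" by measurable
    have "emeasure (distr ?G (euclid d) (affine_image d \<mu> M)) A = (\<integral>\<^sup>+x. indicator A (affine_image d \<mu> M x) \<partial>?G)"
      using A by (subst nn_integral_distr[OF affG, symmetric]) auto
    also have "\<dots> = (\<integral>\<^sup>+x. ennreal (K * exp (- (1/2) * (\<Sum>i<d. (x i)\<^sup>2))) * indicator A (affine_image d \<mu> M x) \<partial>?M)"
      unfolding G by (subst nn_integral_density) auto
    also have "\<dots> = (\<integral>\<^sup>+x. ennreal K * ?g (affine_image d \<mu> M x) \<partial>?M)"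
      using K by (simp add: w_aff ennreal_mult mult.assoc)
    also have "\<dots> = ennreal K * (\<integral>\<^sup>+x. ?g (\<lambda>i\<in>{..<d}. L x i + \<mu> i) \<partial>?M)"
      by (subst nn_integral_cmult) (auto simp: aff_alt)
    also have "(\<integral>\<^sup>+x. ?g (\<lambda>i\<in>{..<d}. L x i + \<mu> i) \<partial>?M) = c * (\<integral>\<^sup>+x. ?g (\<lambda>i\<in>{..<d}. x i + \<mu> i) \<partial>?M)"
      by (rule haar) measurable
    also have "(\<integral>\<^sup>+x. ?g (\<lambda>i\<in>{..<d}. x i + \<mu> i) \<partial>?M) = (\<integral>\<^sup>+x. ?g x \<partial>?M)"
      by (rule nn_integral_translate_PiM_lborel) auto
    finally show ?thesis by (simp add: mult.assoc)
  qed
  define W where "W = (\<integral>\<^sup>+x. ennreal (w x) \<partial>?M)"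
  interpret G: prob_space ?G by (intro prob_space_PiM prob_space_std_normal)
  have affG: "affine_image d \<mu> M \<in> ?G \<rightarrow>\<^sub>M euclid d"
    using aff measurable_cong_sets[OF setsG setsE] by simp
  interpret D: prob_space "distr ?G (euclid d) (affine_image d \<mu> M)"
    by (rule G.prob_space_distr[OF affG])
  have "1 = ennreal K * c * W"
  proof -
    have "1 = emeasure (distr ?G (euclid d) (affine_image d \<mu> M)) (space (euclid d))"
      using D.emeasure_space_1 by simp
    also have "\<dots> = ennreal K * c * (\<integral>\<^sup>+x. ennreal (w x) * indicator (space (euclid d)) x \<partial>?M)"
      by (rule em) auto
    also have "(\<integral>\<^sup>+x. ennreal (w x) * indicator (space (euclid d)) x \<partial>?M) = W"
      unfolding W_def using sets_eq_imp_space_eq[OF setsE] by (intro nn_integral_cong) simp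
    finally show ?thesis .
  qed
  then have one: "(ennreal K * c) * W = 1" by simp
  have W0: "W \<noteq> 0" using one by auto
  have Wtop: "W \<noteq> \<top>" using one W0 by (auto simp: ennreal_mult_top ennreal_top_mult split: if_splits)
  have wint: "(LINT y|?M. w y) = enn2real W"
    unfolding W_def by (rule integral_eq_nn_integral) (auto simp: w_def)
  have Wr: "enn2real W > 0" "ennreal (enn2real W) = W"
    using W0 Wtop by (auto simp: enn2real_positive_iff less_top zero_less_iff_neq_zero)
  have Kc: "ennreal K * c = ennreal (1 / enn2real W)"
  proof -
    have "ennreal K * c = ennreal K * c * (W * ennreal (1 / enn2real W))"
      using Wr by (metis ennreal_1 ennreal_mult' less_imp_le mult.right_neutral nonzero_mult_div_cancel_left
          order_less_irrefl times_divide_eq_right)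
    also have "\<dots> = ennreal (1 / enn2real W)" using one by (metis mult.assoc mult_1)
    finally show ?thesis .
  qed
  show ?thesis
  proof (rule measure_eqI)
    show s: "sets (distr ?G (euclid d) (affine_image d \<mu> M)) =
       sets (density (lebesgue_euclid d) (\<lambda>x. ennreal (w x / (LINT y|lebesgue_euclid d. w y))))"
      by (simp add: setsE lebesgue_euclid_def)
    fix A assume "A \<in> sets (distr ?G (euclid d) (affine_image d \<mu> M))"
    then have A: "A \<in> sets (euclid d)" by simp
    then have A'[measurable]: "A \<in> sets ?M" using setsE by simp
    have "emeasure (density (lebesgue_euclid d) (\<lambda>x. ennreal (w x / (LINT y|lebesgue_euclid d. w y)))) A
       = (\<integral>\<^sup>+x. ennreal (w x / enn2real W) * indicator A x \<partial>?M)"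
      unfolding lebesgue_euclid_def wint by (rule emeasure_density) auto
    also have "\<dots> = (\<integral>\<^sup>+x. ennreal (1 / enn2real W) * (ennreal (w x) * indicator A x) \<partial>?M)"
    proof (intro nn_integral_cong)
      fix x
      have "ennreal (w x / enn2real W) = ennreal (1 / enn2real W) * ennreal (w x)"
        using Wr(1) by (subst ennreal_mult[symmetric]) (auto simp: w_def)
      then show "ennreal (w x / enn2real W) * indicator A x = ennreal (1 / enn2real W) * (ennreal (w x) * indicator A x)"
        by (simp add: mult.assoc)
    qed
    also have "\<dots> = ennreal (1 / enn2real W) * (\<integral>\<^sup>+x. ennreal (w x) * indicator A x \<partial>?M)"
      by (rule nn_integral_cmult) auto
    finally show "emeasure (distr ?G (euclid d) (affine_image d \<mu> M)) A = emeasure (density (lebesgue_euclid d)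
       (\<lambda>x. ennreal (w x / (LINT y|lebesgue_euclid d. w y)))) A"
      by (simp add: em[OF A] Kc)
  qed
qed

lemma quad_form_mat:
  assumes "A \<in> carrier_mat d d"
  shows "scalar_prod (Matrix.vec d v) (A *\<^sub>v Matrix.vec d w) = quad_form d (\<lambda>i k. A $$ (i,k)) v w"
  using assms by (simp add: scalar_prod_def quad_form_alt lessThan_atLeast0)

text \<open>\<open>M\<close> is the inverse of the matrix \<open>B\<close> whose rows are
  orthonormal for \<open>\<Sigma>\<close>. So \<open>M\<close> times its transpose is
  \<open>\<Sigma>\<close>, the squared length of \<open>v M\<close> is the quadratic form of
  \<open>\<Sigma>\<close> at \<open>v\<close>, and the two Loewner bounds become bounds on that
  length.\<close>

lemma gaussian_class_representation:
  assumes D: "D \<in> gaussian_class d \<kappa>"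
  obtains \<mu> M where "D = distr (PiM {..<d} (\<lambda>_. std_normal)) (euclid d) (affine_image d \<mu> M)"
    and "\<And>v. (\<Sum>i<d. (v i)\<^sup>2) \<le> (\<Sum>j<d. (\<Sum>i<d. v i * M i j)\<^sup>2)"
    and "\<And>v. (\<Sum>j<d. (\<Sum>i<d. v i * M i j)\<^sup>2) \<le> \<kappa> * (\<Sum>i<d. (v i)\<^sup>2)"
proof -
  from D obtain m \<Sigma> where G: "D = gaussian d m \<Sigma>" and m: "m \<in> carrier_vec d" and \<Sigma>: "\<Sigma> \<in> carrier_mat d d"
    and lo: "pos_semidef (\<Sigma> - 1\<^sub>m d)" and up: "pos_semidef (\<kappa> \<cdot>\<^sub>m 1\<^sub>m d - \<Sigma>)"
    by (auto simp: gaussian_class_def loewner_le_def)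
  define S where "S = (\<lambda>i k. \<Sigma> $$ (i,k))"
  have sym: "S i k = S k i" if ik: "i < d" "k < d" for i k
  proof -
    have "transpose_mat (\<Sigma> - 1\<^sub>m d) = \<Sigma> - 1\<^sub>m d" using lo by (simp add: pos_semidef_def)
    then have "transpose_mat (\<Sigma> - 1\<^sub>m d) $$ (i,k) = (\<Sigma> - 1\<^sub>m d) $$ (i,k)" by simp
    then show ?thesis using ik \<Sigma> by (cases "i = k") (auto simp: S_def)
  qed
  have one: "quad_form d (\<lambda>i k. 1\<^sub>m d $$ (i,k)) v v = (\<Sum>i<d. (v i)\<^sup>2)" for v
  proof -
    have "(\<Sum>k<d. 1\<^sub>m d $$ (i,k) * v k) = v i" if "i < d" for i
    proof -
      have "(\<Sum>k<d. 1\<^sub>m d $$ (i,k) * v k) = (\<Sum>k<d. if i = k then v k else 0)"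
        using that by (intro sum.cong) auto
      then show ?thesis using that by simp
    qed
    then show ?thesis unfolding quad_form_alt by (simp add: power2_eq_square)
  qed
  have lower: "(\<Sum>i<d. (v i)\<^sup>2) \<le> quad_form d S v v" for v
  proof -
    have "0 \<le> scalar_prod (Matrix.vec d v) ((\<Sigma> - 1\<^sub>m d) *\<^sub>v Matrix.vec d v)"
      using lo \<Sigma> by (auto simp: pos_semidef_def)
    also have "\<dots> = quad_form d (\<lambda>i k. (\<Sigma> - 1\<^sub>m d) $$ (i,k)) v v"
      by (rule quad_form_mat) (use \<Sigma> in auto)
    also have "\<dots> = quad_form d S v v - quad_form d (\<lambda>i k. 1\<^sub>m d $$ (i,k)) v v"
      using \<Sigma> by (simp add: quad_form_def S_def algebra_simps sum_subtractf)
    finally show ?thesis by (simp add: one)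
  qed
  have upper: "quad_form d S v v \<le> \<kappa> * (\<Sum>i<d. (v i)\<^sup>2)" for v
  proof -
    have "0 \<le> scalar_prod (Matrix.vec d v) ((\<kappa> \<cdot>\<^sub>m 1\<^sub>m d - \<Sigma>) *\<^sub>v Matrix.vec d v)"
      using up \<Sigma> by (auto simp: pos_semidef_def)
    also have "\<dots> = quad_form d (\<lambda>i k. (\<kappa> \<cdot>\<^sub>m 1\<^sub>m d - \<Sigma>) $$ (i,k)) v v"
      by (rule quad_form_mat) (use \<Sigma> in auto)
    also have "\<dots> = \<kappa> * quad_form d (\<lambda>i k. 1\<^sub>m d $$ (i,k)) v v - quad_form d S v v"
      using \<Sigma> by (simp add: quad_form_def S_def algebra_simps sum_subtractf sum_distrib_left)
    finally show ?thesis by (simp add: one)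
  qed
  have pd: "quad_form d S v v > 0" if "\<exists>i<d. v i \<noteq> 0" for v
  proof -
    have "(\<Sum>i<d. (v i)\<^sup>2) > 0" using that by (auto intro: sum_pos2[where i = "SOME i. i < d \<and> v i \<noteq> 0"] simp: sum_pos2)
    with lower[of v] show ?thesis by linarith
  qed
  obtain B where B1: "\<And>i j. i < d \<Longrightarrow> j < d \<Longrightarrow> quad_form d S (B i) (B j) = (if i = j then 1 else 0)"
    and B2: "\<And>i l. i < d \<Longrightarrow> l < d \<Longrightarrow> (\<Sum>k<d. S i k * (\<Sum>j<d. B j k * B j l)) = (if i = l then 1 else 0)"
    by (rule pos_def_factor[OF sym pd]) auto
  define T where "T = (\<lambda>k l. \<Sum>j<d. B j k * B j l)"
  define M where "M = (\<lambda>i j. \<Sum>k<d. S i k * B j k)"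
  have BM: "(\<Sum>k<d. B j k * (\<Sum>l<d. M k l * \<zeta> l)) = \<zeta> j" if "j < d" for \<zeta> j
  proof -
    have "(\<Sum>k<d. B j k * (\<Sum>l<d. M k l * \<zeta> l)) = (\<Sum>l<d. (\<Sum>k<d. B j k * M k l) * \<zeta> l)"
      unfolding sum_distrib_left sum_distrib_right by (subst sum.swap) (simp add: mult.assoc)
    also have "\<dots> = (\<Sum>l<d. (if j = l then 1 else 0) * \<zeta> l)"
      by (intro sum.cong refl) (simp add: B1[symmetric] that M_def quad_form_alt)
    also have "\<dots> = (\<Sum>l<d. if j = l then \<zeta> l else 0)" by (intro sum.cong) auto
    finally show ?thesis using that by simp
  qed
  have MB: "(\<Sum>j<d. M i j * (\<Sum>k<d. B j k * x k)) = x i" if "i < d" for x i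
  proof -
    have "(\<Sum>j<d. M i j * (\<Sum>l<d. B j l * x l)) = (\<Sum>l<d. (\<Sum>j<d. M i j * B j l) * x l)"
      unfolding sum_distrib_left sum_distrib_right by (subst sum.swap) (simp add: mult.assoc)
    also have "\<dots> = (\<Sum>l<d. (if i = l then 1 else 0) * x l)"
    proof (intro sum.cong refl)
      fix l assume "l \<in> {..<d}"
      then have "(if i = l then 1 else 0) = (\<Sum>k<d. S i k * (\<Sum>j<d. B j k * B j l))" using B2 that by simp
      also have "\<dots> = (\<Sum>j<d. M i j * B j l)"
        unfolding M_def sum_distrib_left sum_distrib_right by (subst sum.swap) (simp add: mult.assoc)
      finally show "(\<Sum>j<d. M i j * B j l) * x l = (if i = l then 1 else 0) * x l" by simp
    qed
    also have "\<dots> = (\<Sum>l<d. if i = l then x l else 0)" by (intro sum.cong) auto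
    finally show ?thesis using that by simp
  qed
  \<comment> \<open>The transpose of \<open>B\<close> times \<open>B\<close> inverts
    \<open>\<Sigma>\<close>; hence \<open>mat_inverse\<close> does not fail, and by uniqueness of
    inverses it returns this matrix.\<close>
  define Ti where "Ti = Matrix.mat d d (\<lambda>(k,l). T k l)"
  have Ti: "Ti \<in> carrier_mat d d" by (simp add: Ti_def)
  have ST: "\<Sigma> * Ti = 1\<^sub>m d"
    using \<Sigma> by (intro eq_matI) (auto simp: Ti_def T_def scalar_prod_def B2[unfolded S_def] lessThan_atLeast0[symmetric])
  have TS: "Ti * \<Sigma> = 1\<^sub>m d" by (rule mat_mult_left_right_inverse[OF \<Sigma> Ti ST])
  have inv: "the (mat_inverse \<Sigma>) = Ti"
  proof (cases "mat_inverse \<Sigma>")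
    case None
    have "\<Sigma> \<in> Units (ring_mat TYPE(real) d ())"
      using \<Sigma> Ti ST TS by (auto simp: Units_def ring_mat_def)
    with mat_inverse(1)[OF \<Sigma> None, of "()"] show ?thesis by blast
  next
    case (Some C)
    from mat_inverse(2)[OF \<Sigma> Some] have C: "C * \<Sigma> = 1\<^sub>m d" "C \<in> carrier_mat d d" by auto
    have "C = C * (\<Sigma> * Ti)" using C ST by simp
    also have "\<dots> = (C * \<Sigma>) * Ti" using C(2) \<Sigma> Ti by (simp add: assoc_mult_mat)
    also have "\<dots> = Ti" using C(1) Ti by simp
    finally show ?thesis using Some by simp
  qed
  have weight: "gaussian_weight d m \<Sigma> x = exp (- (1/2) * (\<Sum>j<d. (\<Sum>k<d. B j k * (x k - m $ k))\<^sup>2))" for x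
  proof -
    let ?y = "\<lambda>k. x k - m $ k"
    have y: "Matrix.vec d x - m = Matrix.vec d ?y" using m by auto
    have "scalar_prod (Matrix.vec d x - m) (Ti *\<^sub>v (Matrix.vec d x - m)) = quad_form d (\<lambda>i k. Ti $$ (i,k)) ?y ?y"
      unfolding y by (rule quad_form_mat[OF Ti])
    also have "\<dots> = (\<Sum>k<d. \<Sum>l<d. \<Sum>j<d. (B j k * ?y k) * (B j l * ?y l))"
      unfolding quad_form_def Ti_def T_def
      by (intro sum.cong refl) (simp add: sum_distrib_left sum_distrib_right algebra_simps)
    also have "\<dots> = (\<Sum>k<d. \<Sum>j<d. \<Sum>l<d. (B j k * ?y k) * (B j l * ?y l))"
      by (intro sum.cong refl sum.swap)
    also have "\<dots> = (\<Sum>j<d. \<Sum>k<d. \<Sum>l<d. (B j k * ?y k) * (B j l * ?y l))"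
      by (rule sum.swap)
    also have "\<dots> = (\<Sum>j<d. (\<Sum>k<d. B j k * ?y k)\<^sup>2)"
      by (simp add: power2_eq_square sum_product)
    finally show ?thesis by (simp add: gaussian_weight_def Let_def inv)
  qed
  have "D = distr (PiM {..<d} (\<lambda>_. std_normal)) (euclid d) (affine_image d (\<lambda>k. m $ k) M)"
    unfolding G gaussian_def weight
    by (rule distr_affine_image_std_normal[OF BM MB, symmetric])
  \<comment> \<open>Let \<open>s\<close> be the product of \<open>S\<close> and \<open>v\<close>.
    The left side pairs \<open>s\<close> with \<open>T s\<close>, where \<open>T\<close> inverts
    \<open>S\<close>, that is, it pairs \<open>s\<close> with \<open>v\<close>.\<close>
  moreover have MM: "(\<Sum>j<d. (\<Sum>i<d. v i * M i j)\<^sup>2) = quad_form d S v v" for v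
  proof -
    define s where "s = (\<lambda>k. \<Sum>i<d. v i * S i k)"
    have vM: "(\<Sum>i<d. v i * M i j) = (\<Sum>k<d. s k * B j k)" for j
      unfolding M_def s_def sum_distrib_left sum_distrib_right by (subst sum.swap) (simp add: mult.assoc)
    have s2: "s l = (\<Sum>k<d. S l k * v k)" if "l < d" for l
      unfolding s_def by (intro sum.cong refl) (auto simp: sym that)
    have sB: "(\<Sum>j<d. (\<Sum>k<d. s k * B j k) * (\<Sum>k<d. s k * B j k)) = (\<Sum>k<d. s k * (\<Sum>j<d. B j k * (\<Sum>l<d. B j l * s l)))"
      unfolding sum_distrib_left sum_distrib_right
      by (subst sum.swap) (intro sum.cong refl, simp add: algebra_simps)
    have vs: "v i = (\<Sum>k<d. T i k * s k)" if "i < d" for i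
    proof -
      have ts: "(\<Sum>k<d. T i k * S k l) = (if i = l then 1 else 0)" if "l < d" for l
      proof -
        have "(Ti * \<Sigma>) $$ (i,l) = (if i = l then 1 else 0)" using TS that \<open>i < d\<close> by simp
        then show ?thesis using that \<open>i < d\<close> \<Sigma> by (simp add: Ti_def S_def scalar_prod_def lessThan_atLeast0)
      qed
      have "(\<Sum>k<d. T i k * s k) = (\<Sum>k<d. T i k * (\<Sum>l<d. S k l * v l))"
        by (intro sum.cong refl) (simp add: s2)
      also have "\<dots> = (\<Sum>l<d. (\<Sum>k<d. T i k * S k l) * v l)"
        unfolding sum_distrib_left sum_distrib_right by (subst sum.swap) (simp add: mult.assoc)
      also have "\<dots> = (\<Sum>l<d. if i = l then v l else 0)" by (intro sum.cong refl) (simp add: ts)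
      finally show ?thesis using that by simp
    qed
    have "(\<Sum>j<d. (\<Sum>i<d. v i * M i j)\<^sup>2) = (\<Sum>k<d. s k * (\<Sum>j<d. B j k * (\<Sum>l<d. B j l * s l)))"
      by (simp add: vM power2_eq_square sB)
    also have "\<dots> = (\<Sum>k<d. s k * v k)"
    proof (intro sum.cong refl)
      fix k assume "k \<in> {..<d}"
      have "(\<Sum>j<d. B j k * (\<Sum>l<d. B j l * s l)) = (\<Sum>l<d. T k l * s l)"
        unfolding T_def sum_distrib_left sum_distrib_right by (subst sum.swap) (simp add: mult.assoc)
      then show "s k * (\<Sum>j<d. B j k * (\<Sum>l<d. B j l * s l)) = s k * v k"
        using vs \<open>k \<in> {..<d}\<close> by simp
    qed
    also have "\<dots> = quad_form d S v v" by (simp add: quad_form_alt2 s_def)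
    finally show ?thesis .
  qed
  ultimately show ?thesis
    by (intro that[of "\<lambda>k. m $ k" M]) (auto simp: lower upper)
qed

section \<open>Linear functionals of standard normal vectors\<close>

lemma prob_space_PiM_std_normal: "prob_space (PiM I (\<lambda>_. std_normal))"
  by (intro prob_space_PiM prob_space_std_normal)

lemma product_sigma_finite_prob_space: "(\<And>i. prob_space (M i)) \<Longrightarrow> product_sigma_finite M"
  by (simp add: product_sigma_finite_def prob_space_imp_sigma_finite)

lemma indep_vars_coordinates:
  assumes "I \<noteq> {}"
  shows "prob_space.indep_vars (PiM I (\<lambda>_. std_normal)) (\<lambda>_. borel) (\<lambda>i \<omega>. \<omega> i) I"
proof -
  interpret P: prob_space "PiM I (\<lambda>_. std_normal)" by (rule prob_space_PiM_std_normal)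
  have rv: "(\<lambda>\<omega>. \<omega> i) \<in> PiM I (\<lambda>_. std_normal) \<rightarrow>\<^sub>M borel" if "i \<in> I" for i
    using measurable_component_singleton[OF that, of "\<lambda>_. std_normal"] by simp
  have "distr (PiM I (\<lambda>_. std_normal)) (PiM I (\<lambda>_. borel)) (\<lambda>x. \<lambda>i\<in>I. x i) =
    distr (PiM I (\<lambda>_. std_normal)) (PiM I (\<lambda>_. std_normal)) (\<lambda>x. x)"
    by (intro distr_cong refl) (auto simp: space_PiM extensional_restrict PiE_def intro!: sets_PiM_cong)
  also have "\<dots> = PiM I (\<lambda>i. distr (PiM I (\<lambda>_. std_normal)) borel (\<lambda>\<omega>. \<omega> i))"
    unfolding distr_id
  proof (rule PiM_cong[OF refl])
    fix i assume "i \<in> I"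
    have "std_normal = distr (PiM I (\<lambda>_. std_normal)) std_normal (\<lambda>\<omega>. \<omega> i)"
      by (rule distr_PiM_component[symmetric, OF _ \<open>i \<in> I\<close>]) (rule prob_space_std_normal)
    also have "\<dots> = distr (PiM I (\<lambda>_. std_normal)) borel (\<lambda>\<omega>. \<omega> i)"
      by (rule distr_cong) auto
    finally show "std_normal = distr (PiM I (\<lambda>_. std_normal)) borel (\<lambda>\<omega>. \<omega> i)" .
  qed
  finally show ?thesis
    by (subst P.indep_vars_iff_distr_eq_PiM'[OF assms rv])
qed

lemma indep_vars_block_sums:
  fixes c :: "'i \<Rightarrow> real"
  assumes I: "I \<noteq> {}" and A: "\<And>j. j \<in> L \<Longrightarrow> A j \<subseteq> I" "disjoint_family_on A L"
  shows "prob_space.indep_vars (PiM I (\<lambda>_. std_normal)) (\<lambda>_. borel) (\<lambda>j \<omega>. \<Sum>a\<in>A j. c a * \<omega> a) L"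
proof -
  interpret P: prob_space "PiM I (\<lambda>_. std_normal)" by (rule prob_space_PiM_std_normal)
  have "P.indep_vars (\<lambda>j. PiM (A j) (\<lambda>_. borel)) (\<lambda>j \<omega>. restrict (\<lambda>i. \<omega> i) (A j)) L"
    by (rule P.indep_vars_restrict[OF indep_vars_coordinates[OF I] A])
  then have "P.indep_vars (\<lambda>_. borel) (\<lambda>j \<omega>. (\<Sum>a\<in>A j. c a * restrict (\<lambda>i. \<omega> i) (A j) a)) L"
    by (rule P.indep_vars_compose2) measurable
  then show ?thesis by simp
qed

lemma distributed_coordinate:
  assumes "i \<in> I"
  shows "distributed (PiM I (\<lambda>_. std_normal)) lborel (\<lambda>\<omega>. \<omega> i) std_normal_density"
proof -
  have "distr (PiM I (\<lambda>_. std_normal)) lborel (\<lambda>\<omega>. \<omega> i) = distr (PiM I (\<lambda>_. std_normal)) std_normal (\<lambda>\<omega>. \<omega> i)"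
    by (rule distr_cong) auto
  also have "\<dots> = std_normal"
    by (rule distr_PiM_component[OF _ assms]) (rule prob_space_std_normal)
  finally show ?thesis
    using measurable_component_singleton[OF assms, of "\<lambda>_. std_normal"] by (simp add: distributed_def)
qed

lemma distributed_linear_functional:
  fixes c :: "'i \<Rightarrow> real"
  assumes A: "finite A" "A \<subseteq> I" and pos: "(\<Sum>a\<in>A. (c a)\<^sup>2) > 0"
  shows "distributed (PiM I (\<lambda>_. std_normal)) lborel (\<lambda>\<omega>. \<Sum>a\<in>A. c a * \<omega> a)
    (normal_density 0 (sqrt (\<Sum>a\<in>A. (c a)\<^sup>2)))"
proof -
  interpret P: prob_space "PiM I (\<lambda>_. std_normal)" by (rule prob_space_PiM_std_normal)
  \<comment> \<open>The rule for sums of independent normal variables wants every summand to have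
    positive variance, so zero coefficients are dropped.\<close>
  define A' where "A' = {a\<in>A. c a \<noteq> 0}"
  have A': "finite A'" "A' \<subseteq> I" using A by (auto simp: A'_def)
  have ne: "A' \<noteq> {}"
  proof
    assume "A' = {}"
    then have "(\<Sum>a\<in>A. (c a)\<^sup>2) = 0" by (intro sum.neutral) (auto simp: A'_def)
    with pos show False by simp
  qed
  have sums: "(\<Sum>a\<in>A. c a * \<omega> a) = (\<Sum>a\<in>A'. c a * \<omega> a)" "(\<Sum>a\<in>A. (c a)\<^sup>2) = (\<Sum>a\<in>A'. (c a)\<^sup>2)" for \<omega>
    unfolding A'_def using A by (auto intro!: sum.mono_neutral_right)
  have I: "I \<noteq> {}" using ne A' by auto
  have ind: "P.indep_vars (\<lambda>_. borel) (\<lambda>a \<omega>. c a * \<omega> a) A'"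
    using indep_vars_block_sums[OF I, of A' "\<lambda>a. {a}" c] A' by (auto simp: disjoint_family_on_def)
  have nrm: "distributed (PiM I (\<lambda>_. std_normal)) lborel (\<lambda>\<omega>. c a * \<omega> a) (normal_density 0 \<bar>c a\<bar>)"
    if "a \<in> A'" for a
  proof -
    have "a \<in> I" "c a \<noteq> 0" using that A' by (auto simp: A'_def)
    then show ?thesis
      using P.normal_density_affine[OF distributed_coordinate[OF \<open>a \<in> I\<close>], of "c a" 0] by simp
  qed
  have "distributed (PiM I (\<lambda>_. std_normal)) lborel (\<lambda>\<omega>. \<Sum>a\<in>A'. c a * \<omega> a)
    (normal_density (\<Sum>a\<in>A'. 0) (sqrt (\<Sum>a\<in>A'. \<bar>c a\<bar>\<^sup>2)))"
    by (rule P.sum_indep_normal[OF A'(1) ne ind _ nrm]) (auto simp: A'_def)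
  then show ?thesis by (simp add: sums)
qed

section \<open>Gaussian tail bounds\<close>

lemma std_normal_upper_tail:
  "(\<integral>\<^sup>+x. ennreal (std_normal_density x) * indicator {T<..} x \<partial>lborel) \<le> ennreal (exp (- T\<^sup>2 / 2))"
  if "T \<ge> 0"
proof -
  \<comment> \<open>For \<open>x > T \<ge> 0\<close> one has
    \<open>x\<^sup>2 \<ge> (x - T)\<^sup>2 + T\<^sup>2\<close>, so the density is at most
    \<open>exp (- T\<^sup>2 / 2)\<close> times the normal density with mean \<open>T\<close>, which
    has total mass 1.\<close>
  have "(\<integral>\<^sup>+x. ennreal (std_normal_density x) * indicator {T<..} x \<partial>lborel) \<le>
    (\<integral>\<^sup>+x. ennreal (exp (- T\<^sup>2 / 2)) * ennreal (normal_density T 1 x) \<partial>lborel)"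
  proof (rule nn_integral_mono)
    fix x :: real
    have "std_normal_density x \<le> exp (- T\<^sup>2 / 2) * normal_density T 1 x" if "x > T"
    proof -
      have "- (x - T)\<^sup>2 / 2 + - T\<^sup>2 / 2 \<ge> - x\<^sup>2 / 2"
        using that \<open>T \<ge> 0\<close> mult_nonneg_nonneg[of T "x - T"] by (simp add: power2_eq_square algebra_simps)
      then have "exp (- T\<^sup>2 / 2) * exp (- (x - T)\<^sup>2 / 2) \<ge> exp (- x\<^sup>2 / 2)"
        by (simp add: exp_add[symmetric] add.commute)
      then have "(1 / sqrt (2 * pi)) * exp (- x\<^sup>2 / 2) \<le> (1 / sqrt (2 * pi)) * (exp (- T\<^sup>2 / 2) * exp (- (x - T)\<^sup>2 / 2))"
        by (intro mult_left_mono) auto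
      then show ?thesis by (simp add: normal_density_def)
    qed
    then show "ennreal (std_normal_density x) * indicator {T<..} x \<le> ennreal (exp (- T\<^sup>2 / 2)) * ennreal (normal_density T 1 x)"
      by (auto simp: indicator_def ennreal_mult[symmetric] intro!: ennreal_leI)
  qed
  also have "\<dots> = ennreal (exp (- T\<^sup>2 / 2)) * (\<integral>\<^sup>+x. ennreal (normal_density T 1 x) \<partial>lborel)"
    by (rule nn_integral_cmult) auto
  also have "(\<integral>\<^sup>+x. ennreal (normal_density T 1 x) \<partial>lborel) = 1"
    by (subst nn_integral_eq_integral) auto
  finally show ?thesis by simp
qed

lemma std_normal_tail:
  assumes "T \<ge> 0"
  shows "measure std_normal {x. T < \<bar>x\<bar>} \<le> 2 * exp (- T\<^sup>2 / 2)"
proof -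
  let ?f = "\<lambda>x. ennreal (std_normal_density x) * indicator {T<..} x"
  have sym: "(\<integral>\<^sup>+x. ennreal (std_normal_density x) * indicator {..<-T} x \<partial>lborel) = (\<integral>\<^sup>+x. ?f x \<partial>lborel)"
  proof -
    have "(\<integral>\<^sup>+x. ?f x \<partial>lborel) = ennreal \<bar>-1\<bar> * (\<integral>\<^sup>+x. ?f (0 + (-1) * x) \<partial>lborel)"
      by (rule nn_integral_real_affine) auto
    also have "\<dots> = (\<integral>\<^sup>+x. ennreal (std_normal_density x) * indicator {..<-T} x \<partial>lborel)"
      by (auto simp: std_normal_density_def indicator_def intro!: nn_integral_cong)
    finally show ?thesis ..
  qed
  interpret prob_space std_normal by (rule prob_space_std_normal)
  have "emeasure std_normal {x. T < \<bar>x\<bar>} = (\<integral>\<^sup>+x. ennreal (std_normal_density x) * indicator {x. T < \<bar>x\<bar>} x \<partial>lborel)"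
    by (rule emeasure_density) auto
  also have "\<dots> \<le> (\<integral>\<^sup>+x. ?f x + ennreal (std_normal_density x) * indicator {..<-T} x \<partial>lborel)"
    by (rule nn_integral_mono) (auto simp: indicator_def)
  also have "\<dots> = (\<integral>\<^sup>+x. ?f x \<partial>lborel) + (\<integral>\<^sup>+x. ?f x \<partial>lborel)"
    by (subst nn_integral_add) (auto simp: sym)
  also have "\<dots> \<le> ennreal (exp (- T\<^sup>2 / 2)) + ennreal (exp (- T\<^sup>2 / 2))"
    by (intro add_mono std_normal_upper_tail assms)
  also have "\<dots> = ennreal (2 * exp (- T\<^sup>2 / 2))" by (simp add: ennreal_plus[symmetric] del: ennreal_plus)
  finally show ?thesis by (simp add: emeasure_eq_measure)
qed

lemma measurable_linear_functional:
  assumes "A \<subseteq> I"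
  shows "(\<lambda>\<omega>. \<Sum>a\<in>A. c a * \<omega> a :: real) \<in> borel_measurable (PiM I (\<lambda>_. std_normal))"
proof (intro borel_measurable_sum borel_measurable_times borel_measurable_const)
  fix a assume "a \<in> A"
  then show "(\<lambda>\<omega>. \<omega> a) \<in> borel_measurable (PiM I (\<lambda>_. std_normal))"
    using measurable_component_singleton[of a I "\<lambda>_. std_normal"] assms by auto
qed

lemma linear_functional_tail:
  fixes c :: "'i \<Rightarrow> real"
  assumes A: "finite A" "A \<subseteq> I" and s: "(\<Sum>a\<in>A. (c a)\<^sup>2) \<le> s\<^sup>2" "s \<ge> 0" and T: "T \<ge> 0"
  shows "measure (PiM I (\<lambda>_. std_normal)) {\<omega>\<in>space (PiM I (\<lambda>_. std_normal)). T * s < \<bar>\<Sum>a\<in>A. c a * \<omega> a\<bar>}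
    \<le> 2 * exp (- T\<^sup>2 / 2)"
\<comment> \<open>Variance 0 has no normal density, but then the functional vanishes identically and
  the strict inequality makes the event empty.\<close>
proof (cases "(\<Sum>a\<in>A. (c a)\<^sup>2) > 0")
  case False
  then have "(\<Sum>a\<in>A. (c a)\<^sup>2) = 0" using sum_nonneg[of A "\<lambda>a. (c a)\<^sup>2"] by (simp add: order_less_le)
  then have "c a = 0" if "a \<in> A" for a using A that by (auto simp: sum_nonneg_eq_0_iff)
  then have "(\<Sum>a\<in>A. c a * \<omega> a) = 0" for \<omega> by simp
  moreover have "\<not> T * s < 0" using s T by (simp add: not_less)
  ultimately show ?thesis by simp
next
  case True
  interpret P: prob_space "PiM I (\<lambda>_. std_normal)" by (rule prob_space_PiM_std_normal)
  define \<sigma> where "\<sigma> = sqrt (\<Sum>a\<in>A. (c a)\<^sup>2)"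
  have \<sigma>: "\<sigma> > 0" "\<sigma> \<le> s" using True s by (auto simp: \<sigma>_def intro: real_le_lsqrt)
  let ?X = "\<lambda>\<omega>. \<Sum>a\<in>A. c a * \<omega> a"
  have "distributed (PiM I (\<lambda>_. std_normal)) lborel (\<lambda>\<omega>. (?X \<omega> - 0) / \<sigma>) std_normal_density"
    using distributed_linear_functional[OF A True] \<sigma>
    by (subst P.normal_standard_normal_convert[symmetric]) (auto simp: \<sigma>_def)
  then have d: "distr (PiM I (\<lambda>_. std_normal)) lborel (\<lambda>\<omega>. ?X \<omega> / \<sigma>) = std_normal"
    and [measurable]: "(\<lambda>\<omega>. ?X \<omega> / \<sigma>) \<in> PiM I (\<lambda>_. std_normal) \<rightarrow>\<^sub>M lborel"
    by (auto simp: distributed_def)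
  have [measurable]: "?X \<in> borel_measurable (PiM I (\<lambda>_. std_normal))"
    using A(2) by (rule measurable_linear_functional)
  have "P.prob {\<omega>\<in>space (PiM I (\<lambda>_. std_normal)). T * s < \<bar>?X \<omega>\<bar>} \<le>
    P.prob {\<omega>\<in>space (PiM I (\<lambda>_. std_normal)). T < \<bar>?X \<omega> / \<sigma>\<bar>}"
  proof (rule P.finite_measure_mono)
    show "{\<omega>\<in>space (PiM I (\<lambda>_. std_normal)). T * s < \<bar>?X \<omega>\<bar>} \<subseteq> {\<omega>\<in>space (PiM I (\<lambda>_. std_normal)). T < \<bar>?X \<omega> / \<sigma>\<bar>}"
    proof safe
      fix \<omega> assume "T * s < \<bar>?X \<omega>\<bar>"
      moreover have "T * \<sigma> \<le> T * s" using T \<sigma> by (intro mult_left_mono) auto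
      ultimately show "T < \<bar>?X \<omega> / \<sigma>\<bar>" using \<sigma> by (simp add: pos_less_divide_eq)
    qed
  qed measurable
  also have "\<dots> = measure (distr (PiM I (\<lambda>_. std_normal)) lborel (\<lambda>\<omega>. ?X \<omega> / \<sigma>)) {x. T < \<bar>x\<bar>}"
    by (subst measure_distr) (auto intro!: arg_cong[of _ _ P.prob])
  also have "\<dots> \<le> 2 * exp (- T\<^sup>2 / 2)" unfolding d by (rule std_normal_tail[OF T])
  finally show ?thesis .
qed

text \<open>The product is a multiple of the normal density with standard deviation 1/3. The
  coefficient 4 makes \<open>1 + 2 * 4\<close> a perfect square, and the value is below
  \<open>exp (- 1)\<close>, as the next bound requires.\<close>

lemma nn_integral_exp_square_std_normal:
  "(\<integral>\<^sup>+x. ennreal (std_normal_density x) * ennreal (exp (- 4 * x\<^sup>2)) \<partial>lborel) = ennreal (1 / 3)"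
proof -
  have eq: "std_normal_density x * exp (- 4 * x\<^sup>2) = 1 / 3 * normal_density 0 (1/3) x" for x
  proof -
    have "exp (- x\<^sup>2 / 2) * exp (- 4 * x\<^sup>2) = exp (- (9 * x\<^sup>2) / 2)"
      by (simp add: exp_add[symmetric] field_simps)
    then show ?thesis by (simp add: normal_density_def real_sqrt_divide power_divide field_simps)
  qed
  have "(\<integral>\<^sup>+x. ennreal (std_normal_density x) * ennreal (exp (- 4 * x\<^sup>2)) \<partial>lborel) =
    (\<integral>\<^sup>+x. ennreal (1/3) * ennreal (normal_density 0 (1/3) x) \<partial>lborel)"
  proof (rule nn_integral_cong)
    fix x :: real
    have "ennreal (std_normal_density x) * ennreal (exp (- 4 * x\<^sup>2)) = ennreal (std_normal_density x * exp (- 4 * x\<^sup>2))"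
      by (rule ennreal_mult[symmetric]) auto
    also have "\<dots> = ennreal (1/3) * ennreal (normal_density 0 (1/3) x)"
      unfolding eq by (rule ennreal_mult) auto
    finally show "ennreal (std_normal_density x) * ennreal (exp (- 4 * x\<^sup>2)) = ennreal (1/3) * ennreal (normal_density 0 (1/3) x)" .
  qed
  also have "\<dots> = ennreal (1/3) * (\<integral>\<^sup>+x. ennreal (normal_density 0 (1/3) x) \<partial>lborel)"
    by (rule nn_integral_cmult) auto
  also have "(\<integral>\<^sup>+x. ennreal (normal_density 0 (1/3) x) \<partial>lborel) = 1"
    by (subst nn_integral_eq_integral) auto
  finally show ?thesis by simp
qed

text \<open>A Chernoff bound with exponent -4: disjoint blocks make the factors independent, each
  has mean at most 1/3 and hence at most \<open>exp (- 1)\<close>, and the threshold 1/8 costs only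
  \<open>exp (card L / 2)\<close>.\<close>

lemma sum_squares_lower_tail:
  fixes c :: "'i \<Rightarrow> real" and L :: "'j set"
  assumes I: "I \<noteq> {}" and A: "\<And>j. j \<in> L \<Longrightarrow> finite (A j)" "\<And>j. j \<in> L \<Longrightarrow> A j \<subseteq> I" "disjoint_family_on A L"
    and L: "finite L" and \<sigma>: "\<sigma> > 0" "\<And>j. j \<in> L \<Longrightarrow> \<sigma>\<^sup>2 \<le> (\<Sum>a\<in>A j. (c a)\<^sup>2)"
  shows "measure (PiM I (\<lambda>_. std_normal)) {\<omega>\<in>space (PiM I (\<lambda>_. std_normal)).
      (\<Sum>j\<in>L. (\<Sum>a\<in>A j. c a * \<omega> a)\<^sup>2) < real (card L) * \<sigma>\<^sup>2 / 8} \<le> exp (- real (card L) / 2)"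
proof -
  let ?P = "PiM I (\<lambda>_. std_normal)"
  interpret P: prob_space ?P by (rule prob_space_PiM_std_normal)
  let ?X = "\<lambda>j \<omega>. \<Sum>a\<in>A j. c a * \<omega> a"
  have meas[measurable]: "?X j \<in> borel_measurable ?P" if "j \<in> L" for j
    using A(2)[OF that] by (rule measurable_linear_functional)
  define h where "h = (\<lambda>x::real. ennreal (exp (- 4 * (x / \<sigma>)\<^sup>2)))"
  have [measurable]: "h \<in> borel_measurable borel" unfolding h_def by measurable
  have ind: "P.indep_vars (\<lambda>_. borel) (\<lambda>j \<omega>. h (?X j \<omega>)) L"
    by (rule P.indep_vars_compose2[OF indep_vars_block_sums[OF I A(2,3)]]) auto
  have one: "(\<integral>\<^sup>+\<omega>. h (?X j \<omega>) \<partial>?P) \<le> ennreal (1/3)" if j: "j \<in> L" for j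
  proof -
    define \<tau> where "\<tau> = sqrt (\<Sum>a\<in>A j. (c a)\<^sup>2)"
    have pos: "(\<Sum>a\<in>A j. (c a)\<^sup>2) > 0" using \<sigma>(1) \<sigma>(2)[OF j] by (auto intro: less_le_trans[OF zero_less_power])
    have \<tau>: "\<tau> > 0" "\<sigma> \<le> \<tau>" using pos \<sigma>(2)[OF j] by (auto simp: \<tau>_def intro: real_le_rsqrt)
    have "distributed ?P lborel (\<lambda>\<omega>. (?X j \<omega> - 0) / \<tau>) std_normal_density"
      using distributed_linear_functional[OF A(1,2)[OF j] pos] \<tau>
      by (subst P.normal_standard_normal_convert[symmetric]) (auto simp: \<tau>_def)
    then have d: "distr ?P lborel (\<lambda>\<omega>. ?X j \<omega> / \<tau>) = std_normal"
      and [measurable]: "(\<lambda>\<omega>. ?X j \<omega> / \<tau>) \<in> ?P \<rightarrow>\<^sub>M lborel"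
      by (auto simp: distributed_def)
    have "(\<integral>\<^sup>+\<omega>. h (?X j \<omega>) \<partial>?P) \<le> (\<integral>\<^sup>+\<omega>. ennreal (exp (- 4 * (?X j \<omega> / \<tau>)\<^sup>2)) \<partial>?P)"
    proof (intro nn_integral_mono)
      fix \<omega>
      have "\<bar>?X j \<omega>\<bar> / \<tau> \<le> \<bar>?X j \<omega>\<bar> / \<sigma>" using \<tau> \<sigma>(1) by (intro divide_left_mono) auto
      then have "\<bar>?X j \<omega> / \<tau>\<bar> \<le> \<bar>?X j \<omega> / \<sigma>\<bar>" using \<tau> \<sigma>(1) by simp
      then have "(?X j \<omega> / \<tau>)\<^sup>2 \<le> (?X j \<omega> / \<sigma>)\<^sup>2" by (simp only: abs_le_square_iff)
      then show "h (?X j \<omega>) \<le> ennreal (exp (- 4 * (?X j \<omega> / \<tau>)\<^sup>2))"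
        unfolding h_def by (intro ennreal_leI) simp
    qed
    also have "\<dots> = (\<integral>\<^sup>+x. ennreal (exp (- 4 * x\<^sup>2)) \<partial>distr ?P lborel (\<lambda>\<omega>. ?X j \<omega> / \<tau>))"
      by (rule nn_integral_distr[symmetric]) (use meas[OF j] in simp_all)
    also have "\<dots> = (\<integral>\<^sup>+x. ennreal (std_normal_density x) * ennreal (exp (- 4 * x\<^sup>2)) \<partial>lborel)"
      unfolding d by (subst nn_integral_density) auto
    finally show ?thesis unfolding nn_integral_exp_square_std_normal .
  qed
  define m where "m = card L"
  let ?E = "{\<omega>\<in>space ?P. (\<Sum>j\<in>L. (?X j \<omega>)\<^sup>2) < real (card L) * \<sigma>\<^sup>2 / 8}"
  have E[measurable]: "?E \<in> sets ?P" using L by measurable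
  have "emeasure ?P ?E = (\<integral>\<^sup>+\<omega>. indicator ?E \<omega> \<partial>?P)" by simp
  also have "\<dots> \<le> (\<integral>\<^sup>+\<omega>. ennreal (exp (real m / 2)) * (\<Prod>j\<in>L. h (?X j \<omega>)) \<partial>?P)"
  proof (rule nn_integral_mono)
    fix \<omega>
    have pr: "(\<Prod>j\<in>L. h (?X j \<omega>)) = ennreal (exp (- 4 * (\<Sum>j\<in>L. (?X j \<omega>)\<^sup>2) / \<sigma>\<^sup>2))"
      using L by (simp add: h_def prod_ennreal exp_sum[symmetric] sum_divide_distrib sum_distrib_left power_divide)
    show "indicator ?E \<omega> \<le> ennreal (exp (real m / 2)) * (\<Prod>j\<in>L. h (?X j \<omega>))"
    proof (cases "\<omega> \<in> ?E")
      case True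
      then have "4 * (\<Sum>j\<in>L. (?X j \<omega>)\<^sup>2) / \<sigma>\<^sup>2 \<le> real m / 2"
        using \<sigma>(1) by (simp add: m_def divide_simps)
      then have "1 \<le> exp (real m / 2 + - 4 * (\<Sum>j\<in>L. (?X j \<omega>)\<^sup>2) / \<sigma>\<^sup>2)" by simp
      then have "1 \<le> exp (real m / 2) * exp (- 4 * (\<Sum>j\<in>L. (?X j \<omega>)\<^sup>2) / \<sigma>\<^sup>2)"
        by (simp only: exp_add)
      then have "ennreal 1 \<le> ennreal (exp (real m / 2)) * ennreal (exp (- 4 * (\<Sum>j\<in>L. (?X j \<omega>)\<^sup>2) / \<sigma>\<^sup>2))"
        by (subst ennreal_mult[symmetric]) (auto intro!: ennreal_leI)
      then show ?thesis unfolding pr using True by simp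
    qed simp
  qed
  also have "\<dots> = ennreal (exp (real m / 2)) * (\<integral>\<^sup>+\<omega>. (\<Prod>j\<in>L. h (?X j \<omega>)) \<partial>?P)"
    by (rule nn_integral_cmult) measurable
  also have "(\<integral>\<^sup>+\<omega>. (\<Prod>j\<in>L. h (?X j \<omega>)) \<partial>?P) = (\<Prod>j\<in>L. \<integral>\<^sup>+\<omega>. h (?X j \<omega>) \<partial>?P)"
    by (rule P.indep_vars_nn_integral[OF L ind]) simp
  also have "\<dots> \<le> (\<Prod>j\<in>L. ennreal (1/3))" by (intro prod_mono_ennreal one)
  also have "(\<Prod>j\<in>L. ennreal (1/3)) = ennreal ((1/3) ^ m)" by (simp add: m_def ennreal_power)
  also have "ennreal (exp (real m / 2)) * ennreal ((1/3) ^ m) \<le> ennreal (exp (- real m / 2))"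
  proof -
    have "exp (1::real) \<le> 3" by (rule exp_le)
    then have "(1/3 :: real) \<le> exp (- 1)" by (simp add: exp_minus divide_simps)
    then have "(1/3 :: real) ^ m \<le> exp (- 1) ^ m" by (intro power_mono) auto
    also have "\<dots> = exp (- real m)" by (simp add: exp_of_nat_mult[symmetric])
    finally have "exp (real m / 2) * (1/3) ^ m \<le> exp (real m / 2) * exp (- real m)" by (intro mult_left_mono) auto
    also have "\<dots> = exp (- real m / 2)" by (simp add: exp_add[symmetric])
    finally show ?thesis by (simp add: ennreal_mult[symmetric] ennreal_leI)
  qed
  finally show ?thesis by (simp add: P.emeasure_eq_measure m_def mult_left_mono)
qed

section \<open>Weighted sums of i.i.d. Gaussian samples\<close>

lemma distr_weighted_sum_std_normal:
  fixes w :: "'i \<Rightarrow> real" and J :: "'j set"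
  assumes fin: "finite I" "finite J" and J: "J \<noteq> {}" and w: "(\<Sum>i\<in>I. (w i)\<^sup>2) = 1"
  shows "distr (PiM (I \<times> J) (\<lambda>_. std_normal)) (PiM J (\<lambda>_. std_normal)) (\<lambda>\<omega>. \<lambda>j\<in>J. \<Sum>i\<in>I. w i * \<omega> (i, j))
    = PiM J (\<lambda>_. std_normal)"
proof -
  let ?P = "PiM (I \<times> J) (\<lambda>_. std_normal)"
  interpret P: prob_space ?P by (rule prob_space_PiM_std_normal)
  have I: "I \<noteq> {}" using w by auto
  let ?X = "\<lambda>j \<omega>. \<Sum>a\<in>I \<times> {j}. w (fst a) * \<omega> a"
  have X: "(\<Sum>i\<in>I. w i * \<omega> (i, j)) = ?X j \<omega>" for \<omega> j
    by (rule sum.reindex_bij_witness[of _ fst "\<lambda>i. (i, j)"]) auto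
  have nz: "I \<times> J \<noteq> {}" using I J by auto
  \<comment> \<open>Different coordinates \<open>j\<close> use disjoint blocks of the array, hence
    are independent; each is normal with variance the sum of the squared weights, which is
    1.\<close>
  have ind: "P.indep_vars (\<lambda>_. borel) ?X J"
    by (rule indep_vars_block_sums[OF nz]) (auto simp: disjoint_family_on_def)
  have meas: "?X j \<in> borel_measurable ?P" if "j \<in> J" for j
    using that by (intro measurable_linear_functional) auto
  have s1: "(\<Sum>a\<in>I \<times> {j}. (w (fst a))\<^sup>2) = 1" for j
  proof -
    have "(\<Sum>a\<in>I \<times> {j}. (w (fst a))\<^sup>2) = (\<Sum>i\<in>I. (w i)\<^sup>2)"
      by (rule sum.reindex_bij_witness[of _ "\<lambda>i. (i, j)" fst]) auto
    then show ?thesis using w by simp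
  qed
  have "distr ?P (PiM J (\<lambda>_. std_normal)) (\<lambda>\<omega>. \<lambda>j\<in>J. \<Sum>i\<in>I. w i * \<omega> (i, j)) =
     distr ?P (PiM J (\<lambda>_. borel)) (\<lambda>\<omega>. \<lambda>j\<in>J. ?X j \<omega>)"
    by (intro distr_cong refl) (auto intro!: sets_PiM_cong simp: X)
  also have "\<dots> = PiM J (\<lambda>j. distr ?P borel (?X j))"
    using P.indep_vars_iff_distr_eq_PiM'[OF J meas] ind by simp
  also have "\<dots> = PiM J (\<lambda>_. std_normal)"
  proof (rule PiM_cong[OF refl])
    fix j assume "j \<in> J"
    have "distributed ?P lborel (?X j) (normal_density 0 (sqrt (\<Sum>a\<in>I \<times> {j}. (w (fst a))\<^sup>2)))"
      by (rule distributed_linear_functional) (use fin \<open>j \<in> J\<close> in \<open>auto simp: s1\<close>)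
    then have "distributed ?P lborel (?X j) std_normal_density" unfolding s1 by simp
    then have "distr ?P lborel (?X j) = std_normal" by (simp add: distributed_def)
    moreover have "distr ?P lborel (?X j) = distr ?P borel (?X j)" by (rule distr_cong) auto
    ultimately show "distr ?P borel (?X j) = std_normal" by simp
  qed
  finally show ?thesis .
qed

text \<open>Shown first for the inverse map: a measure on the flat product is determined by boxes of
  real sets, whose preimages are boxes of boxes. Composing with the currying map gives the
  claim.\<close>

lemma distr_curry_PiM_std_normal:
  fixes I :: "'i set" and J :: "'j set"
  assumes fin: "finite I" "finite J"
  shows "distr (PiM (I \<times> J) (\<lambda>_. std_normal)) (PiM I (\<lambda>_. PiM J (\<lambda>_. std_normal))) (\<lambda>\<omega>. \<lambda>i\<in>I. \<lambda>j\<in>J. \<omega> (i, j))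
    = PiM I (\<lambda>_. PiM J (\<lambda>_. std_normal))"
proof -
  let ?P = "PiM (I \<times> J) (\<lambda>_. std_normal)" and ?Q = "PiM I (\<lambda>_. PiM J (\<lambda>_. std_normal))"
  interpret F: product_sigma_finite "\<lambda>_::'i \<times> 'j. std_normal" by (rule product_sigma_finite_prob_space[OF prob_space_std_normal])
  interpret H: product_sigma_finite "\<lambda>_::'j. std_normal" by (rule product_sigma_finite_prob_space[OF prob_space_std_normal])
  interpret G: product_sigma_finite "\<lambda>_::'i. PiM J (\<lambda>_. std_normal)"
    by (rule product_sigma_finite_prob_space[OF prob_space_PiM_std_normal])
  let ?f = "\<lambda>\<omega>. \<lambda>a\<in>I \<times> J. \<omega> (fst a) (snd a)" and ?g = "\<lambda>\<omega>. \<lambda>i\<in>I. \<lambda>j\<in>J. \<omega> (i, j)"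
  have comp: "(\<lambda>\<omega>. \<omega> i j) \<in> ?Q \<rightarrow>\<^sub>M std_normal" if "i \<in> I" "j \<in> J" for i j
    by (rule measurable_compose[where f = "\<lambda>\<omega>. \<omega> i" and g = "\<lambda>x. x j" and N = "PiM J (\<lambda>_. std_normal)"])
      (intro measurable_component_singleton that)+
  have f: "?f \<in> ?Q \<rightarrow>\<^sub>M ?P"
    by (intro measurable_restrict comp) auto
  have g: "?g \<in> ?P \<rightarrow>\<^sub>M ?Q"
    by (intro measurable_restrict) (auto intro: measurable_component_singleton)
  have "distr ?Q ?P ?f = ?P"
  proof (rule F.PiM_eqI)
    fix A :: "_ \<Rightarrow> real set" assume A: "\<And>a. a \<in> I \<times> J \<Longrightarrow> A a \<in> sets std_normal"
    have vim: "?f -` Pi\<^sub>E (I \<times> J) A \<inter> space ?Q = Pi\<^sub>E I (\<lambda>i. Pi\<^sub>E J (\<lambda>j. A (i, j)))"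
      by (auto simp: space_PiM PiE_iff extensional_def fun_eq_iff)
    have "emeasure (distr ?Q ?P ?f) (Pi\<^sub>E (I \<times> J) A) = emeasure ?Q (Pi\<^sub>E I (\<lambda>i. Pi\<^sub>E J (\<lambda>j. A (i, j))))"
      using A fin by (subst emeasure_distr[OF f]) (auto simp: vim intro!: sets_PiM_I_finite)
    also have "\<dots> = (\<Prod>i\<in>I. emeasure (PiM J (\<lambda>_. std_normal)) (Pi\<^sub>E J (\<lambda>j. A (i, j))))"
      using A fin by (intro G.emeasure_PiM) (auto intro!: sets_PiM_I_finite)
    also have "\<dots> = (\<Prod>i\<in>I. \<Prod>j\<in>J. emeasure std_normal (A (i, j)))"
      using A fin by (intro prod.cong refl H.emeasure_PiM) auto
    also have "\<dots> = (\<Prod>a\<in>I \<times> J. emeasure std_normal (A a))"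
      by (simp add: prod.cartesian_product)
    finally show "emeasure (distr ?Q ?P ?f) (Pi\<^sub>E (I \<times> J) A) = (\<Prod>a\<in>I \<times> J. emeasure std_normal (A a))" .
  qed (use fin in auto)
  then have "distr ?P ?Q ?g = distr (distr ?Q ?P ?f) ?Q ?g" by simp
  also have "\<dots> = distr ?Q ?Q (?g \<circ> ?f)" by (rule distr_distr[OF g f])
  also have "\<dots> = distr ?Q ?Q (\<lambda>x. x)"
    by (intro distr_cong refl) (auto simp: space_PiM PiE_iff extensional_def fun_eq_iff)
  finally show ?thesis by simp
qed

lemma measurable_affine_image: "affine_image d \<mu> M \<in> PiM {..<d} (\<lambda>_. std_normal) \<rightarrow>\<^sub>M euclid d"
  unfolding affine_image_def euclid_def
proof (intro measurable_restrict borel_measurable_add borel_measurable_const borel_measurable_sum borel_measurable_times)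
  fix j assume "j \<in> {..<d}"
  then show "(\<lambda>\<omega>. \<omega> j) \<in> borel_measurable (PiM {..<d} (\<lambda>_. std_normal))"
    using measurable_component_singleton[of j "{..<d}" "\<lambda>_. std_normal"] by auto
qed

lemma iid_representation:
  assumes D: "D = distr (PiM {..<d} (\<lambda>_. std_normal)) (euclid d) (affine_image d \<mu> M)"
  shows "iid n D = distr (PiM ({..<n} \<times> {..<d}) (\<lambda>_. std_normal)) (datasets n (euclid d))
    (\<lambda>\<omega>. \<lambda>i\<in>{..<n}. affine_image d \<mu> M (\<lambda>j. \<omega> (i, j)))"
proof -
  let ?\<gamma> = "PiM {..<d} (\<lambda>_. std_normal)" and ?P = "PiM ({..<n} \<times> {..<d}) (\<lambda>_. std_normal)"
  let ?Q = "PiM {..<n} (\<lambda>_. ?\<gamma>)"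
  let ?g = "\<lambda>\<omega>. \<lambda>i\<in>{..<n}. \<lambda>j\<in>{..<d}. \<omega> (i, j)"
  have g: "?g \<in> ?P \<rightarrow>\<^sub>M ?Q"
    by (intro measurable_restrict) (auto intro: measurable_component_singleton)
  \<comment> \<open>The rule on images of product measures wants probability spaces as targets. A
    point mass serves as one, since only its sigma-algebra matters there.\<close>
  have pE: "prob_space (return (euclid d) (\<lambda>i\<in>{..<d}. 0))"
    by (rule prob_space_return) (auto simp: euclid_def space_PiM)
  have aff: "compose {..<n} (affine_image d \<mu> M) \<in> ?Q \<rightarrow>\<^sub>M datasets n (euclid d)"
    unfolding compose_def datasets_def
    by (intro measurable_restrict measurable_compose[OF _ measurable_affine_image] measurable_component_singleton)
  have "iid n D = PiM {..<n} (\<lambda>_. distr ?\<gamma> (return (euclid d) (\<lambda>i\<in>{..<d}. 0)) (affine_image d \<mu> M))"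
    unfolding iid_def D by (intro PiM_cong refl distr_cong) auto
  also have "\<dots> = distr ?Q (PiM {..<n} (\<lambda>_. return (euclid d) (\<lambda>i\<in>{..<d}. 0))) (compose {..<n} (affine_image d \<mu> M))"
    by (rule distr_PiM_finite_prob_space'[symmetric])
      (use measurable_affine_image in \<open>auto intro: prob_space_PiM_std_normal pE\<close>)
  also have "\<dots> = distr ?Q (datasets n (euclid d)) (compose {..<n} (affine_image d \<mu> M))"
    unfolding datasets_def by (intro distr_cong refl sets_PiM_cong) auto
  also have "\<dots> = distr (distr ?P ?Q ?g) (datasets n (euclid d)) (compose {..<n} (affine_image d \<mu> M))"
    by (subst distr_curry_PiM_std_normal) auto
  also have "\<dots> = distr ?P (datasets n (euclid d)) (compose {..<n} (affine_image d \<mu> M) \<circ> ?g)"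
    by (rule distr_distr[OF aff g])
  also have "\<dots> = distr ?P (datasets n (euclid d)) (\<lambda>\<omega>. \<lambda>i\<in>{..<n}. affine_image d \<mu> M (\<lambda>j. \<omega> (i, j)))"
    by (intro distr_cong refl) (auto simp: compose_def affine_image_def fun_eq_iff)
  finally show ?thesis .
qed

text \<open>The combination commutes with the affine map because the weights sum to 1, and it
  preserves the standard normal law because their squares do.\<close>

lemma distr_iid_weighted_sum:
  assumes D: "D = distr (PiM {..<d} (\<lambda>_. std_normal)) (euclid d) (affine_image d \<mu> M)"
    and d: "d \<ge> 1" and w: "(\<Sum>i<n. w i) = 1" "(\<Sum>i<n. (w i)\<^sup>2) = 1"
  shows "distr (iid n D) (euclid d) (\<lambda>X. \<lambda>l\<in>{..<d}. \<Sum>i<n. w i * X i l) = D"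
proof -
  let ?\<gamma> = "PiM {..<d} (\<lambda>_. std_normal)" and ?P = "PiM ({..<n} \<times> {..<d}) (\<lambda>_. std_normal)"
  let ?h = "\<lambda>X. \<lambda>l\<in>{..<d}. \<Sum>i<n. w i * X i l"
  let ?s = "\<lambda>\<omega>. \<lambda>j\<in>{..<d}. \<Sum>i<n. w i * \<omega> (i, j)"
  have comp: "(\<lambda>X. X i l) \<in> datasets n (euclid d) \<rightarrow>\<^sub>M borel" if "i < n" "l < d" for i l
  proof (rule measurable_compose[where f = "\<lambda>X. X i" and g = "\<lambda>x. x l"])
    show "(\<lambda>X. X i) \<in> datasets n (euclid d) \<rightarrow>\<^sub>M euclid d"
      unfolding datasets_def using that by (intro measurable_component_singleton) auto
    show "(\<lambda>x. x l) \<in> euclid d \<rightarrow>\<^sub>M borel"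
      unfolding euclid_def using that by (intro measurable_component_singleton) auto
  qed
  have h: "?h \<in> datasets n (euclid d) \<rightarrow>\<^sub>M euclid d"
    by (subst (2) euclid_def, intro measurable_restrict borel_measurable_sum borel_measurable_times) (auto intro: comp)
  have mP: "(\<lambda>\<omega>. \<omega> a) \<in> borel_measurable ?P" if "a \<in> {..<n} \<times> {..<d}" for a
    using measurable_component_singleton[OF that, of "\<lambda>_. std_normal"] by simp
  have s: "?s \<in> ?P \<rightarrow>\<^sub>M ?\<gamma>"
    by (intro measurable_restrict) (auto intro!: borel_measurable_sum borel_measurable_times mP)
  let ?r = "\<lambda>\<omega>. \<lambda>i\<in>{..<n}. affine_image d \<mu> M (\<lambda>j. \<omega> (i, j))"
  have r: "?r \<in> ?P \<rightarrow>\<^sub>M datasets n (euclid d)"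
    unfolding datasets_def euclid_def affine_image_def
    by (intro measurable_restrict borel_measurable_add borel_measurable_const borel_measurable_sum borel_measurable_times)
      (auto intro: mP)
  have "distr (iid n D) (euclid d) ?h = distr ?P (euclid d) (?h \<circ> ?r)"
    unfolding iid_representation[OF D] by (rule distr_distr[OF h r])
  also have "\<dots> = distr ?P (euclid d) (affine_image d \<mu> M \<circ> ?s)"
  proof (intro distr_cong refl)
    fix \<omega> assume "\<omega> \<in> space ?P"
    show "(?h \<circ> ?r) \<omega> = (affine_image d \<mu> M \<circ> ?s) \<omega>"
    proof
      fix l
      have "(\<Sum>i<n. w i * (\<mu> l + (\<Sum>j<d. M l j * \<omega> (i, j)))) =
         (\<Sum>i<n. w i) * \<mu> l + (\<Sum>i<n. \<Sum>j<d. M l j * (w i * \<omega> (i, j)))"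
        by (simp add: algebra_simps sum.distrib sum_distrib_left)
      also have "(\<Sum>i<n. \<Sum>j<d. M l j * (w i * \<omega> (i, j))) = (\<Sum>j<d. M l j * (\<Sum>i<n. w i * \<omega> (i, j)))"
        by (subst sum.swap) (simp add: sum_distrib_left)
      finally show "(?h \<circ> ?r) \<omega> l = (affine_image d \<mu> M \<circ> ?s) \<omega> l"
        by (simp add: affine_image_def w(1))
    qed
  qed
  also have "\<dots> = distr (distr ?P ?\<gamma> ?s) (euclid d) (affine_image d \<mu> M)"
    by (rule distr_distr[OF measurable_affine_image s, symmetric])
  also have "distr ?P ?\<gamma> ?s = ?\<gamma>"
    using d by (intro distr_weighted_sum_std_normal w(2)) (auto simp: lessThan_empty_iff)
  finally show ?thesis unfolding D .
qed

section \<open>Norm-preserving shifts\<close>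

text \<open>The substitution \<open>x = sqrt (y / C)\<close> is singular at 0, so it is made on
  compact intervals away from 0 and extended to the half line by monotone convergence.\<close>

lemma nn_integral_sqrt_substitution:
  fixes g :: "real \<Rightarrow> ennreal"
  assumes C: "C > 0" and g[measurable]: "g \<in> borel_measurable borel"
  shows "(\<integral>\<^sup>+x. g x * indicator {0<..} x \<partial>lborel) =
    (\<integral>\<^sup>+y. g (sqrt (y / C)) * ennreal (1 / (2 * sqrt (C * y))) * indicator {0<..} y \<partial>lborel)"
proof -
  define a where "a = (\<lambda>n::nat. 1 / real (Suc n))"
  define b where "b = (\<lambda>n::nat. real (Suc n))"
  let ?l = "\<lambda>n x. g x * indicator {a n..b n} x"
  let ?r = "\<lambda>n y. g (sqrt (y / C)) * ennreal (1 / (2 * sqrt (C * y))) * indicator {C * (a n)\<^sup>2..C * (b n)\<^sup>2} y"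
  have ab: "0 < a n" "a n \<le> 1" "1 \<le> b n" for n by (auto simp: a_def b_def)
  have mono: "a n \<le> a m" "b m \<le> b n" if "m \<le> n" for m n
    using that by (auto simp: a_def b_def divide_simps)
  have lim0: "a \<longlonglongrightarrow> 0" unfolding a_def using LIMSEQ_inverse_real_of_nat by (simp add: inverse_eq_divide)
  have liminf: "filterlim b at_top sequentially" unfolding b_def
    by (rule filterlim_compose[OF filterlim_real_sequentially filterlim_Suc])
  \<comment> \<open>For \<open>n = 0\<close> both end points are 1 and the interval degenerates,
    hence \<open>n \<ge> 1\<close>.\<close>
  have eq: "(\<integral>\<^sup>+x. ?l n x \<partial>lborel) = (\<integral>\<^sup>+y. ?r n y \<partial>lborel)" if n: "n \<ge> 1" for n
  proof -
    have "a n < 1" "1 < b n" using n by (auto simp: a_def b_def)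
    then have anb: "a n < b n" by linarith
    have "C * (a n)\<^sup>2 < C * (b n)\<^sup>2" using C anb ab(1)[of n] by (intro mult_strict_left_mono power_strict_mono) auto
    moreover have "((\<lambda>y. sqrt (y / C)) has_real_derivative 1 / (2 * sqrt (C * y))) (at y)" if "y \<in> {C * (a n)\<^sup>2..C * (b n)\<^sup>2}" for y
    proof -
      have "C * (a n)\<^sup>2 > 0" using C ab(1)[of n] by auto
      then have y: "y > 0" using that by auto
      have s: "sqrt (C * y) = C * sqrt (y / C)"
        using C y by (simp add: real_sqrt_mult real_sqrt_divide field_simps)
      have "((\<lambda>y. sqrt (y / C)) has_real_derivative (inverse (sqrt (y / C)) / 2) * (1 / C)) (at y)"
        using C divide_pos_pos[OF y C] by (auto intro!: derivative_eq_intros)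
      also have "(inverse (sqrt (y / C)) / 2) * (1 / C) = 1 / (2 * sqrt (C * y))"
        unfolding s using C y by (simp add: field_simps)
      finally show ?thesis .
    qed
    moreover have "continuous_on {C * (a n)\<^sup>2..C * (b n)\<^sup>2} (\<lambda>y. 1 / (2 * sqrt (C * y)))"
    proof (intro continuous_intros ballI)
      fix y assume y: "y \<in> {C * (a n)\<^sup>2..C * (b n)\<^sup>2}"
      have "C * (a n)\<^sup>2 > 0" using C ab(1)[of n] by auto
      then show "2 * sqrt (C * y) \<noteq> 0" using y C by auto
    qed
    moreover have "0 \<le> 1 / (2 * sqrt (C * y))" if "y \<in> {C * (a n)\<^sup>2..C * (b n)\<^sup>2}" for y
    proof -
      have "C * (a n)\<^sup>2 > 0" using C ab(1)[of n] by auto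
      then show ?thesis using that C by auto
    qed
    ultimately have "(\<integral>\<^sup>+x. g x * indicator {sqrt (C * (a n)\<^sup>2 / C)..sqrt (C * (b n)\<^sup>2 / C)} x \<partial>lborel) =
       (\<integral>\<^sup>+y. g (sqrt (y / C)) * ennreal (1 / (2 * sqrt (C * y))) * indicator {C * (a n)\<^sup>2..C * (b n)\<^sup>2} y \<partial>lborel)"
      by (intro nn_integral_substitution_aux) auto
    then show ?thesis using C ab(1,3)[of n] by simp
  qed
  have lim_l: "(\<lambda>n. \<integral>\<^sup>+x. ?l n x \<partial>lborel) \<longlonglongrightarrow> (\<integral>\<^sup>+x. g x * indicator {0<..} x \<partial>lborel)"
  proof (rule nn_integral_LIMSEQ)
    show "incseq ?l"
    proof (intro incseq_SucI le_funI)
      fix n x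
      show "?l n x \<le> ?l (Suc n) x" using mono[of n "Suc n"] by (auto simp: indicator_def)
    qed
    fix x
    show "(\<lambda>n. ?l n x) \<longlonglongrightarrow> g x * indicator {0<..} x"
    proof (cases "x > 0")
      case True
      have "eventually (\<lambda>n. a n < x) sequentially" using lim0 True by (rule order_tendstoD)
      moreover have "eventually (\<lambda>n. x \<le> b n) sequentially" using liminf by (simp add: filterlim_at_top)
      ultimately have "eventually (\<lambda>n. ?l n x = g x * indicator {0<..} x) sequentially"
        by eventually_elim (use True in auto)
      then show ?thesis by (rule tendsto_eventually)
    next
      case False
      then have "?l n x = g x * indicator {0<..} x" for n
        using ab(1)[of n] by (auto simp: indicator_def)
      then show ?thesis by simp
    qed
  qed auto
  have lim_r: "(\<lambda>n. \<integral>\<^sup>+y. ?r n y \<partial>lborel) \<longlonglongrightarrow>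
    (\<integral>\<^sup>+y. g (sqrt (y / C)) * ennreal (1 / (2 * sqrt (C * y))) * indicator {0<..} y \<partial>lborel)"
  proof (rule nn_integral_LIMSEQ)
    have mono': "C * (a n)\<^sup>2 \<le> C * (a m)\<^sup>2" "C * (b m)\<^sup>2 \<le> C * (b n)\<^sup>2" if "m \<le> n" for m n
      using mono[OF that] ab[of m] ab[of n] C by (auto intro!: mult_left_mono power_mono)
    show "incseq ?r"
    proof (intro incseq_SucI le_funI)
      fix n y
      have "C * (a (Suc n))\<^sup>2 \<le> y \<and> y \<le> C * (b (Suc n))\<^sup>2" if "C * (a n)\<^sup>2 \<le> y" "y \<le> C * (b n)\<^sup>2"
        using mono'[of n "Suc n"] that by auto
      then show "?r n y \<le> ?r (Suc n) y" by (auto simp: indicator_def simp del: of_nat_Suc)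
    qed
    fix y :: real
    let ?u = "g (sqrt (y / C)) * ennreal (1 / (2 * sqrt (C * y))) * indicator {0<..} y"
    show "(\<lambda>n. ?r n y) \<longlonglongrightarrow> ?u"
    proof (cases "y > 0")
      case True
      then have s: "sqrt (y / C) > 0" "y = C * (sqrt (y / C))\<^sup>2" using C by auto
      have "eventually (\<lambda>n. a n < sqrt (y / C)) sequentially" using lim0 s(1) by (rule order_tendstoD)
      moreover have "eventually (\<lambda>n. sqrt (y / C) \<le> b n) sequentially" using liminf by (simp add: filterlim_at_top)
      ultimately have "eventually (\<lambda>n. ?r n y = ?u) sequentially"
      proof eventually_elim
        case (elim n)
        have "(a n)\<^sup>2 \<le> (sqrt (y / C))\<^sup>2" "(sqrt (y / C))\<^sup>2 \<le> (b n)\<^sup>2"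
          using elim ab(1)[of n] s(1) by (auto intro!: power_mono simp del: real_sqrt_pow2)
        then have "C * (a n)\<^sup>2 \<le> C * (sqrt (y / C))\<^sup>2" "C * (sqrt (y / C))\<^sup>2 \<le> C * (b n)\<^sup>2"
          using C by (auto intro!: mult_left_mono simp del: real_sqrt_pow2)
        then have "C * (a n)\<^sup>2 \<le> y" "y \<le> C * (b n)\<^sup>2"
          unfolding s(2)[symmetric] .
        then show ?case using True by (simp add: indicator_def)
      qed
      then show ?thesis by (rule tendsto_eventually)
    next
      case False
      have "?r n y = ?u" for n
      proof -
        have "C * (a n)\<^sup>2 > 0" using C ab(1)[of n] by auto
        with False have "\<not> C * (a n)\<^sup>2 \<le> y" by linarith
        with False show ?thesis by (simp add: indicator_def)
      qed
      then show ?thesis by simp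
    qed
  qed auto
  have "eventually (\<lambda>n. (\<integral>\<^sup>+y. ?r n y \<partial>lborel) = (\<integral>\<^sup>+x. ?l n x \<partial>lborel)) sequentially"
    using eventually_ge_at_top[of 1] by eventually_elim (rule eq[symmetric])
  from LIMSEQ_unique[OF lim_l Lim_transform_eventually[OF lim_r this]] show ?thesis .
qed

text \<open>The foot \<open>b\<close> is where the line meets the hyperplane on which coordinate
  \<open>j\<close> vanishes, rather than the orthogonal projection of the origin; so feet range over
  a product space with one coordinate fewer.\<close>

definition line_point :: "'i set \<Rightarrow> 'i \<Rightarrow> ('i \<Rightarrow> real) \<Rightarrow> ('i \<Rightarrow> real) \<Rightarrow> real \<Rightarrow> 'i \<Rightarrow> real" where
  "line_point r j c b t = (\<lambda>i\<in>r. (if i = j then 0 else b i) + t * c i)"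

text \<open>Coordinate \<open>j\<close> is scaled by \<open>c j\<close>, and then, for fixed
  \<open>t\<close>, the other coordinates are translated by \<open>t * c i\<close>. Only the scaling
  has a Jacobian.\<close>

lemma nn_integral_shear:
  fixes c :: "'i \<Rightarrow> real" and F :: "('i \<Rightarrow> real) \<Rightarrow> ennreal"
  assumes r: "finite r" "j \<in> r" and c: "c j \<noteq> 0" and F[measurable]: "F \<in> borel_measurable (PiM r (\<lambda>_. lborel))"
  shows "(\<integral>\<^sup>+p. F p \<partial>PiM r (\<lambda>_. lborel)) =
    ennreal \<bar>c j\<bar> * (\<integral>\<^sup>+t. \<integral>\<^sup>+b. F (line_point r j c b t) \<partial>PiM (r - {j}) (\<lambda>_. lborel) \<partial>lborel)"
proof -
  interpret product_sigma_finite "\<lambda>_::'i. lborel :: real measure" by standard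
  interpret S: sigma_finite_measure "PiM (r - {j}) (\<lambda>_. lborel :: real measure)"
    using r by (intro sigma_finite) auto
  have ins: "insert j (r - {j}) = r" using r by auto
  have F': "F \<in> borel_measurable (PiM (insert j (r - {j})) (\<lambda>_. lborel))" unfolding ins by (rule F)
  let ?B = "PiM (r - {j}) (\<lambda>_. lborel :: real measure)"
  have "(\<lambda>(f, y). f(j := y)) \<in> ?B \<Otimes>\<^sub>M lborel \<rightarrow>\<^sub>M PiM r (\<lambda>_. lborel)"
    using measurable_add_dim[of j "r - {j}" "\<lambda>_. lborel"] unfolding ins .
  from measurable_compose[OF measurable_pair_swap' this]
  have upd: "(\<lambda>(y, x). x(j := y)) \<in> lborel \<Otimes>\<^sub>M ?B \<rightarrow>\<^sub>M PiM r (\<lambda>_. lborel)"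
    by (simp add: case_prod_beta)
  have m1: "(\<lambda>(y, x). F (x(j := y))) \<in> borel_measurable (lborel \<Otimes>\<^sub>M PiM (r - {j}) (\<lambda>_. lborel))"
    using measurable_compose[OF upd F] by (simp add: case_prod_beta)
  have "(\<integral>\<^sup>+p. F p \<partial>PiM r (\<lambda>_. lborel)) = (\<integral>\<^sup>+y. \<integral>\<^sup>+x. F (x(j := y)) \<partial>PiM (r - {j}) (\<lambda>_. lborel) \<partial>lborel)"
    using product_nn_integral_insert_rev[OF _ _ F'] r unfolding ins by auto
  also have "\<dots> = ennreal \<bar>c j\<bar> * (\<integral>\<^sup>+t. \<integral>\<^sup>+x. F (x(j := 0 + c j * t)) \<partial>PiM (r - {j}) (\<lambda>_. lborel) \<partial>lborel)"
    using m1 by (intro nn_integral_real_affine c S.borel_measurable_nn_integral) (simp add: measurable_lborel1 cong: measurable_cong_sets)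
  also have "(\<integral>\<^sup>+t. \<integral>\<^sup>+x. F (x(j := 0 + c j * t)) \<partial>PiM (r - {j}) (\<lambda>_. lborel) \<partial>lborel) =
     (\<integral>\<^sup>+t. \<integral>\<^sup>+b. F (line_point r j c b t) \<partial>PiM (r - {j}) (\<lambda>_. lborel) \<partial>lborel)"
  proof (rule nn_integral_cong)
    fix t :: real
    have m2[measurable]: "(\<lambda>x. F (x(j := c j * t))) \<in> borel_measurable (PiM (r - {j}) (\<lambda>_. lborel))"
      using measurable_compose[OF measurable_Pair1'[of "c j * t" lborel "PiM (r - {j}) (\<lambda>_. lborel)"] m1] by simp
    have "(\<integral>\<^sup>+x. F (x(j := c j * t)) \<partial>PiM (r - {j}) (\<lambda>_. lborel)) =
      (\<integral>\<^sup>+x. F ((\<lambda>i\<in>r-{j}. x i + t * c i)(j := c j * t)) \<partial>PiM (r - {j}) (\<lambda>_. lborel))"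
      using r by (intro nn_integral_translate_PiM_lborel[symmetric, where f = "\<lambda>x. F (x(j := c j * t))"]) auto
    also have "\<dots> = (\<integral>\<^sup>+b. F (line_point r j c b t) \<partial>PiM (r - {j}) (\<lambda>_. lborel))"
      using r by (intro nn_integral_cong arg_cong[of _ _ F]) (auto simp: line_point_def fun_eq_iff)
    finally show "(\<integral>\<^sup>+x. F (x(j := 0 + c j * t)) \<partial>PiM (r - {j}) (\<lambda>_. lborel)) =
      (\<integral>\<^sup>+b. F (line_point r j c b t) \<partial>PiM (r - {j}) (\<lambda>_. lborel))" by simp
  qed
  finally show ?thesis .
qed

text \<open>Coordinates on the half space of all \<open>p\<close> with \<open>\<langle>p, c\<rangle> > 0\<close>: the foot \<open>b\<close> of the line through
  \<open>p\<close> in direction \<open>c\<close>, and the squared norm of \<open>p\<close>, which is monotone along that line.\<close>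

lemma nn_integral_norm_coordinates:
  fixes c :: "'i \<Rightarrow> real" and G :: "('i \<Rightarrow> real) \<Rightarrow> ennreal"
  assumes r: "finite r" "j \<in> r" and c: "c j \<noteq> 0" and G[measurable]: "G \<in> borel_measurable (PiM r (\<lambda>_. lborel))"
  defines "C \<equiv> (\<Sum>i\<in>r. (c i)\<^sup>2)"
  defines "e \<equiv> \<lambda>b. (\<Sum>i\<in>r-{j}. b i * c i)"
  defines "D \<equiv> \<lambda>b. (\<Sum>i\<in>r-{j}. (b i)\<^sup>2) - (e b)\<^sup>2 / C"
  shows "(\<integral>\<^sup>+p. G p * indicator {0<..} (\<Sum>i\<in>r. p i * c i) \<partial>PiM r (\<lambda>_. lborel)) =
    ennreal \<bar>c j\<bar> * (\<integral>\<^sup>+q. \<integral>\<^sup>+b. G (line_point r j c b (sqrt ((q - D b) / C) - e b / C)) *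
       ennreal (1 / (2 * sqrt (C * (q - D b)))) * indicator {0<..} (q - D b) \<partial>PiM (r - {j}) (\<lambda>_. lborel) \<partial>lborel)"
proof -
  interpret product_sigma_finite "\<lambda>_::'i. lborel :: real measure" by standard
  let ?B = "PiM (r - {j}) (\<lambda>_. lborel :: real measure)"
  interpret S: sigma_finite_measure ?B using r by (intro sigma_finite) auto
  interpret P: pair_sigma_finite "lborel :: real measure" ?B ..
  have C: "C > 0" unfolding C_def using r c by (intro sum_pos2[of r j]) auto
  have split: "(\<Sum>i\<in>r. f i) = f j + (\<Sum>i\<in>r-{j}. f i)" for f :: "'i \<Rightarrow> real"
    using r by (simp add: sum.remove)
  \<comment> \<open>\<open>D b\<close> is the squared distance of the line from the origin, and
    \<open>t + e b / C\<close> is the line parameter measured from the nearest point; the half space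
    is where it is positive.\<close>
  have ip: "(\<Sum>i\<in>r. line_point r j c b t i * c i) = C * (t + e b / C)" for b t
  proof -
    have "(\<Sum>i\<in>r. line_point r j c b t i * c i) = (\<Sum>i\<in>r. (if i = j then 0 else b i) * c i + t * (c i)\<^sup>2)"
      by (intro sum.cong) (auto simp: line_point_def algebra_simps power2_eq_square)
    also have "\<dots> = (\<Sum>i\<in>r. (if i = j then 0 else b i) * c i) + t * C"
      by (simp add: sum.distrib C_def sum_distrib_left)
    also have "(\<Sum>i\<in>r. (if i = j then 0 else b i) * c i) = e b"
      unfolding split e_def by (auto intro!: sum.cong)
    finally show ?thesis using C by (simp add: field_simps)
  qed
  have [measurable]: "e \<in> borel_measurable ?B" unfolding e_def by measurable
  have [measurable]: "D \<in> borel_measurable ?B" unfolding D_def by measurable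
  have lp: "(\<lambda>x. line_point r j c (snd x) (fst x)) \<in> lborel \<Otimes>\<^sub>M ?B \<rightarrow>\<^sub>M PiM r (\<lambda>_. lborel)"
    unfolding line_point_def
  proof (rule measurable_restrict)
    fix i assume "i \<in> r"
    then show "(\<lambda>x. (if i = j then 0 else snd x i) + fst x * c i) \<in> lborel \<Otimes>\<^sub>M ?B \<rightarrow>\<^sub>M lborel"
      by (cases "i = j") auto
  qed
  have Glp: "(\<lambda>x. G (line_point r j c (snd x) (f (fst x) (snd x)))) \<in> borel_measurable (lborel \<Otimes>\<^sub>M ?B)"
    if [measurable]: "(\<lambda>x. f (fst x) (snd x)) \<in> borel_measurable (lborel \<Otimes>\<^sub>M ?B)" for f
  proof -
    have "(\<lambda>x. (f (fst x) (snd x), snd x)) \<in> lborel \<Otimes>\<^sub>M ?B \<rightarrow>\<^sub>M lborel \<Otimes>\<^sub>M ?B" by measurable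
    from measurable_compose[OF this measurable_compose[OF lp G]] show ?thesis by simp
  qed
  have Gt: "(\<lambda>t. G (line_point r j c b t)) \<in> borel_measurable borel" if "b \<in> space ?B" for b
    using measurable_compose[OF measurable_Pair2'[OF that] measurable_compose[OF lp G]] by simp
  have "(\<integral>\<^sup>+p. G p * indicator {0<..} (\<Sum>i\<in>r. p i * c i) \<partial>PiM r (\<lambda>_. lborel)) =
     ennreal \<bar>c j\<bar> * (\<integral>\<^sup>+t. \<integral>\<^sup>+b. G (line_point r j c b t) * indicator {0<..} (\<Sum>i\<in>r. line_point r j c b t i * c i) \<partial>?B \<partial>lborel)"
    by (rule nn_integral_shear[where c = c and j = j, OF r c]) measurable
  also have "(\<integral>\<^sup>+t. \<integral>\<^sup>+b. G (line_point r j c b t) * indicator {0<..} (\<Sum>i\<in>r. line_point r j c b t i * c i) \<partial>?B \<partial>lborel) =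
     (\<integral>\<^sup>+t. \<integral>\<^sup>+b. G (line_point r j c b t) * indicator {0<..} (t + e b / C) \<partial>?B \<partial>lborel)"
    using C by (intro nn_integral_cong) (simp add: ip indicator_def zero_less_mult_iff)
  also have "\<dots> = (\<integral>\<^sup>+b. \<integral>\<^sup>+t. G (line_point r j c b t) * indicator {0<..} (t + e b / C) \<partial>lborel \<partial>?B)"
  proof (rule P.Fubini'[symmetric])
    show "(\<lambda>(t, b). G (line_point r j c b t) * indicator {0<..} (t + e b / C)) \<in> borel_measurable (lborel \<Otimes>\<^sub>M ?B)"
      unfolding case_prod_beta by (intro borel_measurable_times_ennreal Glp) measurable
  qed
  also have "\<dots> = (\<integral>\<^sup>+b. \<integral>\<^sup>+q. G (line_point r j c b (sqrt ((q - D b) / C) - e b / C)) *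
       ennreal (1 / (2 * sqrt (C * (q - D b)))) * indicator {0<..} (q - D b) \<partial>lborel \<partial>?B)"
  proof (rule nn_integral_cong)
    fix b assume b: "b \<in> space ?B"
    note [measurable] = Gt[OF b]
    let ?h = "\<lambda>x. G (line_point r j c b (x - e b / C))"
    have "(\<integral>\<^sup>+t. G (line_point r j c b t) * indicator {0<..} (t + e b / C) \<partial>lborel) =
       ennreal \<bar>1\<bar> * (\<integral>\<^sup>+x. G (line_point r j c b (- (e b / C) + 1 * x)) * indicator {0<..} ((- (e b / C) + 1 * x) + e b / C) \<partial>lborel)"
      by (rule nn_integral_real_affine) auto
    also have "\<dots> = (\<integral>\<^sup>+x. ?h x * indicator {0<..} x \<partial>lborel)"
      by simp
    also have "\<dots> = (\<integral>\<^sup>+y. ?h (sqrt (y / C)) * ennreal (1 / (2 * sqrt (C * y))) * indicator {0<..} y \<partial>lborel)"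
      by (rule nn_integral_sqrt_substitution[OF C]) measurable
    also have "\<dots> = ennreal \<bar>1\<bar> * (\<integral>\<^sup>+q. ?h (sqrt ((- D b + 1 * q) / C)) * ennreal (1 / (2 * sqrt (C * (- D b + 1 * q)))) * indicator {0<..} (- D b + 1 * q) \<partial>lborel)"
      by (rule nn_integral_real_affine) auto
    finally show "(\<integral>\<^sup>+t. G (line_point r j c b t) * indicator {0<..} (t + e b / C) \<partial>lborel) =
      (\<integral>\<^sup>+q. G (line_point r j c b (sqrt ((q - D b) / C) - e b / C)) *
       ennreal (1 / (2 * sqrt (C * (q - D b)))) * indicator {0<..} (q - D b) \<partial>lborel)" by simp
  qed
  also have "\<dots> = (\<integral>\<^sup>+q. \<integral>\<^sup>+b. G (line_point r j c b (sqrt ((q - D b) / C) - e b / C)) *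
       ennreal (1 / (2 * sqrt (C * (q - D b)))) * indicator {0<..} (q - D b) \<partial>?B \<partial>lborel)"
  proof (rule P.Fubini')
    show "(\<lambda>(q, b). G (line_point r j c b (sqrt ((q - D b) / C) - e b / C)) *
       ennreal (1 / (2 * sqrt (C * (q - D b)))) * indicator {0<..} (q - D b)) \<in> borel_measurable (lborel \<Otimes>\<^sub>M ?B)"
      unfolding case_prod_beta by (intro borel_measurable_times_ennreal Glp) measurable
  qed
  finally show ?thesis .
qed

text \<open>The shift \<open>\<alpha> q\<close> depends on \<open>p\<close> only through its squared
  norm \<open>q\<close>, and the multiple of \<open>c\<close> restores that norm. So in the
  coordinates \<open>q\<close> and \<open>b\<close> the map translates \<open>b\<close> for each
  fixed \<open>q\<close>, and the pointwise inequality can be integrated. The factors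
  \<open>x\<close> and \<open>sqrt \<Delta>\<close> in it come from the Jacobians at the old and at
  the new point.\<close>

lemma nn_integral_norm_preserving_shift:
  fixes c :: "'i \<Rightarrow> real" and G G' :: "('i \<Rightarrow> real) \<Rightarrow> ennreal" and \<alpha> :: "real \<Rightarrow> 'i \<Rightarrow> real"
  assumes r: "finite r" "j \<in> r" and c: "c j \<noteq> 0"
    and G[measurable]: "G \<in> borel_measurable (PiM r (\<lambda>_. lborel))"
    and G'[measurable]: "G' \<in> borel_measurable (PiM r (\<lambda>_. lborel))"
    and orth: "\<And>q. (\<Sum>i\<in>r. \<alpha> q i * c i) = 0"
    and C_eq: "C = (\<Sum>i\<in>r. (c i)\<^sup>2)"
    and pos: "\<And>p. p \<in> extensional r \<Longrightarrow> G p \<noteq> 0 \<Longrightarrow> (\<Sum>i\<in>r. p i * c i) > 0"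
    and dom: "\<And>p q x \<Delta>. p \<in> extensional r \<Longrightarrow> G p \<noteq> 0 \<Longrightarrow> q = (\<Sum>i\<in>r. (p i)\<^sup>2) \<Longrightarrow>
      x = (\<Sum>i\<in>r. p i * c i) \<Longrightarrow>
      \<Delta> = x\<^sup>2 - C * (2 * (\<Sum>i\<in>r. p i * \<alpha> q i) + (\<Sum>i\<in>r. (\<alpha> q i)\<^sup>2)) \<Longrightarrow>
      \<Delta> > 0 \<and> G p * ennreal (sqrt \<Delta>) \<le> G' (\<lambda>i\<in>r. p i + \<alpha> q i + (sqrt \<Delta> - x) / C * c i) * ennreal x"
  shows "(\<integral>\<^sup>+p. G p \<partial>PiM r (\<lambda>_. lborel)) \<le> (\<integral>\<^sup>+p. G' p \<partial>PiM r (\<lambda>_. lborel))"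
proof -
  let ?B = "PiM (r - {j}) (\<lambda>_. lborel :: real measure)"
  let ?R = "PiM r (\<lambda>_. lborel :: real measure)"
  define e where "e = (\<lambda>b. (\<Sum>i\<in>r-{j}. b i * c i))"
  define D where "D = (\<lambda>b. (\<Sum>i\<in>r-{j}. (b i)\<^sup>2) - (e b)\<^sup>2 / C)"
  have C: "C > 0" unfolding C_eq using r c by (intro sum_pos2[of r j]) auto
  define P where "P = (\<lambda>b q. line_point r j c b (sqrt ((q - D b) / C) - e b / C))"
  define W where "W = (\<lambda>G b q. (G (P b q) :: ennreal) * ennreal (1 / (2 * sqrt (C * (q - D b)))) * indicator {0<..} (q - D b))"
  have coord: "(\<integral>\<^sup>+p. H p * indicator {0<..} (\<Sum>i\<in>r. p i * c i) \<partial>?R) =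
      ennreal \<bar>c j\<bar> * (\<integral>\<^sup>+q. \<integral>\<^sup>+b. W H b q \<partial>?B \<partial>lborel)" if "H \<in> borel_measurable ?R" for H
    using nn_integral_norm_coordinates[where G = H and c = c and j = j, OF r c that] unfolding W_def P_def D_def e_def C_eq .
  have split: "(\<Sum>i\<in>r. f i) = f j + (\<Sum>i\<in>r-{j}. f i)" for f :: "'i \<Rightarrow> real"
    using r by (simp add: sum.remove)
  define E where "E = (\<lambda>b i. if i = j then 0 else b i :: real)"
  have sumE: "(\<Sum>i\<in>r. E b i * g i) = (\<Sum>i\<in>r-{j}. b i * g i)" for b g
    unfolding split E_def by (auto intro!: sum.cong)
  have sumE2: "(\<Sum>i\<in>r. (E b i)\<^sup>2) = (\<Sum>i\<in>r-{j}. (b i)\<^sup>2)" for b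
    unfolding split E_def by (auto intro!: sum.cong)
  have lpE: "line_point r j c b t i = E b i + t * c i" if "i \<in> r" for b t i
    using that by (simp add: line_point_def E_def)
  have ip: "(\<Sum>i\<in>r. line_point r j c b t i * c i) = C * (t + e b / C)" for b t
  proof -
    have "(\<Sum>i\<in>r. line_point r j c b t i * c i) = (\<Sum>i\<in>r. E b i * c i + t * (c i)\<^sup>2)"
      by (intro sum.cong) (auto simp: lpE algebra_simps power2_eq_square)
    also have "\<dots> = e b + t * C" by (simp add: sum.distrib C_eq sum_distrib_left sumE e_def)
    finally show ?thesis using C by (simp add: field_simps)
  qed
  have nrm: "(\<Sum>i\<in>r. (line_point r j c b t i)\<^sup>2) = C * (t + e b / C)\<^sup>2 + D b" for b t
  proof -
    have "(\<Sum>i\<in>r. (line_point r j c b t i)\<^sup>2) = (\<Sum>i\<in>r. (E b i)\<^sup>2 + 2 * t * (E b i * c i) + t\<^sup>2 * (c i)\<^sup>2)"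
      by (intro sum.cong refl) (simp add: lpE power2_eq_square algebra_simps)
    also have "\<dots> = (\<Sum>i\<in>r-{j}. (b i)\<^sup>2) + 2 * t * e b + t\<^sup>2 * C"
      by (simp add: sum.distrib C_eq sum_distrib_left[symmetric] sumE sumE2 e_def)
    also have "\<dots> = C * (t + e b / C)\<^sup>2 + D b"
      unfolding D_def using C by (simp add: power2_eq_square field_simps)
    finally show ?thesis .
  qed
  \<comment> \<open>Subtracting the multiple of \<open>c\<close> brings coordinate \<open>j\<close>
    of the shifted foot back to 0.\<close>
  define sh where "sh = (\<lambda>q b. \<lambda>i\<in>r-{j}. b i + (\<alpha> q i - \<alpha> q j / c j * c i))"
  have dom': "W G b q \<le> W G' (sh q b) q" if b: "b \<in> space ?B" for b q
  proof (cases "q - D b > 0 \<and> G (P b q) \<noteq> 0")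
    case False
    then show ?thesis by (auto simp: W_def indicator_def)
  next
    case True
    define p where "p = P b q"
    define x where "x = (\<Sum>i\<in>r. p i * c i)"
    define s where "s = sqrt ((q - D b) / C)"
    have s: "s > 0" "C * s\<^sup>2 = q - D b" using True C by (auto simp: s_def)
    have pe: "p \<in> extensional r" by (simp add: p_def P_def line_point_def)
    have Gp: "G p \<noteq> 0" using True by (simp add: p_def)
    have q: "q = (\<Sum>i\<in>r. (p i)\<^sup>2)" unfolding p_def P_def nrm s_def[symmetric] using s by simp
    have x: "x = C * s" unfolding x_def p_def P_def ip s_def[symmetric] by simp
    have xpos: "x > 0" using x s C by simp
    define \<Delta> where "\<Delta> = x\<^sup>2 - C * (2 * (\<Sum>i\<in>r. p i * \<alpha> q i) + (\<Sum>i\<in>r. (\<alpha> q i)\<^sup>2))"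
    define p' where "p' = (\<lambda>i\<in>r. p i + \<alpha> q i + (sqrt \<Delta> - x) / C * c i)"
    from dom[OF pe Gp q x_def \<Delta>_def] have \<Delta>: "\<Delta> > 0" and ineq: "G p * ennreal (sqrt \<Delta>) \<le> G' p' * ennreal x"
      unfolding p'_def by auto
    define b' where "b' = sh q b"
    define a where "a = \<alpha> q j / c j"
    have Eb': "E b' i = E b i + \<alpha> q i - a * c i" if "i \<in> r" for i
      using that c by (auto simp: E_def b'_def sh_def a_def)
    have e': "e b' = e b - a * C"
    proof -
      have "e b' = (\<Sum>i\<in>r. E b' i * c i)" by (simp add: sumE e_def)
      also have "\<dots> = (\<Sum>i\<in>r. E b i * c i + \<alpha> q i * c i - a * (c i)\<^sup>2)"
        by (intro sum.cong refl) (simp add: Eb' power2_eq_square algebra_simps)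
      also have "\<dots> = e b - a * C"
        by (simp add: sum.distrib sum_subtractf C_eq sum_distrib_left[symmetric] orth sumE e_def)
      finally show ?thesis .
    qed
    have pE: "p i = E b i + (s - e b / C) * c i" if "i \<in> r" for i
      using that by (simp add: p_def P_def lpE s_def)
    have p\<alpha>: "(\<Sum>i\<in>r. p i * \<alpha> q i) = (\<Sum>i\<in>r. E b i * \<alpha> q i)"
    proof -
      have "(\<Sum>i\<in>r. p i * \<alpha> q i) = (\<Sum>i\<in>r. E b i * \<alpha> q i + (s - e b / C) * (\<alpha> q i * c i))"
        by (intro sum.cong refl) (simp add: pE algebra_simps)
      also have "\<dots> = (\<Sum>i\<in>r. E b i * \<alpha> q i)"
        by (simp add: sum.distrib sum_distrib_left[symmetric] orth)
      finally show ?thesis .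
    qed
    have n': "(\<Sum>i\<in>r-{j}. (b' i)\<^sup>2) = (\<Sum>i\<in>r-{j}. (b i)\<^sup>2) + (2 * (\<Sum>i\<in>r. p i * \<alpha> q i) + (\<Sum>i\<in>r. (\<alpha> q i)\<^sup>2)) - 2 * a * e b + a\<^sup>2 * C"
    proof -
      have "(\<Sum>i\<in>r-{j}. (b' i)\<^sup>2) = (\<Sum>i\<in>r. (E b' i)\<^sup>2)" by (simp add: sumE2)
      also have "\<dots> = (\<Sum>i\<in>r. (E b i)\<^sup>2 + 2 * (E b i * \<alpha> q i) + (\<alpha> q i)\<^sup>2 - 2 * a * (E b i * c i) - 2 * a * (\<alpha> q i * c i) + a\<^sup>2 * (c i)\<^sup>2)"
        by (intro sum.cong refl) (simp add: Eb' power2_eq_square algebra_simps)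
      also have "\<dots> = (\<Sum>i\<in>r. (E b i)\<^sup>2) + 2 * (\<Sum>i\<in>r. E b i * \<alpha> q i) + (\<Sum>i\<in>r. (\<alpha> q i)\<^sup>2) - 2 * a * (\<Sum>i\<in>r. E b i * c i) + a\<^sup>2 * C"
        by (simp add: sum.distrib sum_subtractf C_eq sum_distrib_left[symmetric] orth)
      finally show ?thesis by (simp add: sumE2 sumE e_def p\<alpha>)
    qed
    have D': "D b' = D b + (2 * (\<Sum>i\<in>r. p i * \<alpha> q i) + (\<Sum>i\<in>r. (\<alpha> q i)\<^sup>2))"
      unfolding D_def n' e' using C by (simp add: power2_eq_square field_simps)
    \<comment> \<open>Hence \<open>sqrt \<Delta>\<close> is the inner product of the new point with
      \<open>c\<close>, the counterpart of \<open>x\<close>.\<close>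
    have \<Delta>': "\<Delta> = C * (q - D b')"
    proof -
      have "x\<^sup>2 = C * (q - D b)" unfolding x using s(2)[symmetric] by (simp add: power2_eq_square)
      then show ?thesis unfolding \<Delta>_def D' by (simp add: algebra_simps)
    qed
    then have q': "q - D b' > 0" using \<Delta> C by (simp add: zero_less_mult_iff)
    have sq: "sqrt ((q - D b') / C) = sqrt \<Delta> / C"
    proof -
      have "(q - D b') / C = \<Delta> / C\<^sup>2" unfolding \<Delta>' using C by (simp add: power2_eq_square)
      then show ?thesis using C by (simp add: real_sqrt_divide)
    qed
    have pp: "P b' q = p'"
    proof
      fix i
      show "P b' q i = p' i"
      proof (cases "i \<in> r")
        case True
        have "P b' q i = E b' i + (sqrt \<Delta> / C - e b' / C) * c i" using True by (simp add: P_def lpE sq)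
        also have "\<dots> = p' i" unfolding e' using True C by (simp add: p'_def Eb' pE x field_simps)
        finally show ?thesis .
      qed (simp add: P_def p'_def line_point_def)
    qed
    have wx: "sqrt (C * (q - D b)) = x"
      using s C xpos unfolding x by (simp add: real_sqrt_unique power2_eq_square mult.assoc flip: s(2))
    have "W G b q = G p * ennreal (1 / (2 * x))" using True by (simp add: W_def p_def wx)
    also have "\<dots> = G p * ennreal (sqrt \<Delta>) * ennreal (1 / (2 * x * sqrt \<Delta>))"
      using \<Delta> xpos by (simp add: mult.assoc ennreal_mult[symmetric] del: ennreal_mult)
    also have "\<dots> \<le> G' p' * ennreal x * ennreal (1 / (2 * x * sqrt \<Delta>))"
      by (intro mult_right_mono ineq) simp
    also have "\<dots> = G' p' * ennreal (1 / (2 * sqrt \<Delta>))"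
      using \<Delta> xpos by (simp add: mult.assoc ennreal_mult[symmetric] del: ennreal_mult)
    also have "\<dots> = W G' b' q" using q' by (simp add: W_def pp \<Delta>')
    finally show ?thesis by (simp add: b'_def)
  qed
  have Wm: "(\<lambda>b. W H b q) \<in> borel_measurable ?B" if [measurable]: "H \<in> borel_measurable ?R" for H q
  proof -
    have [measurable]: "e \<in> borel_measurable ?B" unfolding e_def by measurable
    have [measurable]: "D \<in> borel_measurable ?B" unfolding D_def by measurable
    have "(\<lambda>b. P b q) \<in> ?B \<rightarrow>\<^sub>M ?R"
      unfolding P_def line_point_def
    proof (rule measurable_restrict)
      fix i assume "i \<in> r"
      then show "(\<lambda>b. (if i = j then 0 else b i) + (sqrt ((q - D b) / C) - e b / C) * c i) \<in> ?B \<rightarrow>\<^sub>M lborel"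
        by (cases "i = j") auto
    qed
    from measurable_compose[OF this that] have "(\<lambda>b. H (P b q)) \<in> borel_measurable ?B" .
    moreover have "(\<lambda>b. ennreal (1 / (2 * sqrt (C * (q - D b)))) * indicator {0<..} (q - D b)) \<in> borel_measurable ?B"
      by measurable
    ultimately show ?thesis unfolding W_def mult.assoc by (rule borel_measurable_times_ennreal)
  qed
  have "(\<integral>\<^sup>+p. G p \<partial>?R) = (\<integral>\<^sup>+p. G p * indicator {0<..} (\<Sum>i\<in>r. p i * c i) \<partial>?R)"
  proof (rule nn_integral_cong)
    fix p assume "p \<in> space ?R"
    then show "G p = G p * indicator {0<..} (\<Sum>i\<in>r. p i * c i)"
      using pos[of p] by (cases "G p = 0") (auto simp: space_PiM PiE_def)
  qed
  also have "\<dots> = ennreal \<bar>c j\<bar> * (\<integral>\<^sup>+q. \<integral>\<^sup>+b. W G b q \<partial>?B \<partial>lborel)" by (rule coord) fact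
  also have "\<dots> \<le> ennreal \<bar>c j\<bar> * (\<integral>\<^sup>+q. \<integral>\<^sup>+b. W G' (sh q b) q \<partial>?B \<partial>lborel)"
    by (intro mult_left_mono nn_integral_mono dom') auto
  also have "(\<integral>\<^sup>+q. \<integral>\<^sup>+b. W G' (sh q b) q \<partial>?B \<partial>lborel) = (\<integral>\<^sup>+q. \<integral>\<^sup>+b. W G' b q \<partial>?B \<partial>lborel)"
    unfolding sh_def using r
    by (intro nn_integral_cong nn_integral_translate_PiM_lborel[where f = "\<lambda>b. W G' b _"] Wm G') auto
  also have "ennreal \<bar>c j\<bar> * (\<integral>\<^sup>+q. \<integral>\<^sup>+b. W G' b q \<partial>?B \<partial>lborel) =
    (\<integral>\<^sup>+p. G' p * indicator {0<..} (\<Sum>i\<in>r. p i * c i) \<partial>?R)" by (rule coord[symmetric]) fact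
  also have "\<dots> \<le> (\<integral>\<^sup>+p. G' p \<partial>?R)"
    by (intro nn_integral_mono) (auto simp: indicator_def)
  finally show ?thesis .
qed

section \<open>Stability of randomly weighted sums\<close>

text \<open>The density at the shifted point differs from the original one by a factor
  \<open>exp (x - \<surd>D - S)\<close>, and the norm coordinates contribute a factor \<open>\<surd>D / x\<close>. To first order
  both \<open>x - \<surd>D\<close> and \<open>S\<close> equal \<open>A\<close>, so that only the fluctuation \<open>g\<close> is left.\<close>

lemma shift_exponent_bound:
  fixes u T \<eta> :: real
  assumes u: "u \<ge> 50 * T" and T: "T \<ge> 1" and \<eta>: "0 \<le> \<eta>" "T * \<eta> \<le> 1 / 100"
    and S: "\<bar>S\<bar> \<le> 2 * u * \<eta>" and g: "\<bar>g\<bar> \<le> T * \<eta>" and A: "A = S + g"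
    and N: "0 \<le> N" "N \<le> \<eta>\<^sup>2" and s: "\<bar>s\<bar> \<le> T * u" and x: "x = u\<^sup>2 + s"
    and D: "D = x\<^sup>2 - u\<^sup>2 * (2 * A + N)"
  shows "x > 0" "D > 0" "x - sqrt D - S + (sqrt D - x) / x \<le> 1"
proof -
  have u50: "u \<ge> 50" using u T by linarith
  have eta1: "\<eta> \<le> 1 / 100" using \<eta> T mult_right_mono[of 1 T \<eta>] by linarith
  have uu: "u\<^sup>2 \<ge> 50 * u" using u50 by (simp add: power2_eq_square)
  have Tu: "T * u \<le> u\<^sup>2 / 50" using mult_right_mono[OF u, of u] u50 by (simp add: power2_eq_square)
  have xl: "x \<ge> 98/100 * u\<^sup>2" and xu: "x \<le> 102/100 * u\<^sup>2" using s Tu unfolding x by linarith+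
  have u2: "u\<^sup>2 > 0" using u50 by simp
  show x0: "x > 0" using xl u2 by linarith
  have ueta: "u * \<eta> \<le> u / 100" using eta1 u50 mult_left_mono[of \<eta> "1/100" u] by simp
  have Ab: "\<bar>A\<bar> \<le> 2 * u * \<eta> + 1/100" using S g \<eta> unfolding A by linarith
  have N1: "N \<le> 1/10000" using N power_mono[OF eta1 \<eta>(1), of 2] by (simp add: power2_eq_square)
  have \<delta>: "\<bar>2 * A + N\<bar> \<le> 4 * (u * \<eta>) + 3/100" using Ab N N1 by linarith
  then have \<delta>1: "\<bar>2 * A + N\<bar> \<le> u / 20" using ueta u50 by linarith
  have \<delta>2: "\<bar>2 * A + N\<bar> \<le> u\<^sup>2 / 1000" using \<delta>1 uu by linarith
  have Dl: "D \<ge> (9/10 * u\<^sup>2)\<^sup>2"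
  proof -
    have "u\<^sup>2 * (2 * A + N) \<le> u\<^sup>2 * (u\<^sup>2 / 1000)" using \<delta>2 u2 by (intro mult_left_mono) linarith+
    moreover have "x\<^sup>2 \<ge> (98/100 * u\<^sup>2)\<^sup>2" using xl u2 by (intro power_mono) auto
    ultimately have "D \<ge> (98/100 * u\<^sup>2)\<^sup>2 - u\<^sup>2 * (u\<^sup>2 / 1000)" unfolding D by linarith
    also have "(98/100 * u\<^sup>2)\<^sup>2 - u\<^sup>2 * (u\<^sup>2 / 1000) = (9594/10000) * (u\<^sup>2 * u\<^sup>2)"
      by (simp add: power2_eq_square field_simps)
    finally have "D \<ge> (9594/10000) * (u\<^sup>2 * u\<^sup>2)" .
    moreover have "(9/10 * u\<^sup>2)\<^sup>2 = 81/100 * (u\<^sup>2 * u\<^sup>2)" by (simp add: power2_eq_square)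
    moreover have "u\<^sup>2 * u\<^sup>2 \<ge> 0" by simp
    ultimately show ?thesis by linarith
  qed
  have "(9/10 * u\<^sup>2)\<^sup>2 > 0" using u2 by simp
  then show D0: "D > 0" using Dl by linarith
  define y where "y = sqrt D"
  have y2: "y\<^sup>2 = D" using D0 by (simp add: y_def)
  have yl: "y \<ge> 9/10 * u\<^sup>2" using Dl real_le_rsqrt unfolding y_def by blast
  have y0: "y > 0" using yl u2 by linarith
  define v where "v = x + y"
  have v: "v \<ge> 188/100 * u\<^sup>2" using xl yl by (simp add: v_def)
  have v0: "v > 0" using v u2 by linarith
  have xy: "(x - y) * v = u\<^sup>2 * (2 * A + N)"
    using y2 unfolding D v_def by (simp add: power2_eq_square algebra_simps)
  have ratio: "u\<^sup>2 / v \<le> 6/10" using v u2 unfolding pos_divide_le_eq[OF v0] by linarith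
  have xyv: "x - y = (2 * A + N) * (u\<^sup>2 / v)" using xy v0 by (simp add: field_simps)
  have xyb: "\<bar>x - y\<bar> \<le> 6/10 * \<bar>2 * A + N\<bar>"
  proof -
    have "\<bar>x - y\<bar> = \<bar>2 * A + N\<bar> * (u\<^sup>2 / v)" unfolding xyv abs_mult using v0 by simp
    also have "\<dots> \<le> \<bar>2 * A + N\<bar> * (6/10)" by (intro mult_left_mono ratio) auto
    finally show ?thesis by simp
  qed
  have dev: "\<bar>2 * u\<^sup>2 - v\<bar> \<le> 21/10 * (T * u)"
  proof -
    have "2 * u\<^sup>2 - v = - 2 * s + (x - y)" unfolding v_def x by simp
    moreover have "u \<le> T * u" using T u50 mult_right_mono[of 1 T u] by linarith
    moreover have "\<bar>x - y\<bar> \<le> 6/10 * (u / 20)" by (rule order_trans[OF xyb]) (intro mult_left_mono \<delta>1, simp)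
    then have "\<bar>x - y\<bar> \<le> u / 10" using u50 by simp
    ultimately show ?thesis using s unfolding abs_le_iff by linarith
  qed
  \<comment> \<open>\<open>v\<close> differs from \<open>2 * u\<^sup>2\<close> by order
    \<open>T * u\<close>, a relative error of order \<open>T / u\<close>. Multiplied by
    \<open>A\<close>, which may be as large as order \<open>u * \<eta>\<close>, it leaves order
    \<open>T * \<eta>\<close>; this is why that product is required to be small.\<close>
  have main: "A * (2 * u\<^sup>2 / v - 1) \<le> 1/10"
  proof -
    have "A * (2 * u\<^sup>2 / v - 1) \<le> \<bar>A\<bar> * (\<bar>2 * u\<^sup>2 - v\<bar> / v)"
    proof -
      have eq: "2 * u\<^sup>2 / v - 1 = (2 * u\<^sup>2 - v) / v" using v0 by (simp add: field_simps)
      have "A * (2 * u\<^sup>2 / v - 1) \<le> \<bar>A * ((2 * u\<^sup>2 - v) / v)\<bar>" unfolding eq by (rule abs_ge_self)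
      also have "\<dots> = \<bar>A\<bar> * (\<bar>2 * u\<^sup>2 - v\<bar> / v)" using v0 by (simp add: abs_mult)
      finally show ?thesis .
    qed
    also have "\<dots> \<le> (2 * u * \<eta> + 1/100) * ((21/10 * (T * u)) / (188/100 * u\<^sup>2))"
      using Ab dev v v0 u2 u50 T \<eta>(1) divide_nonneg_pos[OF abs_ge_zero v0, of "2 * u\<^sup>2 - v"]
      by (intro mult_mono frac_le) auto
    also have "\<dots> = (21/10) / (188/100) * (2 * (T * \<eta>) + T / u / 100)"
      using u50 by (simp add: field_simps power2_eq_square)
    also have "T / u \<le> 1 / 50" using u u50 by (simp add: divide_le_eq)
    then have "(21/10) / (188/100) * (2 * (T * \<eta>) + T / u / 100) \<le> 1/10" using \<eta>(2) by simp
    finally show ?thesis .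
  qed
  have "x - y - S = A * (2 * u\<^sup>2 / v - 1) + g + N * (u\<^sup>2 / v)"
    unfolding xyv A by (simp add: algebra_simps add_divide_distrib)
  also have "\<dots> \<le> 1/10 + 1/100 + 1/10000"
  proof -
    have "u\<^sup>2 / v \<le> 1" using ratio by linarith
    from mult_left_mono[OF this N(1)] show ?thesis using main g \<eta>(2) N1 by linarith
  qed
  finally have 1: "x - y - S \<le> 1/10 + 1/100 + 1/10000" .
  have "(y - x) / x \<le> 1/10"
  proof -
    have "\<bar>x - y\<bar> \<le> 6/10 * (u\<^sup>2 / 1000)" by (rule order_trans[OF xyb]) (intro mult_left_mono \<delta>2, simp)
    then have "y - x \<le> x / 10" using xl u2 unfolding abs_le_iff by linarith
    then show ?thesis using x0 by (simp add: divide_le_eq)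
  qed
  with 1 show "x - sqrt D - S + (sqrt D - x) / x \<le> 1" unfolding y_def by linarith
qed

section \<open>Gaussian weights under a norm-preserving shift\<close>

lemma measurable_PiM_std_normal:
  "f \<in> borel_measurable (PiM r (\<lambda>_. std_normal)) \<longleftrightarrow> f \<in> borel_measurable (PiM r (\<lambda>_. lborel :: real measure))"
  by (intro arg_cong2[where f = "(\<in>)"] refl measurable_cong_sets sets_PiM_cong) auto

lemma nn_integral_translated_std_normal:
  fixes f :: "('i \<Rightarrow> real) \<Rightarrow> ennreal"
  assumes r: "finite r" and f[measurable]: "f \<in> borel_measurable (PiM r (\<lambda>_. lborel))"
  shows "(\<integral>\<^sup>+\<omega>. f (\<lambda>i\<in>r. 1 + \<omega> i) \<partial>PiM r (\<lambda>_. std_normal)) =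
    (\<integral>\<^sup>+p. ennreal ((1 / sqrt (2 * pi)) ^ card r * exp (- (1/2) * (\<Sum>i\<in>r. (p i - 1)\<^sup>2))) * f p \<partial>PiM r (\<lambda>_. lborel))"
proof -
  let ?R = "PiM r (\<lambda>_. lborel :: real measure)"
  let ?d = "\<lambda>p. ennreal ((1 / sqrt (2 * pi)) ^ card r * exp (- (1/2) * (\<Sum>i\<in>r. (p i - 1)\<^sup>2))) * f p"
  have tr[measurable]: "(\<lambda>x. \<lambda>i\<in>r. 1 + x i) \<in> ?R \<rightarrow>\<^sub>M ?R" by measurable
  have "(\<integral>\<^sup>+\<omega>. f (\<lambda>i\<in>r. 1 + \<omega> i) \<partial>PiM r (\<lambda>_. std_normal)) =
    (\<integral>\<^sup>+x. ennreal ((1 / sqrt (2 * pi)) ^ card r * exp (- (1/2) * (\<Sum>i\<in>r. (x i)\<^sup>2))) * f (\<lambda>i\<in>r. 1 + x i) \<partial>?R)"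
    unfolding PiM_std_normal[OF r] by (rule nn_integral_density) measurable
  also have "\<dots> = (\<integral>\<^sup>+x. ?d (\<lambda>i\<in>r. x i + 1) \<partial>?R)"
    by (intro nn_integral_cong) (simp add: add.commute)
  also have "\<dots> = (\<integral>\<^sup>+p. ?d p \<partial>?R)"
    using r by (rule nn_integral_translate_PiM_lborel) measurable
  finally show ?thesis .
qed

lemma coordinate_tail:
  assumes r: "finite r" and T: "T \<ge> 0"
  shows "{\<omega>\<in>space (PiM r (\<lambda>_. std_normal)). \<exists>i\<in>r. T < \<bar>\<omega> i\<bar>} \<in> sets (PiM r (\<lambda>_. std_normal))"
    and "measure (PiM r (\<lambda>_. std_normal)) {\<omega>\<in>space (PiM r (\<lambda>_. std_normal)). \<exists>i\<in>r. T < \<bar>\<omega> i\<bar>}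
      \<le> real (card r) * (2 * exp (- T\<^sup>2 / 2))"
proof -
  let ?N = "PiM r (\<lambda>_. std_normal)"
  interpret N: prob_space ?N by (rule prob_space_PiM_std_normal)
  define B where "B = (\<lambda>i. {\<omega>\<in>space ?N. T * 1 < \<bar>\<Sum>a\<in>{i}. 1 * \<omega> a\<bar>})"
  have Bm: "B i \<in> sets ?N" if "i \<in> r" for i
  proof -
    have "(\<lambda>\<omega>. \<Sum>a\<in>{i}. 1 * \<omega> a) \<in> borel_measurable ?N"
      using that by (intro measurable_linear_functional) auto
    then show ?thesis unfolding B_def by measurable
  qed
  have eq: "{\<omega>\<in>space ?N. \<exists>i\<in>r. T < \<bar>\<omega> i\<bar>} = (\<Union>i\<in>r. B i)" by (auto simp: B_def)
  show "{\<omega>\<in>space ?N. \<exists>i\<in>r. T < \<bar>\<omega> i\<bar>} \<in> sets ?N"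
    unfolding eq using r Bm by (intro sets.finite_UN) auto
  have "N.prob (\<Union>i\<in>r. B i) \<le> (\<Sum>i\<in>r. N.prob (B i))"
    using r Bm by (intro N.finite_measure_subadditive_finite) auto
  also have "\<dots> \<le> (\<Sum>i\<in>r. 2 * exp (- T\<^sup>2 / 2))"
    unfolding B_def using T by (intro sum_mono linear_functional_tail) auto
  finally show "N.prob {\<omega>\<in>space ?N. \<exists>i\<in>r. T < \<bar>\<omega> i\<bar>} \<le> real (card r) * (2 * exp (- T\<^sup>2 / 2))"
    unfolding eq by simp
qed

text \<open>\<open>f\<close> and \<open>f'\<close> test the outputs on two datasets as functions of
  the weights in \<open>r\<close>, and \<open>q0\<close> stands for the squares of the weights
  outside \<open>r\<close>, which stay fixed. The shift \<open>\<alpha>\<^sub>1\<close> makes up for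
  the changed pairs; \<open>\<alpha>\<^sub>2\<close>, scaled by the norm of all weights, makes up
  for the changed center. For typical weights the ratio of densities, Jacobians included, is at most
  \<open>exp 1\<close>.\<close>

lemma weight_shift:
  fixes n \<alpha>\<^sub>1 \<alpha>\<^sub>2 :: "'i \<Rightarrow> real" and f f' :: "('i \<Rightarrow> real) \<Rightarrow> ennreal"
  assumes r: "finite r"
    and f[measurable]: "f \<in> borel_measurable (PiM r (\<lambda>_. lborel))" "\<And>p. f p \<le> 1"
    and f'[measurable]: "f' \<in> borel_measurable (PiM r (\<lambda>_. lborel))"
    and C_eq: "C = (\<Sum>i\<in>r. (n i)\<^sup>2)" "C = (\<Sum>i\<in>r. n i)"
    and orth: "(\<Sum>i\<in>r. \<alpha>\<^sub>1 i * n i) = 0" "(\<Sum>i\<in>r. \<alpha>\<^sub>2 i * n i) = 0"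
    and T: "T \<ge> 1" and C: "real (card r) \<le> 4 * C" "sqrt C \<ge> 50 * T"
    and q0: "0 \<le> q0" "4 * T\<^sup>2 * real (card r) + q0 \<le> \<rho>\<^sup>2" "0 \<le> \<rho>"
    and \<eta>: "\<eta> = L2_set \<alpha>\<^sub>1 r + \<rho> * L2_set \<alpha>\<^sub>2 r" "T * \<eta> \<le> 1 / 100"
    and inv: "\<And>p p' \<tau>. (\<And>i. i \<in> r \<Longrightarrow> p' i = p i + \<alpha>\<^sub>1 i + sqrt ((\<Sum>i\<in>r. (p i)\<^sup>2) + q0) * \<alpha>\<^sub>2 i + \<tau> * n i) \<Longrightarrow>
      p \<in> extensional r \<Longrightarrow> p' \<in> extensional r \<Longrightarrow>
      (\<Sum>i\<in>r. (p' i)\<^sup>2) = (\<Sum>i\<in>r. (p i)\<^sup>2) \<Longrightarrow> (\<Sum>i\<in>r. (p i)\<^sup>2) > 0 \<Longrightarrow> f p = f' p'"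
  shows "(\<integral>\<^sup>+\<omega>. f (\<lambda>i\<in>r. 1 + \<omega> i) \<partial>PiM r (\<lambda>_. std_normal)) \<le>
    ennreal (exp 1) * (\<integral>\<^sup>+\<omega>. f' (\<lambda>i\<in>r. 1 + \<omega> i) \<partial>PiM r (\<lambda>_. std_normal)) +
    ennreal (2 * (real (card r) + 3) * exp (- T\<^sup>2 / 2))"
proof -
  let ?R = "PiM r (\<lambda>_. lborel :: real measure)" and ?N = "PiM r (\<lambda>_. std_normal)"
  interpret N: prob_space ?N by (rule prob_space_PiM_std_normal)
  have Cpos: "C > 0"
  proof -
    have "sqrt C > 0" using C(2) T by linarith
    then show ?thesis by simp
  qed
  define u where "u = sqrt C"
  have u: "u \<ge> 50 * T" "u\<^sup>2 = C" "u > 0" using C(2) Cpos by (auto simp: u_def)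
  have "\<exists>j\<in>r. n j \<noteq> 0"
  proof (rule ccontr)
    assume "\<not> ?thesis"
    then have "C = 0" unfolding C_eq(2) by (intro sum.neutral) auto
    with Cpos show False by simp
  qed
  then obtain j where j: "j \<in> r" "n j \<noteq> 0" by auto
  \<comment> \<open>Typical weights: every coordinate is within \<open>T\<close> of 1, and the three
    functionals that enter the exponent are within \<open>T\<close> standard deviations of their
    means. These are the \<open>card r + 3\<close> Gaussian tails in the additive error.\<close>
  define E where "E = {p. (\<forall>i\<in>r. \<bar>p i - 1\<bar> \<le> T) \<and> \<bar>\<Sum>i\<in>r. n i * (p i - 1)\<bar> \<le> T * u \<and>
    \<bar>\<Sum>i\<in>r. \<alpha>\<^sub>1 i * (p i - 1)\<bar> \<le> T * L2_set \<alpha>\<^sub>1 r \<and> \<bar>\<Sum>i\<in>r. \<alpha>\<^sub>2 i * (p i - 1)\<bar> \<le> T * L2_set \<alpha>\<^sub>2 r}"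
  define \<phi> where "\<phi> = (\<lambda>p. ennreal ((1 / sqrt (2 * pi)) ^ card r * exp (- (1/2) * (\<Sum>i\<in>r. (p i - 1)\<^sup>2))))"
  define G where "G = (\<lambda>p. \<phi> p * (f p * indicator E p))"
  define G' where "G' = (\<lambda>p. \<phi> p * (ennreal (exp 1) * f' p))"
  define \<alpha> where "\<alpha> = (\<lambda>q i. \<alpha>\<^sub>1 i + sqrt (q + q0) * \<alpha>\<^sub>2 i)"
  have \<eta>0: "\<eta> \<ge> 0" unfolding \<eta>(1) using q0 by (intro add_nonneg_nonneg mult_nonneg_nonneg L2_set_nonneg)
  have [measurable]: "\<phi> \<in> borel_measurable ?R" unfolding \<phi>_def by measurable
  have E[measurable]: "(\<lambda>p. indicator E p :: ennreal) \<in> borel_measurable ?R"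
    unfolding E_def indicator_def mem_Collect_eq using r by measurable
  have Gm: "G \<in> borel_measurable ?R" "G' \<in> borel_measurable ?R" unfolding G_def G'_def by measurable
  have est: "(\<Sum>i\<in>r. p i * n i) > 0" (is ?th1)
    "\<Delta> > 0 \<and> G p * ennreal (sqrt \<Delta>) \<le> G' (\<lambda>i\<in>r. p i + \<alpha> q i + (sqrt \<Delta> - x) / C * n i) * ennreal x" (is ?th2)
    if p: "p \<in> extensional r" and Gp: "G p \<noteq> 0" and q: "q = (\<Sum>i\<in>r. (p i)\<^sup>2)" and x: "x = (\<Sum>i\<in>r. p i * n i)"
      and \<Delta>: "\<Delta> = x\<^sup>2 - C * (2 * (\<Sum>i\<in>r. p i * \<alpha> q i) + (\<Sum>i\<in>r. (\<alpha> q i)\<^sup>2))" for p q x \<Delta>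
  proof -
    have pE: "p \<in> E" using Gp by (auto simp: G_def indicator_def split: if_splits)
    have qb: "q + q0 \<le> \<rho>\<^sup>2"
    proof -
      have "(p i)\<^sup>2 \<le> 4 * T\<^sup>2" if "i \<in> r" for i
      proof -
        have "\<bar>p i\<bar> \<le> 2 * T" using pE that T by (fastforce simp: E_def)
        then have "\<bar>p i\<bar>\<^sup>2 \<le> (2 * T)\<^sup>2" by (intro power_mono) auto
        then show ?thesis by (simp add: power_mult_distrib)
      qed
      then have "q \<le> real (card r) * (4 * T\<^sup>2)" unfolding q by (rule sum_bounded_above)
      then show ?thesis using q0 by (simp add: algebra_simps)
    qed
    have q0': "0 \<le> q + q0" unfolding q using q0 by (intro add_nonneg_nonneg sum_nonneg) auto
    have sb: "0 \<le> sqrt (q + q0)" "sqrt (q + q0) \<le> \<rho>" using qb q0' q0 by (auto intro: real_le_lsqrt)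
    have L2: "L2_set (\<alpha> q) r \<le> \<eta>"
    proof -
      have "L2_set (\<alpha> q) r \<le> L2_set \<alpha>\<^sub>1 r + L2_set (\<lambda>i. sqrt (q + q0) * \<alpha>\<^sub>2 i) r"
        unfolding \<alpha>_def by (rule L2_set_triangle_ineq)
      also have "L2_set (\<lambda>i. sqrt (q + q0) * \<alpha>\<^sub>2 i) r = sqrt (q + q0) * L2_set \<alpha>\<^sub>2 r"
        using sb by (simp add: L2_set_right_distrib)
      also have "\<dots> \<le> \<rho> * L2_set \<alpha>\<^sub>2 r" using sb by (intro mult_right_mono) auto
      finally show ?thesis by (simp add: \<eta>(1))
    qed
    define S where "S = (\<Sum>i\<in>r. \<alpha> q i)"
    define g where "g = (\<Sum>i\<in>r. \<alpha> q i * (p i - 1))"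
    define N where "N = (\<Sum>i\<in>r. (\<alpha> q i)\<^sup>2)"
    define s where "s = (\<Sum>i\<in>r. n i * (p i - 1))"
    \<comment> \<open>Cauchy-Schwarz against the all-ones vector. The bound is not small; it
      suffices because \<open>S\<close> cancels from the exponent to first order.\<close>
    have Sb: "\<bar>S\<bar> \<le> 2 * u * \<eta>"
    proof -
      have "\<bar>S\<bar> \<le> (\<Sum>i\<in>r. \<bar>1\<bar> * \<bar>\<alpha> q i\<bar>)" unfolding S_def by simp
      also have "\<dots> \<le> L2_set (\<lambda>_. 1) r * L2_set (\<alpha> q) r" by (rule L2_set_mult_ineq)
      also have "\<dots> \<le> (2 * u) * \<eta>"
      proof (intro mult_mono L2)
        have "sqrt (real (card r)) \<le> sqrt (4 * C)" using C(1) by simp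
        also have "\<dots> = 2 * u" by (simp add: u_def real_sqrt_mult)
        finally show "L2_set (\<lambda>_. 1) r \<le> 2 * u" by (simp add: L2_set_def)
      qed (use u in auto)
      finally show ?thesis .
    qed
    have gb: "\<bar>g\<bar> \<le> T * \<eta>"
    proof -
      have "g = (\<Sum>i\<in>r. \<alpha>\<^sub>1 i * (p i - 1)) + sqrt (q + q0) * (\<Sum>i\<in>r. \<alpha>\<^sub>2 i * (p i - 1))"
      proof -
        have "g = (\<Sum>i\<in>r. \<alpha>\<^sub>1 i * (p i - 1) + sqrt (q + q0) * (\<alpha>\<^sub>2 i * (p i - 1)))"
          unfolding g_def \<alpha>_def by (intro sum.cong refl) (simp add: algebra_simps)
        then show ?thesis by (simp add: sum.distrib sum_distrib_left)
      qed
      then have "\<bar>g\<bar> \<le> \<bar>\<Sum>i\<in>r. \<alpha>\<^sub>1 i * (p i - 1)\<bar> + sqrt (q + q0) * \<bar>\<Sum>i\<in>r. \<alpha>\<^sub>2 i * (p i - 1)\<bar>"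
        using sb(1) by (simp add: abs_mult order_trans[OF abs_triangle_ineq])
      also have "\<dots> \<le> T * L2_set \<alpha>\<^sub>1 r + \<rho> * (T * L2_set \<alpha>\<^sub>2 r)"
        using pE sb q0(3) by (intro add_mono mult_mono) (auto simp: E_def)
      finally show ?thesis by (simp add: \<eta>(1) algebra_simps)
    qed
    have Nb: "0 \<le> N" "N \<le> \<eta>\<^sup>2"
    proof -
      show "0 \<le> N" unfolding N_def by (intro sum_nonneg) auto
      then have "N = (L2_set (\<alpha> q) r)\<^sup>2" by (simp add: L2_set_def N_def)
      also have "\<dots> \<le> \<eta>\<^sup>2" by (intro power_mono L2 L2_set_nonneg)
      finally show "N \<le> \<eta>\<^sup>2" .
    qed
    have sbd: "\<bar>s\<bar> \<le> T * u" using pE by (simp add: E_def s_def)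
    have x': "x = u\<^sup>2 + s"
      unfolding x s_def u(2) by (simp add: C_eq(2) algebra_simps sum_subtractf)
    have A: "(\<Sum>i\<in>r. p i * \<alpha> q i) = S + g"
      unfolding S_def g_def by (simp add: algebra_simps sum_subtractf)
    note bnd = shift_exponent_bound[OF u(1) T \<eta>0 \<eta>(2) Sb gb A Nb sbd x' \<Delta>[folded u(2) N_def]]
    show th1: ?th1 using bnd(1) unfolding x .
    define y where "y = sqrt \<Delta>"
    have y: "y > 0" "y\<^sup>2 = \<Delta>" using bnd(2) by (auto simp: y_def)
    \<comment> \<open>The root of the quadratic equation for the step along \<open>n\<close> that
      restores the norm; \<open>y\<close> is the inner product of the new point with
      \<open>n\<close>.\<close>
    define \<tau> where "\<tau> = (y - x) / C"
    define p' where "p' = (\<lambda>i\<in>r. p i + \<alpha> q i + \<tau> * n i)"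
    have \<alpha>n: "(\<Sum>i\<in>r. \<alpha> q i * n i) = 0"
    proof -
      have "(\<Sum>i\<in>r. \<alpha> q i * n i) = (\<Sum>i\<in>r. \<alpha>\<^sub>1 i * n i) + sqrt (q + q0) * (\<Sum>i\<in>r. \<alpha>\<^sub>2 i * n i)"
        unfolding \<alpha>_def by (simp add: sum.distrib sum_distrib_left algebra_simps)
      then show ?thesis by (simp add: orth)
    qed
    have nrm: "(\<Sum>i\<in>r. (p' i)\<^sup>2) = (\<Sum>i\<in>r. (p i)\<^sup>2)"
    proof -
      have "(\<Sum>i\<in>r. (p' i)\<^sup>2) = (\<Sum>i\<in>r. (p i)\<^sup>2 + 2 * (p i * \<alpha> q i) + (\<alpha> q i)\<^sup>2 + 2 * \<tau> * (p i * n i) + 2 * \<tau> * (\<alpha> q i * n i) + \<tau>\<^sup>2 * (n i)\<^sup>2)"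
        by (intro sum.cong refl) (simp add: p'_def power2_eq_square algebra_simps)
      also have "\<dots> = (\<Sum>i\<in>r. (p i)\<^sup>2) + (2 * (\<Sum>i\<in>r. p i * \<alpha> q i) + N) + (2 * \<tau> * x + \<tau>\<^sup>2 * C)"
        by (simp add: sum.distrib sum_distrib_left[symmetric] \<alpha>n N_def x C_eq(1))
      also have "2 * \<tau> * x + \<tau>\<^sup>2 * C = (y\<^sup>2 - x\<^sup>2) / C"
        unfolding \<tau>_def using Cpos by (simp add: power2_eq_square field_simps)
      also have "(y\<^sup>2 - x\<^sup>2) / C = - (2 * (\<Sum>i\<in>r. p i * \<alpha> q i) + N)"
        unfolding y(2) \<Delta> N_def using Cpos by (simp add: field_simps)
      finally show ?thesis by simp
    qed
    have ppos: "(\<Sum>i\<in>r. (p i)\<^sup>2) > 0"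
    proof (rule ccontr)
      assume "\<not> ?thesis"
      then have "(\<Sum>i\<in>r. (p i)\<^sup>2) = 0" using sum_nonneg[of r "\<lambda>i. (p i)\<^sup>2"] by (simp add: order_less_le)
      then have "x = 0" unfolding x using r by (intro sum.neutral) (auto simp: sum_nonneg_eq_0_iff)
      with bnd(1) show False by simp
    qed
    have ff: "f p = f' p'"
      by (rule inv[where \<tau> = \<tau>]) (use p nrm ppos in \<open>auto simp: p'_def \<alpha>_def q\<close>)
    \<comment> \<open>At equal norms the squared distance from the all-ones vector changes only
      through the coordinate sum, to which the step along \<open>n\<close> contributes
      \<open>\<tau> * C = y - x\<close>.\<close>
    have diff: "(\<Sum>i\<in>r. (p' i - 1)\<^sup>2) = (\<Sum>i\<in>r. (p i - 1)\<^sup>2) - 2 * (S + (y - x))"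
    proof -
      have "(\<Sum>i\<in>r. (v i - 1)\<^sup>2) = (\<Sum>i\<in>r. (v i)\<^sup>2) - 2 * (\<Sum>i\<in>r. v i) + real (card r)" for v :: "'i \<Rightarrow> real"
        by (simp add: power2_eq_square algebra_simps sum.distrib sum_subtractf sum_distrib_right)
      moreover have "(\<Sum>i\<in>r. p' i) = (\<Sum>i\<in>r. p i) + S + (y - x)"
        using Cpos 
        by (simp add: p'_def S_def sum.distrib sum_distrib_left[symmetric] C_eq(2)[symmetric])
          (simp add: \<tau>_def)
      ultimately show ?thesis by (simp add: nrm)
    qed
    have dens: "exp (- (1/2) * (\<Sum>i\<in>r. (p i - 1)\<^sup>2)) * y \<le> exp (- (1/2) * (\<Sum>i\<in>r. (p' i - 1)\<^sup>2)) * (exp 1 * x)"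
    proof -
      \<comment> \<open>The Jacobian ratio \<open>y / x\<close> is moved into the exponent by
        \<open>1 + h \<le> exp h\<close>.\<close>
      have yx: "y \<le> x * exp ((y - x) / x)"
      proof -
        have "1 + (y - x) / x \<le> exp ((y - x) / x)" by (rule exp_ge_add_one_self)
        then have "x * (1 + (y - x) / x) \<le> x * exp ((y - x) / x)" using bnd(1) by (intro mult_left_mono) auto
        moreover have "x * (1 + (y - x) / x) = y" using bnd(1) by (simp add: field_simps)
        ultimately show ?thesis by simp
      qed
      have "exp (- (1/2) * (\<Sum>i\<in>r. (p i - 1)\<^sup>2)) = exp (- (1/2) * (\<Sum>i\<in>r. (p' i - 1)\<^sup>2)) * exp (x - y - S)"
        unfolding exp_add[symmetric] diff by (simp add: algebra_simps)
      then have "exp (- (1/2) * (\<Sum>i\<in>r. (p i - 1)\<^sup>2)) * y =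
        exp (- (1/2) * (\<Sum>i\<in>r. (p' i - 1)\<^sup>2)) * (exp (x - y - S) * y)" by simp
      also have "\<dots> \<le> exp (- (1/2) * (\<Sum>i\<in>r. (p' i - 1)\<^sup>2)) * (exp (x - y - S) * (x * exp ((y - x) / x)))"
        using yx by (intro mult_left_mono) auto
      also have "exp (x - y - S) * (x * exp ((y - x) / x)) = exp (x - y - S + (y - x) / x) * x"
        by (simp add: exp_add)
      also have "exp (- (1/2) * (\<Sum>i\<in>r. (p' i - 1)\<^sup>2)) * (exp (x - y - S + (y - x) / x) * x) \<le>
         exp (- (1/2) * (\<Sum>i\<in>r. (p' i - 1)\<^sup>2)) * (exp 1 * x)"
        using bnd(1,3) by (intro mult_left_mono mult_right_mono) (auto simp: y_def)
      finally show ?thesis .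
    qed
    have "G p * ennreal (sqrt \<Delta>) = \<phi> p * ennreal y * f p"
      using pE by (simp add: G_def y_def mult_ac)
    also have "\<phi> p * ennreal y \<le> \<phi> p' * ennreal (exp 1 * x)"
    proof -
      have k: "0 \<le> (1 / sqrt (2 * pi)) ^ card r" by simp
      have "\<phi> p * ennreal y = ennreal ((1 / sqrt (2 * pi)) ^ card r * (exp (- (1/2) * (\<Sum>i\<in>r. (p i - 1)\<^sup>2)) * y))"
        using y by (simp add: \<phi>_def ennreal_mult[symmetric] mult.assoc)
      also have "\<dots> \<le> ennreal ((1 / sqrt (2 * pi)) ^ card r * (exp (- (1/2) * (\<Sum>i\<in>r. (p' i - 1)\<^sup>2)) * (exp 1 * x)))"
        by (intro ennreal_leI mult_left_mono dens k)
      also have "\<dots> = \<phi> p' * ennreal (exp 1 * x)"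
        using bnd(1) by (simp add: \<phi>_def ennreal_mult[symmetric] mult.assoc)
      finally show ?thesis .
    qed
    then have "\<phi> p * ennreal y * f p \<le> \<phi> p' * ennreal (exp 1 * x) * f p" by (rule mult_right_mono) simp
    also have "\<phi> p' * ennreal (exp 1 * x) * f p = G' p' * ennreal x"
      using bnd(1) by (simp add: G'_def ff ennreal_mult mult_ac)
    finally have "G p * ennreal (sqrt \<Delta>) \<le> G' p' * ennreal x" .
    then show ?th2 using bnd(2) by (simp add: p'_def \<tau>_def y_def)
  qed
  have main: "(\<integral>\<^sup>+p. G p \<partial>?R) \<le> (\<integral>\<^sup>+p. G' p \<partial>?R)"
  proof (rule nn_integral_norm_preserving_shift[where c = n and j = j and \<alpha> = \<alpha> and C = C, OF r j(1) j(2) Gm])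
    fix q
    have "(\<Sum>i\<in>r. \<alpha> q i * n i) = (\<Sum>i\<in>r. \<alpha>\<^sub>1 i * n i) + sqrt (q + q0) * (\<Sum>i\<in>r. \<alpha>\<^sub>2 i * n i)"
      unfolding \<alpha>_def by (simp add: sum.distrib sum_distrib_left algebra_simps)
    then show "(\<Sum>i\<in>r. \<alpha> q i * n i) = 0" by (simp add: orth)
  qed (use C_eq(1) est in blast)+
  have one_plus[measurable]: "(\<lambda>\<omega>. \<lambda>i\<in>r. 1 + \<omega> i) \<in> ?R \<rightarrow>\<^sub>M ?R" by measurable
  have bad: "(\<integral>\<^sup>+\<omega>. indicator (- E) (\<lambda>i\<in>r. 1 + \<omega> i) \<partial>?N) \<le> ennreal (2 * (real (card r) + 3) * exp (- T\<^sup>2 / 2))"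
  proof -
    define bad1 where "bad1 = (\<lambda>(c :: 'i \<Rightarrow> real) s. {\<omega>\<in>space ?N. T * s < \<bar>\<Sum>a\<in>r. c a * \<omega> a\<bar>})"
    have bm: "bad1 c s \<in> sets ?N" for c s
    proof -
      have "(\<lambda>\<omega>. \<Sum>a\<in>r. c a * \<omega> a) \<in> borel_measurable ?N" by (rule measurable_linear_functional) simp
      then show ?thesis unfolding bad1_def by measurable
    qed
    have b1: "N.prob (bad1 c (L2_set c r)) \<le> 2 * exp (- T\<^sup>2 / 2)" for c
      unfolding bad1_def using r T
      by (intro linear_functional_tail) (auto simp: L2_set_def sum_nonneg)
    define B where "B = {\<omega>\<in>space ?N. \<exists>i\<in>r. T < \<bar>\<omega> i\<bar>}"
    have Bm: "B \<in> sets ?N" and B: "N.prob B \<le> real (card r) * (2 * exp (- T\<^sup>2 / 2))"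
      unfolding B_def using coordinate_tail[OF r, of T] T by auto
    let ?U = "B \<union> (bad1 n (L2_set n r) \<union> (bad1 \<alpha>\<^sub>1 (L2_set \<alpha>\<^sub>1 r) \<union> bad1 \<alpha>\<^sub>2 (L2_set \<alpha>\<^sub>2 r)))"
    have un: "L2_set n r = u" by (simp add: L2_set_def u_def C_eq(1))
    have "(\<integral>\<^sup>+\<omega>. indicator (- E) (\<lambda>i\<in>r. 1 + \<omega> i) \<partial>?N) \<le> (\<integral>\<^sup>+\<omega>. indicator ?U \<omega> \<partial>?N)"
    proof (rule nn_integral_mono)
      fix \<omega> assume \<omega>: "\<omega> \<in> space ?N"
      have "\<omega> \<in> ?U" if "(\<lambda>i\<in>r. 1 + \<omega> i) \<notin> E"
        using that \<omega> by (auto simp: E_def bad1_def B_def un not_le)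
      then show "indicator (- E) (\<lambda>i\<in>r. 1 + \<omega> i) \<le> (indicator ?U \<omega> :: ennreal)"
        by (auto simp: indicator_def)
    qed
    also have "\<dots> = ennreal (N.prob ?U)"
      using bm Bm by (simp add: N.emeasure_eq_measure)
    also have "N.prob ?U \<le> N.prob B + (N.prob (bad1 n (L2_set n r)) + (N.prob (bad1 \<alpha>\<^sub>1 (L2_set \<alpha>\<^sub>1 r)) + N.prob (bad1 \<alpha>\<^sub>2 (L2_set \<alpha>\<^sub>2 r))))"
      using bm Bm by (intro order_trans[OF measure_Un_le] add_left_mono sets.Un) auto
    then have "ennreal (N.prob ?U) \<le> ennreal (2 * (real (card r) + 3) * exp (- T\<^sup>2 / 2))"
      using B b1[of n] b1[of \<alpha>\<^sub>1] b1[of \<alpha>\<^sub>2] by (intro ennreal_leI) (simp add: algebra_simps)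
    finally show ?thesis .
  qed
  have m1: "(\<lambda>\<omega>. f (\<lambda>i\<in>r. 1 + \<omega> i) * indicator E (\<lambda>i\<in>r. 1 + \<omega> i)) \<in> borel_measurable ?N"
    unfolding measurable_PiM_std_normal
    by (rule measurable_compose[OF one_plus, where g = "\<lambda>p. f p * indicator E p"]) measurable
  have m2: "(\<lambda>\<omega>. indicator (- E) (\<lambda>i\<in>r. 1 + \<omega> i) :: ennreal) \<in> borel_measurable ?N"
  proof -
    have "(\<lambda>p. indicator (- E) p :: ennreal) = (\<lambda>p. 1 - indicator E p)"
      by (auto simp: indicator_def)
    then have "(\<lambda>p. indicator (- E) p :: ennreal) \<in> borel_measurable ?R" by simp
    then show ?thesis unfolding measurable_PiM_std_normal
      by (rule measurable_compose[OF one_plus])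
  qed
  have "(\<integral>\<^sup>+\<omega>. f (\<lambda>i\<in>r. 1 + \<omega> i) \<partial>?N) \<le>
    (\<integral>\<^sup>+\<omega>. f (\<lambda>i\<in>r. 1 + \<omega> i) * indicator E (\<lambda>i\<in>r. 1 + \<omega> i) + indicator (- E) (\<lambda>i\<in>r. 1 + \<omega> i) \<partial>?N)"
    using f(2) by (intro nn_integral_mono) (auto simp: indicator_def)
  also have "\<dots> = (\<integral>\<^sup>+\<omega>. f (\<lambda>i\<in>r. 1 + \<omega> i) * indicator E (\<lambda>i\<in>r. 1 + \<omega> i) \<partial>?N) +
    (\<integral>\<^sup>+\<omega>. indicator (- E) (\<lambda>i\<in>r. 1 + \<omega> i) \<partial>?N)"
    by (rule nn_integral_add[OF m1 m2])
  finally have split: "(\<integral>\<^sup>+\<omega>. f (\<lambda>i\<in>r. 1 + \<omega> i) \<partial>?N) \<le>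
    (\<integral>\<^sup>+\<omega>. f (\<lambda>i\<in>r. 1 + \<omega> i) * indicator E (\<lambda>i\<in>r. 1 + \<omega> i) \<partial>?N) +
    (\<integral>\<^sup>+\<omega>. indicator (- E) (\<lambda>i\<in>r. 1 + \<omega> i) \<partial>?N)" .
  have "(\<integral>\<^sup>+\<omega>. f (\<lambda>i\<in>r. 1 + \<omega> i) * indicator E (\<lambda>i\<in>r. 1 + \<omega> i) \<partial>?N) = (\<integral>\<^sup>+p. G p \<partial>?R)"
    unfolding G_def \<phi>_def
    by (rule nn_integral_translated_std_normal[OF r, where f = "\<lambda>p. f p * indicator E p"]) measurable
  also have "\<dots> \<le> (\<integral>\<^sup>+p. G' p \<partial>?R)" by (rule main)
  also have "(\<integral>\<^sup>+p. G' p \<partial>?R) = (\<integral>\<^sup>+\<omega>. ennreal (exp 1) * f' (\<lambda>i\<in>r. 1 + \<omega> i) \<partial>?N)"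
    unfolding G'_def \<phi>_def
    by (rule nn_integral_translated_std_normal[OF r, where f = "\<lambda>p. ennreal (exp 1) * f' p", symmetric]) measurable
  also have "\<dots> = ennreal (exp 1) * (\<integral>\<^sup>+\<omega>. f' (\<lambda>i\<in>r. 1 + \<omega> i) \<partial>?N)"
    by (rule nn_integral_cmult) (unfold measurable_PiM_std_normal, rule measurable_compose[OF one_plus f'])
  finally show ?thesis by (rule order_trans[OF split add_mono[OF _ bad]])
qed

text \<open>The vector with entries \<open>\<Sum>m<d. \<xi> m * z i m\<close> is the solution of
  least norm, found from the normal equations, which the Gram bound makes solvable. Lying in the
  span of the coordinate vectors of \<open>z\<close>, it is orthogonal to everything that
  annihilates \<open>z\<close>.\<close>

lemma row_space_solution:
  fixes z :: "'i \<Rightarrow> nat \<Rightarrow> real"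
  assumes g0: "g > 0"
    and gram: "\<And>v. g * (\<Sum>l<d. (v l)\<^sup>2) \<le> (\<Sum>i\<in>r. (\<Sum>l<d. v l * z i l)\<^sup>2)"
  obtains \<xi> where "\<And>l. l < d \<Longrightarrow> (\<Sum>i\<in>r. (\<Sum>m<d. \<xi> m * z i m) * z i l) = w l"
    and "g * (\<Sum>i\<in>r. (\<Sum>m<d. \<xi> m * z i m)\<^sup>2) \<le> (\<Sum>l<d. (w l)\<^sup>2)"
proof -
  define S where "S = (\<lambda>m l. \<Sum>i\<in>r. z i m * z i l)"
  have q: "quad_form d S v w' = (\<Sum>i\<in>r. (\<Sum>l<d. v l * z i l) * (\<Sum>l<d. w' l * z i l))" for v w'
  proof -
    have "(\<Sum>i\<in>r. (\<Sum>l<d. v l * z i l) * (\<Sum>l<d. w' l * z i l)) = (\<Sum>i\<in>r. \<Sum>m<d. \<Sum>l<d. v m * (z i m * z i l) * w' l)"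
      by (simp add: sum_product algebra_simps)
    also have "\<dots> = (\<Sum>m<d. \<Sum>i\<in>r. \<Sum>l<d. v m * (z i m * z i l) * w' l)" by (rule sum.swap)
    also have "\<dots> = (\<Sum>m<d. \<Sum>l<d. \<Sum>i\<in>r. v m * (z i m * z i l) * w' l)" by (intro sum.cong refl sum.swap)
    also have "\<dots> = quad_form d S v w'"
      by (simp add: quad_form_def S_def sum_distrib_left sum_distrib_right)
    finally show ?thesis ..
  qed
  have pd: "quad_form d S v v > 0" if "\<exists>i<d. v i \<noteq> 0" for v
  proof -
    from that obtain i where i: "i < d" "v i \<noteq> 0" by auto
    have "(\<Sum>i<d. (v i)\<^sup>2) > 0" by (rule sum_pos2[of _ i]) (use i in auto)
    then have "0 < g * (\<Sum>i<d. (v i)\<^sup>2)" using g0 by simp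
    also have "\<dots> \<le> quad_form d S v v" unfolding q using gram[of v] by (simp add: power2_eq_square)
    finally show ?thesis .
  qed
  have "\<exists>\<xi>. \<forall>i<d. (\<Sum>k<d. S i k * \<xi> k) = w i"
    by (rule pos_def_solvable[OF _ pd]) (simp_all add: S_def mult.commute)
  then obtain \<xi> where \<xi>: "\<And>l. l < d \<Longrightarrow> (\<Sum>k<d. S l k * \<xi> k) = w l" by auto
  have 1: "(\<Sum>i\<in>r. (\<Sum>m<d. \<xi> m * z i m) * z i l) = w l" if "l < d" for l
  proof -
    have "(\<Sum>i\<in>r. (\<Sum>m<d. \<xi> m * z i m) * z i l) = (\<Sum>m<d. \<Sum>i\<in>r. (\<xi> m * z i m) * z i l)"
      unfolding sum_distrib_right by (rule sum.swap)
    also have "\<dots> = w l" using \<xi>[OF that] by (simp add: S_def sum_distrib_left sum_distrib_right mult_ac)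
    finally show ?thesis .
  qed
  define a where "a = (\<Sum>i\<in>r. (\<Sum>m<d. \<xi> m * z i m)\<^sup>2)"
  define X where "X = (\<Sum>l<d. (\<xi> l)\<^sup>2)"
  define W where "W = (\<Sum>l<d. (w l)\<^sup>2)"
  have a0: "a \<ge> 0" "W \<ge> 0" unfolding a_def W_def by (simp_all add: sum_nonneg)
  have aw: "a = (\<Sum>l<d. \<xi> l * w l)"
  proof -
    have "a = quad_form d S \<xi> \<xi>" unfolding a_def q by (simp add: power2_eq_square)
    then show ?thesis unfolding quad_form_alt using \<xi> by simp
  qed
  have cs: "a\<^sup>2 \<le> X * W" unfolding aw X_def W_def by (rule Cauchy_Schwarz_ineq_sum)
  have ga: "g * X \<le> a" using gram[of \<xi>] by (simp add: a_def X_def)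
  \<comment> \<open>The Gram bound gives \<open>g * X \<le> a\<close> and Cauchy-Schwarz gives
    \<open>a\<^sup>2 \<le> X * W\<close>; together \<open>g * a\<^sup>2 \<le> a * W\<close>, and
    \<open>a\<close> cancels unless it is 0.\<close>
  have "g * a \<le> W"
  proof (cases "a = 0")
    case False
    have "a * (g * a) = g * a\<^sup>2" by (simp add: power2_eq_square)
    also have "\<dots> \<le> g * (X * W)" using cs g0 by (intro mult_left_mono) auto
    also have "\<dots> = (g * X) * W" by simp
    also have "\<dots> \<le> a * W" using ga a0 by (intro mult_right_mono) auto
    finally show ?thesis using False a0 by (simp add: mult_le_cancel_left)
  qed (use a0 in simp)
  then show ?thesis using that[OF 1] by (simp add: a_def W_def)
qed

lemma L2_set_sum_le: "L2_set (\<lambda>l. \<Sum>i\<in>K. f i l) A \<le> (\<Sum>i\<in>K. L2_set (f i) A)" if "finite K"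
  using that
proof (induction K)
  case (insert i K)
  then show ?case using L2_set_triangle_ineq[of "f i" "\<lambda>l. \<Sum>i\<in>K. f i l" A] by simp
qed (simp add: L2_set_def)

definition mix :: "nat \<Rightarrow> 'i set \<Rightarrow> real \<Rightarrow> (nat \<Rightarrow> real) \<Rightarrow> ('i \<Rightarrow> nat \<Rightarrow> real) \<Rightarrow> ('i \<Rightarrow> real) \<Rightarrow> nat \<Rightarrow> real" where
  "mix d I s m z p = (\<lambda>l\<in>{..<d}. m l + s * (\<Sum>i\<in>I. p i * z i l) / sqrt (\<Sum>i\<in>I. (p i)\<^sup>2))"

lemma measurable_mix[measurable]: "mix d I s m z \<in> PiM I (\<lambda>_. lborel) \<rightarrow>\<^sub>M euclid d"
  unfolding mix_def euclid_def by measurable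

text \<open>The weights in \<open>K\<close>, where the pairs may differ, are kept fixed and
  integrated last; those in \<open>I - K\<close> are shifted until the two outputs agree. The last
  numerical condition bounds the length of that shift times \<open>T\<close>: each pair in
  \<open>K\<close> costs its weight, at most \<open>2 * T\<close>, times \<open>R / sqrt g\<close>,
  and the center costs the norm of all weights, at most \<open>2 * T * sqrt (card I)\<close>, times
  \<open>2 * B / sqrt g\<close>, with the 2 bounding \<open>1 / s\<close>.\<close>

lemma mix_stable:
  fixes z z' :: "'i \<Rightarrow> nat \<Rightarrow> real" and m m' :: "nat \<Rightarrow> real"
  assumes I: "finite I" "K \<subseteq> I"
    and same: "\<And>i l. i \<in> I - K \<Longrightarrow> l < d \<Longrightarrow> z' i l = z i l"
    and g0: "g > 0"
    and gram: "\<And>v. g * (\<Sum>l<d. (v l)\<^sup>2) \<le> (\<Sum>i\<in>I-K. (\<Sum>l<d. v l * z i l)\<^sup>2)"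
    and total: "(\<Sum>l<d. (\<Sum>i\<in>I-K. z i l)\<^sup>2) \<le> g * real (card (I - K)) / 4"
    and zK: "\<And>i. i \<in> K \<Longrightarrow> L2_set (\<lambda>l. z i l - z' i l) {..<d} \<le> R" and R: "R \<ge> 0"
    and mm: "L2_set (\<lambda>l. m l - m' l) {..<d} \<le> B"
    and s: "s \<ge> 1 / 2" and T: "T \<ge> 1" and big: "real (card (I - K)) \<ge> 4000 * T\<^sup>2"
    and \<eta>: "T * (2 * T * real (card K) * R / sqrt g + 2 * T * sqrt (real (card I)) * (2 * B / sqrt g)) \<le> 1 / 100"
    and A[measurable]: "A \<in> sets (euclid d)"
  shows "measure (PiM I (\<lambda>_. std_normal)) {\<omega>\<in>space (PiM I (\<lambda>_. std_normal)). mix d I s m z (\<lambda>i\<in>I. 1 + \<omega> i) \<in> A}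
    \<le> exp 1 * measure (PiM I (\<lambda>_. std_normal)) {\<omega>\<in>space (PiM I (\<lambda>_. std_normal)). mix d I s m' z' (\<lambda>i\<in>I. 1 + \<omega> i) \<in> A}
      + 2 * (real (card I) + 3) * exp (- T\<^sup>2 / 2)"
proof -
  define r where "r = I - K"
  have fin: "finite r" "finite K" "K \<inter> r = {}" "K \<union> r = I" using I by (auto simp: r_def finite_subset)
  have card: "card I = card K + card r" using fin by (metis card_Un_disjoint)
  let ?P = "PiM I (\<lambda>_. std_normal)" and ?PK = "PiM K (\<lambda>_. std_normal)" and ?Pr = "PiM r (\<lambda>_. std_normal)"
  interpret F: product_sigma_finite "\<lambda>_::'i. std_normal"
    by (rule product_sigma_finite_prob_space[OF prob_space_std_normal])
  interpret P: prob_space ?P by (rule prob_space_PiM_std_normal)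
  interpret PK: prob_space ?PK by (rule prob_space_PiM_std_normal)
  interpret Pr: prob_space ?Pr by (rule prob_space_PiM_std_normal)
  have sI: "sets ?P = sets (PiM I (\<lambda>_. lborel))" by (intro sets_PiM_cong) auto
  have sr: "sets ?Pr = sets (PiM r (\<lambda>_. lborel))" by (intro sets_PiM_cong) auto
  have s0: "s > 0" using s by simp

  obtain \<xi>0 where \<xi>0: "\<And>l. l < d \<Longrightarrow> (\<Sum>i\<in>r. (\<Sum>m<d. \<xi>0 m * z i m) * z i l) = (\<Sum>i\<in>r. z i l)"
    "g * (\<Sum>i\<in>r. (\<Sum>m<d. \<xi>0 m * z i m)\<^sup>2) \<le> (\<Sum>l<d. (\<Sum>i\<in>r. z i l)\<^sup>2)"
    using row_space_solution[OF g0 gram, where w = "\<lambda>l. \<Sum>i\<in>I-K. z i l"] unfolding r_def by blast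
  \<comment> \<open>The projection of the all-ones vector to the span of the coordinate vectors of
    \<open>z\<close>; the remainder \<open>n\<close> can be added to the weights without changing
    the weighted sum of \<open>z\<close>.\<close>
  define \<beta> where "\<beta> = (\<lambda>i. \<Sum>m<d. \<xi>0 m * z i m)"
  define n where "n = (\<lambda>i. 1 - \<beta> i)"
  have nz: "(\<Sum>i\<in>r. n i * z i l) = 0" if "l < d" for l
    using \<xi>0(1)[OF that] by (simp add: n_def \<beta>_def left_diff_distrib sum_subtractf)
  have orth: "(\<Sum>i\<in>r. (\<Sum>m<d. \<xi> m * z i m) * n i) = 0" for \<xi>
  proof -
    have "(\<Sum>i\<in>r. (\<Sum>m<d. \<xi> m * z i m) * n i) = (\<Sum>m<d. \<Sum>i\<in>r. \<xi> m * z i m * n i)"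
      unfolding sum_distrib_right by (rule sum.swap)
    also have "\<dots> = (\<Sum>m<d. \<xi> m * (\<Sum>i\<in>r. n i * z i m))"
      by (simp add: sum_distrib_left mult_ac)
    also have "\<dots> = 0" by (simp add: nz)
    finally show ?thesis .
  qed
  define C where "C = (\<Sum>i\<in>r. (n i)\<^sup>2)"
  have C2: "C = (\<Sum>i\<in>r. n i)"
  proof -
    have "C = (\<Sum>i\<in>r. n i - \<beta> i * n i)"
      unfolding C_def by (intro sum.cong refl) (simp add: n_def power2_eq_square algebra_simps)
    then show ?thesis using orth[of \<xi>0] by (simp add: sum_subtractf \<beta>_def)
  qed
  \<comment> \<open>Pythagoras: \<open>C\<close> is \<open>card r\<close> minus the squared length
    of \<open>\<beta>\<close>, and \<open>total\<close> limits the overlap of the all-ones vector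
    with the span.\<close>
  have Ccard: "C \<ge> 3 / 4 * real (card r)"
  proof -
    have "(\<Sum>i\<in>r. n i) + (\<Sum>i\<in>r. \<beta> i * n i) = (\<Sum>i\<in>r. 1 - (\<beta> i)\<^sup>2)"
      unfolding sum.distrib[symmetric] by (intro sum.cong refl) (simp add: n_def power2_eq_square algebra_simps)
    then have "C = real (card r) - (\<Sum>i\<in>r. (\<beta> i)\<^sup>2)"
      using orth[of \<xi>0] by (simp add: C2 \<beta>_def sum_subtractf)
    moreover have "g * (\<Sum>i\<in>r. (\<beta> i)\<^sup>2) \<le> g * (real (card r) / 4)"
      using \<xi>0(2) total by (simp add: \<beta>_def r_def)
    then have "(\<Sum>i\<in>r. (\<beta> i)\<^sup>2) \<le> real (card r) / 4" using g0 by (simp add: mult_le_cancel_left)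
    ultimately show ?thesis by linarith
  qed
  have sqrtC: "sqrt C \<ge> 50 * T"
  proof (rule real_le_rsqrt)
    have "(50 * T)\<^sup>2 = 2500 * T\<^sup>2" by (simp add: power_mult_distrib)
    also have "\<dots> \<le> C" using Ccard big unfolding r_def by linarith
    finally show "(50 * T)\<^sup>2 \<le> C" .
  qed
  obtain \<xi>2 where \<xi>2: "\<And>l. l < d \<Longrightarrow> (\<Sum>i\<in>r. (\<Sum>m<d. \<xi>2 m * z i m) * z i l) = (m l - m' l) / s"
    "g * (\<Sum>i\<in>r. (\<Sum>m<d. \<xi>2 m * z i m)\<^sup>2) \<le> (\<Sum>l<d. ((m l - m' l) / s)\<^sup>2)"
    using row_space_solution[OF g0 gram, where w = "\<lambda>l. (m l - m' l) / s"] unfolding r_def by blast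
  define \<alpha>2 where "\<alpha>2 = (\<lambda>i. \<Sum>m<d. \<xi>2 m * z i m)"
  have L2w: "L2_set (\<lambda>i. \<Sum>m<d. \<xi> m * z i m) r \<le> W / sqrt g"
    if "g * (\<Sum>i\<in>r. (\<Sum>m<d. \<xi> m * z i m)\<^sup>2) \<le> (\<Sum>l<d. (w l)\<^sup>2)" "L2_set w {..<d} \<le> W" for \<xi> w W
  proof -
    have "sqrt g * L2_set (\<lambda>i. \<Sum>m<d. \<xi> m * z i m) r \<le> L2_set w {..<d}"
      unfolding L2_set_def real_sqrt_mult[symmetric] using that(1) by simp
    then show ?thesis using that(2) g0 by (simp add: field_simps)
  qed
  have \<alpha>2: "L2_set \<alpha>2 r \<le> 2 * B / sqrt g"
  proof -
    have "L2_set (\<lambda>l. (m l - m' l) / s) {..<d} = L2_set (\<lambda>l. (1 / s) * (m l - m' l)) {..<d}" by simp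
    also have "\<dots> = (1 / s) * L2_set (\<lambda>l. m l - m' l) {..<d}"
      using s0 by (intro L2_set_right_distrib[symmetric]) auto
    also have "\<dots> \<le> 2 * B"
      using s mm L2_set_nonneg[of "\<lambda>l. m l - m' l" "{..<d}"] by (intro mult_mono) (auto simp: divide_simps)
    finally show ?thesis unfolding \<alpha>2_def by (intro L2w[OF \<xi>2(2)])
  qed
  define F where "F = (\<lambda>p. indicator A (mix d I s m z p) :: ennreal)"
  define F' where "F' = (\<lambda>p. indicator A (mix d I s m' z' p) :: ennreal)"
  have FI[measurable]: "F \<in> borel_measurable (PiM I (\<lambda>_. lborel))" "F' \<in> borel_measurable (PiM I (\<lambda>_. lborel))"
    unfolding F_def F'_def by measurable
  have one_plus: "(\<lambda>\<omega>. \<lambda>i\<in>I. 1 + \<omega> i) \<in> ?P \<rightarrow>\<^sub>M PiM I (\<lambda>_. lborel)"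
    unfolding measurable_cong_sets[OF sI refl] by measurable
  define t where "t = exp (- T\<^sup>2 / 2)"
  have t0: "t \<ge> 0" by (simp add: t_def)
  define bad where "bad = {x\<in>space ?PK. \<exists>i\<in>K. T < \<bar>x i\<bar>}"
  have bad_m: "bad \<in> sets ?PK" and bad: "PK.prob bad \<le> real (card K) * (2 * t)"
    unfolding bad_def t_def using coordinate_tail[OF fin(2), of T] T by auto

  \<comment> \<open>The arguments are not symmetric: \<open>x\<close> holds centered normal values
    for \<open>K\<close>, while \<open>y\<close> holds weights that already include the mean
    1.\<close>
  define join where "join = (\<lambda>x (y :: 'i \<Rightarrow> real). \<lambda>i\<in>I. if i \<in> K then 1 + x i else y i :: real)"
  have merge_join: "(\<lambda>i\<in>I. 1 + merge K r (x, y) i) = join x (\<lambda>i\<in>r. 1 + y i)" for x y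
    using fin by (auto simp: join_def fun_eq_iff merge_def r_def)
  have join_m: "join x \<in> PiM r (\<lambda>_. lborel) \<rightarrow>\<^sub>M PiM I (\<lambda>_. lborel)" for x
    unfolding join_def
  proof (rule measurable_restrict)
    fix i assume "i \<in> I"
    then show "(\<lambda>y. if i \<in> K then 1 + x i else y i) \<in> PiM r (\<lambda>_. lborel) \<rightarrow>\<^sub>M lborel"
      by (cases "i \<in> K") (auto simp: r_def)
  qed
  \<comment> \<open>If some weight in \<open>K\<close> is atypical, the left side is bounded by 1
    and charged to \<open>bad\<close>; otherwise \<open>weight_shift\<close> applies with
    \<open>x\<close> fixed.\<close>
  have inner: "(\<integral>\<^sup>+y. F (join x (\<lambda>i\<in>r. 1 + y i)) \<partial>?Pr) \<le>
     ennreal (exp 1) * (\<integral>\<^sup>+y. F' (join x (\<lambda>i\<in>r. 1 + y i)) \<partial>?Pr) + ennreal (2 * (real (card r) + 3) * t) + indicator bad x"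
    if x: "x \<in> space ?PK" for x
  proof (cases "x \<in> bad")
    case True
    have "(\<integral>\<^sup>+y. F (join x (\<lambda>i\<in>r. 1 + y i)) \<partial>?Pr) \<le> (\<integral>\<^sup>+y. 1 \<partial>?Pr)"
      by (intro nn_integral_mono) (simp add: F_def indicator_def)
    also have "\<dots> \<le> indicator bad x" using True Pr.emeasure_space_1 by simp
    finally show ?thesis by (rule order_trans) simp
  next
    case False
    then have xb: "\<bar>1 + x i\<bar> \<le> 2 * T" if "i \<in> K" for i
      using x that T by (fastforce simp: bad_def)
    \<comment> \<open>The change that the pairs in \<open>K\<close> cause in the weighted sum at
      fixed weights; \<open>\<alpha>1\<close> has to supply it.\<close>
    define w where "w = (\<lambda>l. \<Sum>i\<in>K. (1 + x i) * (z i l - z' i l))"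
    obtain \<xi>1 where \<xi>1: "\<And>l. l < d \<Longrightarrow> (\<Sum>i\<in>r. (\<Sum>m<d. \<xi>1 m * z i m) * z i l) = w l"
      "g * (\<Sum>i\<in>r. (\<Sum>m<d. \<xi>1 m * z i m)\<^sup>2) \<le> (\<Sum>l<d. (w l)\<^sup>2)"
      using row_space_solution[OF g0 gram, where w = w] unfolding r_def by blast
    define \<alpha>1 where "\<alpha>1 = (\<lambda>i. \<Sum>m<d. \<xi>1 m * z i m)"
    have wb: "L2_set w {..<d} \<le> 2 * T * real (card K) * R"
    proof -
      have "L2_set w {..<d} \<le> (\<Sum>i\<in>K. L2_set (\<lambda>l. (1 + x i) * (z i l - z' i l)) {..<d})"
        unfolding w_def by (rule L2_set_sum_le[OF fin(2)])
      also have "\<dots> \<le> (\<Sum>i\<in>K. 2 * T * R)"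
      proof (rule sum_mono)
        fix i assume i: "i \<in> K"
        have "L2_set (\<lambda>l. (1 + x i) * (z i l - z' i l)) {..<d} = L2_set (\<lambda>l. \<bar>1 + x i\<bar> * (z i l - z' i l)) {..<d}"
          by (simp add: L2_set_def power_mult_distrib)
        also have "\<dots> = \<bar>1 + x i\<bar> * L2_set (\<lambda>l. z i l - z' i l) {..<d}"
          by (simp add: L2_set_right_distrib)
        also have "\<dots> \<le> 2 * T * R" using xb[OF i] zK[OF i] T by (intro mult_mono) (auto intro: L2_set_nonneg)
        finally show "L2_set (\<lambda>l. (1 + x i) * (z i l - z' i l)) {..<d} \<le> 2 * T * R" .
      qed
      finally show ?thesis by (simp add: mult_ac)
    qed
    have \<alpha>1: "L2_set \<alpha>1 r \<le> 2 * T * real (card K) * R / sqrt g"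
      unfolding \<alpha>1_def by (rule L2w[OF \<xi>1(2) wb])
    define q0 where "q0 = (\<Sum>i\<in>K. (1 + x i)\<^sup>2)"
    have q0: "0 \<le> q0" "4 * T\<^sup>2 * real (card r) + q0 \<le> (2 * T * sqrt (real (card I)))\<^sup>2"
    proof -
      show "0 \<le> q0" unfolding q0_def by (intro sum_nonneg) auto
      have "q0 \<le> real (card K) * (4 * T\<^sup>2)" unfolding q0_def
      proof (rule sum_bounded_above)
        fix i assume "i \<in> K"
        then have "\<bar>1 + x i\<bar>\<^sup>2 \<le> (2 * T)\<^sup>2" by (intro power_mono xb) auto
        then show "(1 + x i)\<^sup>2 \<le> 4 * T\<^sup>2" by (simp add: power_mult_distrib)
      qed
      then show "4 * T\<^sup>2 * real (card r) + q0 \<le> (2 * T * sqrt (real (card I)))\<^sup>2"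
        by (simp add: power_mult_distrib card algebra_simps)
    qed
    show ?thesis
    proof -
      have "(\<integral>\<^sup>+y. F (join x (\<lambda>i\<in>r. 1 + y i)) \<partial>?Pr) \<le>
        ennreal (exp 1) * (\<integral>\<^sup>+y. F' (join x (\<lambda>i\<in>r. 1 + y i)) \<partial>?Pr) + ennreal (2 * (real (card r) + 3) * exp (- T\<^sup>2 / 2))"
      proof (rule weight_shift[where f = "\<lambda>p. F (join x p)" and f' = "\<lambda>p. F' (join x p)" and n = n and
            \<alpha>\<^sub>1 = \<alpha>1 and \<alpha>\<^sub>2 = \<alpha>2 and ?q0.0 = q0 and \<rho> = "2 * T * sqrt (real (card I))", OF fin(1) _ _ _ C_def C2 _ _ T _ sqrtC q0 _ refl])
        show "(\<lambda>p. F (join x p)) \<in> borel_measurable (PiM r (\<lambda>_. lborel))"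
          by (rule measurable_compose[OF join_m FI(1)])
        show "(\<lambda>p. F' (join x p)) \<in> borel_measurable (PiM r (\<lambda>_. lborel))"
          by (rule measurable_compose[OF join_m FI(2)])
        show "F (join x p) \<le> 1" for p by (simp add: F_def indicator_def)
        show "(\<Sum>i\<in>r. \<alpha>1 i * n i) = 0" "(\<Sum>i\<in>r. \<alpha>2 i * n i) = 0" by (simp_all add: \<alpha>1_def \<alpha>2_def orth)
        show "real (card r) \<le> 4 * C" using Ccard by linarith
        show "0 \<le> 2 * T * sqrt (real (card I))" using T by simp
        have "L2_set \<alpha>1 r + 2 * T * sqrt (real (card I)) * L2_set \<alpha>2 r \<le>
          2 * T * real (card K) * R / sqrt g + 2 * T * sqrt (real (card I)) * (2 * B / sqrt g)"
          using \<alpha>1 \<alpha>2 T by (intro add_mono mult_left_mono) auto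
        then show "T * (L2_set \<alpha>1 r + 2 * T * sqrt (real (card I)) * L2_set \<alpha>2 r) \<le> 1 / 100"
          using T by (intro order_trans[OF mult_left_mono \<eta>]) auto
        fix p p' \<tau>
        assume p': "\<And>i. i \<in> r \<Longrightarrow> p' i = p i + \<alpha>1 i + sqrt ((\<Sum>i\<in>r. (p i)\<^sup>2) + q0) * \<alpha>2 i + \<tau> * n i"
          and nrm: "(\<Sum>i\<in>r. (p' i)\<^sup>2) = (\<Sum>i\<in>r. (p i)\<^sup>2)" and ppos: "(\<Sum>i\<in>r. (p i)\<^sup>2) > 0"
        define \<rho> where "\<rho> = sqrt ((\<Sum>i\<in>r. (p i)\<^sup>2) + q0)"
        have sumI: "(\<Sum>i\<in>I. h i (join x y i)) = (\<Sum>i\<in>K. h i (1 + x i)) + (\<Sum>i\<in>r. h i (y i))" for h :: "'i \<Rightarrow> real \<Rightarrow> real" and y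
        proof -
          have "(\<Sum>i\<in>I. h i (join x y i)) = (\<Sum>i\<in>K. h i (join x y i)) + (\<Sum>i\<in>r. h i (join x y i))"
            using fin by (metis sum.union_disjoint)
          also have "\<dots> = (\<Sum>i\<in>K. h i (1 + x i)) + (\<Sum>i\<in>r. h i (y i))"
            using I by (intro arg_cong2[where f = "(+)"] sum.cong) (auto simp: join_def r_def)
          finally show ?thesis .
        qed
        have nI: "sqrt (\<Sum>i\<in>I. (join x p i)\<^sup>2) = \<rho>" "sqrt (\<Sum>i\<in>I. (join x p' i)\<^sup>2) = \<rho>"
          using sumI[of "\<lambda>_ v. v\<^sup>2"] by (simp_all add: \<rho>_def q0_def nrm add.commute)
        have "mix d I s m z (join x p) l = mix d I s m' z' (join x p') l" for l
        proof (cases "l < d")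
          case l: True
          have "(\<Sum>i\<in>r. p' i * z i l) = (\<Sum>i\<in>r. p i * z i l + \<alpha>1 i * z i l + \<rho> * (\<alpha>2 i * z i l) + \<tau> * (n i * z i l))"
            by (intro sum.cong refl) (simp add: p' \<rho>_def algebra_simps)
          also have "\<dots> = (\<Sum>i\<in>r. p i * z i l) + w l + \<rho> * ((m l - m' l) / s)"
            using \<xi>1(1)[OF l] \<xi>2(1)[OF l] nz[OF l]
            by (simp add: sum.distrib sum_distrib_left[symmetric] \<alpha>1_def \<alpha>2_def)
          finally have r1: "(\<Sum>i\<in>r. p' i * z i l) = (\<Sum>i\<in>r. p i * z i l) + w l + \<rho> * ((m l - m' l) / s)" .
          have "(\<Sum>i\<in>I. join x p' i * z' i l) = (\<Sum>i\<in>K. (1 + x i) * z' i l) + (\<Sum>i\<in>r. p' i * z i l)"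
            unfolding sumI[of "\<lambda>i v. v * z' i l"] using same l by (simp add: r_def)
          also have "\<dots> = (\<Sum>i\<in>I. join x p i * z i l) + \<rho> * ((m l - m' l) / s)"
            unfolding sumI[of "\<lambda>i v. v * z i l"] r1 w_def by (simp add: algebra_simps sum_subtractf)
          finally have tot: "(\<Sum>i\<in>I. join x p' i * z' i l) = (\<Sum>i\<in>I. join x p i * z i l) + \<rho> * ((m l - m' l) / s)" .
          have \<rho>0: "\<rho> > 0" unfolding \<rho>_def using ppos q0(1) by simp
          have "m' l + s * (\<Sum>i\<in>I. join x p' i * z' i l) / \<rho> = m l + s * (\<Sum>i\<in>I. join x p i * z i l) / \<rho>"
            unfolding tot using s0 \<rho>0 by (simp add: field_simps)
          then show ?thesis using l by (simp add: mix_def nI)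
        qed (simp add: mix_def)
        then show "F (join x p) = F' (join x p')" unfolding F_def F'_def by presburger
      qed
      then show ?thesis using False by (simp add: t_def)
    qed
  qed
  have Fm: "(\<lambda>\<omega>. F (\<lambda>i\<in>I. 1 + \<omega> i)) \<in> borel_measurable (PiM (K \<union> r) (\<lambda>_. std_normal))"
    "(\<lambda>\<omega>. F' (\<lambda>i\<in>I. 1 + \<omega> i)) \<in> borel_measurable (PiM (K \<union> r) (\<lambda>_. std_normal))"
    unfolding fin(4) by (rule measurable_compose[OF one_plus FI(1)]) (rule measurable_compose[OF one_plus FI(2)])
  have fold: "(\<integral>\<^sup>+\<omega>. H (\<lambda>i\<in>I. 1 + \<omega> i) \<partial>?P) = (\<integral>\<^sup>+x. \<integral>\<^sup>+y. H (join x (\<lambda>i\<in>r. 1 + y i)) \<partial>?Pr \<partial>?PK)"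
    "(\<lambda>x. \<integral>\<^sup>+y. H (join x (\<lambda>i\<in>r. 1 + y i)) \<partial>?Pr) \<in> borel_measurable ?PK"
    if H: "(\<lambda>\<omega>. H (\<lambda>i\<in>I. 1 + \<omega> i)) \<in> borel_measurable (PiM (K \<union> r) (\<lambda>_. std_normal))" for H :: "_ \<Rightarrow> ennreal"
  proof -
    show "(\<integral>\<^sup>+\<omega>. H (\<lambda>i\<in>I. 1 + \<omega> i) \<partial>?P) = (\<integral>\<^sup>+x. \<integral>\<^sup>+y. H (join x (\<lambda>i\<in>r. 1 + y i)) \<partial>?Pr \<partial>?PK)"
      using F.product_nn_integral_fold[OF fin(3,2,1) H] unfolding fin(4) merge_join .
    have "(\<lambda>(x, y). H (\<lambda>i\<in>I. 1 + merge K r (x, y) i)) \<in> borel_measurable (?PK \<Otimes>\<^sub>M ?Pr)"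
      using measurable_compose[OF measurable_merge H] by (simp add: case_prod_beta)
    then have "(\<lambda>x. \<integral>\<^sup>+y. H (\<lambda>i\<in>I. 1 + merge K r (x, y) i) \<partial>?Pr) \<in> borel_measurable ?PK"
      by (rule Pr.borel_measurable_nn_integral)
    then show "(\<lambda>x. \<integral>\<^sup>+y. H (join x (\<lambda>i\<in>r. 1 + y i)) \<partial>?Pr) \<in> borel_measurable ?PK"
      unfolding merge_join .
  qed
  have em: "emeasure ?P {\<omega>\<in>space ?P. mix d I s m z (\<lambda>i\<in>I. 1 + \<omega> i) \<in> A} = (\<integral>\<^sup>+\<omega>. F (\<lambda>i\<in>I. 1 + \<omega> i) \<partial>?P)"
    if F: "F = (\<lambda>p. indicator A (mix d I s m z p))" for F and m z
  proof -
    have meas: "(\<lambda>\<omega>. mix d I s m z (\<lambda>i\<in>I. 1 + \<omega> i)) \<in> ?P \<rightarrow>\<^sub>M euclid d"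
      by (rule measurable_compose[OF one_plus measurable_mix])
    let ?S = "{\<omega>\<in>space ?P. mix d I s m z (\<lambda>i\<in>I. 1 + \<omega> i) \<in> A}"
    have "?S \<in> sets ?P"
      using measurable_sets[OF meas A] by (simp add: vimage_def Int_def conj_commute)
    then have "emeasure ?P ?S = (\<integral>\<^sup>+\<omega>. indicator ?S \<omega> \<partial>?P)" by simp
    also have "\<dots> = (\<integral>\<^sup>+\<omega>. F (\<lambda>i\<in>I. 1 + \<omega> i) \<partial>?P)"
      unfolding F by (intro nn_integral_cong) (simp add: indicator_def)
    finally show ?thesis .
  qed
  have "(\<integral>\<^sup>+\<omega>. F (\<lambda>i\<in>I. 1 + \<omega> i) \<partial>?P) \<le> (\<integral>\<^sup>+x. (ennreal (exp 1) * (\<integral>\<^sup>+y. F' (join x (\<lambda>i\<in>r. 1 + y i)) \<partial>?Pr) +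
      ennreal (2 * (real (card r) + 3) * t)) + indicator bad x \<partial>?PK)"
    unfolding fold(1)[OF Fm(1)] by (intro nn_integral_mono inner)
  also have "\<dots> = ennreal (exp 1) * (\<integral>\<^sup>+\<omega>. F' (\<lambda>i\<in>I. 1 + \<omega> i) \<partial>?P) + ennreal (2 * (real (card r) + 3) * t) + emeasure ?PK bad"
    using bad_m fold(2)[OF Fm(2)]
    by (simp add: nn_integral_add nn_integral_cmult fold(1)[OF Fm(2)] PK.emeasure_space_1)
  also have "\<dots> \<le> ennreal (exp 1) * (\<integral>\<^sup>+\<omega>. F' (\<lambda>i\<in>I. 1 + \<omega> i) \<partial>?P) + ennreal (2 * (real (card r) + 3) * t) +
      ennreal (real (card K) * (2 * t))"
    unfolding PK.emeasure_eq_measure by (intro add_left_mono ennreal_leI bad)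
  finally have "ennreal (P.prob {\<omega>\<in>space ?P. mix d I s m z (\<lambda>i\<in>I. 1 + \<omega> i) \<in> A}) \<le>
     ennreal (exp 1) * ennreal (P.prob {\<omega>\<in>space ?P. mix d I s m' z' (\<lambda>i\<in>I. 1 + \<omega> i) \<in> A}) +
     ennreal (2 * (real (card r) + 3) * t) + ennreal (real (card K) * (2 * t))"
    unfolding em[OF F_def, symmetric] em[OF F'_def, symmetric] P.emeasure_eq_measure by simp
  also have "\<dots> = ennreal (exp 1 * P.prob {\<omega>\<in>space ?P. mix d I s m' z' (\<lambda>i\<in>I. 1 + \<omega> i) \<in> A} +
     2 * (real (card r) + 3) * t + real (card K) * (2 * t))"
    using t0 by (simp add: ennreal_mult[symmetric] ennreal_plus[symmetric] del: ennreal_plus)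
  finally have "P.prob {\<omega>\<in>space ?P. mix d I s m z (\<lambda>i\<in>I. 1 + \<omega> i) \<in> A} \<le>
    exp 1 * P.prob {\<omega>\<in>space ?P. mix d I s m' z' (\<lambda>i\<in>I. 1 + \<omega> i) \<in> A} + 2 * (real (card r) + 3) * t + real (card K) * (2 * t)"
    using t0 by (subst (asm) ennreal_le_iff) auto
  moreover have "2 * (real (card I) + 3) * exp (- T\<^sup>2 / 2) = 2 * (real (card r) + 3) * t + real (card K) * (2 * t)"
    unfolding t_def card by (simp add: algebra_simps)
  ultimately show ?thesis by linarith
qed

section \<open>Finite mixtures of kernels\<close>

text \<open>Serves twice: for the random decision between the weighted sum and a constant, whose
  probabilities depend on the data, and for the uniform choice of a subsample.\<close>

lemma kernel_mixture:
  fixes c :: "'f \<Rightarrow> 'a \<Rightarrow> real" and A :: "'f \<Rightarrow> 'a \<Rightarrow> 'b measure"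
  assumes F: "finite F" and c[measurable]: "\<And>f. f \<in> F \<Longrightarrow> c f \<in> borel_measurable M"
    and c0: "\<And>f x. f \<in> F \<Longrightarrow> x \<in> space M \<Longrightarrow> c f x \<ge> 0"
    and c1: "\<And>x. x \<in> space M \<Longrightarrow> (\<Sum>f\<in>F. c f x) = 1"
    and A[measurable]: "\<And>f. f \<in> F \<Longrightarrow> A f \<in> M \<rightarrow>\<^sub>M prob_algebra N"
  obtains K where "K \<in> M \<rightarrow>\<^sub>M prob_algebra N"
    and "\<And>x S. x \<in> space M \<Longrightarrow> S \<in> sets N \<Longrightarrow> measure (K x) S = (\<Sum>f\<in>F. c f x * measure (A f x) S)"
proof -
  define K where "K = (\<lambda>x. point_measure F (\<lambda>f. ennreal (c f x)) \<bind> (\<lambda>f. A f x))"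
  have Ap: "prob_space (A f x)" "sets (A f x) = sets N" if "f \<in> F" "x \<in> space M" for f x
    using measurable_space[OF A[OF that(1)] that(2)] by (auto simp: space_prob_algebra)
  have km: "(\<lambda>f. A f x) \<in> point_measure F (\<lambda>f. ennreal (c f x)) \<rightarrow>\<^sub>M subprob_algebra N" if x: "x \<in> space M" for x
  proof -
    have "A f x \<in> space (subprob_algebra N)" if "f \<in> F" for f
      using Ap[OF that x] by (auto simp: space_subprob_algebra intro: prob_space_imp_subprob_space)
    then show ?thesis by (simp add: measurable_point_measure_eq1 Pi_iff)
  qed
  have ne: "F \<noteq> {}" if "x \<in> space M" for x using c1[OF that] by auto
  have em: "emeasure (K x) S = (\<Sum>f\<in>F. ennreal (c f x) * emeasure (A f x) S)" if x: "x \<in> space M" and S: "S \<in> sets N" for x S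
    unfolding K_def using ne[OF x] F
    by (subst emeasure_bind[OF _ km[OF x] S]) (auto simp: space_point_measure nn_integral_point_measure_finite)
  have sK: "sets (K x) = sets N" if x: "x \<in> space M" for x
    unfolding K_def by (rule sets_bind) (use Ap(2) ne x in \<open>auto simp: space_point_measure\<close>)
  have pK: "prob_space (K x)" if x: "x \<in> space M" for x
  proof (rule prob_spaceI)
    have "emeasure (K x) (space (K x)) = emeasure (K x) (space N)"
      using sets_eq_imp_space_eq[OF sK[OF x]] by simp
    also have "\<dots> = (\<Sum>f\<in>F. ennreal (c f x))"
      unfolding em[OF x sets.top]
    proof (rule sum.cong[OF refl])
      fix f assume "f \<in> F"
      then show "ennreal (c f x) * emeasure (A f x) (space N) = ennreal (c f x)"
        using Ap[of f x] x prob_space.emeasure_space_1[of "A f x"] sets_eq_imp_space_eq[of "A f x" N] by simp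
    qed
    also have "\<dots> = 1" using c1[OF x] c0[OF _ x] by (simp add: sum_ennreal)
    finally show "emeasure (K x) (space (K x)) = 1" .
  qed
  have "K \<in> M \<rightarrow>\<^sub>M prob_algebra N"
  proof (rule measurable_prob_algebraI[OF pK measurable_subprob_algebra])
    fix S assume S[measurable]: "S \<in> sets N"
    have "(\<lambda>x. \<Sum>f\<in>F. ennreal (c f x) * emeasure (A f x) S) \<in> borel_measurable M"
    proof (intro borel_measurable_sum borel_measurable_times_ennreal)
      fix f assume f: "f \<in> F"
      show "(\<lambda>x. ennreal (c f x)) \<in> borel_measurable M" using c[OF f] by measurable
      show "(\<lambda>x. emeasure (A f x) S) \<in> borel_measurable M"
        by (rule measurable_compose[OF measurable_prob_algebraD[OF A[OF f]] measurable_emeasure_subprob_algebra[OF S]])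
    qed
    then show "(\<lambda>x. emeasure (K x) S) \<in> borel_measurable M"
      by (rule measurable_cong[THEN iffD2, rotated]) (rule em[OF _ S])
  qed (auto simp: sK intro: pK prob_space_imp_subprob_space)
  moreover have "measure (K x) S = (\<Sum>f\<in>F. c f x * measure (A f x) S)" if x: "x \<in> space M" and S: "S \<in> sets N" for x S
  proof -
    have "ennreal (c f x) * emeasure (A f x) S = ennreal (c f x * measure (A f x) S)" if f: "f \<in> F" for f
    proof -
      interpret prob_space "A f x" using Ap(1)[OF f x] .
      show ?thesis using c0[OF f x] by (simp add: emeasure_eq_measure ennreal_mult)
    qed
    then have "emeasure (K x) S = (\<Sum>f\<in>F. ennreal (c f x * measure (A f x) S))"
      unfolding em[OF x S] by (intro sum.cong) auto
    also have "\<dots> = ennreal (\<Sum>f\<in>F. c f x * measure (A f x) S)"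
      using c0[OF _ x] by (intro sum_ennreal) auto
    finally show ?thesis
      using c0[OF _ x] by (simp add: measure_def sum_nonneg)
  qed
  ultimately show ?thesis by (rule that)
qed

section \<open>Good subsets of a dataset\<close>

text \<open>The divisor \<open>sqrt 2\<close> gives the difference of two independent samples the
  covariance of a single sample.\<close>

definition half_diff :: "nat \<Rightarrow> (nat \<Rightarrow> nat \<Rightarrow> real) \<Rightarrow> nat \<Rightarrow> nat \<Rightarrow> real" where
  "half_diff k X i l = (X i l - X (k + i) l) / sqrt 2"

definition center :: "nat \<Rightarrow> nat set \<Rightarrow> (nat \<Rightarrow> nat \<Rightarrow> real) \<Rightarrow> nat \<Rightarrow> real" where
  "center k J X l = (\<Sum>i\<in>J. X i l + X (k + i) l) / (2 * real (card J))"

definition points :: "nat \<Rightarrow> nat set \<Rightarrow> nat set" where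
  "points k J = J \<union> (+) k ` J"

text \<open>Integer directions that stand in for all directions, so that the Gram condition is a
  finite conjunction: this gives measurability and permits a union bound.\<close>

definition grid :: "nat \<Rightarrow> nat \<Rightarrow> (nat \<Rightarrow> real) set" where
  "grid d N = ({..<d} \<rightarrow>\<^sub>E real_of_int ` {- int N..int N})"

lemma finite_grid: "finite (grid d N)"
  unfolding grid_def by (intro finite_PiE) auto

lemma card_grid: "card (grid d N) = (2 * N + 1) ^ d"
proof -
  have "card (real_of_int ` {- int N..int N}) = 2 * N + 1"
    by (subst card_image) (auto simp: inj_on_def)
  then show ?thesis unfolding grid_def by (simp add: card_PiE)
qed

text \<open>Scale \<open>v\<close> until its largest entry is \<open>N\<close> in absolute value and
  round down, which moves each entry by at most 1. Passing between \<open>w\<close> and the grid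
  point \<open>u\<close> twice by \<open>(a + b)\<^sup>2 \<le> 2 * a\<^sup>2 + 2 * b\<^sup>2\<close>
  loses a factor 4; the rounding errors are at most half of the left side by the choice of
  \<open>N\<close>. Together this is the factor 8.\<close>

lemma gram_bound_from_grid:
  fixes z :: "'i \<Rightarrow> nat \<Rightarrow> real"
  assumes J: "finite J" and g0: "g > 0"
    and grid: "\<And>v. v \<in> grid d N \<Longrightarrow> g * (\<Sum>l<d. (v l)\<^sup>2) \<le> (\<Sum>i\<in>J. (\<Sum>l<d. v l * z i l)\<^sup>2)"
    and z: "\<And>i. i \<in> J \<Longrightarrow> (\<Sum>l<d. (z i l)\<^sup>2) \<le> Q"
    and N: "real d * (g / 2 + real (card J) * Q) \<le> g * (real N)\<^sup>2 / 8"
  shows "g / 8 * (\<Sum>l<d. (v l)\<^sup>2) \<le> (\<Sum>i\<in>J. (\<Sum>l<d. v l * z i l)\<^sup>2)"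
proof (cases "\<exists>l<d. v l \<noteq> 0")
  case False
  then show ?thesis by (simp add: sum_nonneg)
next
  case True
  define M where "M = Max ((\<lambda>l. \<bar>v l\<bar>) ` {..<d})"
  from True obtain l0 where l0: "l0 < d" "v l0 \<noteq> 0" by auto
  have Mb: "\<bar>v l\<bar> \<le> M" if "l < d" for l unfolding M_def using that by (intro Max_ge) auto
  have M0: "M > 0" using Mb[OF l0(1)] l0(2) by linarith
  have "M \<in> (\<lambda>l. \<bar>v l\<bar>) ` {..<d}" unfolding M_def using l0 by (intro Max_in) auto
  then obtain l1 where l1: "l1 < d" "\<bar>v l1\<bar> = M" by auto
  have N0: "N > 0"
  proof (rule ccontr)
    assume "\<not> N > 0"
    then have "real d * (g / 2 + real (card J) * Q) \<le> 0" using N by simp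
    moreover have "real (card J) * Q \<ge> 0"
    proof (cases "J = {}")
      case False
      then obtain i where i: "i \<in> J" by auto
      have "0 \<le> (\<Sum>l<d. (z i l)\<^sup>2)" by (simp add: sum_nonneg)
      then show ?thesis using z[OF i] by simp
    qed simp
    then have "real d * (g / 2 + real (card J) * Q) > 0" using l0 g0 by (intro mult_pos_pos) auto
    ultimately show False by simp
  qed
  define c where "c = real N / M"
  have c0: "c > 0" using N0 M0 by (simp add: c_def)
  define w where "w = (\<lambda>l. c * v l)"
  define u where "u = (\<lambda>l\<in>{..<d}. real_of_int \<lfloor>w l\<rfloor>)"
  define h where "h = (\<lambda>l. w l - u l)"
  have wb: "\<bar>w l\<bar> \<le> real N" if "l < d" for l
  proof -
    have "\<bar>w l\<bar> = c * \<bar>v l\<bar>" using c0 by (simp add: w_def abs_mult)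
    also have "\<dots> \<le> c * M" using c0 Mb[OF that] by (intro mult_left_mono) auto
    finally show ?thesis using M0 by (simp add: c_def)
  qed
  have ug: "u \<in> grid d N"
    unfolding grid_def
  proof (rule PiE_I)
    fix l assume "l \<in> {..<d}"
    then have "- real N \<le> w l" "w l \<le> real N" using wb[of l] by auto
    then have "- int N \<le> \<lfloor>w l\<rfloor>" "\<lfloor>w l\<rfloor> \<le> int N" by linarith+
    then show "u l \<in> real_of_int ` {- int N..int N}" using \<open>l \<in> {..<d}\<close> by (auto simp: u_def)
  qed (simp add: u_def)
  have hb: "(h l)\<^sup>2 \<le> 1" if "l < d" for l
  proof -
    have "\<bar>h l\<bar> \<le> 1" using that by (simp add: h_def u_def) linarith
    then show ?thesis by (simp add: abs_square_le_1)
  qed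
  have hs: "(\<Sum>l<d. (h l)\<^sup>2) \<le> real d"
    using sum_bounded_above[of "{..<d}" "\<lambda>l. (h l)\<^sup>2" 1] hb by auto
  have two: "(a + b)\<^sup>2 \<le> 2 * a\<^sup>2 + 2 * b\<^sup>2" for a b :: real
    using zero_le_power2[of "a - b"] by (simp add: power2_eq_square algebra_simps)
  have hz: "(\<Sum>l<d. h l * z i l)\<^sup>2 \<le> real d * Q" if i: "i \<in> J" for i
  proof -
    have "(\<Sum>l<d. h l * z i l)\<^sup>2 \<le> (\<Sum>l<d. (h l)\<^sup>2) * (\<Sum>l<d. (z i l)\<^sup>2)" by (rule Cauchy_Schwarz_ineq_sum)
    also have "\<dots> \<le> real d * Q" using hs z[OF i] by (intro mult_mono) (auto simp: sum_nonneg)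
    finally show ?thesis .
  qed
  have "g * (\<Sum>l<d. (u l)\<^sup>2) \<le> (\<Sum>i\<in>J. (\<Sum>l<d. u l * z i l)\<^sup>2)" by (rule grid[OF ug])
  also have "\<dots> \<le> (\<Sum>i\<in>J. 2 * (\<Sum>l<d. w l * z i l)\<^sup>2 + 2 * (real d * Q))"
  proof (rule sum_mono)
    fix i assume i: "i \<in> J"
    have "(\<Sum>l<d. u l * z i l) = (\<Sum>l<d. w l * z i l) + - (\<Sum>l<d. h l * z i l)"
      by (simp add: h_def algebra_simps sum_subtractf)
    then have "(\<Sum>l<d. u l * z i l)\<^sup>2 \<le> 2 * (\<Sum>l<d. w l * z i l)\<^sup>2 + 2 * (- (\<Sum>l<d. h l * z i l))\<^sup>2"
      using two by presburger
    then show "(\<Sum>l<d. u l * z i l)\<^sup>2 \<le> 2 * (\<Sum>l<d. w l * z i l)\<^sup>2 + 2 * (real d * Q)"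
      using hz[OF i] by simp
  qed
  finally have 1: "g * (\<Sum>l<d. (u l)\<^sup>2) \<le> 2 * (\<Sum>i\<in>J. (\<Sum>l<d. w l * z i l)\<^sup>2) + 2 * real d * (real (card J) * Q)"
    by (simp add: sum.distrib sum_distrib_left algebra_simps)
  have "(\<Sum>l<d. (w l)\<^sup>2) \<le> (\<Sum>l<d. 2 * (u l)\<^sup>2 + 2 * (h l)\<^sup>2)"
  proof (rule sum_mono)
    fix l
    have "w l = u l + h l" by (simp add: h_def)
    then show "(w l)\<^sup>2 \<le> 2 * (u l)\<^sup>2 + 2 * (h l)\<^sup>2" using two by presburger
  qed
  then have 2: "(\<Sum>l<d. (w l)\<^sup>2) \<le> 2 * (\<Sum>l<d. (u l)\<^sup>2) + 2 * real d"
    using hs by (simp add: sum.distrib sum_distrib_left[symmetric])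
  have 3: "(\<Sum>l<d. (w l)\<^sup>2) \<ge> (real N)\<^sup>2"
  proof -
    have "\<bar>w l1\<bar> = real N" using l1 c0 M0 by (simp add: w_def abs_mult c_def)
    then have "(w l1)\<^sup>2 = (real N)\<^sup>2" by (metis power2_abs)
    then show ?thesis using member_le_sum[of l1 "{..<d}" "\<lambda>l. (w l)\<^sup>2"] l1 by auto
  qed
  define Wn where "Wn = (\<Sum>l<d. (w l)\<^sup>2)"
  define Uq where "Uq = (\<Sum>l<d. (u l)\<^sup>2)"
  define Y where "Y = (\<Sum>i\<in>J. (\<Sum>l<d. w l * z i l)\<^sup>2)"
  define q where "q = real d * (real (card J) * Q)"
  have "g * Wn \<le> 2 * (g * Uq) + 2 * (g * real d)"
    using mult_left_mono[OF 2, of g] g0 unfolding Wn_def Uq_def by (simp add: algebra_simps)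
  moreover have "g * Uq \<le> 2 * Y + 2 * q" using 1 unfolding Uq_def Y_def q_def by simp
  moreover have "g * real d / 2 + q \<le> g * (real N)\<^sup>2 / 8" using N unfolding q_def by (simp add: algebra_simps)
  moreover have "g * (real N)\<^sup>2 \<le> g * Wn" using 3 g0 unfolding Wn_def by (intro mult_left_mono) auto
  ultimately have "g * Wn / 8 \<le> Y" by linarith
  moreover have "Wn = c\<^sup>2 * (\<Sum>l<d. (v l)\<^sup>2)"
    unfolding Wn_def w_def by (simp add: power_mult_distrib sum_distrib_left)
  moreover have "Y = c\<^sup>2 * (\<Sum>i\<in>J. (\<Sum>l<d. v l * z i l)\<^sup>2)"
  proof -
    have "(\<Sum>l<d. w l * z i l) = c * (\<Sum>l<d. v l * z i l)" for i
      by (simp add: w_def sum_distrib_left mult.assoc)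
    then show ?thesis unfolding Y_def by (simp only: power_mult_distrib sum_distrib_left[symmetric])
  qed
  ultimately have "c\<^sup>2 * (g / 8 * (\<Sum>l<d. (v l)\<^sup>2)) \<le> c\<^sup>2 * (\<Sum>i\<in>J. (\<Sum>l<d. v l * z i l)\<^sup>2)"
    by (simp add: algebra_simps)
  then show ?thesis using c0 by (simp add: mult_le_cancel_left_pos)
qed

text \<open>The bounds on a subset \<open>J\<close> of the pairs are relaxed with each missing pair, so that goodness is
  inherited by subsets; hence the size of the largest good subset changes by at most one between
  neighbors.\<close>

definition good :: "nat \<Rightarrow> nat \<Rightarrow> nat \<Rightarrow> real \<Rightarrow> real \<Rightarrow> (nat \<Rightarrow> nat \<Rightarrow> real) \<Rightarrow> nat set \<Rightarrow> bool" where
  "good d k N \<rho> B X J \<longleftrightarrow>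
    (\<forall>u\<in>points k J. \<forall>u'\<in>points k J. \<forall>l<d. \<bar>X u l - X u' l\<bar> \<le> \<rho>) \<and>
    (\<forall>v\<in>grid d N. (real k / 8 - (real k - real (card J)) * (real d * \<rho>\<^sup>2)) * (\<Sum>l<d. (v l)\<^sup>2)
      \<le> (\<Sum>i\<in>J. (\<Sum>l<d. v l * half_diff k X i l)\<^sup>2)) \<and>
    (\<forall>l<d. \<bar>\<Sum>i\<in>J. half_diff k X i l\<bar> \<le> B + (real k - real (card J)) * \<rho>)"

lemma good_half_diff:
  assumes "good d k N \<rho> B X J" "i \<in> J" "l < d"
  shows "\<bar>half_diff k X i l\<bar> \<le> \<rho>"
proof -
  have "\<bar>X i l - X (k + i) l\<bar> \<le> \<rho>" using assms by (auto simp: good_def points_def)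
  moreover have "\<bar>half_diff k X i l\<bar> \<le> \<bar>X i l - X (k + i) l\<bar>"
    using mult_left_mono[of 1 "sqrt 2" "\<bar>X i l - X (k + i) l\<bar>"] by (simp add: half_diff_def abs_divide divide_le_eq)
  ultimately show ?thesis by linarith
qed

lemma good_half_diff_norm:
  assumes "good d k N \<rho> B X J" "i \<in> J"
  shows "(\<Sum>l<d. (half_diff k X i l)\<^sup>2) \<le> real d * \<rho>\<^sup>2"
proof -
  have "(\<Sum>l<d. (half_diff k X i l)\<^sup>2) \<le> real (card {..<d}) * \<rho>\<^sup>2"
  proof (rule sum_bounded_above)
    fix l assume "l \<in> {..<d}"
    then have "\<bar>half_diff k X i l\<bar>\<^sup>2 \<le> \<rho>\<^sup>2" using good_half_diff[OF assms] by (intro power_mono) auto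
    then show "(half_diff k X i l)\<^sup>2 \<le> \<rho>\<^sup>2" by simp
  qed
  then show ?thesis by simp
qed

text \<open>By Cauchy-Schwarz a removed pair takes at most \<open>real d * \<rho>\<^sup>2\<close>
  per unit of squared length from the quadratic form, and it changes each coordinate sum by at most
  \<open>\<rho>\<close>. This is the slack that the definition grants per missing pair.\<close>

lemma good_subset:
  assumes g: "good d k N \<rho> B X J" and J: "finite J" "J' \<subseteq> J"
  shows "good d k N \<rho> B X J'"
proof -
  have fin: "finite J'" "finite (J - J')" using J by (auto intro: finite_subset)
  have card: "real (card J) = real (card J') + real (card (J - J'))"
    using J by (metis card_Diff_subset card_mono fin(1) le_add_diff_inverse of_nat_add)
  have split: "(\<Sum>i\<in>J. f i) = (\<Sum>i\<in>J'. f i) + (\<Sum>i\<in>J-J'. f i)" for f :: "nat \<Rightarrow> real"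
    using J by (metis sum.subset_diff add.commute)
  show ?thesis unfolding good_def
  proof (intro conjI ballI allI impI)
    fix u u' l assume "u \<in> points k J'" "u' \<in> points k J'" "l < d"
    moreover have "points k J' \<subseteq> points k J" using J by (auto simp: points_def)
    ultimately show "\<bar>X u l - X u' l\<bar> \<le> \<rho>" using g unfolding good_def by blast
  next
    fix v assume v: "v \<in> grid d N"
    let ?V = "\<Sum>l<d. (v l)\<^sup>2"
    have "(\<Sum>i\<in>J-J'. (\<Sum>l<d. v l * half_diff k X i l)\<^sup>2) \<le> real (card (J - J')) * (?V * (real d * \<rho>\<^sup>2))"
    proof (rule sum_bounded_above)
      fix i assume i: "i \<in> J - J'"
      have "(\<Sum>l<d. v l * half_diff k X i l)\<^sup>2 \<le> ?V * (\<Sum>l<d. (half_diff k X i l)\<^sup>2)"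
        by (rule Cauchy_Schwarz_ineq_sum)
      also have "\<dots> \<le> ?V * (real d * \<rho>\<^sup>2)"
        using good_half_diff_norm[OF g] i by (intro mult_left_mono) (auto simp: sum_nonneg)
      finally show "(\<Sum>l<d. v l * half_diff k X i l)\<^sup>2 \<le> ?V * (real d * \<rho>\<^sup>2)" .
    qed
    moreover have "(real k / 8 - (real k - real (card J)) * (real d * \<rho>\<^sup>2)) * ?V \<le> (\<Sum>i\<in>J. (\<Sum>l<d. v l * half_diff k X i l)\<^sup>2)"
      using g v by (auto simp: good_def)
    ultimately show "(real k / 8 - (real k - real (card J')) * (real d * \<rho>\<^sup>2)) * ?V \<le> (\<Sum>i\<in>J'. (\<Sum>l<d. v l * half_diff k X i l)\<^sup>2)"
      unfolding split card by (simp add: algebra_simps)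
  next
    fix l assume l: "l < d"
    have "\<bar>\<Sum>i\<in>J-J'. half_diff k X i l\<bar> \<le> (\<Sum>i\<in>J-J'. \<bar>half_diff k X i l\<bar>)" by (rule sum_abs)
    also have "\<dots> \<le> real (card (J - J')) * \<rho>"
      using good_half_diff[OF g _ l] by (intro sum_bounded_above) auto
    finally have "\<bar>\<Sum>i\<in>J-J'. half_diff k X i l\<bar> \<le> real (card (J - J')) * \<rho>" .
    moreover have "\<bar>a\<bar> \<le> \<bar>a + b\<bar> + \<bar>b\<bar>" for a b :: real by linarith
    from this[of "\<Sum>i\<in>J'. half_diff k X i l" "\<Sum>i\<in>J-J'. half_diff k X i l"]
    have "\<bar>\<Sum>i\<in>J'. half_diff k X i l\<bar> \<le> \<bar>\<Sum>i\<in>J. half_diff k X i l\<bar> + \<bar>\<Sum>i\<in>J-J'. half_diff k X i l\<bar>"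
      unfolding split .
    moreover have "\<bar>\<Sum>i\<in>J. half_diff k X i l\<bar> \<le> B + (real k - real (card J)) * \<rho>" using g l by (auto simp: good_def)
    ultimately show "\<bar>\<Sum>i\<in>J'. half_diff k X i l\<bar> \<le> B + (real k - real (card J')) * \<rho>"
      unfolding card by (simp add: algebra_simps)
  qed
qed

lemma half_diff_cong:
  "X i = X' i \<Longrightarrow> X (k + i) = X' (k + i) \<Longrightarrow> half_diff k X i = half_diff k X' i"
  by (rule ext) (simp add: half_diff_def)

lemma good_cong:
  assumes "\<And>u. u \<in> points k J \<Longrightarrow> X u = X' u"
  shows "good d k N \<rho> B X J = good d k N \<rho> B X' J"
proof -
  have hd: "half_diff k X i = half_diff k X' i" if "i \<in> J" for i
    using that by (intro half_diff_cong assms) (auto simp: points_def)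
  have "(\<Sum>i\<in>J. (\<Sum>l<d. v l * half_diff k X i l)\<^sup>2) = (\<Sum>i\<in>J. (\<Sum>l<d. v l * half_diff k X' i l)\<^sup>2)" for v
    by (intro sum.cong refl) (simp add: hd)
  moreover have "(\<Sum>i\<in>J. half_diff k X i l) = (\<Sum>i\<in>J. half_diff k X' i l)" for l
    by (intro sum.cong refl) (simp add: hd)
  ultimately show ?thesis unfolding good_def using assms by simp
qed

text \<open>Relative to the center of \<open>r\<close> the deviations of the points of
  \<open>r\<close> sum to 0, so only the pairs in \<open>J - r\<close> contribute.\<close>

lemma center_deviation:
  assumes g: "good d k N \<rho> B X J" and J: "finite J" "r \<subseteq> J" "r \<noteq> {}" and l: "l < d"
  shows "\<bar>center k J X l - center k r X l\<bar> \<le> real (card (J - r)) * \<rho> / real (card J)"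
proof -
  have fin: "finite r" "finite (J - r)" using J by (auto intro: finite_subset)
  have c0: "real (card r) > 0" "real (card J) > 0" using J fin by (auto simp: card_gt_0_iff)
  define c where "c = center k r X l"
  have r0: "(\<Sum>i\<in>r. X i l + X (k + i) l - 2 * c) = 0"
    using c0 by (simp add: sum_subtractf c_def center_def)
  \<comment> \<open>A point of \<open>J\<close> is within \<open>\<rho>\<close> of every point of
    \<open>r\<close>, hence of their mean.\<close>
  have dev: "\<bar>X u l - c\<bar> \<le> \<rho>" if u: "u \<in> points k J" for u
  proof -
    have "X u l - c = (\<Sum>i\<in>r. (X u l - X i l) + (X u l - X (k + i) l)) / (2 * real (card r))"
      using c0 by (simp add: c_def center_def sum.distrib sum_subtractf field_simps)
    moreover have "\<bar>\<Sum>i\<in>r. (X u l - X i l) + (X u l - X (k + i) l)\<bar> \<le> real (card r) * (2 * \<rho>)"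
    proof (rule order_trans[OF sum_abs sum_bounded_above])
      fix i assume "i \<in> r"
      then have "\<bar>X u l - X i l\<bar> \<le> \<rho>" "\<bar>X u l - X (k + i) l\<bar> \<le> \<rho>"
        using g u l J by (auto simp: good_def points_def)
      then show "\<bar>(X u l - X i l) + (X u l - X (k + i) l)\<bar> \<le> 2 * \<rho>" by linarith
    qed
    ultimately show ?thesis using c0 by (simp add: abs_divide divide_le_eq mult_ac)
  qed
  have "center k J X l - c = (\<Sum>i\<in>J. X i l + X (k + i) l - 2 * c) / (2 * real (card J))"
    using c0 by (simp add: center_def sum_subtractf field_simps)
  also have "(\<Sum>i\<in>J. X i l + X (k + i) l - 2 * c) = (\<Sum>i\<in>J-r. X i l + X (k + i) l - 2 * c)"
    using r0 J by (simp add: sum.subset_diff[of r J])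
  finally have "\<bar>center k J X l - c\<bar> = \<bar>\<Sum>i\<in>J-r. X i l + X (k + i) l - 2 * c\<bar> / (2 * real (card J))"
    using c0 by (simp add: abs_divide)
  also have "\<bar>\<Sum>i\<in>J-r. X i l + X (k + i) l - 2 * c\<bar> \<le> real (card (J - r)) * (2 * \<rho>)"
  proof (rule order_trans[OF sum_abs sum_bounded_above])
    fix i assume "i \<in> J - r"
    then have "\<bar>X i l - c\<bar> \<le> \<rho>" "\<bar>X (k + i) l - c\<bar> \<le> \<rho>" using dev by (auto simp: points_def)
    then show "\<bar>X i l + X (k + i) l - 2 * c\<bar> \<le> 2 * \<rho>" by linarith
  qed
  finally show ?thesis using c0 by (simp add: c_def divide_right_mono)
qed

section \<open>The base mechanism\<close>

abbreviation data :: "nat \<Rightarrow> nat \<Rightarrow> (nat \<Rightarrow> nat \<Rightarrow> real) measure" where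
  "data d n \<equiv> datasets n (euclid d)"

lemma measurable_data_component:
  assumes "u < n" "l < d"
  shows "(\<lambda>X. X u l) \<in> borel_measurable (data d n)"
proof (rule measurable_compose[where f = "\<lambda>X. X u" and g = "\<lambda>x. x l"])
  show "(\<lambda>X. X u) \<in> data d n \<rightarrow>\<^sub>M euclid d"
    unfolding datasets_def using assms by (intro measurable_component_singleton) auto
  show "(\<lambda>x. x l) \<in> borel_measurable (euclid d)"
    unfolding euclid_def using assms by (intro measurable_component_singleton) auto
qed

lemma points_less: "J \<subseteq> {..<k} \<Longrightarrow> u \<in> points k J \<Longrightarrow> u < 2 * k"
  by (auto simp: points_def)

lemma measurable_half_diff:
  assumes "i < k" "l < d"
  shows "(\<lambda>X. half_diff k X i l) \<in> borel_measurable (data d (2 * k))"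
  unfolding half_diff_def using assms
  by (intro borel_measurable_divide borel_measurable_diff measurable_data_component borel_measurable_const) auto

lemma pred_good:
  assumes J: "J \<subseteq> {..<k}"
  shows "Measurable.pred (data d (2 * k)) (\<lambda>X. good d k N \<rho> B X J)"
proof -
  have fin: "finite J" "finite (points k J)" using J by (auto simp: points_def finite_subset)
  have conv: "(\<forall>l<d. P l) \<longleftrightarrow> (\<forall>l\<in>{..<d}. P l)" for P by auto
  have hd: "(\<lambda>X. half_diff k X i l) \<in> borel_measurable (data d (2 * k))" if "i \<in> J" "l \<in> {..<d}" for i l
    using that J by (intro measurable_half_diff) auto
  have pt: "(\<lambda>X. X u l) \<in> borel_measurable (data d (2 * k))" if "u \<in> points k J" "l \<in> {..<d}" for u l
    using that points_less[OF J] by (intro measurable_data_component) auto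
  have le: "Measurable.pred (data d (2 * k)) (\<lambda>X. f X \<le> g X)"
    if "f \<in> borel_measurable (data d (2 * k))" "g \<in> borel_measurable (data d (2 * k))" for f g :: "_ \<Rightarrow> real"
    using borel_measurable_le[OF that] by (simp add: pred_def)
  show ?thesis unfolding good_def conv
    by (intro pred_intros_logic pred_intros_finite le fin finite_grid finite_lessThan
        borel_measurable_abs borel_measurable_diff borel_measurable_const borel_measurable_sum
        borel_measurable_power borel_measurable_times hd pt)
qed

section \<open>Measurable selection of a largest good subset\<close>

definition candidates :: "nat \<Rightarrow> nat \<Rightarrow> nat \<Rightarrow> real \<Rightarrow> real \<Rightarrow> (nat \<Rightarrow> nat \<Rightarrow> real) \<Rightarrow> nat set set" where
  "candidates d k N \<rho> B X = {J. J \<subseteq> {..<k} \<and> (good d k N \<rho> B X J \<or> J = {})}"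

text \<open>The argument is the family of candidates and not the dataset: ties are broken by
  \<open>SOME\<close>, and the choice is measurable since it factors through a family with finitely
  many possible values.\<close>

definition largest :: "nat set set \<Rightarrow> nat set" where
  "largest \<G> = (SOME J. J \<in> \<G> \<and> (\<forall>J'\<in>\<G>. card J' \<le> card J))"

lemma largest:
  assumes "finite \<G>" "\<G> \<noteq> {}"
  shows "largest \<G> \<in> \<G>" "J' \<in> \<G> \<Longrightarrow> card J' \<le> card (largest \<G>)"
proof -
  have "Max (card ` \<G>) \<in> card ` \<G>" using assms by (intro Max_in) auto
  then obtain J where J: "J \<in> \<G>" "card J = Max (card ` \<G>)" by auto
  then have "J \<in> \<G> \<and> (\<forall>J'\<in>\<G>. card J' \<le> card J)" using assms by auto
  then have "largest \<G> \<in> \<G> \<and> (\<forall>J'\<in>\<G>. card J' \<le> card (largest \<G>))"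
    unfolding largest_def by (rule someI[where P = "\<lambda>J. J \<in> \<G> \<and> (\<forall>J'\<in>\<G>. card J' \<le> card J)"])
  then show "largest \<G> \<in> \<G>" "J' \<in> \<G> \<Longrightarrow> card J' \<le> card (largest \<G>)" by auto
qed

lemma candidates: "finite (candidates d k N \<rho> B X)" "candidates d k N \<rho> B X \<noteq> {}"
proof -
  have "candidates d k N \<rho> B X \<subseteq> Pow {..<k}" by (auto simp: candidates_def)
  then show "finite (candidates d k N \<rho> B X)" by (rule finite_subset) auto
  have "{} \<in> candidates d k N \<rho> B X" by (simp add: candidates_def)
  then show "candidates d k N \<rho> B X \<noteq> {}" by blast
qed

lemma measurable_candidates:
  "candidates d k N \<rho> B \<in> data d (2 * k) \<rightarrow>\<^sub>M count_space (Pow (Pow {..<k}))"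
proof -
  have "candidates d k N \<rho> B -` {\<G>} \<inter> space (data d (2 * k)) \<in> sets (data d (2 * k))" if \<G>: "\<G> \<in> Pow (Pow {..<k})" for \<G>
  proof -
    have "candidates d k N \<rho> B -` {\<G>} \<inter> space (data d (2 * k)) =
      {X \<in> space (data d (2 * k)). \<forall>J\<in>Pow {..<k}. (J \<in> \<G>) = (good d k N \<rho> B X J \<or> J = {})}"
    proof -
      have "candidates d k N \<rho> B X = \<G> \<longleftrightarrow> (\<forall>J\<in>Pow {..<k}. (J \<in> \<G>) = (good d k N \<rho> B X J \<or> J = {}))" for X
      proof
        assume "candidates d k N \<rho> B X = \<G>"
        then have eq: "J \<in> \<G> \<longleftrightarrow> J \<in> candidates d k N \<rho> B X" for J by simp
        show "\<forall>J\<in>Pow {..<k}. (J \<in> \<G>) = (good d k N \<rho> B X J \<or> J = {})"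
          unfolding eq by (simp add: candidates_def)
      next
        assume eq: "\<forall>J\<in>Pow {..<k}. (J \<in> \<G>) = (good d k N \<rho> B X J \<or> J = {})"
        show "candidates d k N \<rho> B X = \<G>"
        proof (rule Set.set_eqI)
          fix J
          show "J \<in> candidates d k N \<rho> B X \<longleftrightarrow> J \<in> \<G>"
            using eq[rule_format, of J] \<G> by (cases "J \<subseteq> {..<k}") (simp add: candidates_def, auto simp: candidates_def)
        qed
      qed
      then show ?thesis by (simp add: vimage_def Int_def conj_commute)
    qed
    also have "\<dots> \<in> sets (data d (2 * k))"
    proof -
      have "Measurable.pred (data d (2 * k)) (\<lambda>X. \<forall>J\<in>Pow {..<k}. (J \<in> \<G>) = (good d k N \<rho> B X J \<or> J = {}))"
      proof (rule pred_intros_finite(3))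
        fix J assume "J \<in> Pow {..<k}"
        then have [measurable]: "Measurable.pred (data d (2 * k)) (\<lambda>X. good d k N \<rho> B X J)"
          by (intro pred_good) auto
        show "Measurable.pred (data d (2 * k)) (\<lambda>X. (J \<in> \<G>) = (good d k N \<rho> B X J \<or> J = {}))"
          by measurable
      qed auto
      then show ?thesis by (simp add: pred_def)
    qed
    finally show ?thesis .
  qed
  moreover have "candidates d k N \<rho> B \<in> space (data d (2 * k)) \<rightarrow> Pow (Pow {..<k})"
    by (auto simp: candidates_def)
  ultimately show ?thesis by (subst measurable_count_space_eq2) auto
qed

text \<open>The random part is scaled so that for \<open>J = {..<k}\<close> the squared weights of
  the \<open>2 * k\<close> samples sum to 1. Pairs outside \<open>J\<close> are replaced by 0
  instead of being removed, so the norm of the weights always involves all \<open>k\<close> of them,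
  whatever \<open>J\<close> is.\<close>

definition subset_mix :: "nat \<Rightarrow> nat \<Rightarrow> nat set \<Rightarrow> (nat \<Rightarrow> nat \<Rightarrow> real) \<Rightarrow> (nat \<Rightarrow> real) \<Rightarrow> nat \<Rightarrow> real" where
  "subset_mix d k J X \<omega> = mix d {..<k} (sqrt (1 - 1 / (2 * real k))) (center k J X)
    (\<lambda>i l. if i \<in> J then half_diff k X i l else 0) (\<lambda>i\<in>{..<k}. 1 + \<omega> i)"

lemma measurable_subset_mix:
  assumes J: "J \<subseteq> {..<k}"
  shows "(\<lambda>(X, \<omega>). subset_mix d k J X \<omega>) \<in> data d (2 * k) \<Otimes>\<^sub>M PiM {..<k} (\<lambda>_. std_normal) \<rightarrow>\<^sub>M euclid d"
proof -
  let ?M = "data d (2 * k) \<Otimes>\<^sub>M PiM {..<k} (\<lambda>_. std_normal)"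
  have \<omega>: "(\<lambda>x. snd x i) \<in> borel_measurable ?M" if "i \<in> {..<k}" for i
    using measurable_compose[OF measurable_snd measurable_component_singleton[OF that, of "\<lambda>_. std_normal"]] by simp
  have X: "(\<lambda>x. fst x u l) \<in> borel_measurable ?M" if "u < 2 * k" "l < d" for u l
    using measurable_compose[OF measurable_fst measurable_data_component[OF that]] .
  have hd: "(\<lambda>x. if i \<in> J then half_diff k (fst x) i l else 0) \<in> borel_measurable ?M" if "i \<in> {..<k}" "l \<in> {..<d}" for i l
    using measurable_compose[OF measurable_fst measurable_half_diff[of i k l d]] that by (cases "i \<in> J") auto
  have c: "(\<lambda>x. center k J (fst x) l) \<in> borel_measurable ?M" if l: "l \<in> {..<d}" for l
    unfolding center_def using J l
    by (intro borel_measurable_divide borel_measurable_sum borel_measurable_add borel_measurable_const X) auto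
  have p: "(\<lambda>x. (\<lambda>i\<in>{..<k}. 1 + snd x i) i) \<in> borel_measurable ?M" if "i \<in> {..<k}" for i
    using \<omega>[OF that] that by simp
  have "(\<lambda>x. \<Sum>i<k. ((\<lambda>i\<in>{..<k}. 1 + snd x i) i)\<^sup>2) \<in> borel_measurable ?M"
    by (intro borel_measurable_sum borel_measurable_power p)
  from measurable_compose[OF this borel_measurable_sqrt]
  have sq: "(\<lambda>x. sqrt (\<Sum>i<k. ((\<lambda>i\<in>{..<k}. 1 + snd x i) i)\<^sup>2)) \<in> borel_measurable ?M" .
  show ?thesis unfolding subset_mix_def mix_def case_prod_beta
  proof (subst euclid_def, rule measurable_restrict)
    fix l assume l: "l \<in> {..<d}"
    show "(\<lambda>x. center k J (fst x) l + sqrt (1 - 1 / (2 * real k)) *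
       (\<Sum>i<k. (\<lambda>i\<in>{..<k}. 1 + snd x i) i * (if i \<in> J then half_diff k (fst x) i l else 0)) /
         sqrt (\<Sum>i<k. ((\<lambda>i\<in>{..<k}. 1 + snd x i) i)\<^sup>2)) \<in> ?M \<rightarrow>\<^sub>M borel"
      by (intro borel_measurable_add borel_measurable_divide borel_measurable_times borel_measurable_const
          borel_measurable_sum sq c hd p l)
  qed
qed

definition subset_law :: "nat \<Rightarrow> nat \<Rightarrow> nat set \<Rightarrow> (nat \<Rightarrow> nat \<Rightarrow> real) \<Rightarrow> (nat \<Rightarrow> real) measure" where
  "subset_law d k J X = distr (PiM {..<k} (\<lambda>_. std_normal)) (euclid d) (subset_mix d k J X)"

lemma measurable_subset_mix_fixed:
  assumes J: "J \<subseteq> {..<k}" and X: "X \<in> space (data d (2 * k))"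
  shows "subset_mix d k J X \<in> PiM {..<k} (\<lambda>_. std_normal) \<rightarrow>\<^sub>M euclid d"
  using measurable_compose[OF measurable_Pair1'[OF X] measurable_subset_mix[OF J]] by simp

lemma measurable_subset_law:
  assumes J: "J \<subseteq> {..<k}"
  shows "subset_law d k J \<in> data d (2 * k) \<rightarrow>\<^sub>M prob_algebra (euclid d)"
proof (rule measurable_prob_algebraI)
  let ?P = "PiM {..<k} (\<lambda>_. std_normal)"
  interpret P: prob_space ?P by (rule prob_space_PiM_std_normal)
  show "prob_space (subset_law d k J X)" if "X \<in> space (data d (2 * k))" for X
    unfolding subset_law_def by (rule P.prob_space_distr[OF measurable_subset_mix_fixed[OF J that]])
  have "(\<lambda>_. ?P) \<in> data d (2 * k) \<rightarrow>\<^sub>M subprob_algebra ?P"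
    by (rule measurable_const) (simp add: space_subprob_algebra P.prob_space_axioms prob_space_imp_subprob_space)
  from measurable_distr2[OF measurable_subset_mix[OF J] this]
  show "subset_law d k J \<in> data d (2 * k) \<rightarrow>\<^sub>M subprob_algebra (euclid d)"
    unfolding subset_law_def .
qed

lemma measure_subset_law:
  assumes J: "J \<subseteq> {..<k}" and X: "X \<in> space (data d (2 * k))" and S: "S \<in> sets (euclid d)"
  shows "measure (subset_law d k J X) S =
    measure (PiM {..<k} (\<lambda>_. std_normal)) {\<omega>\<in>space (PiM {..<k} (\<lambda>_. std_normal)). subset_mix d k J X \<omega> \<in> S}"
  unfolding subset_law_def measure_distr[OF measurable_subset_mix_fixed[OF J X] S]
  by (intro arg_cong2[where f = measure]) auto

text \<open>The logistic function of the number of discarded pairs changes by at most a factor \<open>e\<close>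
  between neighbors, and so does its complement.\<close>

definition gate :: "real \<Rightarrow> nat \<Rightarrow> real" where
  "gate \<tau> m = 1 / (1 + exp (real m - \<tau>))"

lemma gate_bounds: "0 \<le> gate \<tau> m" "gate \<tau> m \<le> 1"
  by (auto simp: gate_def add_pos_pos divide_le_eq)

lemma gate_neighbor:
  assumes "m \<le> m' + 1" "m' \<le> m + 1"
  shows "gate \<tau> m \<le> exp 1 * gate \<tau> m'" "1 - gate \<tau> m \<le> exp 1 * (1 - gate \<tau> m')"
proof -
  define a where "a = exp (real m - \<tau>)"
  define b where "b = exp (real m' - \<tau>)"
  have pos: "a > 0" "b > 0" by (auto simp: a_def b_def)
  have ab: "a \<le> exp 1 * b" "b \<le> exp 1 * a"
    using assms unfolding a_def b_def exp_add[symmetric] by auto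
  have e1: "exp (1::real) \<ge> 1" by simp
  have g: "gate \<tau> m = 1 / (1 + a)" "gate \<tau> m' = 1 / (1 + b)" by (auto simp: gate_def a_def b_def)
  have "1 + b \<le> exp 1 * (1 + a)" unfolding distrib_left using ab(2) e1 by linarith
  then show "gate \<tau> m \<le> exp 1 * gate \<tau> m'" unfolding g using pos by (simp add: divide_simps mult_ac add_pos_pos)
  have c: "1 - 1 / (1 + a) = a / (1 + a)" "1 - 1 / (1 + b) = b / (1 + b)" using pos by (auto simp: field_simps)
  have "a * (1 + b) \<le> exp 1 * b * (1 + a)"
  proof -
    have "a * b \<le> exp 1 * (a * b)" using pos e1 mult_right_mono[of 1 "exp 1" "a * b"] by simp
    then show ?thesis using ab(1) by (simp add: algebra_simps)
  qed
  then show "1 - gate \<tau> m \<le> exp 1 * (1 - gate \<tau> m')"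
    unfolding g c using pos by (simp add: divide_simps mult_ac add_pos_pos)
qed

text \<open>\<open>t\<close> is the number of discarded pairs beyond which the gate is open with
  probability at most \<open>\<delta>\<close>, and \<open>m\<close> bounds the number of pairs that
  two neighbors do not share. \<open>c1\<close> and \<open>c2\<close> preserve the Gram bound when
  pairs are missing and carry it from the grid to all directions; \<open>c3\<close> controls the
  overlap with the all-ones vector; \<open>c4\<close> and \<open>c5\<close> are the conditions of
  \<open>mix_stable\<close> on size and on the length of the shift; \<open>c6\<close> bounds its
  additive error; \<open>c7\<close> is the bound on the gate; \<open>c8\<close> leaves at least half
  of the pairs.\<close>

locale base_mechanism =
  fixes d k N t :: nat and \<rho> B T \<tau> \<delta> :: real and m :: real
  assumes d1: "d \<ge> 1" and \<rho>0: "\<rho> > 0" and B0: "B \<ge> 0" and T1: "T \<ge> 1"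
    and m_def: "m = 2 * real t + 3"
    and c1: "16 * m * (real d * \<rho>\<^sup>2) \<le> real k"
    and c2: "8 * real d * (1 / 2 + 16 * (real d * \<rho>\<^sup>2)) \<le> (real N)\<^sup>2"
    and c3: "1024 * real d * (B + m * \<rho>)\<^sup>2 \<le> (real k)\<^sup>2"
    and c4: "8000 * T\<^sup>2 \<le> real k"
    and c5: "240 * T\<^sup>2 * m * sqrt (real d * \<rho>\<^sup>2) \<le> sqrt (real k) / 100"
    and c6: "2 * (real k + 3) * exp (- T\<^sup>2 / 2) \<le> \<delta>"
    and c7: "exp (\<tau> - (real t + 1)) \<le> \<delta>"
    and c8: "2 * m \<le> real k"
begin

abbreviation "P \<equiv> PiM {..<k} (\<lambda>_. std_normal)"

definition chosen :: "(nat \<Rightarrow> nat \<Rightarrow> real) \<Rightarrow> nat set" where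
  "chosen X = largest (candidates d k N \<rho> B X)"

definition discarded :: "(nat \<Rightarrow> nat \<Rightarrow> real) \<Rightarrow> nat" where
  "discarded X = k - card (chosen X)"

lemma chosen: "chosen X \<subseteq> {..<k}" "chosen X \<noteq> {} \<Longrightarrow> good d k N \<rho> B X (chosen X)"
  using largest(1)[OF candidates[of d k N \<rho> B X]] by (auto simp: chosen_def candidates_def)

lemma chosen_max: "J \<subseteq> {..<k} \<Longrightarrow> good d k N \<rho> B X J \<Longrightarrow> card J \<le> card (chosen X)"
  unfolding chosen_def by (rule largest(2)[OF candidates]) (simp add: candidates_def)

lemma measurable_chosen: "chosen \<in> data d (2 * k) \<rightarrow>\<^sub>M count_space (Pow {..<k})"
proof -
  \<comment> \<open>\<open>largest\<close> may return anything on the empty family, which never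
    occurs but belongs to the discrete space; the default \<open>{}\<close> keeps all values inside
    \<open>Pow {..<k}\<close>.\<close>
  define g where "g = (\<lambda>\<G>. if \<G> = {} then {} else largest \<G>)"
  have "g \<in> count_space (Pow (Pow {..<k})) \<rightarrow>\<^sub>M count_space (Pow {..<k})"
  proof -
    have "g \<G> \<in> Pow {..<k}" if \<G>: "\<G> \<in> Pow (Pow {..<k})" for \<G>
    proof (cases "\<G> = {}")
      case False
      have "finite \<G>" using \<G> by (auto intro: finite_subset)
      from largest(1)[OF this False] show ?thesis using \<G> False by (auto simp: g_def)
    qed (simp add: g_def)
    then show ?thesis by simp
  qed
  from measurable_compose[OF measurable_candidates this]
  have "(\<lambda>X. g (candidates d k N \<rho> B X)) \<in> data d (2 * k) \<rightarrow>\<^sub>M count_space (Pow {..<k})" .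
  moreover have "(\<lambda>X. g (candidates d k N \<rho> B X)) = chosen"
    by (rule ext) (simp add: g_def chosen_def candidates(2))
  ultimately show ?thesis by simp
qed

text \<open>Without the affected pair, the choice for \<open>X\<close> consists of samples common to
  both datasets, so it is good for \<open>X'\<close> as well and at most one pair smaller.\<close>

lemma discarded_neighbor:
  assumes i0: "i0 < k" and same: "\<And>u. u < 2 * k \<Longrightarrow> u \<noteq> i0 \<Longrightarrow> u \<noteq> k + i0 \<Longrightarrow> X u = X' u"
  shows "discarded X' \<le> discarded X + 1"
\<comment> \<open>An empty remainder is not known to be good, but then at most one pair was chosen
  and the bound is trivial.\<close>
proof (cases "chosen X - {i0} = {}")
  case True
  then have "chosen X \<subseteq> {i0}" by auto
  from card_mono[OF _ this] have "card (chosen X) \<le> 1" by simp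
  then show ?thesis unfolding discarded_def by simp
next
  case False
  then have g: "good d k N \<rho> B X (chosen X - {i0})"
    using chosen[of X] by (intro good_subset[OF chosen(2)]) (auto intro: finite_subset)
  have "good d k N \<rho> B X' (chosen X - {i0}) = good d k N \<rho> B X (chosen X - {i0})"
    using chosen(1)[of X] i0 by (intro good_cong same[symmetric]) (auto simp: points_def)
  with g have "card (chosen X - {i0}) \<le> card (chosen X')"
    using chosen(1)[of X] by (intro chosen_max) auto
  moreover have "card (chosen X) \<le> card (chosen X - {i0}) + 1"
    by (simp add: card_Diff_singleton_if) arith
  ultimately show ?thesis unfolding discarded_def by simp
qed

text \<open>\<open>mix_stable\<close> is applied with \<open>r\<close>, the unaffected pairs chosen
  on both sides, as the shifted part. Goodness of the larger choice is inherited by \<open>r\<close>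
  and yields the Gram and sum bounds there; the two centers are compared through the center of
  \<open>r\<close>.\<close>

lemma law_stable:
  assumes X: "X \<in> space (data d (2 * k))" and X': "X' \<in> space (data d (2 * k))"
    and i0: "i0 < k" and same: "\<And>u. u < 2 * k \<Longrightarrow> u \<noteq> i0 \<Longrightarrow> u \<noteq> k + i0 \<Longrightarrow> X u = X' u"
    and few: "discarded X \<le> t" "discarded X' \<le> t + 1"
    and S: "S \<in> sets (euclid d)"
  shows "measure (subset_law d k (chosen X) X) S \<le> exp 1 * measure (subset_law d k (chosen X') X') S + \<delta>"
proof -
  define J where "J = chosen X"
  define J' where "J' = chosen X'"
  define r where "r = J \<inter> J' - {i0}"
  define K where "K = {..<k} - r"
  have Js: "J \<subseteq> {..<k}" "J' \<subseteq> {..<k}" unfolding J_def J'_def by (rule chosen(1))+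
  have fin: "finite J" "finite J'" "finite r" "finite K" using Js by (auto simp: r_def K_def finite_subset)
  have rk: "r \<subseteq> {..<k}" using Js by (auto simp: r_def)
  have cJ: "card J + t \<ge> k" "card J' + t + 1 \<ge> k" using few unfolding discarded_def J_def J'_def by auto
  have m3: "m \<ge> 3" by (simp add: m_def)
  have k6: "real k \<ge> 6" using c8 m3 by linarith
  \<comment> \<open>At most \<open>t\<close> pairs are missing on one side, at most
    \<open>t + 1\<close> on the other, and \<open>i0\<close> is removed.\<close>
  have cK: "real (card K) \<le> m"
  proof -
    have "K \<subseteq> ({..<k} - J) \<union> ({..<k} - J') \<union> {i0}" unfolding K_def r_def by auto
    then have "card K \<le> card (({..<k} - J) \<union> ({..<k} - J') \<union> {i0})" by (intro card_mono) auto
    also have "\<dots> \<le> card ({..<k} - J) + card ({..<k} - J') + 1"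
      by (intro order_trans[OF card_Un_le] add_mono) auto
    also have "card ({..<k} - J) = k - card J" using Js fin by (subst card_Diff_subset) auto
    also have "card ({..<k} - J') = k - card J'" using Js fin by (subst card_Diff_subset) auto
    finally have "card K \<le> 2 * t + 2" using cJ by linarith
    then show ?thesis unfolding m_def by linarith
  qed
  have cr: "real k = real (card r) + real (card K)"
    unfolding K_def using rk fin by (simp add: card_Diff_subset of_nat_diff card_mono[of "{..<k}" r, simplified])
  have rhalf: "real (card r) \<ge> real k / 2" using cr cK c8 by linarith
  have rne: "r \<noteq> {}" using rhalf k6 by auto
  then have Jne: "J \<noteq> {}" "J' \<noteq> {}" by (auto simp: r_def)
  have gJ: "good d k N \<rho> B X J" "good d k N \<rho> B X' J'"
    using chosen(2) Jne unfolding J_def J'_def by auto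
  have gr: "good d k N \<rho> B X r" by (rule good_subset[OF gJ(1) fin(1)]) (auto simp: r_def)
  have XX: "X u = X' u" if "u \<in> points k r" for u
    using that rk i0 by (intro same) (auto simp: points_def r_def)
  have hdr: "half_diff k X i = half_diff k X' i" if "i \<in> r" for i
    using that by (intro half_diff_cong XX) (auto simp: points_def)
  define z where "z = (\<lambda>i l. if i \<in> J then half_diff k X i l else 0)"
  define z' where "z' = (\<lambda>i l. if i \<in> J' then half_diff k X' i l else 0)"
  have zr: "z i l = half_diff k X i l" "z' i l = half_diff k X i l" if "i \<in> r" for i l
    using that hdr[OF that] by (auto simp: z_def z'_def r_def)
  have IK: "{..<k} - K = r" using rk by (auto simp: K_def)
  define R where "R = sqrt (real d * \<rho>\<^sup>2)"
  have R: "R > 0" "R\<^sup>2 = real d * \<rho>\<^sup>2" using d1 \<rho>0 by (auto simp: R_def)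
  have zb: "L2_set (z i) {..<d} \<le> R" "L2_set (z' i) {..<d} \<le> R" for i
    using good_half_diff_norm[OF gJ(1), of i] R(1)
    by (cases "i \<in> J", simp_all add: z_def L2_set_def R_def)
      (use good_half_diff_norm[OF gJ(2), of i] R(1) in \<open>cases "i \<in> J'", simp_all add: z'_def L2_set_def R_def\<close>)
  \<comment> \<open>Missing pairs reduce \<open>k / 8\<close> to at worst \<open>k / 16\<close>, and
    the passage from the grid to all directions loses another factor 8.\<close>
  have gram: "real k / 128 * (\<Sum>l<d. (v l)\<^sup>2) \<le> (\<Sum>i\<in>{..<k}-K. (\<Sum>l<d. v l * z i l)\<^sup>2)" for v
  proof -
    define g where "g = real k / 8 - (real k - real (card r)) * (real d * \<rho>\<^sup>2)"
    have "(real k - real (card r)) * (real d * \<rho>\<^sup>2) \<le> m * (real d * \<rho>\<^sup>2)"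
      using cr cK by (intro mult_right_mono) auto
    then have g: "g \<ge> real k / 16" unfolding g_def using c1 by linarith
    have g0: "g > 0" using g k6 by linarith
    have cond: "real d * (g / 2 + real (card r) * (real d * \<rho>\<^sup>2)) \<le> g * (real N)\<^sup>2 / 8"
    proof -
      have "real (card r) \<le> 16 * g" using g cr by linarith
      then have "real (card r) * (real d * \<rho>\<^sup>2) \<le> 16 * g * (real d * \<rho>\<^sup>2)" by (intro mult_right_mono) auto
      then have "real d * (g / 2 + real (card r) * (real d * \<rho>\<^sup>2)) \<le> real d * (g / 2 + 16 * g * (real d * \<rho>\<^sup>2))"
        by (intro mult_left_mono) auto
      also have "\<dots> = g / 8 * (8 * real d * (1 / 2 + 16 * (real d * \<rho>\<^sup>2)))" by (simp add: algebra_simps)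
      also have "\<dots> \<le> g / 8 * (real N)\<^sup>2" using g0 by (intro mult_left_mono c2) auto
      finally show ?thesis by simp
    qed
    have "g / 8 * (\<Sum>l<d. (v l)\<^sup>2) \<le> (\<Sum>i\<in>r. (\<Sum>l<d. v l * half_diff k X i l)\<^sup>2)"
    proof (rule gram_bound_from_grid[OF fin(3) g0 _ _ cond])
      show "g * (\<Sum>l<d. (v l)\<^sup>2) \<le> (\<Sum>i\<in>r. (\<Sum>l<d. v l * half_diff k X i l)\<^sup>2)" if "v \<in> grid d N" for v
        using gr that by (auto simp: good_def g_def)
      show "(\<Sum>l<d. (half_diff k X i l)\<^sup>2) \<le> real d * \<rho>\<^sup>2" if "i \<in> r" for i
        by (rule good_half_diff_norm[OF gr that])
    qed
    moreover have "real k / 128 * (\<Sum>l<d. (v l)\<^sup>2) \<le> g / 8 * (\<Sum>l<d. (v l)\<^sup>2)"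
      using g by (intro mult_right_mono sum_nonneg) auto
    moreover have "(\<Sum>i\<in>r. (\<Sum>l<d. v l * half_diff k X i l)\<^sup>2) = (\<Sum>i\<in>{..<k}-K. (\<Sum>l<d. v l * z i l)\<^sup>2)"
      unfolding IK by (intro sum.cong refl) (simp add: zr)
    ultimately show ?thesis by linarith
  qed
  have total: "(\<Sum>l<d. (\<Sum>i\<in>{..<k}-K. z i l)\<^sup>2) \<le> real k / 128 * real (card ({..<k}-K)) / 4"
  proof -
    have "(\<Sum>l<d. (\<Sum>i\<in>{..<k}-K. z i l)\<^sup>2) \<le> real (card {..<d}) * (B + m * \<rho>)\<^sup>2"
    proof (rule sum_bounded_above)
      fix l assume l: "l \<in> {..<d}"
      have "(\<Sum>i\<in>{..<k}-K. z i l) = (\<Sum>i\<in>r. half_diff k X i l)" unfolding IK by (intro sum.cong refl) (simp add: zr)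
      moreover have "\<bar>\<Sum>i\<in>r. half_diff k X i l\<bar> \<le> B + (real k - real (card r)) * \<rho>"
        using gr l by (auto simp: good_def)
      moreover have "(real k - real (card r)) * \<rho> \<le> m * \<rho>" using cr cK \<rho>0 by (intro mult_right_mono) auto
      ultimately have "\<bar>\<Sum>i\<in>{..<k}-K. z i l\<bar> \<le> B + m * \<rho>" by linarith
      from power_mono[OF this abs_ge_zero, of 2] show "(\<Sum>i\<in>{..<k}-K. z i l)\<^sup>2 \<le> (B + m * \<rho>)\<^sup>2" by simp
    qed
    also have "\<dots> \<le> (real k)\<^sup>2 / 1024" using c3 by simp
    also have "\<dots> \<le> real k / 128 * real (card ({..<k}-K)) / 4"
    proof -
      have "real k * (real k / 2) \<le> real k * real (card r)" using rhalf by (intro mult_left_mono) auto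
      then show ?thesis unfolding IK by (simp add: power2_eq_square)
    qed
    finally show ?thesis .
  qed
  have zK: "L2_set (\<lambda>l. z i l - z' i l) {..<d} \<le> 2 * R" for i
  proof -
    have "L2_set (\<lambda>l. z i l - z' i l) {..<d} = L2_set (\<lambda>l. z i l + - z' i l) {..<d}" by simp
    also have "\<dots> \<le> L2_set (z i) {..<d} + L2_set (\<lambda>l. - z' i l) {..<d}" by (rule L2_set_triangle_ineq)
    also have "L2_set (\<lambda>l. - z' i l) {..<d} = L2_set (z' i) {..<d}" by (simp add: L2_set_def)
    finally show ?thesis using zb[of i] by linarith
  qed
  have mm: "L2_set (\<lambda>l. center k J X l - center k J' X' l) {..<d} \<le> 4 * m * R / real k"
  proof -
    have cc: "center k r X l = center k r X' l" for l
      unfolding center_def using XX by (intro arg_cong2[where f = "(/)"] sum.cong refl) (auto simp: points_def)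
    have dev: "real (card (Q - r)) * \<rho> / real (card Q) \<le> 2 * m * \<rho> / real k"
      if Q: "Q \<subseteq> {..<k}" "r \<subseteq> Q" for Q
    proof -
      have "card (Q - r) \<le> card K" using Q fin by (intro card_mono) (auto simp: K_def)
      then have 1: "real (card (Q - r)) \<le> m" using cK by linarith
      have "card r \<le> card Q" using Q by (intro card_mono) (auto intro: finite_subset)
      then have 2: "real (card Q) \<ge> real k / 2" using rhalf by linarith
      have "real (card (Q - r)) * \<rho> / real (card Q) \<le> m * \<rho> / (real k / 2)"
        using 1 2 k6 \<rho>0 m3 by (intro frac_le mult_right_mono) auto
      then show ?thesis by (simp add: mult_ac)
    qed
    have b: "\<bar>center k J X l - center k J' X' l\<bar> \<le> 4 * m * \<rho> / real k" if l: "l < d" for l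
    proof -
      have rJ: "r \<subseteq> J" "r \<subseteq> J'" by (auto simp: r_def)
      have "\<bar>center k J X l - center k r X l\<bar> \<le> 2 * m * \<rho> / real k"
        by (rule order_trans[OF center_deviation[OF gJ(1) fin(1) rJ(1) rne l] dev[OF Js(1) rJ(1)]])
      moreover have "\<bar>center k J' X' l - center k r X' l\<bar> \<le> 2 * m * \<rho> / real k"
        by (rule order_trans[OF center_deviation[OF gJ(2) fin(2) rJ(2) rne l] dev[OF Js(2) rJ(2)]])
      moreover have "4 * m * \<rho> / real k = 2 * m * \<rho> / real k + 2 * m * \<rho> / real k" by simp
      ultimately show ?thesis unfolding cc by linarith
    qed
    have "(\<Sum>l<d. (center k J X l - center k J' X' l)\<^sup>2) \<le> real (card {..<d}) * (4 * m * \<rho> / real k)\<^sup>2"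
    proof (rule sum_bounded_above)
      fix l assume "l \<in> {..<d}"
      then have "\<bar>center k J X l - center k J' X' l\<bar> \<le> 4 * m * \<rho> / real k" using b by auto
      from power_mono[OF this abs_ge_zero, of 2]
      show "(center k J X l - center k J' X' l)\<^sup>2 \<le> (4 * m * \<rho> / real k)\<^sup>2" by simp
    qed
    also have "\<dots> = (4 * m * R / real k)\<^sup>2" by (simp add: power_divide power_mult_distrib R(2))
    finally show ?thesis unfolding L2_set_def using R(1) m3 k6 by (intro real_le_lsqrt) (auto simp: sum_nonneg)
  qed
  \<comment> \<open>12 is a rational upper bound for \<open>sqrt 128\<close>.\<close>
  have kg: "1 / sqrt (real k / 128) \<le> 12 / sqrt (real k)"
  proof -
    have "sqrt (real k / 128) \<ge> sqrt (real k) / 12"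
      by (rule real_le_rsqrt) (simp add: power_divide)
    moreover have "sqrt (real k) / 12 > 0" using k6 by simp
    ultimately have "1 / sqrt (real k / 128) \<le> 1 / (sqrt (real k) / 12)" by (intro divide_left_mono) auto
    then show ?thesis by simp
  qed
  have s: "sqrt (1 - 1 / (2 * real k)) \<ge> 1 / 2"
    by (rule real_le_rsqrt) (use k6 in \<open>simp add: power2_eq_square field_simps\<close>)
  \<comment> \<open>With \<open>a = 12 / sqrt k\<close>, the pairs in \<open>K\<close> cost
    \<open>4 * T * m * R * a\<close> and the center at most \<open>16 * T * m * R * a\<close>. The
    sum 20, multiplied by 12, is the constant 240 of \<open>c5\<close>.\<close>
  have \<eta>: "T * (2 * T * real (card K) * (2 * R) / sqrt (real k / 128) +
     2 * T * sqrt (real (card {..<k})) * (2 * (4 * m * R / real k) / sqrt (real k / 128))) \<le> 1 / 100"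
  proof -
    define a where "a = 12 / sqrt (real k)"
    have a: "1 / sqrt (real k / 128) \<le> a" "a \<ge> 0" using kg by (auto simp: a_def)
    have div: "y / sqrt (real k / 128) \<le> y * a" if "y \<ge> 0" for y
      using mult_left_mono[OF a(1) that] by simp
    have ak: "sqrt (real k) * a = 12" using k6 by (simp add: a_def)
    have k1: "1 \<le> sqrt (real k)" using k6 by simp
    have sk: "sqrt (real k) * sqrt (real k) = real k" by simp
    have "2 * T * real (card K) * (2 * R) / sqrt (real k / 128) \<le> 2 * T * m * (2 * R) * a"
    proof -
      have "2 * T * real (card K) * (2 * R) / sqrt (real k / 128) \<le> 2 * T * real (card K) * (2 * R) * a"
        using T1 R(1) by (intro div) auto
      also have "\<dots> \<le> 2 * T * m * (2 * R) * a" using T1 R(1) a(2) cK by (intro mult_right_mono mult_left_mono) auto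
      finally show ?thesis .
    qed
    moreover have "2 * T * sqrt (real (card {..<k})) * (2 * (4 * m * R / real k) / sqrt (real k / 128)) \<le> 16 * T * m * R * a"
    proof -
      have "2 * (4 * m * R / real k) / sqrt (real k / 128) \<le> 2 * (4 * m * R / real k) * a"
        using m3 R(1) by (intro div) auto
      then have "2 * T * sqrt (real k) * (2 * (4 * m * R / real k) / sqrt (real k / 128)) \<le>
         2 * T * sqrt (real k) * (2 * (4 * m * R / real k) * a)"
        using T1 by (intro mult_left_mono) auto
      also have "\<dots> = 16 * T * m * R * a / sqrt (real k)"
        using k6 by (simp add: field_simps)
      also have "\<dots> \<le> 16 * T * m * R * a / 1"
        using k1 T1 m3 R(1) a(2) by (intro divide_left_mono) auto
      finally show ?thesis by simp
    qed
    ultimately have "2 * T * real (card K) * (2 * R) / sqrt (real k / 128) +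
      2 * T * sqrt (real (card {..<k})) * (2 * (4 * m * R / real k) / sqrt (real k / 128)) \<le> 20 * T * m * R * a"
      by linarith
    then have "T * (2 * T * real (card K) * (2 * R) / sqrt (real k / 128) +
      2 * T * sqrt (real (card {..<k})) * (2 * (4 * m * R / real k) / sqrt (real k / 128))) \<le> T * (20 * T * m * R * a)"
      using T1 by (intro mult_left_mono) auto
    also have "\<dots> = 240 * T\<^sup>2 * m * R / sqrt (real k)" by (simp add: a_def power2_eq_square)
    also have "\<dots> \<le> 1 / 100" using c5 k6 unfolding R_def[symmetric] by (simp add: divide_le_eq)
    finally show ?thesis .
  qed
  have "measure P {\<omega>\<in>space P. mix d {..<k} (sqrt (1 - 1 / (2 * real k))) (center k J X) z (\<lambda>i\<in>{..<k}. 1 + \<omega> i) \<in> S} \<le>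
    exp 1 * measure P {\<omega>\<in>space P. mix d {..<k} (sqrt (1 - 1 / (2 * real k))) (center k J' X') z' (\<lambda>i\<in>{..<k}. 1 + \<omega> i) \<in> S}
      + 2 * (real (card {..<k}) + 3) * exp (- T\<^sup>2 / 2)"
  proof (rule mix_stable[where K = K and g = "real k / 128" and R = "2 * R" and B = "4 * m * R / real k", OF _ _ _ _ gram total _ _ mm s T1 _ \<eta> S])
    show "K \<subseteq> {..<k}" by (auto simp: K_def)
    show "z' i l = z i l" if "i \<in> {..<k} - K" "l < d" for i l using that(1) unfolding IK by (simp add: zr)
    show "4000 * T\<^sup>2 \<le> real (card ({..<k} - K))" unfolding IK using rhalf c4 by linarith
  qed (use k6 R(1) zK in auto)
  then show ?thesis
    unfolding J_def[symmetric] J'_def[symmetric] measure_subset_law[OF Js(1) X S] measure_subset_law[OF Js(2) X' S] subset_mix_def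
    using c6 by (simp add: z_def z'_def)
qed

lemma base_mechanism_exists:
  obtains A where "sampler (2 * k) (euclid d) A"
    and "\<And>X S. X \<in> space (data d (2 * k)) \<Longrightarrow> S \<in> sets (euclid d) \<Longrightarrow> measure (A X) S =
      gate \<tau> (discarded X) * measure (subset_law d k (chosen X) X) S +
      (1 - gate \<tau> (discarded X)) * indicator S (\<lambda>l\<in>{..<d}. 0)"
proof -
  define z0 where "z0 = (\<lambda>l\<in>{..<d}. 0 :: real)"
  have z0: "z0 \<in> space (euclid d)" by (auto simp: z0_def euclid_def space_PiM)
  define c where "c = (\<lambda>b X. if b then gate \<tau> (discarded X) else 1 - gate \<tau> (discarded X))"
  define K where "K = (\<lambda>b X. if b then subset_law d k (chosen X) X else return (euclid d) z0)"
  have gm[measurable]: "(\<lambda>X. gate \<tau> (discarded X)) \<in> borel_measurable (data d (2 * k))"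
    unfolding discarded_def by (rule measurable_compose[OF measurable_chosen]) simp
  have "(\<lambda>X. subset_law d k (chosen X) X) \<in> data d (2 * k) \<rightarrow>\<^sub>M prob_algebra (euclid d)"
    by (rule measurable_compose_countable'[OF measurable_subset_law measurable_chosen]) (auto intro: countable_finite)
  moreover have "(\<lambda>X. return (euclid d) z0) \<in> data d (2 * k) \<rightarrow>\<^sub>M prob_algebra (euclid d)"
    by (rule measurable_const) (simp add: space_prob_algebra z0 prob_space_return)
  ultimately have K: "K b \<in> data d (2 * k) \<rightarrow>\<^sub>M prob_algebra (euclid d)" for b
    by (cases b) (simp_all add: K_def)
  have cm: "c b \<in> borel_measurable (data d (2 * k))" for b by (cases b) (simp_all add: c_def)
  obtain A where A: "A \<in> data d (2 * k) \<rightarrow>\<^sub>M prob_algebra (euclid d)"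
    "\<And>X S. X \<in> space (data d (2 * k)) \<Longrightarrow> S \<in> sets (euclid d) \<Longrightarrow> measure (A X) S = (\<Sum>b\<in>UNIV. c b X * measure (K b X) S)"
    by (rule kernel_mixture[where F = "UNIV :: bool set" and c = c and A = K and M = "data d (2 * k)" and N = "euclid d"])
      (use cm K gate_bounds in \<open>auto simp: c_def UNIV_bool\<close>)
  show ?thesis
  proof (rule that)
    show "sampler (2 * k) (euclid d) A" unfolding sampler_def by (rule A(1))
    show "measure (A X) S = gate \<tau> (discarded X) * measure (subset_law d k (chosen X) X) S +
      (1 - gate \<tau> (discarded X)) * indicator S (\<lambda>l\<in>{..<d}. 0)"
      if "X \<in> space (data d (2 * k))" "S \<in> sets (euclid d)" for X S
      unfolding A(2)[OF that] using that(2) by (simp add: UNIV_bool c_def K_def measure_return z0_def)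
  qed
qed

lemma base_mechanism_private:
  assumes A: "\<And>X S. X \<in> space (data d (2 * k)) \<Longrightarrow> S \<in> sets (euclid d) \<Longrightarrow> measure (A X) S =
      gate \<tau> (discarded X) * measure (subset_law d k (chosen X) X) S +
      (1 - gate \<tau> (discarded X)) * indicator S (\<lambda>l\<in>{..<d}. 0)"
  shows "diff_private 2 \<delta> (2 * k) (euclid d) A"
  unfolding diff_private_def
proof (intro ballI impI)
  fix X X' S assume X: "X \<in> space (data d (2 * k))" and X': "X' \<in> space (data d (2 * k))"
    and nb: "neighbors (2 * k) X X'" and S: "S \<in> sets (euclid d)"
  from nb obtain w where w: "{i. i < 2 * k \<and> X i \<noteq> X' i} = {w}"
    unfolding neighbors_def by (auto simp: card_1_singleton_iff)
  define i0 where "i0 = (if w < k then w else w - k)"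
  have "w < 2 * k" using w by blast
  then have i0: "i0 < k" by (auto simp: i0_def)
  have same: "X u = X' u" if "u < 2 * k" "u \<noteq> i0" "u \<noteq> k + i0" for u
  proof (rule ccontr)
    assume "X u \<noteq> X' u"
    then have "u = w" using w that(1) by blast
    then show False using that by (auto simp: i0_def split: if_splits)
  qed
  define h where "h = measure (subset_law d k (chosen X) X) S"
  define h' where "h' = measure (subset_law d k (chosen X') X') S"
  define p where "p = gate \<tau> (discarded X)"
  define p' where "p' = gate \<tau> (discarded X')"
  define I :: real where "I = indicator S (\<lambda>l\<in>{..<d}. 0)"
  have I: "0 \<le> I" by (simp add: I_def)
  have h: "0 \<le> h" "h \<le> 1" "0 \<le> h'"
  proof -
    have "prob_space (subset_law d k (chosen X) X)"
      using measurable_space[OF measurable_subset_law[OF chosen(1)] X] by (simp add: space_prob_algebra)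
    then show "h \<le> 1" unfolding h_def by (rule prob_space.prob_le_1)
  qed (simp_all add: h_def h'_def)
  have p: "0 \<le> p" "p \<le> 1" "0 \<le> p'" "p' \<le> 1" unfolding p_def p'_def by (rule gate_bounds)+
  have T: "discarded X' \<le> discarded X + 1" "discarded X \<le> discarded X' + 1"
    using discarded_neighbor[OF i0, of X X'] discarded_neighbor[OF i0, of X' X] same by auto
  have g: "p \<le> exp 1 * p'" "1 - p \<le> exp 1 * (1 - p')"
    unfolding p_def p'_def by (rule gate_neighbor[OF T(2,1)])+
  have e2: "exp (2::real) = exp 1 * exp 1" by (simp add: exp_add[symmetric])
  have e1: "exp (1::real) \<ge> 1" by simp
  have \<delta>0: "\<delta> \<ge> 0" using c7 by (meson exp_ge_zero order_trans)
  have rest: "(1 - p) * I \<le> exp 2 * ((1 - p') * I)"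
  proof -
    have "exp 1 * (1 - p') \<le> exp 2 * (1 - p')" using p by (intro mult_right_mono) auto
    with g(2) have "1 - p \<le> exp 2 * (1 - p')" by linarith
    from mult_right_mono[OF this I] show ?thesis by (simp add: mult.assoc)
  qed
  have main: "p * h \<le> exp 2 * (p' * h') + \<delta>"
  proof (cases "discarded X \<le> t")
    case True
    have "h \<le> exp 1 * h' + \<delta>"
      unfolding h_def h'_def using True T(1) by (intro law_stable[OF X X' i0 same _ _ S]) auto
    then have "p * h \<le> p * (exp 1 * h' + \<delta>)" using p by (intro mult_left_mono) auto
    also have "\<dots> \<le> (exp 1 * p') * (exp 1 * h') + \<delta>"
    proof -
      have "p * (exp 1 * h') \<le> (exp 1 * p') * (exp 1 * h')" using g(1) h by (intro mult_right_mono) auto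
      moreover have "p * \<delta> \<le> \<delta>" using p \<delta>0 mult_right_mono[of p 1 \<delta>] by simp
      ultimately show ?thesis by (simp add: algebra_simps)
    qed
    finally show ?thesis by (simp add: e2 mult_ac)
  next
    case False
    have "p \<le> \<delta>"
    proof -
      have "p \<le> 1 / exp (real (discarded X) - \<tau>)"
        unfolding p_def gate_def by (intro divide_left_mono) (auto simp: add_pos_pos)
      also have "\<dots> = exp (\<tau> - real (discarded X))" by (simp add: exp_minus[symmetric] inverse_eq_divide[symmetric])
      also have "\<dots> \<le> exp (\<tau> - (real t + 1))" using False by simp
      finally show ?thesis using c7 by linarith
    qed
    then have "p * h \<le> \<delta>" using h p mult_mono[of p \<delta> h 1] \<delta>0 by simp
    moreover have "exp 2 * (p' * h') \<ge> 0" using p h by simp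
    ultimately show ?thesis by linarith
  qed
  have "measure (A X) S = p * h + (1 - p) * I" "measure (A X') S = p' * h' + (1 - p') * I"
    unfolding A[OF X S] A[OF X' S] by (simp_all add: p_def h_def p'_def h'_def I_def)
  then show "measure (A X) S \<le> exp 2 * measure (A X') S + \<delta>"
    using main rest by (simp add: distrib_left)
qed

end

section \<open>Accuracy of the base mechanism\<close>

lemma sum_lessThan_double: "(\<Sum>u<2 * k. f u) = (\<Sum>i<k. f i + f (k + i))" for f :: "nat \<Rightarrow> 'a::comm_monoid_add"
proof -
  have "{..<2 * k} = {..<k} \<union> (+) k ` {..<k}"
  proof (rule Set.set_eqI)
    fix u
    show "u \<in> {..<2 * k} \<longleftrightarrow> u \<in> {..<k} \<union> (+) k ` {..<k}"
      by (cases "u < k") (auto simp: image_iff intro!: bexI[of _ "u - k"])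
  qed
  moreover have "{..<k} \<inter> (+) k ` {..<k} = {}" by auto
  ultimately have "(\<Sum>u<2 * k. f u) = (\<Sum>i<k. f i) + (\<Sum>u\<in>(+) k ` {..<k}. f u)"
    by (simp add: sum.union_disjoint)
  also have "(\<Sum>u\<in>(+) k ` {..<k}. f u) = (\<Sum>i<k. f (k + i))"
    by (subst sum.reindex) (auto simp: inj_on_def)
  finally show ?thesis by (simp add: sum.distrib)
qed

lemma sum_Times_fst_snd: "(\<Sum>a\<in>U \<times> W. f (fst a) (snd a)) = (\<Sum>u\<in>U. \<Sum>j\<in>W. f u j)"
  by (simp add: sum.cartesian_product case_prod_beta)

section \<open>Kernels evaluated on i.i.d. data\<close>

lemma sets_iid: "sets D = sets X \<Longrightarrow> sets (iid n D) = sets (datasets n X)"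
  unfolding iid_def datasets_def by (intro sets_PiM_cong) auto

lemma space_iid: "sets D = sets X \<Longrightarrow> space (iid n D) = space (datasets n X)"
  by (rule sets_eq_imp_space_eq[OF sets_iid])

lemma prob_space_iid: "prob_space D \<Longrightarrow> prob_space (iid n D)"
  unfolding iid_def by (rule prob_space_PiM)

lemma measurable_kernel_measure:
  assumes "A \<in> M \<rightarrow>\<^sub>M prob_algebra N" "S \<in> sets N"
  shows "(\<lambda>x. measure (A x) S) \<in> borel_measurable M"
proof -
  have "(\<lambda>x. emeasure (A x) S) \<in> borel_measurable M"
    by (rule measurable_compose[OF measurable_prob_algebraD[OF assms(1)] measurable_emeasure_subprob_algebra[OF assms(2)]])
  then show ?thesis unfolding measure_def by measurable
qed

lemma kernel_measure_bounds:
  assumes "A \<in> M \<rightarrow>\<^sub>M prob_algebra N" "x \<in> space M"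
  shows "0 \<le> measure (A x) S" "measure (A x) S \<le> 1"
proof -
  have "prob_space (A x)" using measurable_space[OF assms] by (simp add: space_prob_algebra)
  then show "measure (A x) S \<le> 1" by (rule prob_space.prob_le_1)
qed simp

lemma measure_output_distr:
  assumes D: "prob_space D" "sets D = sets X" and A: "sampler n X A" and S: "S \<in> sets X"
  shows "measure (output_distr n A D) S = (\<integral>Y. measure (A Y) S \<partial>iid n D)"
proof -
  interpret prob_space "iid n D" by (rule prob_space_iid[OF D(1)])
  interpret subprob_space "iid n D" by (rule prob_space_imp_subprob_space) (rule prob_space_axioms)
  have "A \<in> iid n D \<rightarrow>\<^sub>M subprob_algebra X"
    using measurable_prob_algebraD[OF A[unfolded sampler_def]] measurable_cong_sets[OF sets_iid[OF D(2), of n] refl]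
    by blast
  then show ?thesis unfolding output_distr_def by (rule measure_bind[OF _ S])
qed

lemma integrable_kernel_measure:
  assumes D: "prob_space D" "sets D = sets X" and A: "A \<in> datasets n X \<rightarrow>\<^sub>M prob_algebra N" and S: "S \<in> sets N"
  shows "integrable (iid n D) (\<lambda>Y. measure (A Y) S)"
proof -
  interpret prob_space "iid n D" by (rule prob_space_iid[OF D(1)])
  show ?thesis
  proof (rule integrable_const_bound[where B = 1])
    show "(\<lambda>Y. measure (A Y) S) \<in> borel_measurable (iid n D)"
      using measurable_kernel_measure[OF A S] measurable_cong_sets[OF sets_iid[OF D(2), of n] refl] by blast
    show "AE Y in iid n D. norm (measure (A Y) S) \<le> 1"
      using kernel_measure_bounds[OF A] by (intro AE_I2) (auto simp: space_iid[OF D(2)])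
  qed
qed

lemma measure_UN_le_card:
  assumes "prob_space M" "finite I" "\<And>i. i \<in> I \<Longrightarrow> F i \<in> sets M" "\<And>i. i \<in> I \<Longrightarrow> measure M (F i) \<le> b"
  shows "measure M (\<Union>i\<in>I. F i) \<le> real (card I) * b"
proof -
  interpret prob_space M by fact
  have "measure M (\<Union>i\<in>I. F i) \<le> (\<Sum>i\<in>I. measure M (F i))"
    using assms by (intro finite_measure_subadditive_finite) auto
  also have "\<dots> \<le> real (card I) * b" using assms(4) by (rule sum_bounded_above)
  finally show ?thesis .
qed

text \<open>A union bound over events on the underlying standard normal array: a sample coordinate
  far from its mean (\<open>E1\<close>), a large coordinate sum of half differences
  (\<open>E2\<close>), and a small quadratic form in a grid direction (\<open>E3\<close>). The first
  two are upper tails of linear functionals, the third is a lower tail of a sum of independent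
  squares.\<close>

lemma full_subset_good:
  fixes M :: "nat \<Rightarrow> nat \<Rightarrow> real"
  assumes D: "D = distr (PiM {..<d} (\<lambda>_. std_normal)) (euclid d) (affine_image d \<mu> M)"
    and lower: "\<And>v. (\<Sum>l<d. (v l)\<^sup>2) \<le> (\<Sum>j<d. (\<Sum>l<d. v l * M l j)\<^sup>2)"
    and upper: "\<And>v. (\<Sum>j<d. (\<Sum>l<d. v l * M l j)\<^sup>2) \<le> \<kappa> * (\<Sum>l<d. (v l)\<^sup>2)"
    and T: "T \<ge> 0" and \<kappa>: "\<kappa> \<ge> 0" and d: "d \<ge> 1" and k: "k \<ge> 1"
    and \<rho>: "\<rho> = 2 * (T * sqrt \<kappa>)" and B: "B = T * sqrt (real k * \<kappa>)"
  shows "measure (iid (2 * k) D) {X\<in>space (iid (2 * k) D). \<not> good d k N \<rho> B X {..<k}} \<le>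
    (4 * real k * real d + 2 * real d) * exp (- T\<^sup>2 / 2) + (2 * real N + 1) ^ d * exp (- real k / 2)"
proof -
  let ?I = "{..<2 * k} \<times> {..<d}"
  let ?P = "PiM ?I (\<lambda>_. std_normal)"
  interpret P: prob_space ?P by (rule prob_space_PiM_std_normal)
  define r where "r = (\<lambda>\<omega>. \<lambda>i\<in>{..<2 * k}. affine_image d \<mu> M (\<lambda>j. \<omega> (i, j)))"
  have coord: "(\<lambda>\<omega>. \<omega> a) \<in> borel_measurable ?P" if "a \<in> ?I" for a
    using measurable_component_singleton[OF that, of "\<lambda>_. std_normal"] by simp
  have r: "r \<in> ?P \<rightarrow>\<^sub>M data d (2 * k)"
    unfolding r_def datasets_def euclid_def affine_image_def
    by (intro measurable_restrict borel_measurable_add borel_measurable_const borel_measurable_sum borel_measurable_times)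
      (auto intro: coord)
  have sD: "sets D = sets (euclid d)" unfolding D by simp
  have iid: "iid (2 * k) D = distr ?P (data d (2 * k)) r"
    unfolding r_def by (rule iid_representation[OF D])
  have rX: "r \<omega> u l = \<mu> l + (\<Sum>j<d. M l j * \<omega> (u, j))" if "u < 2 * k" "l < d" for \<omega> u l
    using that by (simp add: r_def affine_image_def)
  have row: "(\<Sum>j<d. (M l j)\<^sup>2) \<le> \<kappa>" if l: "l < d" for l
  proof -
    have "(\<Sum>i<d. (if i = l then 1 else 0) * M i j) = M l j" for j
    proof -
      have "(\<Sum>i<d. (if i = l then 1 else 0) * M i j) = (\<Sum>i<d. if i = l then M i j else 0)" by (intro sum.cong) auto
      then show ?thesis using l by simp
    qed
    moreover have "(\<Sum>i<d. (if i = l then 1 else 0 :: real)\<^sup>2) = 1"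
    proof -
      have "(\<Sum>i<d. (if i = l then 1 else 0 :: real)\<^sup>2) = (\<Sum>i<d. if i = l then 1 else 0)" by (intro sum.cong) auto
      then show ?thesis using l by simp
    qed
    ultimately show ?thesis using upper[of "\<lambda>i. if i = l then 1 else 0"] by simp
  qed
  define t where "t = 2 * exp (- T\<^sup>2 / 2)"
  \<comment> \<open>Signs and scale that express a half difference as a linear functional of the
    array; the mean cancels.\<close>
  define sg :: "nat \<Rightarrow> real" where "sg = (\<lambda>u. if u < k then 1 / sqrt 2 else - 1 / sqrt 2)"
  have sg2: "(sg u)\<^sup>2 = 1 / 2" for u by (simp add: sg_def power_divide)
  have hd: "half_diff k (r \<omega>) i l = (\<Sum>a\<in>{i, k + i} \<times> {..<d}. sg (fst a) * M l (snd a) * \<omega> a)"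
    if "i < k" "l < d" for \<omega> i l
  proof -
    have "(\<Sum>a\<in>{i, k + i} \<times> {..<d}. sg (fst a) * M l (snd a) * \<omega> a) =
       (\<Sum>u\<in>{i, k + i}. \<Sum>j<d. sg u * M l j * \<omega> (u, j))"
      by (simp add: sum.cartesian_product case_prod_beta)
    also have "\<dots> = (\<Sum>j<d. M l j * \<omega> (i, j)) / sqrt 2 - (\<Sum>j<d. M l j * \<omega> (k + i, j)) / sqrt 2"
      using that by (simp add: sg_def sum_divide_distrib sum_negf mult_ac)
    finally show ?thesis using that by (simp add: half_diff_def rX diff_divide_distrib)
  qed
  define E1 where "E1 = (\<lambda>(u, l). {\<omega>\<in>space ?P. T * sqrt \<kappa> < \<bar>\<Sum>a\<in>{u} \<times> {..<d}. M l (snd a) * \<omega> a\<bar>})"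
  define E2 where "E2 = (\<lambda>l. {\<omega>\<in>space ?P. T * sqrt (real k * \<kappa>) < \<bar>\<Sum>a\<in>?I. sg (fst a) * M l (snd a) * \<omega> a\<bar>})"
  define E3 where "E3 = (\<lambda>v. {\<omega>\<in>space ?P. (\<Sum>i<k. (\<Sum>a\<in>{i, k + i} \<times> {..<d}. sg (fst a) * (\<Sum>l<d. v l * M l (snd a)) * \<omega> a)\<^sup>2)
    < real (card {..<k}) * (L2_set v {..<d})\<^sup>2 / 8})"
  \<comment> \<open>The lower tail bound needs positive variance, so the zero vector is left out;
    for it the Gram condition is trivial.\<close>
  define V where "V = {v\<in>grid d N. L2_set v {..<d} > 0}"
  have V: "finite V" "card V \<le> (2 * N + 1) ^ d"
    using finite_grid[of d N] card_mono[OF finite_grid[of d N], of V] by (auto simp: V_def card_grid)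
  have lf: "(\<lambda>\<omega>. \<Sum>a\<in>A. c a * \<omega> a) \<in> borel_measurable ?P" if "A \<subseteq> ?I" for A c
    using that by (rule measurable_linear_functional)
  have m1: "E1 x \<in> sets ?P" if "x \<in> ?I" for x
  proof -
    have [measurable]: "(\<lambda>\<omega>. \<Sum>a\<in>{fst x} \<times> {..<d}. M (snd x) (snd a) * \<omega> a) \<in> borel_measurable ?P"
      using that by (intro lf) auto
    show ?thesis unfolding E1_def case_prod_beta by measurable
  qed
  have m2: "E2 l \<in> sets ?P" for l
  proof -
    have [measurable]: "(\<lambda>\<omega>. \<Sum>a\<in>?I. sg (fst a) * M l (snd a) * \<omega> a) \<in> borel_measurable ?P"
      by (intro lf) auto
    show ?thesis unfolding E2_def by measurable
  qed
  have m3: "E3 v \<in> sets ?P" for v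
  proof -
    have [measurable]: "(\<lambda>\<omega>. \<Sum>i<k. (\<Sum>a\<in>{i, k + i} \<times> {..<d}. sg (fst a) * (\<Sum>l<d. v l * M l (snd a)) * \<omega> a)\<^sup>2) \<in> borel_measurable ?P"
      by (intro borel_measurable_sum borel_measurable_power lf) auto
    show ?thesis unfolding E3_def by measurable
  qed
  have p1: "P.prob (E1 x) \<le> t" if xI: "x \<in> ?I" for x
  proof -
    obtain u l where x: "x = (u, l)" "u < 2 * k" "l < d" using xI by (cases x) auto
    have "(\<Sum>a\<in>{u} \<times> {..<d}. (M l (snd a))\<^sup>2) = (\<Sum>j<d. (M l j)\<^sup>2)"
      by (rule sum.reindex_bij_witness[of _ "\<lambda>j. (u, j)" snd]) auto
    then have "(\<Sum>a\<in>{u} \<times> {..<d}. (M l (snd a))\<^sup>2) \<le> (sqrt \<kappa>)\<^sup>2" using row[OF x(3)] \<kappa> by simp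
    then show ?thesis unfolding E1_def t_def x(1) prod.case
      using x T \<kappa> by (intro linear_functional_tail) auto
  qed
  have p2: "P.prob (E2 l) \<le> t" if l: "l < d" for l
  proof -
    have "(\<Sum>a\<in>?I. (sg (fst a) * M l (snd a))\<^sup>2) = (\<Sum>u<2 * k. \<Sum>j<d. (1 / 2) * (M l j)\<^sup>2)"
      unfolding sum_Times_fst_snd[where f = "\<lambda>u j. (sg u * M l j)\<^sup>2"] by (simp only: power_mult_distrib sg2)
    also have "\<dots> = real k * (\<Sum>j<d. (M l j)\<^sup>2)" by (simp add: sum_divide_distrib[symmetric])
    also have "\<dots> \<le> real k * \<kappa>" using row[OF l] by (intro mult_left_mono) auto
    also have "\<dots> = (sqrt (real k * \<kappa>))\<^sup>2" using \<kappa> by simp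
    finally show ?thesis unfolding E2_def t_def
      using T \<kappa> by (intro linear_functional_tail) auto
  qed
  have p3: "P.prob (E3 v) \<le> exp (- real k / 2)" if v: "v \<in> V" for v
  proof -
    have "P.prob (E3 v) \<le> exp (- real (card {..<k}) / 2)"
      unfolding E3_def
    proof (rule sum_squares_lower_tail)
      show "?I \<noteq> {}" using d k by (auto simp: lessThan_empty_iff)
      show "disjoint_family_on (\<lambda>i. {i, k + i} \<times> {..<d}) {..<k}" by (auto simp: disjoint_family_on_def)
      show "0 < L2_set v {..<d}" using v by (simp add: V_def)
      fix i assume i: "i \<in> {..<k}"
      have "(\<Sum>a\<in>{i, k + i} \<times> {..<d}. (sg (fst a) * (\<Sum>l<d. v l * M l (snd a)))\<^sup>2) =
         (\<Sum>u\<in>{i, k + i}. \<Sum>j<d. (1 / 2) * (\<Sum>l<d. v l * M l j)\<^sup>2)"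
        unfolding sum_Times_fst_snd[where f = "\<lambda>u j. (sg u * (\<Sum>l<d. v l * M l j))\<^sup>2"] by (simp only: power_mult_distrib sg2)
      also have "\<dots> = (\<Sum>j<d. (\<Sum>l<d. v l * M l j)\<^sup>2)" using i by (simp add: sum_divide_distrib[symmetric])
      finally show "(L2_set v {..<d})\<^sup>2 \<le> (\<Sum>a\<in>{i, k + i} \<times> {..<d}. (sg (fst a) * (\<Sum>l<d. v l * M l (snd a)))\<^sup>2)"
        using lower[of v] by (simp add: L2_set_def sum_nonneg)
    qed auto
    then show ?thesis by simp
  qed
  let ?U = "(\<Union>x\<in>?I. E1 x) \<union> ((\<Union>l\<in>{..<d}. E2 l) \<union> (\<Union>v\<in>V. E3 v))"
  have incl: "{\<omega>\<in>space ?P. \<not> good d k N \<rho> B (r \<omega>) {..<k}} \<subseteq> ?U"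
  proof (rule subsetI, rule ccontr)
    fix \<omega> assume \<omega>: "\<omega> \<in> {\<omega>\<in>space ?P. \<not> good d k N \<rho> B (r \<omega>) {..<k}}" and no: "\<omega> \<notin> ?U"
    have dev: "\<bar>r \<omega> u l - \<mu> l\<bar> \<le> T * sqrt \<kappa>" if "u < 2 * k" "l < d" for u l
    proof -
      have "(\<Sum>a\<in>{u} \<times> {..<d}. M l (snd a) * \<omega> a) = (\<Sum>j<d. M l j * \<omega> (u, j))"
        by (rule sum.reindex_bij_witness[of _ "\<lambda>j. (u, j)" snd]) auto
      then show ?thesis using no \<omega> that by (force simp: E1_def rX not_less)
    qed
    have "good d k N \<rho> B (r \<omega>) {..<k}"
      unfolding good_def
    proof (intro conjI ballI allI impI)
      fix u u' l assume u: "u \<in> points k {..<k}" "u' \<in> points k {..<k}" and l: "l < d"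
      then show "\<bar>r \<omega> u l - r \<omega> u' l\<bar> \<le> \<rho>"
        using dev[of u l] dev[of u' l] points_less[of "{..<k}" k] unfolding \<rho> by fastforce
    next
      fix v assume v: "v \<in> grid d N"
      have hs: "(\<Sum>l<d. v l * half_diff k (r \<omega>) i l) =
         (\<Sum>a\<in>{i, k + i} \<times> {..<d}. sg (fst a) * (\<Sum>l<d. v l * M l (snd a)) * \<omega> a)" if "i < k" for i
      proof -
        have "(\<Sum>l<d. v l * half_diff k (r \<omega>) i l) =
          (\<Sum>l<d. \<Sum>a\<in>{i, k + i} \<times> {..<d}. v l * (sg (fst a) * M l (snd a) * \<omega> a))"
          using that by (simp add: hd sum_distrib_left)
        also have "\<dots> = (\<Sum>a\<in>{i, k + i} \<times> {..<d}. \<Sum>l<d. v l * (sg (fst a) * M l (snd a) * \<omega> a))"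
          by (rule sum.swap)
        also have "\<dots> = (\<Sum>a\<in>{i, k + i} \<times> {..<d}. sg (fst a) * (\<Sum>l<d. v l * M l (snd a)) * \<omega> a)"
          by (intro sum.cong refl) (simp add: sum_distrib_left sum_distrib_right mult_ac)
        finally show ?thesis .
      qed
      have v2: "(\<Sum>l<d. (v l)\<^sup>2) = (L2_set v {..<d})\<^sup>2" by (simp add: L2_set_def sum_nonneg)
      have "real k / 8 * (\<Sum>l<d. (v l)\<^sup>2) \<le> (\<Sum>i<k. (\<Sum>l<d. v l * half_diff k (r \<omega>) i l)\<^sup>2)"
      proof (cases "v \<in> V")
        case True
        then show ?thesis using no \<omega> by (force simp: E3_def hs v2 not_less)
      next
        case False
        then have "L2_set v {..<d} = 0" using v L2_set_nonneg[of v "{..<d}"] by (auto simp: V_def)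
        then show ?thesis unfolding v2 by (simp add: sum_nonneg)
      qed
      then show "(real k / 8 - (real k - real (card {..<k})) * (real d * \<rho>\<^sup>2)) * (\<Sum>l<d. (v l)\<^sup>2)
        \<le> (\<Sum>i<k. (\<Sum>l<d. v l * half_diff k (r \<omega>) i l)\<^sup>2)" by simp
    next
      fix l assume l: "l < d"
      have "(\<Sum>i<k. half_diff k (r \<omega>) i l) = (\<Sum>i<k. (\<Sum>j<d. sg i * M l j * \<omega> (i, j)) + (\<Sum>j<d. sg (k + i) * M l j * \<omega> (k + i, j)))"
      proof (intro sum.cong refl)
        fix i assume "i \<in> {..<k}"
        then show "half_diff k (r \<omega>) i l = (\<Sum>j<d. sg i * M l j * \<omega> (i, j)) + (\<Sum>j<d. sg (k + i) * M l j * \<omega> (k + i, j))"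
          using l by (simp add: half_diff_def rX sg_def sum_divide_distrib sum_negf diff_divide_distrib mult_ac)
      qed
      also have "\<dots> = (\<Sum>u<2 * k. \<Sum>j<d. sg u * M l j * \<omega> (u, j))" by (simp add: sum_lessThan_double)
      also have "\<dots> = (\<Sum>a\<in>?I. sg (fst a) * M l (snd a) * \<omega> a)"
        by (simp add: sum.cartesian_product case_prod_beta)
      finally show "\<bar>\<Sum>i<k. half_diff k (r \<omega>) i l\<bar> \<le> B + (real k - real (card {..<k})) * \<rho>"
        using no \<omega> l by (force simp: E2_def B not_less)
    qed
    then show False using \<omega> by simp
  qed
  have predg: "Measurable.pred (data d (2 * k)) (\<lambda>X. good d k N \<rho> B X {..<k})" by (rule pred_good) simp
  have "measure (iid (2 * k) D) {X\<in>space (iid (2 * k) D). \<not> good d k N \<rho> B X {..<k}} =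
    P.prob {\<omega>\<in>space ?P. \<not> good d k N \<rho> B (r \<omega>) {..<k}}"
  proof -
    have "{X\<in>space (data d (2 * k)). \<not> good d k N \<rho> B X {..<k}} \<in> sets (data d (2 * k))"
      using predg by measurable
    then have "measure (distr ?P (data d (2 * k)) r) {X\<in>space (data d (2 * k)). \<not> good d k N \<rho> B X {..<k}} =
      P.prob (r -` {X\<in>space (data d (2 * k)). \<not> good d k N \<rho> B X {..<k}} \<inter> space ?P)"
      by (rule measure_distr[OF r])
    also have "r -` {X\<in>space (data d (2 * k)). \<not> good d k N \<rho> B X {..<k}} \<inter> space ?P =
      {\<omega>\<in>space ?P. \<not> good d k N \<rho> B (r \<omega>) {..<k}}"
      using measurable_space[OF r] by auto
    finally show ?thesis unfolding iid by simp
  qed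
  also have "\<dots> \<le> P.prob ?U"
    by (intro P.finite_measure_mono incl sets.Un sets.finite_UN m1 m2 m3 V) auto
  also have "\<dots> \<le> P.prob (\<Union>x\<in>?I. E1 x) + (P.prob (\<Union>l\<in>{..<d}. E2 l) + P.prob (\<Union>v\<in>V. E3 v))"
    by (intro order_trans[OF measure_Un_le] add_left_mono measure_Un_le sets.Un sets.finite_UN m1 m2 m3 V) auto
  also have "\<dots> \<le> real (card ?I) * t + (real (card {..<d}) * t + real (card V) * exp (- real k / 2))"
    by (intro add_mono measure_UN_le_card P.prob_space_axioms V(1) m1 m2 m3 p1 p2 p3) auto
  also have "\<dots> \<le> (4 * real k * real d + 2 * real d) * exp (- T\<^sup>2 / 2) + (2 * real N + 1) ^ d * exp (- real k / 2)"
  proof -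
    have "real (card V) \<le> real ((2 * N + 1) ^ d)" using V(2) by (rule of_nat_mono)
    also have "real ((2 * N + 1) ^ d) = (2 * real N + 1) ^ d" by (simp add: add.commute)
    finally have "real (card V) * exp (- real k / 2) \<le> (2 * real N + 1) ^ d * exp (- real k / 2)"
      by (intro mult_right_mono) auto
    then show ?thesis by (simp add: t_def card_cartesian_product algebra_simps)
  qed
  finally show ?thesis .
qed

text \<open>By Fubini the normal variables may be fixed first. For almost all of them the output is
  a combination of the samples whose weights satisfy both identities, so its law is already
  \<open>D\<close> before averaging.\<close>

lemma integral_subset_law_full:
  assumes D: "D = distr (PiM {..<d} (\<lambda>_. std_normal)) (euclid d) (affine_image d \<mu> M)"
    and d: "d \<ge> 1" and k: "k \<ge> 1" and S: "S \<in> sets (euclid d)"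
  shows "(\<integral>X. measure (subset_law d k {..<k} X) S \<partial>iid (2 * k) D) = measure D S"
proof -
  let ?P = "PiM {..<k} (\<lambda>_. std_normal)" and ?Q = "iid (2 * k) D"
  interpret P: prob_space ?P by (rule prob_space_PiM_std_normal)
  interpret G: prob_space "PiM {..<d} (\<lambda>_. std_normal)" by (rule prob_space_PiM_std_normal)
  have pD: "prob_space D" unfolding D by (rule G.prob_space_distr[OF measurable_affine_image])
  interpret D: prob_space D by (rule pD)
  have sD: "sets D = sets (euclid d)" unfolding D by simp
  interpret Q: prob_space ?Q by (rule prob_space_iid[OF pD])
  interpret PQ: pair_sigma_finite ?Q ?P ..
  have sQ: "sets ?Q = sets (data d (2 * k))" by (rule sets_iid[OF sD])
  have spQ: "space ?Q = space (data d (2 * k))" by (rule space_iid[OF sD])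
  have mixm: "(\<lambda>(X, \<omega>). subset_mix d k {..<k} X \<omega>) \<in> ?Q \<Otimes>\<^sub>M ?P \<rightarrow>\<^sub>M euclid d"
    using measurable_subset_mix[of "{..<k}" k d]
      measurable_cong_sets[OF sets_pair_measure_cong[OF sQ refl] refl, of ?P "euclid d"] by blast
  have "(\<integral>\<^sup>+X. ennreal (measure (subset_law d k {..<k} X) S) \<partial>?Q) = (\<integral>\<^sup>+X. \<integral>\<^sup>+\<omega>. indicator S (subset_mix d k {..<k} X \<omega>) \<partial>?P \<partial>?Q)"
  proof (rule nn_integral_cong)
    fix X assume X: "X \<in> space ?Q"
    have m: "subset_mix d k {..<k} X \<in> ?P \<rightarrow>\<^sub>M euclid d"
      using X by (intro measurable_subset_mix_fixed) (auto simp: spQ)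
    interpret L: prob_space "subset_law d k {..<k} X"
      unfolding subset_law_def by (rule P.prob_space_distr[OF m])
    have "ennreal (measure (subset_law d k {..<k} X) S) = emeasure (subset_law d k {..<k} X) S"
      by (simp add: L.emeasure_eq_measure)
    also have "\<dots> = (\<integral>\<^sup>+x. indicator S x \<partial>distr ?P (euclid d) (subset_mix d k {..<k} X))"
      unfolding subset_law_def using S by simp
    also have "\<dots> = (\<integral>\<^sup>+\<omega>. indicator S (subset_mix d k {..<k} X \<omega>) \<partial>?P)"
      using S by (intro nn_integral_distr[OF m]) simp
    finally show "ennreal (measure (subset_law d k {..<k} X) S) = (\<integral>\<^sup>+\<omega>. indicator S (subset_mix d k {..<k} X \<omega>) \<partial>?P)" .
  qed
  also have "\<dots> = (\<integral>\<^sup>+\<omega>. \<integral>\<^sup>+X. indicator S (subset_mix d k {..<k} X \<omega>) \<partial>?Q \<partial>?P)"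
  proof (rule PQ.Fubini'[symmetric])
    show "(\<lambda>(X, \<omega>). indicator S (subset_mix d k {..<k} X \<omega>) :: ennreal) \<in> borel_measurable (?Q \<Otimes>\<^sub>M ?P)"
      using measurable_compose[OF mixm borel_measurable_indicator[OF S]] by (simp add: split_beta')
  qed
  also have "\<dots> = (\<integral>\<^sup>+\<omega>. emeasure D S \<partial>?P)"
  proof (rule nn_integral_cong_AE)
    \<comment> \<open>Excludes the null event that all \<open>1 + \<omega> i\<close> vanish, where
      division by the norm would break the identity for the squared weights.\<close>
    have "AE \<omega> in ?P. \<omega> 0 \<noteq> -1"
    proof -
      have k0: "0 \<in> {..<k}" using k by auto
      have "distributed ?P lborel (\<lambda>\<omega>. \<omega> 0) std_normal_density" by (rule distributed_coordinate[OF k0])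
      then have dd: "distr ?P lborel (\<lambda>\<omega>. \<omega> 0) = std_normal" "(\<lambda>\<omega>. \<omega> 0) \<in> ?P \<rightarrow>\<^sub>M lborel" by (auto simp: distributed_def)
      have "AE x in lborel. x \<noteq> (-1 :: real)" by (rule AE_lborel_singleton)
      then have "AE x in std_normal. x \<noteq> -1" by (subst AE_density) auto
      then show ?thesis using AE_distrD[OF dd(2), of "\<lambda>x. x \<noteq> -1"] unfolding dd(1) by simp
    qed
    then show "AE \<omega> in ?P. (\<integral>\<^sup>+X. indicator S (subset_mix d k {..<k} X \<omega>) \<partial>?Q) = emeasure D S"
    proof (rule AE_mp, intro AE_I2 impI)
      fix \<omega> assume \<omega>: "\<omega> \<in> space ?P" "\<omega> 0 \<noteq> -1"
      define q where "q = (\<Sum>i<k. (1 + \<omega> i)\<^sup>2)"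
      have q: "q > 0"
        unfolding q_def by (rule sum_pos2[of _ 0]) (use \<omega>(2) k in \<open>auto simp: add_eq_0_iff\<close>)
      define s where "s = sqrt (1 - 1 / (2 * real k))"
      have s2: "s\<^sup>2 = 1 - 1 / (2 * real k)" unfolding s_def using k by simp
      \<comment> \<open>The two samples of a pair carry the random part with opposite signs, so it
        drops out of the sum; the squares add up to \<open>1 / (2 * real k)\<close> from the
        constant part and \<open>s\<^sup>2\<close> from the random part.\<close>
      define w where "w = (\<lambda>u. 1 / (2 * real k) + (if u < k then s * (1 + \<omega> u) / (sqrt 2 * sqrt q) else - (s * (1 + \<omega> (u - k)) / (sqrt 2 * sqrt q))))"
      have w1: "(\<Sum>u<2 * k. w u) = 1"
      proof -
        have "(\<Sum>u<2 * k. w u) = (\<Sum>i<k. 1 / real k)"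
          unfolding sum_lessThan_double by (intro sum.cong refl) (simp add: w_def)
        then show ?thesis using k by simp
      qed
      have w2: "(\<Sum>u<2 * k. (w u)\<^sup>2) = 1"
      proof -
        have "(\<Sum>u<2 * k. (w u)\<^sup>2) = (\<Sum>i<k. 1 / (2 * (real k)\<^sup>2) + s\<^sup>2 / q * (1 + \<omega> i)\<^sup>2)"
          unfolding sum_lessThan_double
        proof (intro sum.cong refl)
          fix i assume "i \<in> {..<k}"
          define x where "x = s * (1 + \<omega> i) / (sqrt 2 * sqrt q)"
          have "x\<^sup>2 = s\<^sup>2 * (1 + \<omega> i)\<^sup>2 / (2 * q)" using q by (simp add: x_def power_divide power_mult_distrib)
          moreover have "(w i)\<^sup>2 + (w (k + i))\<^sup>2 = (1 / (2 * real k) + x)\<^sup>2 + (1 / (2 * real k) + - x)\<^sup>2"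
            using \<open>i \<in> {..<k}\<close> by (simp add: w_def x_def)
          moreover have "(a + x)\<^sup>2 + (a + - x)\<^sup>2 = 2 * a\<^sup>2 + 2 * x\<^sup>2" for a
            by (simp add: power2_eq_square algebra_simps)
          ultimately show "(w i)\<^sup>2 + (w (k + i))\<^sup>2 = 1 / (2 * (real k)\<^sup>2) + s\<^sup>2 / q * (1 + \<omega> i)\<^sup>2"
            by (simp add: power_divide power_mult_distrib)
        qed
        also have "\<dots> = real k * (1 / (2 * (real k)\<^sup>2)) + s\<^sup>2 / q * q"
          by (simp only: sum.distrib sum_distrib_left[symmetric] sum_constant card_lessThan q_def[symmetric])
        also have "\<dots> = 1" unfolding s2 using q k by (simp add: power2_eq_square field_simps)
        finally show ?thesis .
      qed
      have mixw: "subset_mix d k {..<k} X \<omega> = (\<lambda>l\<in>{..<d}. \<Sum>u<2 * k. w u * X u l)" for X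
      proof
        fix l
        have "(\<Sum>u<2 * k. w u * X u l) = (\<Sum>i<k. (X i l + X (k + i) l) / (2 * real k) + s / sqrt q * ((1 + \<omega> i) * half_diff k X i l))"
          unfolding sum_lessThan_double
        proof (intro sum.cong refl)
          fix i assume "i \<in> {..<k}"
          define a where "a = s * (1 + \<omega> i) / (sqrt 2 * sqrt q)"
          have "w i = 1 / (2 * real k) + a" "w (k + i) = 1 / (2 * real k) - a"
            using \<open>i \<in> {..<k}\<close> by (simp_all add: w_def a_def)
          then have "w i * X i l + w (k + i) * X (k + i) l = (X i l + X (k + i) l) / (2 * real k) + a * (X i l - X (k + i) l)"
            by (simp add: ring_distribs add_divide_distrib)
          also have "a * (X i l - X (k + i) l) = s / sqrt q * ((1 + \<omega> i) * half_diff k X i l)"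
            by (simp add: a_def half_diff_def mult_ac)
          finally show "w i * X i l + w (k + i) * X (k + i) l = (X i l + X (k + i) l) / (2 * real k) + s / sqrt q * ((1 + \<omega> i) * half_diff k X i l)" .
        qed
        also have "\<dots> = center k {..<k} X l + s * (\<Sum>i<k. (1 + \<omega> i) * half_diff k X i l) / sqrt q"
          by (simp add: sum.distrib center_def sum_divide_distrib sum_distrib_left add_divide_distrib)
        finally show "subset_mix d k {..<k} X \<omega> l = (\<lambda>l\<in>{..<d}. \<Sum>u<2 * k. w u * X u l) l"
          by (simp add: subset_mix_def mix_def s_def q_def)
      qed
      have mw: "(\<lambda>X. \<lambda>l\<in>{..<d}. \<Sum>u<2 * k. w u * X u l) \<in> ?Q \<rightarrow>\<^sub>M euclid d"
        unfolding measurable_cong_sets[OF sQ refl]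
      proof (subst (2) euclid_def, rule measurable_restrict)
        fix l assume "l \<in> {..<d}"
        then show "(\<lambda>X. \<Sum>u<2 * k. w u * X u l) \<in> borel_measurable (data d (2 * k))"
          by (intro borel_measurable_sum borel_measurable_times borel_measurable_const measurable_data_component) auto
      qed
      have "(\<integral>\<^sup>+X. indicator S (subset_mix d k {..<k} X \<omega>) \<partial>?Q) =
        (\<integral>\<^sup>+x. indicator S x \<partial>distr ?Q (euclid d) (\<lambda>X. \<lambda>l\<in>{..<d}. \<Sum>u<2 * k. w u * X u l))"
        unfolding mixw using S by (intro nn_integral_distr[OF mw, symmetric]) simp
      also have "distr ?Q (euclid d) (\<lambda>X. \<lambda>l\<in>{..<d}. \<Sum>u<2 * k. w u * X u l) = D"
        by (rule distr_iid_weighted_sum[OF D d w1 w2])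
      finally show "(\<integral>\<^sup>+X. indicator S (subset_mix d k {..<k} X \<omega>) \<partial>?Q) = emeasure D S" using S sD by simp
    qed
  qed
  also have "\<dots> = ennreal (measure D S)" using P.emeasure_space_1 by (simp add: D.emeasure_eq_measure)
  finally have nn: "(\<integral>\<^sup>+X. ennreal (measure (subset_law d k {..<k} X) S) \<partial>?Q) = ennreal (measure D S)" .
  have bm: "(\<lambda>X. measure (subset_law d k {..<k} X) S) \<in> borel_measurable ?Q"
    using measurable_kernel_measure[OF measurable_subset_law[of "{..<k}" k d] S] measurable_cong_sets[OF sQ refl] by blast
  show ?thesis using nn by (subst integral_eq_nn_integral) (use bm in auto)
qed

text \<open>On good data all pairs are chosen, so the mechanism differs from the exact one only if
  the constant is output, which has probability at most \<open>exp (- \<tau>)\<close>. The remaining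
  terms bound the probability of bad data.\<close>

lemma (in base_mechanism) base_mechanism_accurate:
  assumes A: "sampler (2 * k) (euclid d) A"
    "\<And>X S. X \<in> space (data d (2 * k)) \<Longrightarrow> S \<in> sets (euclid d) \<Longrightarrow> measure (A X) S =
      gate \<tau> (discarded X) * measure (subset_law d k (chosen X) X) S +
      (1 - gate \<tau> (discarded X)) * indicator S (\<lambda>l\<in>{..<d}. 0)"
    and D: "D \<in> gaussian_class d \<kappa>" and \<kappa>: "\<kappa> \<ge> 0"
    and \<rho>: "\<rho> = 2 * (T * sqrt \<kappa>)" and B: "B = T * sqrt (real k * \<kappa>)"
    and S: "S \<in> sets (euclid d)"
  shows "\<bar>measure D S - measure (output_distr (2 * k) A D) S\<bar> \<le>
    exp (- \<tau>) + ((4 * real k * real d + 2 * real d) * exp (- T\<^sup>2 / 2) + (2 * real N + 1) ^ d * exp (- real k / 2))"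
proof -
  obtain \<mu> M where DM: "D = distr (PiM {..<d} (\<lambda>_. std_normal)) (euclid d) (affine_image d \<mu> M)"
    and lo: "\<And>v. (\<Sum>i<d. (v i)\<^sup>2) \<le> (\<Sum>j<d. (\<Sum>i<d. v i * M i j)\<^sup>2)"
    and up: "\<And>v. (\<Sum>j<d. (\<Sum>i<d. v i * M i j)\<^sup>2) \<le> \<kappa> * (\<Sum>i<d. (v i)\<^sup>2)"
    by (rule gaussian_class_representation[OF D]) auto
  let ?Q = "iid (2 * k) D"
  interpret G: prob_space "PiM {..<d} (\<lambda>_. std_normal)" by (rule prob_space_PiM_std_normal)
  have pD: "prob_space D" unfolding DM by (rule G.prob_space_distr[OF measurable_affine_image])
  have sD: "sets D = sets (euclid d)" unfolding DM by simp
  interpret Q: prob_space ?Q by (rule prob_space_iid[OF pD])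
  have sQ: "sets ?Q = sets (data d (2 * k))" and spQ: "space ?Q = space (data d (2 * k))"
    by (rule sets_iid[OF sD], rule space_iid[OF sD])
  have k1: "k \<ge> 1"
  proof -
    have "m \<ge> 3" by (simp add: m_def)
    then have "real k \<ge> 6" using c8 by linarith
    then show ?thesis by simp
  qed
  define a where "a = (\<lambda>X. measure (A X) S)"
  define h where "h = (\<lambda>X. measure (subset_law d k {..<k} X) S)"
  define bad where "bad = {X\<in>space ?Q. \<not> good d k N \<rho> B X {..<k}}"
  have badm: "bad \<in> sets ?Q"
  proof -
    have "Measurable.pred (data d (2 * k)) (\<lambda>X. good d k N \<rho> B X {..<k})" by (rule pred_good) simp
    then have "{X\<in>space (data d (2 * k)). \<not> good d k N \<rho> B X {..<k}} \<in> sets (data d (2 * k))" by measurable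
    then show ?thesis unfolding bad_def sQ spQ .
  qed
  have ia: "integrable ?Q a" unfolding a_def
    by (rule integrable_kernel_measure[OF pD sD A(1)[unfolded sampler_def] S])
  have ih: "integrable ?Q h" unfolding h_def
    by (rule integrable_kernel_measure[OF pD sD measurable_subset_law S]) simp
  have hb: "0 \<le> h X" "h X \<le> 1" if "X \<in> space ?Q" for X
    unfolding h_def using kernel_measure_bounds[OF measurable_subset_law[of "{..<k}" k d]] that by (auto simp: spQ)
  have ab: "0 \<le> a X" "a X \<le> 1" if "X \<in> space ?Q" for X
    unfolding a_def using kernel_measure_bounds[OF A(1)[unfolded sampler_def]] that by (auto simp: spQ)
  have diff: "\<bar>h X - a X\<bar> \<le> exp (- \<tau>) + indicator bad X" if X: "X \<in> space ?Q" for X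
  proof (cases "X \<in> bad")
    case True
    have "\<bar>h X - a X\<bar> \<le> 1" using hb[OF X] ab[OF X] by linarith
    moreover have "indicator bad X = (1 :: real)" using True by simp
    ultimately show ?thesis using exp_ge_zero[of "- \<tau>"] by linarith
  next
    case False
    then have g: "good d k N \<rho> B X {..<k}" using X by (simp add: bad_def)
    have "card {..<k} \<le> card (chosen X)" by (rule chosen_max[OF _ g]) simp
    then have ch: "chosen X = {..<k}" using chosen(1)[of X] by (intro card_seteq) auto
    have disc: "discarded X = 0" by (simp add: discarded_def ch)
    define p where "p = gate \<tau> 0"
    have p: "0 \<le> p" "p \<le> 1" unfolding p_def by (rule gate_bounds)+
    have p': "1 - p \<le> exp (- \<tau>)"
    proof -
      have "1 - p = exp (- \<tau>) / (1 + exp (- \<tau>))"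
        unfolding p_def gate_def by (simp add: field_simps add_pos_pos add_nonneg_eq_0_iff)
      also have "\<dots> \<le> exp (- \<tau>) / 1" by (intro divide_left_mono) (auto simp: add_pos_pos)
      finally show ?thesis by simp
    qed
    define I :: real where "I = indicator S (\<lambda>l\<in>{..<d}. 0)"
    have I: "0 \<le> I" "I \<le> 1" by (auto simp: I_def indicator_def)
    have "a X = p * h X + (1 - p) * I"
      unfolding a_def using A(2)[of X S] X S by (simp add: spQ ch disc p_def h_def I_def)
    then have "h X - a X = (1 - p) * (h X - I)" by (simp add: algebra_simps)
    then have "\<bar>h X - a X\<bar> = (1 - p) * \<bar>h X - I\<bar>" using p by (simp add: abs_mult)
    also have "\<dots> \<le> (1 - p) * 1" using p hb[OF X] I by (intro mult_left_mono) auto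
    finally show ?thesis using p' False by simp
  qed
  have "measure D S = (\<integral>X. h X \<partial>?Q)"
    unfolding h_def by (rule integral_subset_law_full[OF DM d1 k1 S, symmetric])
  moreover have "measure (output_distr (2 * k) A D) S = (\<integral>X. a X \<partial>?Q)"
    unfolding a_def by (rule measure_output_distr[OF pD sD A(1) S])
  ultimately have "\<bar>measure D S - measure (output_distr (2 * k) A D) S\<bar> = \<bar>\<integral>X. h X - a X \<partial>?Q\<bar>"
    using ia ih by simp
  also have "\<dots> \<le> (\<integral>X. \<bar>h X - a X\<bar> \<partial>?Q)" by (rule integral_abs_bound)
  also have "\<dots> \<le> (\<integral>X. exp (- \<tau>) + indicator bad X \<partial>?Q)"
    using ia ih badm by (intro integral_mono diff) (auto simp: Q.emeasure_eq_measure)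
  also have "\<dots> = exp (- \<tau>) + Q.prob bad"
    using badm by (simp add: Q.emeasure_eq_measure Q.prob_space)
  also have "Q.prob bad \<le> (4 * real k * real d + 2 * real d) * exp (- T\<^sup>2 / 2) + (2 * real N + 1) ^ d * exp (- real k / 2)"
    unfolding bad_def using T1 by (intro full_subset_good[OF DM lo up _ \<kappa> d1 k1 \<rho> B]) auto
  finally show ?thesis by simp
qed

section \<open>Amplification by subsampling\<close>

text \<open>A choice that picks the changed sample is compared with all \<open>b\<close> choices
  that agree with it in the other blocks; the subsamples then differ in at most one entry. Averaging
  over the \<open>b\<close> comparisons bounds the contribution of the affected choices by
  \<open>exp 2 / b \<le> \<epsilon>\<close> times the full mass for \<open>Y'\<close>, plus the
  \<open>\<delta>\<close> term. The unaffected choices contribute at most that mass itself, and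
  \<open>1 + \<epsilon> \<le> exp \<epsilon>\<close>.\<close>

lemma subsampling:
  fixes A0 :: "(nat \<Rightarrow> 'a) \<Rightarrow> 'a measure"
  assumes A0: "sampler n X A0" and dp: "diff_private 2 \<delta> n X A0" and \<delta>: "\<delta> \<ge> 0"
    and b: "b \<ge> 1" "exp 2 / real b \<le> \<epsilon>"
  obtains A where "sampler (n * b) X A" "diff_private \<epsilon> \<delta> (n * b) X A"
    "\<And>D S. prob_space D \<Longrightarrow> sets D = sets X \<Longrightarrow> S \<in> sets X \<Longrightarrow>
      measure (output_distr (n * b) A D) S = measure (output_distr n A0 D) S"
proof -
  \<comment> \<open>Block \<open>u\<close> occupies the \<open>b\<close> indices from
    \<open>u * b\<close> on, and \<open>c u\<close> is the position picked in it.\<close>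
  define F where "F = ({..<n} \<rightarrow>\<^sub>E {..<b})"
  define sel where "sel = (\<lambda>c (Y :: nat \<Rightarrow> 'a). \<lambda>u\<in>{..<n}. Y (u * b + c u))"
  have finF: "finite F" unfolding F_def by (intro finite_PiE) auto
  have cardF: "card F > 0" unfolding F_def using b by (simp add: card_PiE)
  have idx: "u * b + c u < n * b" if "c \<in> F" "u < n" for c u
  proof -
    have "c u < b" using that by (auto simp: F_def)
    then have "u * b + c u < (u + 1) * b" by simp
    also have "\<dots> \<le> n * b" using that by (intro mult_right_mono) auto
    finally show ?thesis .
  qed
  have sel: "sel c \<in> datasets (n * b) X \<rightarrow>\<^sub>M datasets n X" if "c \<in> F" for c
    unfolding sel_def datasets_def using idx[OF that]
    by (intro measurable_restrict measurable_component_singleton) auto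
  have A0m: "A0 \<in> datasets n X \<rightarrow>\<^sub>M prob_algebra X" using A0 by (simp add: sampler_def)
  obtain A where A: "A \<in> datasets (n * b) X \<rightarrow>\<^sub>M prob_algebra X"
    "\<And>Y S. Y \<in> space (datasets (n * b) X) \<Longrightarrow> S \<in> sets X \<Longrightarrow>
      measure (A Y) S = (\<Sum>c\<in>F. 1 / real (card F) * measure (A0 (sel c Y)) S)"
    by (rule kernel_mixture[where F = F and c = "\<lambda>_ _. 1 / real (card F)" and A = "\<lambda>c Y. A0 (sel c Y)"
          and M = "datasets (n * b) X" and N = X])
      (use finF cardF measurable_compose[OF sel A0m] in auto)
  have out: "measure (output_distr (n * b) A D) S = measure (output_distr n A0 D) S"
    if D: "prob_space D" "sets D = sets X" and S: "S \<in> sets X" for D S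
  proof -
    have int: "integrable (iid (n * b) D) (\<lambda>Y. measure (A0 (sel c Y)) S)"
      and eq: "(\<integral>Y. measure (A0 (sel c Y)) S \<partial>iid (n * b) D) = (\<integral>Y. measure (A0 Y) S \<partial>iid n D)" if c: "c \<in> F" for c
    proof -
      show "integrable (iid (n * b) D) (\<lambda>Y. measure (A0 (sel c Y)) S)"
        by (rule integrable_kernel_measure[OF D measurable_compose[OF sel[OF c] A0m] S])
      have inj: "inj_on (\<lambda>u. u * b + c u) {..<n}"
      proof (rule inj_onI)
        fix u v assume uv: "u \<in> {..<n}" "v \<in> {..<n}" "u * b + c u = v * b + c v"
        then have "c u < b" "c v < b" using c by (auto simp: F_def)
        then have "(u * b + c u) div b = u" "(v * b + c v) div b = v" by simp_all
        then show "u = v" using uv(3) by metis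
      qed
      have "iid n D = distr (iid (n * b) D) (iid n D) (sel c)"
        unfolding iid_def sel_def
        by (rule distr_PiM_reindex[symmetric, where M = "\<lambda>_. D", OF D(1) inj]) (use idx[OF c] in auto)
      then have "(\<integral>Y. measure (A0 Y) S \<partial>iid n D) = (\<integral>Y. measure (A0 Y) S \<partial>distr (iid (n * b) D) (iid n D) (sel c))" by simp
      also have "\<dots> = (\<integral>Y. measure (A0 (sel c Y)) S \<partial>iid (n * b) D)"
      proof (rule integral_distr)
        show "sel c \<in> iid (n * b) D \<rightarrow>\<^sub>M iid n D"
          using sel[OF c] unfolding measurable_cong_sets[OF sets_iid[OF D(2), of "n * b"] sets_iid[OF D(2), of n]] .
        show "(\<lambda>Y. measure (A0 Y) S) \<in> borel_measurable (iid n D)"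
          using measurable_kernel_measure[OF A0m S] unfolding measurable_cong_sets[OF sets_iid[OF D(2), of n] refl] .
      qed
      finally show "(\<integral>Y. measure (A0 (sel c Y)) S \<partial>iid (n * b) D) = (\<integral>Y. measure (A0 Y) S \<partial>iid n D)" by simp
    qed
    have "measure (output_distr (n * b) A D) S = (\<integral>Y. measure (A Y) S \<partial>iid (n * b) D)"
      by (rule measure_output_distr[OF D _ S]) (simp add: sampler_def A(1))
    also have "\<dots> = (\<integral>Y. (\<Sum>c\<in>F. 1 / real (card F) * measure (A0 (sel c Y)) S) \<partial>iid (n * b) D)"
      by (intro Bochner_Integration.integral_cong refl A(2) S) (simp add: space_iid[OF D(2)])
    also have "\<dots> = (\<Sum>c\<in>F. 1 / real (card F) * (\<integral>Y. measure (A0 (sel c Y)) S \<partial>iid (n * b) D))"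
      using int by (subst Bochner_Integration.integral_sum) auto
    also have "\<dots> = (\<integral>Y. measure (A0 Y) S \<partial>iid n D)" using eq cardF by simp
    also have "\<dots> = measure (output_distr n A0 D) S"
      by (rule measure_output_distr[OF D A0 S, symmetric])
    finally show ?thesis .
  qed
  have "diff_private \<epsilon> \<delta> (n * b) X A"
    unfolding diff_private_def
  proof (intro ballI impI)
    fix Y Y' S assume Y: "Y \<in> space (datasets (n * b) X)" and Y': "Y' \<in> space (datasets (n * b) X)"
      and nb: "neighbors (n * b) Y Y'" and S: "S \<in> sets X"
    from nb obtain i0 where i0: "{i. i < n * b \<and> Y i \<noteq> Y' i} = {i0}"
      unfolding neighbors_def by (auto simp: card_1_singleton_iff)
    then have i0b: "i0 < n * b" by blast
    define u0 where "u0 = i0 div b"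
    define c0 where "c0 = i0 mod b"
    have u0: "u0 < n" unfolding u0_def using i0b by (rule less_mult_imp_div_less)
    have c0: "c0 < b" unfolding c0_def using b by simp
    have same: "Y (u * b + c u) = Y' (u * b + c u)" if "c \<in> F" "u < n" "u \<noteq> u0 \<or> c u \<noteq> c0" for c u
    proof (rule ccontr)
      assume "Y (u * b + c u) \<noteq> Y' (u * b + c u)"
      then have "u * b + c u \<in> {i. i < n * b \<and> Y i \<noteq> Y' i}" using idx[OF that(1,2)] by simp
      then have e: "i0 = u * b + c u" unfolding i0 by simp
      have "c u < b" using that by (auto simp: F_def)
      then have "u0 = u" "c0 = c u" unfolding u0_def c0_def e by simp_all
      then show False using that(3) by simp
    qed
    define a where "a = (\<lambda>c. measure (A0 (sel c Y)) S)"
    define a' where "a' = (\<lambda>c. measure (A0 (sel c Y')) S)"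
    have a'0: "a' c \<ge> 0" for c by (simp add: a'_def)
    \<comment> \<open>\<open>neighbors\<close> demands exactly one difference, so equal subsamples
      need a separate argument.\<close>
    have near: "measure (A0 Z) S \<le> exp 2 * measure (A0 Z') S + \<delta>"
      if Z: "Z \<in> space (datasets n X)" "Z' \<in> space (datasets n X)" and zz: "\<And>u. u < n \<Longrightarrow> u \<noteq> u0 \<Longrightarrow> Z u = Z' u" for Z Z'
    proof (cases "Z u0 = Z' u0")
      case True
      have "Z = Z'"
        using Z zz True by (intro extensionalityI[of _ "{..<n}"]) (auto simp: datasets_def space_PiM PiE_def)
      moreover have "1 * measure (A0 Z') S \<le> exp 2 * measure (A0 Z') S" by (intro mult_right_mono) auto
      ultimately show ?thesis using \<delta> by simp
    next
      case False
      then have "{i. i < n \<and> Z i \<noteq> Z' i} = {u0}" using zz u0 by auto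
      then have "neighbors n Z Z'" by (simp add: neighbors_def)
      then show ?thesis using dp Z S by (auto simp: diff_private_def)
    qed
    define C where "C = {c\<in>F. c u0 = c0}"
    have C: "finite C" "C \<subseteq> F" using finF by (auto simp: C_def)
    have upd: "c(u0 := j) \<in> F" if "c \<in> C" "j < b" for c j
      using that u0 by (auto simp: C_def F_def PiE_def extensional_def)
    \<comment> \<open>Every choice function arises exactly once from a member of \<open>C\<close> by
      overwriting its value at \<open>u0\<close>.\<close>
    have bij: "(\<Sum>x\<in>C \<times> {..<b}. g ((fst x)(u0 := snd x))) = (\<Sum>c\<in>F. g c)" for g :: "_ \<Rightarrow> real"
    proof (rule sum.reindex_bij_witness[of _ "\<lambda>c. (c(u0 := c0), c u0)" "\<lambda>x. (fst x)(u0 := snd x)"])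
      fix x assume x: "x \<in> C \<times> {..<b}"
      then show "((((fst x)(u0 := snd x))(u0 := c0)), ((fst x)(u0 := snd x)) u0) = x"
        by (auto simp: C_def fun_eq_iff)
      show "(fst x)(u0 := snd x) \<in> F" using x by (auto intro: upd)
    next
      fix c assume c: "c \<in> F"
      then show "(c(u0 := c0), c u0) \<in> C \<times> {..<b}"
        using u0 c0 by (auto simp: C_def F_def PiE_def extensional_def)
    qed auto
    have dominated: "a c \<le> exp 2 * a' (c(u0 := j)) + \<delta>" if c: "c \<in> C" and j: "j < b" for c j
      unfolding a_def a'_def
    proof (rule near)
      show "sel c Y \<in> space (datasets n X)" using measurable_space[OF sel Y] c C by auto
      show "sel (c(u0 := j)) Y' \<in> space (datasets n X)" using measurable_space[OF sel[OF upd[OF c j]] Y'] .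
      fix u assume "u < n" "u \<noteq> u0"
      then show "sel c Y u = sel (c(u0 := j)) Y' u" using same[of c u] c C by (auto simp: sel_def)
    qed
    have off: "a c = a' c" if "c \<in> F - C" for c
    proof -
      have "sel c Y = sel c Y'"
        unfolding sel_def using same[of c] that by (intro restrict_ext) (fastforce simp: C_def)
      then show ?thesis by (simp add: a_def a'_def)
    qed
    define M' where "M' = (\<Sum>c\<in>F. a' c)"
    have "real b * (\<Sum>c\<in>C. a c) = (\<Sum>x\<in>C \<times> {..<b}. a (fst x))"
      unfolding sum_Times_fst_snd[where f = "\<lambda>c _. a c"] by (simp add: sum_distrib_left)
    also have "\<dots> \<le> (\<Sum>x\<in>C \<times> {..<b}. exp 2 * a' ((fst x)(u0 := snd x)) + \<delta>)"
      by (intro sum_mono) (use dominated in auto)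
    also have "\<dots> = (\<Sum>c\<in>F. exp 2 * a' c + \<delta>)"
      by (rule bij[where g = "\<lambda>c. exp 2 * a' c + \<delta>"])
    also have "\<dots> = exp 2 * M' + real (card F) * \<delta>"
      by (simp add: sum.distrib sum_distrib_left M'_def)
    finally have "(\<Sum>c\<in>C. a c) \<le> (exp 2 * M' + real (card F) * \<delta>) / real b"
      using b by (simp add: pos_le_divide_eq mult.commute)
    also have "\<dots> = exp 2 / real b * M' + real (card F) * \<delta> / real b"
      by (simp add: add_divide_distrib)
    also have "\<dots> \<le> \<epsilon> * M' + real (card F) * \<delta> / 1"
      using b \<delta> a'0 by (intro add_mono mult_right_mono divide_left_mono) (auto simp: M'_def sum_nonneg)
    finally have sC: "(\<Sum>c\<in>C. a c) \<le> \<epsilon> * M' + real (card F) * \<delta>" by simp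
    have "(\<Sum>c\<in>F. a c) = (\<Sum>c\<in>F-C. a c) + (\<Sum>c\<in>C. a c)"
      using finF C by (metis sum.subset_diff)
    also have "(\<Sum>c\<in>F-C. a c) = (\<Sum>c\<in>F-C. a' c)" by (intro sum.cong refl off)
    also have "\<dots> \<le> M'" unfolding M'_def using finF a'0 by (intro sum_mono2) auto
    finally have tot: "(\<Sum>c\<in>F. a c) \<le> (1 + \<epsilon>) * M' + real (card F) * \<delta>"
      using sC by (simp add: algebra_simps)
    have "(1 + \<epsilon>) * M' \<le> exp \<epsilon> * M'"
      using a'0 by (intro mult_right_mono exp_ge_add_one_self) (auto simp: M'_def sum_nonneg)
    with tot have "(\<Sum>c\<in>F. a c) \<le> exp \<epsilon> * M' + real (card F) * \<delta>" by linarith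
    then have "(\<Sum>c\<in>F. a c) / real (card F) \<le> (exp \<epsilon> * M' + real (card F) * \<delta>) / real (card F)"
      by (intro divide_right_mono) auto
    also have "\<dots> = exp \<epsilon> * (M' / real (card F)) + \<delta>" using cardF by (simp add: field_simps)
    finally show "measure (A Y) S \<le> exp \<epsilon> * measure (A Y') S + \<delta>"
      unfolding A(2)[OF Y S] A(2)[OF Y' S] M'_def a_def a'_def by (simp add: sum_divide_distrib)
  qed
  then show ?thesis using that[of A] A(1) out by (auto simp: sampler_def)
qed

section \<open>Choice of the parameters\<close>

text \<open>The left side is \<open>40 * 2 * 10 ^ 20\<close>, the constant in the bound on
  \<open>Z\<close> below, and \<open>2 ^ 73\<close> is the first power of 2 above it.\<close>

lemma exp_73_ge: "8 * 10 ^ 21 \<le> exp (73 :: real)"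
proof -
  have "(8 * 10 ^ 21 :: real) \<le> 2 ^ 73" by simp
  also have "\<dots> \<le> exp 1 ^ 73" using exp_ge_add_one_self[of "1 :: real"] by (intro power_mono) auto
  also have "\<dots> = exp (73 :: real)" by (simp flip: exp_of_nat_mult)
  finally show ?thesis .
qed

text \<open>There is an apparent circle: \<open>k\<close> must dominate powers of \<open>T\<close>,
  while \<open>T\<close> must make \<open>exp (- T\<^sup>2 / 2)\<close> small against
  \<open>1 / k\<close>. Since \<open>T\<^sup>2\<close> depends on \<open>k\<close> only
  logarithmically, \<open>k\<close> is fixed first as a large multiple of \<open>b * L ^ 5\<close>,
  and \<open>W\<close>, the value of \<open>T\<^sup>2\<close>, is bounded by a multiple of
  \<open>L\<close> afterwards.\<close>

lemma parameters_exist: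
  fixes d :: nat and \<kappa> \<delta> \<alpha> :: real
  assumes d: "d \<ge> 1" and \<kappa>: "\<kappa> \<ge> 1" and \<delta>: "0 < \<delta>" "\<delta> \<le> 1 / 2" and \<alpha>: "0 < \<alpha>" "\<alpha> \<le> 1 / 2"
  defines "L \<equiv> 1 + ln (real d * \<kappa> / (\<alpha> * \<delta>))"
  obtains k N t \<rho> B T \<tau> m where "base_mechanism d k N t \<rho> B T \<tau> \<delta> m"
    and "\<rho> = 2 * (T * sqrt \<kappa>)" "B = T * sqrt (real k * \<kappa>)"
    and "exp (- \<tau>) + ((4 * real k * real d + 2 * real d) * exp (- T\<^sup>2 / 2) + (2 * real N + 1) ^ d * exp (- real k / 2)) \<le> \<alpha>"
    and "real k \<le> 2 * 10 ^ 20 * (real d * \<kappa> * L ^ 5)"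
proof -
  define y where "y = real d * \<kappa> / (\<alpha> * \<delta>)"
  define b where "b = real d * \<kappa>"
  have d1: "real d \<ge> 1" using d by simp
  have b1: "b \<ge> 1" using d1 \<kappa> mult_mono[of 1 "real d" 1 \<kappa>] by (simp add: b_def)
  have db: "real d \<le> b" using d1 \<kappa> mult_left_mono[of 1 \<kappa> "real d"] by (simp add: b_def)
  have \<alpha>\<delta>: "0 < \<alpha> * \<delta>" "\<alpha> * \<delta> \<le> 1 / 4" using \<alpha> \<delta> mult_mono[of \<alpha> "1/2" \<delta> "1/2"] by auto
  have y4: "y \<ge> 4" unfolding y_def using \<alpha>\<delta> b1 by (simp add: pos_le_divide_eq b_def)
  have L_y: "L = 1 + ln y" by (simp add: L_def y_def)
  have L2: "L \<ge> 2"
  proof -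
    have "exp 1 \<le> y" using exp_le y4 by linarith
    then have "ln y \<ge> 1" using y4 by (simp add: ln_ge_iff)
    then show ?thesis by (simp add: L_y)
  qed
  define q where "q = b * L ^ 5"
  have L5: "L ^ 5 \<ge> 1" using L2 by (intro one_le_power) auto
  have q1: "q \<ge> 1" unfolding q_def using b1 L5 mult_mono[of 1 b 1 "L ^ 5"] by simp
  define k where "k = nat \<lceil>10 ^ 20 * q\<rceil>"
  have k_lower: "10 ^ 20 * q \<le> real k" unfolding k_def by (rule of_nat_ceiling)
  have k_upper: "real k \<le> 2 * 10 ^ 20 * q"
  proof -
    have "real k \<le> 10 ^ 20 * q + 1"
      unfolding k_def using q1 of_int_ceiling_le_add_one[of "10 ^ 20 * q"] by simp
    also have "\<dots> \<le> 2 * 10 ^ 20 * q" using q1 by simp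
    finally show ?thesis .
  qed
  have k1: "real k \<ge> 100" using k_lower q1 by simp
  define Z where "Z = 40 * real k * real d / (\<alpha> * \<delta>)"
  define W where "W = 2 * ln Z"
  have Zk: "real k \<le> Z"
  proof -
    have "real k * (\<alpha> * \<delta>) \<le> real k * 1" using \<alpha>\<delta> by (intro mult_left_mono) auto
    also have "\<dots> \<le> real k * (40 * real d)" using d1 by (intro mult_left_mono) auto
    finally show ?thesis unfolding Z_def using \<alpha>\<delta> by (simp add: pos_le_divide_eq mult_ac)
  qed
  have Z0: "Z > 0" using Zk k1 by linarith
  have expW: "exp (W / 2) = Z" using Z0 by (simp add: W_def)
  have expW': "exp (- W / 2) = \<alpha> * \<delta> / (40 * real k * real d)"
  proof -
    have "exp (- W / 2) = inverse (exp (W / 2))" by (simp add: exp_minus[symmetric])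
    then show ?thesis unfolding expW by (simp add: Z_def)
  qed
  have W1: "W \<ge> 1"
  proof -
    have "exp 1 \<le> Z" using exp_le Zk k1 by linarith
    then have "ln Z \<ge> 1" using Z0 by (simp add: ln_ge_iff)
    then show ?thesis by (simp add: W_def)
  qed
  \<comment> \<open>\<open>L \<le> exp L\<close> and \<open>y \<le> exp L\<close> turn the product
    \<open>L ^ 5 * (y * y)\<close> into \<open>exp (7 * L)\<close>, so \<open>ln Z\<close> is at
    most linear in \<open>L\<close>.\<close>
  have W_upper: "W \<le> 160 * L"
  proof -
    have Ly: "y \<le> exp L" using y4 by (simp add: L_y exp_add)
    have Lexp: "L \<le> exp L" using exp_ge_add_one_self[of L] by linarith
    have "Z \<le> 40 * (2 * 10 ^ 20 * q) * real d / (\<alpha> * \<delta>)"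
      unfolding Z_def using k_upper \<alpha>\<delta> by (intro divide_right_mono mult_right_mono mult_left_mono) auto
    also have "\<dots> = 8 * 10 ^ 21 * L ^ 5 * (y * real d)" by (simp add: q_def y_def b_def)
    also have "\<dots> \<le> 8 * 10 ^ 21 * L ^ 5 * (y * y)"
    proof (intro mult_left_mono)
      have "b * (\<alpha> * \<delta>) \<le> b * 1" using \<alpha>\<delta> b1 by (intro mult_left_mono) auto
      then have "b \<le> y" unfolding y_def b_def[symmetric] using \<alpha>\<delta> by (simp add: pos_le_divide_eq)
      then show "real d \<le> y" using db by simp
    qed (use y4 L2 in auto)
    also have "\<dots> \<le> exp 73 * exp L ^ 5 * (exp L * exp L)"
      using exp_73_ge Lexp L2 Ly y4 by (intro mult_mono power_mono) auto
    also have "\<dots> = exp (73 + 7 * L)"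
      by (simp add: exp_add[symmetric] exp_of_nat_mult[symmetric])
    finally have "ln Z \<le> 73 + 7 * L" using Z0 by (metis exp_le_cancel_iff exp_ln)
    then show ?thesis using L2 by (simp add: W_def)
  qed
  define T where "T = sqrt W"
  have TW: "T\<^sup>2 = W" using W1 by (simp add: T_def)
  have T1: "T \<ge> 1" using W1 by (simp add: T_def)
  \<comment> \<open>\<open>exp (- \<tau>)\<close> is half of the error budget
    \<open>\<alpha>\<close>; \<open>t\<close> then exceeds \<open>\<tau>\<close> by at least
    \<open>ln (1 / \<delta>)\<close>, as \<open>c7\<close> demands.\<close>
  define \<tau> where "\<tau> = ln (2 / \<alpha>)"
  define t where "t = nat \<lceil>ln (2 / \<alpha>) + ln (1 / \<delta>)\<rceil>"
  define m where "m = 2 * real t + 3"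
  have t_lower: "ln (2 / \<alpha>) + ln (1 / \<delta>) \<le> real t" unfolding t_def by (rule of_nat_ceiling)
  have t_upper: "real t \<le> L + 1"
  proof -
    have pos: "0 \<le> ln (2 / \<alpha>) + ln (1 / \<delta>)" using \<alpha> \<delta> by (intro add_nonneg_nonneg ln_ge_zero) auto
    then have "real t \<le> ln (2 / \<alpha>) + ln (1 / \<delta>) + 1"
      unfolding t_def using of_int_ceiling_le_add_one[of "ln (2 / \<alpha>) + ln (1 / \<delta>)"] by simp
    also have "ln (2 / \<alpha>) + ln (1 / \<delta>) = ln 2 + ln (1 / (\<alpha> * \<delta>))"
      using \<alpha> \<delta> by (simp add: ln_div ln_mult)
    also have "ln 2 \<le> (1 :: real)" using ln_le_minus_one[of "2 :: real"] by simp
    also have "ln (1 / (\<alpha> * \<delta>)) \<le> ln y"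
      unfolding y_def b_def[symmetric] using \<alpha>\<delta> b1 by (intro ln_mono divide_right_mono) auto
    finally show ?thesis by (simp add: L_y)
  qed
  have m3: "m \<ge> 3" by (simp add: m_def)
  have mL: "m \<le> 7 * L" using t_upper L2 by (simp add: m_def)
  \<comment> \<open>\<open>c5\<close> is the requirement of highest order: squared, it asks for
    \<open>k\<close> to be at least a constant times \<open>b * m\<^sup>2 * W ^ 3\<close>. The
    conditions that are linear in \<open>k\<close> ask for no more up to constants, and with
    \<open>m\<close> and \<open>W\<close> of order \<open>L\<close> this is the fifth power.\<close>
  define H where "H = b * m\<^sup>2 * W ^ 3"
  have kH: "10 ^ 11 * H \<le> real k"
  proof -
    have "H \<le> b * (7 * L)\<^sup>2 * (160 * L) ^ 3"
      unfolding H_def using mL m3 W_upper W1 b1 by (intro mult_mono power_mono) auto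
    also have "\<dots> = 200704000 * q" by (simp add: q_def power_mult_distrib power2_eq_square power3_eq_cube eval_nat_numeral)
    finally have "10 ^ 11 * H \<le> 10 ^ 11 * (200704000 * q)" by simp
    also have "\<dots> \<le> 10 ^ 20 * q" using q1 by simp
    finally show ?thesis using k_lower by linarith
  qed
  have W3: "W \<le> W ^ 3" "1 \<le> W ^ 3" using W1 power_increasing[of 1 3 W] by auto
  have mm: "m \<le> m\<^sup>2" "1 \<le> m\<^sup>2" using m3 power_increasing[of 1 2 m] by auto
  have H_ge: "u * v * w \<le> H" if "0 \<le> u" "u \<le> b" "0 \<le> v" "v \<le> m\<^sup>2" "0 \<le> w" "w \<le> W ^ 3" for u v w
    unfolding H_def using that b1 by (intro mult_mono) auto
  have bmW: "b * m * W \<le> H" using H_ge[of b m W] b1 m3 W1 mm W3 by simp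
  have bm2W: "b * m\<^sup>2 * W \<le> H" using H_ge[of b "m\<^sup>2" W] b1 m3 W1 mm W3 by simp
  have bW: "b * W \<le> H" using H_ge[of b 1 W] b1 m3 W1 mm W3 by simp
  have WH: "W \<le> H" using H_ge[of 1 1 W] b1 m3 W1 mm W3 by simp
  have mH: "m \<le> H" using H_ge[of 1 m 1] b1 m3 W1 mm W3 by simp
  have H1: "H \<ge> 1" using WH W1 by linarith
  define \<rho> where "\<rho> = 2 * (T * sqrt \<kappa>)"
  define B where "B = T * sqrt (real k * \<kappa>)"
  \<comment> \<open>The least natural number whose square satisfies \<open>c2\<close> after
    substituting the value of \<open>real d * \<rho>\<^sup>2\<close>.\<close>
  define N where "N = nat \<lceil>sqrt (4 * real d + 512 * (real d * (b * W)))\<rceil>"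
  have \<rho>2: "\<rho>\<^sup>2 = 4 * (W * \<kappa>)" using \<kappa> by (simp add: \<rho>_def power_mult_distrib TW)
  have R2: "real d * \<rho>\<^sup>2 = 4 * (b * W)" by (simp add: \<rho>2 b_def mult_ac)
  have B2: "B\<^sup>2 = real k * (W * \<kappa>)" using \<kappa> by (simp add: B_def power_mult_distrib TW mult_ac)
  have sq0: "0 \<le> 4 * real d + 512 * (real d * (b * W))" using b1 W1 by simp
  have base: "base_mechanism d k N t \<rho> B T \<tau> \<delta> m"
  proof
    show "d \<ge> 1" "T \<ge> 1" "m = 2 * real t + 3" by (fact d, fact T1, fact m_def)
    show "\<rho> > 0" "B \<ge> 0" using T1 \<kappa> by (simp_all add: \<rho>_def B_def)
    show "16 * m * (real d * \<rho>\<^sup>2) \<le> real k" unfolding R2 using bmW kH H1 by (simp add: mult_ac)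
    show "8 * real d * (1 / 2 + 16 * (real d * \<rho>\<^sup>2)) \<le> (real N)\<^sup>2"
    proof -
      have "sqrt (4 * real d + 512 * (real d * (b * W))) \<le> real N" unfolding N_def by (rule of_nat_ceiling)
      then have "(sqrt (4 * real d + 512 * (real d * (b * W))))\<^sup>2 \<le> (real N)\<^sup>2" using sq0 by (intro power_mono) auto
      then have "4 * real d + 512 * (real d * (b * W)) \<le> (real N)\<^sup>2" using sq0 by simp
      then show ?thesis unfolding R2 by (simp add: algebra_simps)
    qed
    show "1024 * real d * (B + m * \<rho>)\<^sup>2 \<le> (real k)\<^sup>2"
    proof -
      have "(B + m * \<rho>)\<^sup>2 \<le> 2 * B\<^sup>2 + 2 * (m * \<rho>)\<^sup>2"
        using sum_squares_ge_zero[of "B - m * \<rho>" 0] by (simp add: power2_eq_square algebra_simps)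
      then have "1024 * real d * (B + m * \<rho>)\<^sup>2 \<le> 1024 * real d * (2 * B\<^sup>2 + 2 * (m * \<rho>)\<^sup>2)"
        by (intro mult_left_mono) auto
      also have "\<dots> = 2048 * (b * W) * real k + 8192 * (b * m\<^sup>2 * W)"
        by (simp add: B2 power_mult_distrib \<rho>2 b_def algebra_simps)
      also have "\<dots> \<le> real k / 2 * real k + 8192 * (b * m\<^sup>2 * W)"
        using bW kH H1 by (intro add_right_mono mult_right_mono) auto
      also have "8192 * (b * m\<^sup>2 * W) \<le> 1 / 2 * real k" using bm2W kH H1 by simp
      also have "1 / 2 * real k \<le> real k / 2 * real k" using k1 by (simp add: mult_left_mono)
      finally show ?thesis by (simp add: power2_eq_square)
    qed
    show "8000 * T\<^sup>2 \<le> real k" unfolding TW using WH kH H1 by simp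
    show "240 * T\<^sup>2 * m * sqrt (real d * \<rho>\<^sup>2) \<le> sqrt (real k) / 100"
    proof -
      have "(24000 * W * m * sqrt (4 * (b * W)))\<^sup>2 = 2304000000 * H"
        using b1 W1 by (simp add: power_mult_distrib H_def power2_eq_square power3_eq_cube)
      also have "\<dots> \<le> real k" using kH H1 by simp
      finally have "24000 * W * m * sqrt (4 * (b * W)) \<le> sqrt (real k)" by (rule real_le_rsqrt)
      then show ?thesis unfolding TW R2 by simp
    qed
    show "2 * (real k + 3) * exp (- T\<^sup>2 / 2) \<le> \<delta>"
    proof -
      have "2 * (real k + 3) * exp (- T\<^sup>2 / 2) \<le> (40 * real k * real d) * exp (- T\<^sup>2 / 2)"
      proof (intro mult_right_mono)
        have "2 * (real k + 3) \<le> 40 * real k * 1" using k1 by simp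
        also have "\<dots> \<le> 40 * real k * real d" using d1 by (intro mult_left_mono) auto
        finally show "2 * (real k + 3) \<le> 40 * real k * real d" .
      qed simp
      also have "\<dots> = \<alpha> * \<delta>" unfolding TW expW' using k1 d1 by simp
      also have "\<dots> \<le> 1 * \<delta>" using \<alpha> \<delta> by (intro mult_right_mono) auto
      finally show ?thesis by simp
    qed
    show "exp (\<tau> - (real t + 1)) \<le> \<delta>"
    proof -
      have "\<tau> - (real t + 1) \<le> ln \<delta>" using t_lower \<delta> by (simp add: \<tau>_def ln_div)
      then have "exp (\<tau> - (real t + 1)) \<le> exp (ln \<delta>)" by simp
      then show ?thesis using \<delta> by simp
    qed
    show "2 * m \<le> real k" using mH kH H1 by simp
  qed
  have acc: "exp (- \<tau>) + ((4 * real k * real d + 2 * real d) * exp (- T\<^sup>2 / 2) + (2 * real N + 1) ^ d * exp (- real k / 2)) \<le> \<alpha>"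
  proof -
    have "exp (- \<tau>) = \<alpha> / 2" using \<alpha> by (simp add: \<tau>_def exp_minus)
    moreover have "(4 * real k * real d + 2 * real d) * exp (- T\<^sup>2 / 2) \<le> \<alpha> / 4"
    proof -
      have "real d * 2 \<le> real d * (6 * real k)" using k1 by (intro mult_left_mono) auto
      then have "(4 * real k * real d + 2 * real d) * exp (- T\<^sup>2 / 2) \<le> (10 * real k * real d) * exp (- T\<^sup>2 / 2)"
        by (intro mult_right_mono) auto
      also have "\<dots> = \<alpha> * \<delta> / 4" unfolding TW expW' using k1 d1 by simp
      also have "\<dots> \<le> \<alpha> / 4" using \<alpha> \<delta> by simp
      finally show ?thesis .
    qed
    \<comment> \<open>Each of the \<open>d\<close> grid coordinates costs at most
      \<open>exp (W / 2)\<close>, and \<open>k\<close> exceeds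
      \<open>real d * W + W\<close>.\<close>
    moreover have "(2 * real N + 1) ^ d * exp (- real k / 2) \<le> \<alpha> / 4"
    proof -
      have bW1: "b * W \<ge> 1" using b1 W1 mult_mono[of 1 b 1 W] by simp
      have "real d * 1 \<le> b * (b * W)" using db bW1 b1 by (intro mult_mono) auto
      moreover have "real d * (b * W) \<le> b * (b * W)" using db bW1 by (intro mult_right_mono) auto
      ultimately have "4 * real d + 512 * (real d * (b * W)) \<le> 529 * (b * (b * W))"
        using bW1 by linarith
      also have "\<dots> \<le> 529 * (b * (b * (W * W)))"
        using W1 b1 by (intro mult_left_mono) auto
      also have "\<dots> = (23 * (b * W))\<^sup>2" by (simp add: power2_eq_square)
      finally have "sqrt (4 * real d + 512 * (real d * (b * W))) \<le> 23 * (b * W)"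
        using bW1 by (intro real_le_lsqrt) (auto simp: sq0)
      moreover have "real N \<le> sqrt (4 * real d + 512 * (real d * (b * W))) + 1"
        unfolding N_def using of_int_ceiling_le_add_one[of "sqrt (4 * real d + 512 * (real d * (b * W)))"] sq0 by simp
      ultimately have "2 * real N + 1 \<le> 49 * (b * W)" using bW1 by linarith
      also have "\<dots> \<le> real k" using bW kH H1 by simp
      finally have "2 * real N + 1 \<le> exp (W / 2)" unfolding expW using Zk by simp
      then have "(2 * real N + 1) ^ d \<le> exp (W / 2) ^ d" by (intro power_mono) auto
      then have "(2 * real N + 1) ^ d * exp (- real k / 2) \<le> exp (W / 2) ^ d * exp (- real k / 2)"
        by (intro mult_right_mono) auto
      also have "\<dots> = exp ((real d * W - real k) / 2)"
        by (simp add: exp_of_nat_mult[symmetric] exp_add[symmetric] diff_divide_distrib)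
      also have "\<dots> \<le> exp (- W / 2)"
      proof -
        have "real d * W \<le> b * W" using db W1 by (intro mult_right_mono) auto
        then have "real d * W + W \<le> real k" using bW WH kH H1 by simp
        then show ?thesis by simp
      qed
      also have "\<dots> \<le> \<alpha> * 1 / (4 * 1 * 1)"
        unfolding expW' using \<alpha> \<delta> k1 d1 by (intro frac_le mult_mono mult_left_mono) auto
      finally show ?thesis by simp
    qed
    ultimately show ?thesis by linarith
  qed
  show ?thesis
    by (rule that[OF base \<rho>_def B_def acc]) (use k_upper in \<open>simp add: q_def b_def\<close>)
qed

section \<open>The sampler\<close>

lemma gaussian_class_prob_space:
  assumes "D \<in> gaussian_class d \<kappa>"
  shows "prob_space D" "sets D = sets (euclid d)"
proof -
  obtain \<mu> M where D: "D = distr (PiM {..<d} (\<lambda>_. std_normal)) (euclid d) (affine_image d \<mu> M)"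
    by (rule gaussian_class_representation[OF assms])
  interpret prob_space "PiM {..<d} (\<lambda>_. std_normal)" by (rule prob_space_PiM_std_normal)
  show "prob_space D" unfolding D by (rule prob_space_distr[OF measurable_affine_image])
  show "sets D = sets (euclid d)" unfolding D by simp
qed

text \<open>On the all-ones vector the two bounds of the representation contradict each
  other.\<close>

lemma gaussian_class_empty:
  assumes "d \<ge> 1" "\<kappa> < 1"
  shows "gaussian_class d \<kappa> = {}"
proof (rule ccontr)
  assume "gaussian_class d \<kappa> \<noteq> {}"
  then obtain D where D: "D \<in> gaussian_class d \<kappa>" by auto
  obtain M where lo: "\<And>v. (\<Sum>i<d. (v i)\<^sup>2) \<le> (\<Sum>j<d. (\<Sum>i<d. v i * M i j)\<^sup>2)"
    and up: "\<And>v. (\<Sum>j<d. (\<Sum>i<d. v i * M i j)\<^sup>2) \<le> \<kappa> * (\<Sum>i<d. (v i)\<^sup>2)"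
    by (rule gaussian_class_representation[OF D]) blast
  have "real d \<le> \<kappa> * real d" using order_trans[OF lo up, of "\<lambda>_. 1"] by simp
  then show False using assms by simp
qed

text \<open>Write \<open>x = z ^ 5\<close> and use \<open>ln z \<le> z - 1\<close>. Through this, a
  single factor \<open>\<kappa>\<close> absorbs the fifth power of
  \<open>1 + ln \<kappa>\<close>.\<close>

lemma power5_log_le: "(1 + ln x) ^ 5 \<le> 3125 * x" if "x \<ge> 1" for x :: real
proof -
  define z where "z = root 5 x"
  have z1: "z \<ge> 1" using that by (simp add: z_def)
  have xz: "x = z ^ 5" using that by (simp add: z_def)
  have "1 + ln x = 1 + 5 * ln z" using z1 by (simp add: xz ln_realpow)
  also have "\<dots> \<le> 5 * z" using ln_le_minus_one[of z] z1 by linarith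
  finally have "(1 + ln x) ^ 5 \<le> (5 * z) ^ 5" using that by (intro power_mono) auto
  then show ?thesis by (simp add: xz power_mult_distrib)
qed

lemma sampler_exists:
  fixes \<kappa> \<epsilon> \<delta> \<alpha> :: real
  assumes d: "d \<ge> 1" and \<kappa>: "\<kappa> \<ge> 1" and \<epsilon>: "0 < \<epsilon>" "\<epsilon> \<le> 1" and \<delta>: "0 < \<delta>" "\<delta> \<le> 1 / 2" and \<alpha>: "0 < \<alpha>" "\<alpha> \<le> 1 / 2"
  obtains n A where "real n \<le> 4 * 10 ^ 26 * (real d / \<epsilon> * \<kappa>\<^sup>2 * ln (real d / (\<delta> * \<epsilon> * \<alpha>)) ^ 5)"
    "sampler n (euclid d) A" "accurate \<alpha> n (gaussian_class d \<kappa>) A" "diff_private \<epsilon> \<delta> n (euclid d) A"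
proof -
  define L where "L = 1 + ln (real d * \<kappa> / (\<alpha> * \<delta>))"
  obtain k N t \<rho> B T \<tau> m where base: "base_mechanism d k N t \<rho> B T \<tau> \<delta> m"
    and \<rho>: "\<rho> = 2 * (T * sqrt \<kappa>)" and B: "B = T * sqrt (real k * \<kappa>)"
    and err: "exp (- \<tau>) + ((4 * real k * real d + 2 * real d) * exp (- T\<^sup>2 / 2) + (2 * real N + 1) ^ d * exp (- real k / 2)) \<le> \<alpha>"
    and k: "real k \<le> 2 * 10 ^ 20 * (real d * \<kappa> * L ^ 5)"
    by (rule parameters_exist[OF d \<kappa> \<delta> \<alpha>]) (unfold L_def, blast)
  interpret base_mechanism d k N t \<rho> B T \<tau> \<delta> m by (rule base)
  obtain A0 where A0: "sampler (2 * k) (euclid d) A0"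
    and law: "\<And>X S. X \<in> space (data d (2 * k)) \<Longrightarrow> S \<in> sets (euclid d) \<Longrightarrow> measure (A0 X) S =
      gate \<tau> (discarded X) * measure (subset_law d k (chosen X) X) S +
      (1 - gate \<tau> (discarded X)) * indicator S (\<lambda>l\<in>{..<d}. 0)"
    by (rule base_mechanism_exists) blast
  \<comment> \<open>The block size that \<open>subsampling\<close> needs to turn the privacy
    parameter 2 into \<open>\<epsilon>\<close>.\<close>
  define b where "b = nat \<lceil>exp 2 / \<epsilon>\<rceil>"
  have b_lower: "exp 2 / \<epsilon> \<le> real b" unfolding b_def by (rule of_nat_ceiling)
  have "exp 2 / \<epsilon> > 0" using \<epsilon> by simp
  then have b0: "real b > 0" using b_lower by linarith
  then have b1: "b \<ge> 1" by simp
  have b_\<epsilon>: "exp 2 / real b \<le> \<epsilon>" using b_lower b0 \<epsilon> by (simp add: divide_le_eq mult.commute)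
  have b_upper: "real b \<le> 10 / \<epsilon>"
  proof -
    have "exp 2 = exp 1 * exp (1 :: real)" by (simp flip: exp_add)
    also have "\<dots> \<le> 3 * 3" using exp_le by (intro mult_mono) auto
    finally have "exp 2 / \<epsilon> \<le> 9 / \<epsilon>" using \<epsilon> by (intro divide_right_mono) auto
    moreover have "real b \<le> exp 2 / \<epsilon> + 1"
      unfolding b_def using of_int_ceiling_le_add_one[of "exp 2 / \<epsilon>"] \<open>exp 2 / \<epsilon> > 0\<close> by simp
    moreover have "1 \<le> 1 / \<epsilon>" using \<epsilon> by simp
    moreover have "9 / \<epsilon> + 1 / \<epsilon> = 10 / \<epsilon>" by (simp flip: add_divide_distrib)
    ultimately show ?thesis by linarith
  qed
  obtain A where A: "sampler (2 * k * b) (euclid d) A" and dp: "diff_private \<epsilon> \<delta> (2 * k * b) (euclid d) A"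
    and out: "\<And>D S. prob_space D \<Longrightarrow> sets D = sets (euclid d) \<Longrightarrow> S \<in> sets (euclid d) \<Longrightarrow>
      measure (output_distr (2 * k * b) A D) S = measure (output_distr (2 * k) A0 D) S"
  proof (rule subsampling)
    show "sampler (2 * k) (euclid d) A0" by (rule A0)
    show "diff_private 2 \<delta> (2 * k) (euclid d) A0" by (rule base_mechanism_private[OF law])
    show "\<delta> \<ge> 0" using \<delta> by simp
    show "b \<ge> 1" "exp 2 / real b \<le> \<epsilon>" by (fact b1, fact b_\<epsilon>)
  qed (rule that)
  have "accurate \<alpha> (2 * k * b) (gaussian_class d \<kappa>) A"
    unfolding accurate_def
  proof
    fix D assume D: "D \<in> gaussian_class d \<kappa>"
    note pD = gaussian_class_prob_space[OF D]
    show "tv_dist D (output_distr (2 * k * b) A D) \<le> \<alpha>"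
      unfolding tv_dist_def
    proof (rule cSUP_least)
      fix S assume "S \<in> sets D"
      then have S: "S \<in> sets (euclid d)" using pD by simp
      have "0 \<le> \<kappa>" using \<kappa> by simp
      then show "\<bar>measure D S - measure (output_distr (2 * k * b) A D) S\<bar> \<le> \<alpha>"
        unfolding out[OF pD S] using base_mechanism_accurate[OF A0 law D _ \<rho> B S] err by linarith
    qed auto
  qed
  moreover have "real (2 * k * b) \<le> 4 * 10 ^ 26 * (real d / \<epsilon> * \<kappa>\<^sup>2 * ln (real d / (\<delta> * \<epsilon> * \<alpha>)) ^ 5)"
  proof -
    define \<Lambda> where "\<Lambda> = ln (real d / (\<delta> * \<epsilon> * \<alpha>))"
    have d1: "real d \<ge> 1" using d by simp
    have pos: "0 < \<delta> * \<epsilon> * \<alpha>" using \<delta> \<epsilon> \<alpha> by simp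
    have \<alpha>\<delta>: "0 < \<alpha> * \<delta>" "\<alpha> * \<delta> \<le> 1 / 4" using \<alpha> \<delta> mult_mono[of \<alpha> "1/2" \<delta> "1/2"] by auto
    have "(\<alpha> * \<delta>) * \<epsilon> \<le> (\<alpha> * \<delta>) * 1" using \<alpha>\<delta> \<epsilon> by (intro mult_left_mono) auto
    then have le: "\<delta> * \<epsilon> * \<alpha> \<le> \<alpha> * \<delta>" by (simp add: mult_ac)
    have mono: "real d / (\<alpha> * \<delta>) \<le> real d / (\<delta> * \<epsilon> * \<alpha>)"
      using le pos by (intro divide_left_mono) (auto simp: mult_pos_pos \<alpha>\<delta>)
    have four: "4 \<le> real d / (\<alpha> * \<delta>)" using \<alpha>\<delta> d1 by (simp add: pos_le_divide_eq)
    have \<Lambda>1: "\<Lambda> \<ge> 1"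
    proof -
      have "exp 1 \<le> real d / (\<delta> * \<epsilon> * \<alpha>)" using exp_le four mono by linarith
      then show ?thesis unfolding \<Lambda>_def using four mono by (simp add: ln_ge_iff)
    qed
    have ln\<kappa>: "ln \<kappa> \<ge> 0" using \<kappa> by simp
    have "L = 1 + (ln (real d / (\<alpha> * \<delta>)) + ln \<kappa>)"
    proof -
      have "real d * \<kappa> / (\<alpha> * \<delta>) = real d / (\<alpha> * \<delta>) * \<kappa>" by simp
      moreover have "ln (real d / (\<alpha> * \<delta>) * \<kappa>) = ln (real d / (\<alpha> * \<delta>)) + ln \<kappa>"
        using four \<kappa> by (intro ln_mult_pos) auto
      ultimately show ?thesis unfolding L_def by simp
    qed
    also have "ln (real d / (\<alpha> * \<delta>)) \<le> \<Lambda>" unfolding \<Lambda>_def using four mono by (intro ln_mono) auto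
    \<comment> \<open>A product instead of a sum, so that the fifth power separates into a power of
      \<open>\<Lambda>\<close>, which the polynomial may contain, and a power of
      \<open>1 + ln \<kappa>\<close>, which it may not.\<close>
    also have "1 + (\<Lambda> + ln \<kappa>) \<le> 2 * \<Lambda> * (1 + ln \<kappa>)"
      using \<Lambda>1 ln\<kappa> mult_right_mono[of 1 "2 * \<Lambda>" "ln \<kappa>"] by (simp add: distrib_left)
    finally have "L \<le> 2 * \<Lambda> * (1 + ln \<kappa>)" by simp
    moreover have "0 \<le> L"
    proof -
      have "1 * 1 \<le> real d / (\<alpha> * \<delta>) * \<kappa>" using four \<kappa> by (intro mult_mono) auto
      then show ?thesis by (simp add: L_def)
    qed
    ultimately have "L ^ 5 \<le> (2 * \<Lambda> * (1 + ln \<kappa>)) ^ 5" by (intro power_mono)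
    also have "\<dots> = 32 * \<Lambda> ^ 5 * (1 + ln \<kappa>) ^ 5" by (simp add: power_mult_distrib)
    also have "\<dots> \<le> 32 * \<Lambda> ^ 5 * (3125 * \<kappa>)" using \<Lambda>1 by (intro mult_left_mono power5_log_le[OF \<kappa>]) auto
    finally have L5: "L ^ 5 \<le> 10 ^ 5 * (\<kappa> * \<Lambda> ^ 5)" by (simp add: mult_ac)
    have "real (2 * k * b) = 2 * real k * real b" by simp
    \<comment> \<open>The constant collects 2 samples per pair, \<open>2 * 10 ^ 20\<close> from
      \<open>k\<close> and 10 from the block size; the later factor \<open>10 ^ 5\<close> is
      \<open>32 * 3125\<close>.\<close>
    also have "\<dots> \<le> 2 * (2 * 10 ^ 20 * (real d * \<kappa> * L ^ 5)) * (10 / \<epsilon>)"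
      using k b_upper b0 by (intro mult_mono mult_left_mono) (auto intro: order_trans[OF of_nat_0_le_iff k])
    also have "\<dots> = 4 * 10 ^ 21 * (real d * \<kappa> / \<epsilon>) * L ^ 5" by simp
    also have "\<dots> \<le> 4 * 10 ^ 21 * (real d * \<kappa> / \<epsilon>) * (10 ^ 5 * (\<kappa> * \<Lambda> ^ 5))"
      using d1 \<kappa> \<epsilon> by (intro mult_left_mono L5) auto
    also have "\<dots> = 4 * 10 ^ 26 * (real d / \<epsilon> * \<kappa>\<^sup>2 * \<Lambda> ^ 5)" by (simp add: power2_eq_square mult_ac)
    finally show ?thesis unfolding \<Lambda>_def .
  qed
  ultimately show ?thesis using that A dp by blast
qed

theorem theorem4:
  shows "\<exists>(C::real) (p::real poly). C > 0 \<and>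
    (\<forall>(d::nat) (\<kappa>::real) (\<epsilon>::real) (\<delta>::real) (\<alpha>::real).
       d \<ge> 1 \<longrightarrow> \<kappa> > 0 \<longrightarrow> \<epsilon> \<in> {0<..1} \<longrightarrow> \<delta> \<in> {0<..1/2} \<longrightarrow> \<alpha> \<in> {0<..1/2} \<longrightarrow>
       (\<exists>(n::nat) \<A>.
          real n \<le> C * (real d / \<epsilon> * \<kappa>\<^sup>2 * poly p (ln (real d / (\<delta> * \<epsilon> * \<alpha>)))) \<and>
          sampler n (euclid d) \<A> \<and>
          accurate \<alpha> n (gaussian_class d \<kappa>) \<A> \<and>
          diff_private \<epsilon> \<delta> n (euclid d) \<A>))"
proof (rule exI[where x = "4 * 10 ^ 26"], rule exI[where x = "monom 1 5"], intro conjI allI impI)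
  show "(4 * 10 ^ 26 :: real) > 0" by simp
  fix d :: nat and \<kappa> \<epsilon> \<delta> \<alpha> :: real
  assume d: "d \<ge> 1" and "\<kappa> > 0" and \<epsilon>: "\<epsilon> \<in> {0<..1}" and \<delta>: "\<delta> \<in> {0<..1/2}" and \<alpha>: "\<alpha> \<in> {0<..1/2}"
  show "\<exists>n \<A>. real n \<le> 4 * 10 ^ 26 * (real d / \<epsilon> * \<kappa>\<^sup>2 * poly (monom 1 5) (ln (real d / (\<delta> * \<epsilon> * \<alpha>)))) \<and>
    sampler n (euclid d) \<A> \<and> accurate \<alpha> n (gaussian_class d \<kappa>) \<A> \<and> diff_private \<epsilon> \<delta> n (euclid d) \<A>"
  \<comment> \<open>For \<open>\<kappa> < 1\<close> the class is empty and a constant sampler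
    without samples will do: accuracy is vacuous, and datasets of size 0 have no neighbors.\<close>
  proof (cases "\<kappa> < 1")
    case True
    let ?A = "\<lambda>_ :: nat \<Rightarrow> nat \<Rightarrow> real. return (euclid d) (\<lambda>l\<in>{..<d}. 0 :: real)"
    have "\<delta> * \<epsilon> * \<alpha> \<le> 1 * 1 * 1" using \<epsilon> \<delta> \<alpha> by (intro mult_mono) auto
    then have "1 \<le> real d / (\<delta> * \<epsilon> * \<alpha>)" using \<epsilon> \<delta> \<alpha> d by (simp add: pos_le_divide_eq mult_pos_pos)
    then have "0 \<le> ln (real d / (\<delta> * \<epsilon> * \<alpha>))" by (rule ln_ge_zero)
    then have "real 0 \<le> 4 * 10 ^ 26 * (real d / \<epsilon> * \<kappa>\<^sup>2 * poly (monom 1 5) (ln (real d / (\<delta> * \<epsilon> * \<alpha>))))"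
      using \<epsilon> by (simp add: poly_monom)
    moreover have "sampler 0 (euclid d) ?A"
      unfolding sampler_def
      by (intro measurable_const) (auto simp: space_prob_algebra euclid_def space_PiM intro!: prob_space_return)
    moreover have "accurate \<alpha> 0 (gaussian_class d \<kappa>) ?A"
      by (simp add: accurate_def gaussian_class_empty[OF d True])
    moreover have "diff_private \<epsilon> \<delta> 0 (euclid d) ?A" by (simp add: diff_private_def neighbors_def)
    ultimately show ?thesis by blast
  next
    case False
    then show ?thesis
      using sampler_exists[of d \<kappa> \<epsilon> \<delta> \<alpha>] d \<epsilon> \<delta> \<alpha> by (simp add: poly_monom) blast
  qed
qed

end
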